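(* Let $f=f(t,x)\in L^p(\mathbb{R}^{n+1})$, $1\le p\le\infty$, and define $$u(t,x)=\int_{\mathbb{R}^{n+1}}p(t,\tau,y)f(t-\tau,x-y)\,dy\,d\tau .$$ Then $$\|u\|_{L^p(\mathbb{R}^{n+1})}\le\|f\|_{L^p(\mathbb{R}^{n+1})}.$$ If $f\in C^2_c(\mathbb{R}^{n+1})$, then $u$ is the unique bounded classical solution to $$\partial_tu-a^{ij}(t)\partial_{ij}u+u=f,\qquad t\in\mathbb{R},\ x\in\mathbb{R}^n,$$ and the following pointwise limit formulas for its derivatives hold: $$\partial_{ij}u(t,x)=\lim_{\varepsilon\to0^+}\int_{\Omega_\varepsilon}\partial_{y_iy_j}p(t,\tau,y)f(t-\tau,x-y)\,dy\,d\tau-f(t,x)I_{ij}(a)(t)$$ and $$\partial_tu(t,x)=\lim_{\varepsilon\to0^+}\int_{\Omega_\varepsilon}(\partial_t+\partial_\tau)p(t,\tau,y)f(t-\tau,x-y)\,dy\,d\tau+f(t,x)J(a)(t).$$ Here $\Omega_\varepsilon=\{(\tau,y)\in\mathbb{R}^{n+1}:\max(|\tau|^{1/2},|y|)>\varepsilon\}$ and, for $i,j=1,\dots,n$ and $t\in\mathbb{R}$, $$I_{ij}(a)(t)=\int_{\{x:|2a(t)^{1/2}x|\ge1\}}\frac{e^{-|x|^2}}{\pi^{n/2}}\frac{(a(t)^{-1/2}x)_j(a(t)^{1/2}x)_i}{|a(t)^{1/2}x|^2}\,dx$$ and $$J(a)(t)=\int_{\{x:|2a(t)^{1/2}x|\le1\}}\frac{e^{-|x|^2}}{\pi^{n/2}}\,dx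 .$$
   Context: Repeated indices are summed, $\partial_{ij}=\partial_{x_ix_j}$, and points of $\mathbb{R}^{n+1}$ are written $(t,x)$ with $t\in\mathbb{R}$, $x\in\mathbb{R}^n$. The matrix of coefficients $a(t)=(a^{ij}(t))$ is assumed to be just bounded, measurable, symmetric ($a^{ij}(t)=a^{ji}(t)$) and uniformly elliptic, that is, there exists $\Lambda>0$ such that $\Lambda|\xi|^2\le a^{ij}(t)\xi_i\xi_j\le\Lambda^{-1}|\xi|^2$ for all $\xi\in\mathbb{R}^n$ and for a.e. $t\in\mathbb{R}$. For $t\in\mathbb{R}$ and $\tau>0$ set $A_{t,\tau}=(A^{ij}(t,\tau))=\int_{t-\tau}^ta^{ij}(r)\,dr$ (entrywise), and let $B_{t,\tau}=(A_{t,\tau})^{-1}$ be its inverse. The kernel $p$ is $$p(t,\tau,x)=\chi_{\tau>0}\,e^{-\tau}\frac{\exp\big(-\tfrac14\langle B_{t,\tau}x,x\rangle\big)}{(4\pi)^{n/2}(\det B_{t,\tau})^{-1/2}},\qquad t,\tau\in\mathbb{R},\ x\in\mathbb{R}^n,$$ where $\chi_{\tau>0}$ is the indicator function of $\{\tau>0\}$.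
   Formalization: The equation and both limit formulas are stated for a.e. t (all x), not every t, since altering a(t) at one time falsifies them; "classical solution" also requires local absolute continuity in t, without which uniqueness fails. *)

theory Defs
  imports "HOL-Analysis.Analysis" "HOL-Probability.Essential_Supremum"
begin

text \<open>
  Points of \<open>\<real>\<^sup>n\<^sup>+\<^sup>1\<close> are pairs \<open>(t, x) :: real \<times> (real ^ 'n)\<close>, with \<open>n = CARD('n) \<ge> 1\<close>.
  Measurability and integrals are with respect to \<^const>\<open>lebesgue\<close> (the completed measure), so
  integrands only have to be meaningful almost everywhere.
\<close>

section \<open>Coefficients and kernel\<close>

text \<open>
  Coefficients are \<open>L\<^sup>\<infinity>\<close> objects: boundedness, symmetry and ellipticity are required almost
  everywhere. In particular \<open>a t\<close> may be arbitrary on a null set of times.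
\<close>

definition elliptic_coeff :: "(real \<Rightarrow> real ^ 'n ^ 'n) \<Rightarrow> bool" where
  "elliptic_coeff a \<longleftrightarrow>
     a \<in> borel_measurable lebesgue \<and>
     (\<exists>K. AE t in lebesgue. \<forall>i j. \<bar>a t $ i $ j\<bar> \<le> K) \<and>
     (AE t in lebesgue. \<forall>i j. a t $ i $ j = a t $ j $ i) \<and>
     (\<exists>\<Lambda>>0. AE t in lebesgue. \<forall>\<xi>::real ^ 'n.
        \<Lambda> * (norm \<xi>)\<^sup>2 \<le> (\<Sum>i\<in>UNIV. \<Sum>j\<in>UNIV. a t $ i $ j * \<xi> $ i * \<xi> $ j) \<and>
        (\<Sum>i\<in>UNIV. \<Sum>j\<in>UNIV. a t $ i $ j * \<xi> $ i * \<xi> $ j) \<le> inverse \<Lambda> * (norm \<xi>)\<^sup>2)"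

definition Amat :: "(real \<Rightarrow> real ^ 'n ^ 'n) \<Rightarrow> real \<Rightarrow> real \<Rightarrow> real ^ 'n ^ 'n" where
  "Amat a t \<tau> = (\<chi> i j. LINT r:{t - \<tau>..t}|lebesgue. a r $ i $ j)"

definition Bmat :: "(real \<Rightarrow> real ^ 'n ^ 'n) \<Rightarrow> real \<Rightarrow> real \<Rightarrow> real ^ 'n ^ 'n" where
  "Bmat a t \<tau> = matrix_inv (Amat a t \<tau>)"

definition kern :: "(real \<Rightarrow> real ^ 'n ^ 'n) \<Rightarrow> real \<Rightarrow> real \<Rightarrow> real ^ 'n \<Rightarrow> real" where
  "kern a t \<tau> x =
     (if \<tau> > 0 then
        exp (- \<tau>) * (exp (- (1 / 4) * ((Bmat a t \<tau> *v x) \<bullet> x)) /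
          ((4 * pi) powr (real CARD('n) / 2) * det (Bmat a t \<tau>) powr (- (1 / 2))))
      else 0)"

definition sol :: "(real \<Rightarrow> real ^ 'n ^ 'n) \<Rightarrow> (real \<times> (real ^ 'n) \<Rightarrow> real) \<Rightarrow>
    real \<times> (real ^ 'n) \<Rightarrow> real" where
  "sol a f = (\<lambda>(t, x). LINT (\<tau>, y)|lebesgue. kern a t \<tau> y * f (t - \<tau>, x - y))"

section \<open>Lebesgue spaces\<close>

definition Lp :: "ennreal \<Rightarrow> ('a::euclidean_space \<Rightarrow> real) set" where
  "Lp p = {f \<in> borel_measurable lebesgue.
     if p = top then esssup lebesgue (\<lambda>z. ereal \<bar>f z\<bar>) < \<infinity>
     else integrable lebesgue (\<lambda>z. \<bar>f z\<bar> powr enn2real p)}"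

definition Lp_norm :: "ennreal \<Rightarrow> ('a::euclidean_space \<Rightarrow> real) \<Rightarrow> real" where
  "Lp_norm p f =
     (if p = top then real_of_ereal (esssup lebesgue (\<lambda>z. ereal \<bar>f z\<bar>))
      else (LINT z|lebesgue. \<bar>f z\<bar> powr enn2real p) powr (1 / enn2real p))"

section \<open>Differentiability\<close>

definition has_partial :: "'n \<Rightarrow> (real ^ 'n \<Rightarrow> real) \<Rightarrow> real ^ 'n \<Rightarrow> bool" where
  "has_partial i g x \<longleftrightarrow> (\<lambda>s. g (x + s *\<^sub>R axis i 1)) differentiable (at 0)"

definition partial :: "'n \<Rightarrow> (real ^ 'n \<Rightarrow> real) \<Rightarrow> real ^ 'n \<Rightarrow> real" where
  "partial i g x = deriv (\<lambda>s. g (x + s *\<^sub>R axis i 1)) 0"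

text \<open>\<open>C\<^sup>2\<^sub>c\<close>: twice continuously Frechet differentiable with compact support.\<close>

definition C2c :: "('a::euclidean_space \<Rightarrow> real) \<Rightarrow> bool" where
  "C2c f \<longleftrightarrow>
     (\<exists>(f' :: 'a \<Rightarrow> 'a \<Rightarrow>\<^sub>L real) (f'' :: 'a \<Rightarrow> 'a \<Rightarrow>\<^sub>L ('a \<Rightarrow>\<^sub>L real)).
        (\<forall>z. (f has_derivative blinfun_apply (f' z)) (at z)) \<and>
        (\<forall>z. (f' has_derivative blinfun_apply (f'' z)) (at z)) \<and>
        continuous_on UNIV f'') \<and>
     compact (closure {z. f z \<noteq> 0})"

text \<open>
  Absolute continuity on every compact interval, in the usual \<open>\<epsilon>\<close>-\<open>\<delta>\<close> form: \<open>D\<close> ranges over the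
  finite families of non-overlapping compact intervals contained in \<open>[b, c]\<close>.
\<close>

definition loc_abs_cont :: "(real \<Rightarrow> real) \<Rightarrow> bool" where
  "loc_abs_cont g \<longleftrightarrow>
     (\<forall>b c. \<forall>\<epsilon>>0. \<exists>\<delta>>0. \<forall>D.
        D division_of \<Union>D \<and> \<Union>D \<subseteq> {b..c} \<and> (\<Sum>K\<in>D. Sup K - Inf K) < \<delta> \<longrightarrow>
        (\<Sum>K\<in>D. \<bar>g (Sup K) - g (Inf K)\<bar>) < \<epsilon>)"

text \<open>
  Since \<open>a\<close> is only measurable in time and is given up to null sets, \<open>\<partial>\<^sub>t u\<close> is in general
  discontinuous in \<open>t\<close> and the equation cannot be expected at every time. A classical solution has
  space derivatives up to order two that exist everywhere and are continuous in \<open>(t, x)\<close>, and it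
  satisfies the equation pointwise, with a genuine time derivative, for almost every \<open>t\<close> and all
  \<open>x\<close>. Local absolute continuity in time has to be part of the notion: without it one could add
  \<open>exp (- t) * c t\<close> with \<open>c\<close> the Cantor function (extended by constants), and uniqueness would fail.
\<close>

definition classical_solution :: "(real \<Rightarrow> real ^ 'n ^ 'n) \<Rightarrow> (real \<times> (real ^ 'n) \<Rightarrow> real) \<Rightarrow>
    (real \<times> (real ^ 'n) \<Rightarrow> real) \<Rightarrow> bool" where
  "classical_solution a f u \<longleftrightarrow>
     continuous_on UNIV u \<and>
     (\<forall>i. (\<forall>t x. has_partial i (\<lambda>z. u (t, z)) x) \<and>
          continuous_on UNIV (\<lambda>(t, x). partial i (\<lambda>z. u (t, z)) x)) \<and>
     (\<forall>i j. (\<forall>t x. has_partial i (partial j (\<lambda>z. u (t, z))) x) \<and>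
          continuous_on UNIV (\<lambda>(t, x). partial i (partial j (\<lambda>z. u (t, z))) x)) \<and>
     (\<forall>x. loc_abs_cont (\<lambda>t. u (t, x))) \<and>
     (AE t in lebesgue. \<forall>x.
        (\<lambda>s. u (s, x)) differentiable (at t) \<and>
        deriv (\<lambda>s. u (s, x)) t
          - (\<Sum>i\<in>UNIV. \<Sum>j\<in>UNIV. a t $ i $ j * partial i (partial j (\<lambda>z. u (t, z))) x)
          + u (t, x) = f (t, x))"

section \<open>The limit formulas\<close>

definition Omega :: "real \<Rightarrow> (real \<times> (real ^ 'n)) set" where
  "Omega \<epsilon> = {(\<tau>, y). max (sqrt \<bar>\<tau>\<bar>) (norm y) > \<epsilon>}"

text \<open>\<open>\<partial>\<^sub>t p + \<partial>\<^sub>\<tau> p\<close>; for almost every \<open>t\<close> both derivatives exist for almost every \<open>\<tau>\<close>.\<close>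

definition kern_dt_dtau :: "(real \<Rightarrow> real ^ 'n ^ 'n) \<Rightarrow> real \<Rightarrow> real \<Rightarrow> real ^ 'n \<Rightarrow> real" where
  "kern_dt_dtau a t \<tau> y = deriv (\<lambda>s. kern a s \<tau> y) t + deriv (\<lambda>s. kern a t s y) \<tau>"

text \<open>The symmetric positive semidefinite square root.\<close>

definition mat_sqrt :: "real ^ 'n ^ 'n \<Rightarrow> real ^ 'n ^ 'n" where
  "mat_sqrt M = (THE S. transpose S = S \<and> (\<forall>\<xi>. 0 \<le> \<xi> \<bullet> (S *v \<xi>)) \<and> S ** S = M)"

definition Icoef :: "(real \<Rightarrow> real ^ 'n ^ 'n) \<Rightarrow> 'n \<Rightarrow> 'n \<Rightarrow> real \<Rightarrow> real" where
  "Icoef a i j t =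
     (LINT x:{x. norm (2 *\<^sub>R (mat_sqrt (a t) *v x)) \<ge> 1}|lebesgue.
        exp (- (norm x)\<^sup>2) / pi powr (real CARD('n) / 2) *
        (((matrix_inv (mat_sqrt (a t)) *v x) $ j * (mat_sqrt (a t) *v x) $ i) /
          (norm (mat_sqrt (a t) *v x))\<^sup>2))"

definition Jcoef :: "(real \<Rightarrow> real ^ 'n ^ 'n) \<Rightarrow> real \<Rightarrow> real" where
  "Jcoef a t =
     (LINT x:{x. norm (2 *\<^sub>R (mat_sqrt (a t) *v x)) \<le> 1}|lebesgue.
        exp (- (norm x)\<^sup>2) / pi powr (real CARD('n) / 2))"

end

theory Submission
  imports Defs "HOL-Probability.Distributions"
begin

text \<open>
  Almost everywhere \<open>a\<close> is the derivative of a Lipschitz matrix function \<open>F\<close>, and \<open>p(t, \<tau>, \<cdot>)\<close> is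
  \<open>exp (- \<tau>)\<close> times the Gaussian whose covariance is proportional to \<open>F t - F (t - \<tau>)\<close>. For fixed \<open>t\<close>
  it has total mass one, and for fixed \<open>\<tau>\<close> its space integral does not depend on \<open>t\<close>, which gives the
  \<open>L\<^sup>p\<close> bound by Jensen's inequality.

  For smooth \<open>f\<close> the space derivatives are moved to \<open>f\<close>. The derivative of a Gaussian with respect to
  its covariance is its Hessian, so the time derivative exists at every \<open>t\<close> at which \<open>F\<close> has derivative
  \<open>a t\<close>. Uniqueness is a maximum principle that uses the equation at almost every time only.

  In the limit formulas \<open>\<Omega>\<^sub>\<epsilon>\<close> is split into \<open>\<tau> > \<epsilon>\<^sup>2\<close>, where the derivatives can be moved to \<open>f\<close>, and
  \<open>\<tau> \<le> \<epsilon>\<^sup>2\<close>, \<open>\<bar>y\<bar> > \<epsilon>\<close>. On the second part parabolic rescaling freezes the coefficients at time \<open>t\<close>,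
  leaving the integral of the Hessian of the Gaussian of covariance \<open>\<sigma> a(t)\<close> over \<open>\<sigma> \<le> 1\<close>,
  \<open>\<bar>z\<bar> > 1\<close>; integrating over \<open>\<sigma>\<close> first and then by parts against \<open>2 ln \<bar>z\<bar>\<close> gives \<open>I\<^sub>i\<^sub>j\<close>. The formula
  for the time derivative follows from \<open>a\<^sup>i\<^sup>j I\<^sub>i\<^sub>j + J = 1\<close>.
\<close>

section \<open>Symmetric matrices\<close>

text \<open>The difficulty is that \<open>a\<close> has no regularity in time, while in each time
  slice the second space derivatives of the kernel have absolute mass of order 1 / \<tau>, so they
  are not integrable up to \<tau> = 0. Two devices replace regularity. A Gaussian average of f is
  Lipschitz in its covariance matrix with a constant that does not see how degenerate the matrix is,
  because both derivatives fall on f; this controls times arbitrarily close to the pole and makes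
  differentiability of F at the single time t sufficient. And in (\<partial>_t + \<partial>_\<tau>)
  p the terms with a(t - \<tau>) cancel, so that only a(t) remains. The exceptional times form one
  null set, the complement of \<open>good_time\<close>, chosen independently of x and f. The
  logarithm in the computation of I has this origin: substituting y = \<sigma>^{1/2} w leaves the
  factor 1 / \<sigma> on |w|^{-2} < \<sigma> \<le> 1, whose integral is 2 ln |w|.\<close>

lemma symmetric_matrix_inner:
  fixes A :: "real ^ 'n ^ 'n"
  assumes "transpose A = A"
  shows "(A *v x) \<bullet> y = x \<bullet> (A *v y)"
  by (metis assms dot_lmul_matrix vector_transpose_matrix)

lemma symmetric_matrixI:
  fixes A :: "real ^ 'n ^ 'n"
  assumes "\<And>x y. (A *v x) \<bullet> y = x \<bullet> (A *v y)"
  shows "transpose A = A"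
proof -
  have "A $ i $ j = A $ j $ i" for i j
    using assms[of "axis j 1" "axis i 1"]
    by (simp add: matrix_vector_mult_basis inner_axis' inner_axis column_def)
  then show ?thesis by (simp add: transpose_def vec_eq_iff)
qed

text \<open>A maximiser of the Rayleigh quotient on the unit sphere of \<open>V\<close> is an
  eigenvector. Working in an invariant subspace allows the lemma to be applied to the orthogonal
  complement of eigenvectors already found.\<close>

lemma symmetric_eigenvector:
  fixes A :: "real ^ 'n ^ 'n"
  assumes sym: "transpose A = A" and V: "subspace V" "\<And>x. x \<in> V \<Longrightarrow> A *v x \<in> V"
    and v0: "v0 \<in> V" "v0 \<noteq> 0"
  obtains v \<mu> where "v \<in> V" "norm v = 1" "A *v v = \<mu> *\<^sub>R v"
proof -
  let ?K = "V \<inter> sphere 0 1"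
  have "compact ?K"
    by (intro closed_Int_compact closed_subspace V compact_sphere)
  moreover have "(1 / norm v0) *\<^sub>R v0 \<in> ?K"
    using v0 V(1) by (auto simp: subspace_scale)
  then have "?K \<noteq> {}" by blast
  moreover have "continuous_on ?K (\<lambda>x. (A *v x) \<bullet> x)"
    by (intro continuous_intros linear_continuous_on matrix_vector_mul_bounded_linear)
  ultimately obtain v where v: "v \<in> ?K" and vmax: "\<And>y. y \<in> ?K \<Longrightarrow> (A *v y) \<bullet> y \<le> (A *v v) \<bullet> v"
    using continuous_attains_sup[of ?K "\<lambda>x. (A *v x) \<bullet> x"] by blast
  define \<mu> where "\<mu> = (A *v v) \<bullet> v"
  have vv: "v \<bullet> v = 1" using v by (simp add: dot_square_norm)
  have quad: "(A *v z) \<bullet> z \<le> \<mu> * (z \<bullet> z)" if "z \<in> V" for z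
  proof (cases "z = 0")
    case False
    then have "(1 / norm z) *\<^sub>R z \<in> ?K"
      using that V(1) by (auto simp: subspace_scale)
    from vmax[OF this] have "((A *v z) \<bullet> z) / (norm z * norm z) \<le> \<mu>"
      by (simp add: \<mu>_def matrix_vector_mult_scaleR)
    then show ?thesis using False by (simp add: divide_simps dot_square_norm power2_eq_square)
  qed simp
  define w where "w = A *v v - \<mu> *\<^sub>R v"
  have wV: "w \<in> V" using V v by (auto simp: w_def intro!: subspace_diff subspace_scale)
  define q where "q = w \<bullet> w"
  define D where "D = \<mu> * (w \<bullet> w) - (A *v w) \<bullet> w"
  \<comment> \<open>First variation: \<open>quad\<close> at \<open>v + s *\<^sub>R w\<close>, in the
    direction of the residual \<open>w\<close>. It is an equality at s = 0, so the term linear in s,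
    with coefficient 2 |w|^2, is bounded by the quadratic one.\<close>
  have main: "2 * q \<le> s * D" if "s > 0" for s
  proof -
    have "v + s *\<^sub>R w \<in> V" using V v wV by (auto intro!: subspace_add subspace_scale)
    from quad[OF this]
    have "(A *v v) \<bullet> v + 2 * s * ((A *v v) \<bullet> w) + s * s * ((A *v w) \<bullet> w)
        \<le> \<mu> * (v \<bullet> v + 2 * s * (v \<bullet> w) + s * s * (w \<bullet> w))"
      using symmetric_matrix_inner[OF sym, of w v]
      by (simp add: matrix_vector_right_distrib matrix_vector_mult_scaleR inner_add_left inner_add_right
          inner_commute algebra_simps)
    moreover have "(A *v v) \<bullet> w - \<mu> * (v \<bullet> w) = q"
      by (simp add: q_def w_def inner_diff_left)
    ultimately have "2 * s * q \<le> s * s * D"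
      unfolding D_def vv by (simp add: \<mu>_def[symmetric] algebra_simps)
    then have "s * (2 * q) \<le> s * (s * D)" by (simp add: algebra_simps)
    with that show ?thesis by simp
  qed
  have "q \<ge> 0" by (simp add: q_def)
  have "q = 0"
  proof (rule ccontr)
    assume "q \<noteq> 0"
    with \<open>q \<ge> 0\<close> have "q > 0" by simp
    \<comment> \<open>The choice s = q / (|D| + 1) makes s D at most q, whatever the sign of
      D.\<close>
    have "2 * q \<le> q / (\<bar>D\<bar> + 1) * D" by (rule main) (use \<open>q > 0\<close> in \<open>auto intro: divide_pos_pos\<close>)
    also have "\<dots> = q * (D / (\<bar>D\<bar> + 1))" by simp
    also have "\<dots> \<le> q * 1"
      using \<open>q > 0\<close> by (intro mult_left_mono) (auto simp: divide_simps)
    finally show False using \<open>q > 0\<close> by simp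
  qed
  then have "A *v v = \<mu> *\<^sub>R v" by (simp add: q_def w_def)
  with v that show thesis by auto
qed

text \<open>An orthonormal family of eigenvectors of largest size spans: otherwise its orthogonal
  complement is nonzero and, by symmetry, invariant, and \<open>symmetric_eigenvector\<close>
  enlarges the family.\<close>

lemma symmetric_eigenbasis:
  fixes A :: "real ^ 'n ^ 'n"
  assumes sym: "transpose A = A"
  obtains E where "finite E" "pairwise orthogonal E" "\<And>e. e \<in> E \<Longrightarrow> norm e = 1"
    "\<And>e. e \<in> E \<Longrightarrow> \<exists>\<mu>. A *v e = \<mu> *\<^sub>R e" "span E = UNIV"
proof -
  define P where "P E \<longleftrightarrow> finite E \<and> pairwise orthogonal E \<and>
    (\<forall>e\<in>E. norm e = 1 \<and> (\<exists>\<mu>. A *v e = \<mu> *\<^sub>R e))" for E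
  have card: "card E \<le> CARD('n)" if "P E" for E
  proof -
    have "independent E"
      using that by (intro pairwise_orthogonal_independent) (auto simp: P_def)
    then show ?thesis using independent_bound[of E] by simp
  qed
  have "P {}" by (simp add: P_def)
  then obtain E where E: "P E" and max: "\<And>E'. P E' \<Longrightarrow> card E' \<le> card E"
    using ex_has_greatest_nat[of P "{}" card "Suc CARD('n)"] card by (auto simp: less_Suc_eq_le)
  have "span E = UNIV"
  proof (rule ccontr)
    assume "span E \<noteq> UNIV"
    then obtain a where a: "a \<noteq> 0" "\<And>x. x \<in> span E \<Longrightarrow> a \<bullet> x = 0"
      using span_not_UNIV_orthogonal by metis
    let ?V = "{x. \<forall>e\<in>E. e \<bullet> x = 0}"
    have V1: "subspace ?V" by (auto simp: subspace_def inner_add_right)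
    have V2: "A *v x \<in> ?V" if "x \<in> ?V" for x
    proof -
      have "e \<bullet> (A *v x) = 0" if "e \<in> E" for e
      proof -
        obtain \<mu> where "A *v e = \<mu> *\<^sub>R e" using E \<open>e \<in> E\<close> unfolding P_def by blast
        then show ?thesis
          using symmetric_matrix_inner[OF sym, of e x] \<open>x \<in> ?V\<close> \<open>e \<in> E\<close> by simp
      qed
      then show ?thesis by simp
    qed
    have V3: "a \<in> ?V" using a by (auto simp: inner_commute span_base)
    obtain v \<mu> where v: "v \<in> ?V" "norm v = 1" "A *v v = \<mu> *\<^sub>R v"
      by (rule symmetric_eigenvector[OF sym V1 V2 V3 a(1)])
    have "v \<notin> E"
    proof
      assume "v \<in> E"
      then have "v \<bullet> v = 0" using v(1) by blast
      then show False using v(2) by simp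
    qed
    moreover have "P (insert v E)"
      using E v unfolding P_def
      by (auto simp: pairwise_insert orthogonal_def inner_commute)
    ultimately show False using max[of "insert v E"] E by (simp add: P_def)
  qed
  with E that show thesis unfolding P_def by blast
qed

definition posdef :: "real ^ 'n ^ 'n \<Rightarrow> bool" where
  "posdef M \<longleftrightarrow> transpose M = M \<and> (\<forall>x. x \<noteq> 0 \<longrightarrow> 0 < (M *v x) \<bullet> x)"

lemma posdef_sqrt_exists:
  fixes M :: "real ^ 'n ^ 'n"
  assumes "posdef M"
  obtains S where "posdef S" "S ** S = M"
proof -
  have sym: "transpose M = M" using assms by (simp add: posdef_def)
  obtain E where E: "finite E" "pairwise orthogonal E" "\<And>e. e \<in> E \<Longrightarrow> norm e = 1"
    "\<And>e. e \<in> E \<Longrightarrow> \<exists>\<mu>. M *v e = \<mu> *\<^sub>R e" "span E = UNIV"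
    using symmetric_eigenbasis[OF sym] by metis
  then obtain \<mu> where \<mu>: "\<And>e. e \<in> E \<Longrightarrow> M *v e = \<mu> e *\<^sub>R e" by metis
  have ee: "e \<bullet> e' = (if e = e' then 1 else 0)" if "e \<in> E" "e' \<in> E" for e e'
    using E(2,3) that by (auto simp: pairwise_def orthogonal_def dot_square_norm)
  have pos: "\<mu> e > 0" if "e \<in> E" for e
  proof -
    have "e \<noteq> 0" using E(3)[OF that] by auto
    then have "0 < (M *v e) \<bullet> e" using assms by (simp add: posdef_def)
    then show ?thesis using \<mu>[OF that] ee[OF that that] by simp
  qed
  define f where "f x = (\<Sum>e\<in>E. (sqrt (\<mu> e) * (x \<bullet> e)) *\<^sub>R e)" for x
  have lin: "linear f"
    by (intro linearI) (simp_all add: f_def inner_add_left algebra_simps sum.distrib scaleR_sum_right)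
  define S where "S = matrix f"
  have S: "S *v x = f x" for x by (simp add: S_def lin)
  have expand: "(\<Sum>e\<in>E. (x \<bullet> e) *\<^sub>R e) = x" for x
    by (rule orthonormal_basis_expand) (use E in auto)
  have fy: "f x \<bullet> y = (\<Sum>e\<in>E. sqrt (\<mu> e) * (x \<bullet> e) * (y \<bullet> e))" for x y
    unfolding f_def inner_sum_left by (rule sum.cong) (auto simp: inner_commute)
  have symS: "transpose S = S"
    by (rule symmetric_matrixI) (unfold S inner_commute[of _ "f _"], unfold fy, simp add: mult_ac)
  have "posdef S"
    unfolding posdef_def
  proof (intro conjI symS allI impI)
    fix x :: "real ^ 'n" assume "x \<noteq> 0"
    have nn: "0 \<le> sqrt (\<mu> e) * (x \<bullet> e) * (x \<bullet> e)" if "e \<in> E" for e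
      using pos[OF that] by (simp add: mult.assoc)
    have "f x \<bullet> x \<noteq> 0"
    proof
      assume "f x \<bullet> x = 0"
      then have "\<forall>e\<in>E. sqrt (\<mu> e) * (x \<bullet> e) * (x \<bullet> e) = 0"
        unfolding fy by (subst (asm) sum_nonneg_eq_0_iff[OF E(1)]) (use nn in auto)
      then have "\<forall>e\<in>E. x \<bullet> e = 0" using pos by (metis less_irrefl mult_eq_0_iff real_sqrt_eq_zero_cancel_iff)
      then have "x = 0" using expand[of x] by simp
      with \<open>x \<noteq> 0\<close> show False by simp
    qed
    moreover have "f x \<bullet> x \<ge> 0" unfolding fy using nn by (rule sum_nonneg)
    ultimately show "0 < (S *v x) \<bullet> x" by (simp add: S)
  qed
  moreover have "S ** S = M"
  proof -
    have fe: "f e = sqrt (\<mu> e) *\<^sub>R e" if "e \<in> E" for e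
    proof -
      have "f e = (\<Sum>e'\<in>E. if e = e' then sqrt (\<mu> e) *\<^sub>R e else 0)"
        unfolding f_def by (rule sum.cong) (auto simp: ee that)
      then show ?thesis using that E(1) by simp
    qed
    have "S *v (S *v e) = M *v e" if "e \<in> E" for e
      using that pos[OF that] by (simp add: S fe linear_scale[OF lin] \<mu>)
    then have "(S ** S) *v x = M *v x" for x
      using linear_eq_on[of "(*v) (S ** S)" "(*v) M" x E]
      by (simp add: E(5) matrix_vector_mul_assoc)
    then show ?thesis by (simp add: matrix_eq)
  qed
  ultimately show thesis using that by blast
qed

text \<open>Compare on an eigenbasis of T. If T e = \<mu> e, then w = S e - \<mu> e satisfies S w =
  -\<mu> w because S S e = \<mu>^2 e; for \<mu> > 0 this contradicts S \<ge> 0 unless w = 0. For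
  \<mu> = 0, |S e|^2 = <e, S S e> = 0.\<close>

lemma psd_sqrt_unique:
  fixes S T :: "real ^ 'n ^ 'n"
  assumes S: "transpose S = S" "\<And>x. 0 \<le> x \<bullet> (S *v x)"
    and T: "transpose T = T" "\<And>x. 0 \<le> x \<bullet> (T *v x)"
    and eq: "S ** S = T ** T"
  shows "S = T"
proof -
  obtain E where E: "\<And>e. e \<in> E \<Longrightarrow> norm e = 1"
    "\<And>e. e \<in> E \<Longrightarrow> \<exists>\<mu>. T *v e = \<mu> *\<^sub>R e" "span E = UNIV"
    using symmetric_eigenbasis[OF T(1)] by metis
  have "S *v e = T *v e" if e: "e \<in> E" for e
  proof -
    obtain \<mu> where \<mu>: "T *v e = \<mu> *\<^sub>R e" using E(2)[OF e] by blast
    have "e \<bullet> e = 1" using E(1)[OF e] by (simp add: dot_square_norm)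
    then have "\<mu> \<ge> 0" using T(2)[of e] \<mu> by simp
    define w where "w = S *v e - \<mu> *\<^sub>R e"
    have SS: "S *v (S *v e) = (\<mu> * \<mu>) *\<^sub>R e"
      using eq by (simp add: matrix_vector_mul_assoc matrix_vector_mult_scaleR \<mu>
          flip: matrix_vector_mul_assoc[of T T])
    have Sw: "S *v w = - \<mu> *\<^sub>R w"
      by (simp add: w_def matrix_vector_mult_diff_distrib matrix_vector_mult_scaleR SS algebra_simps)
    show ?thesis
    proof (cases "\<mu> = 0")
      case True
      have "(S *v e) \<bullet> (S *v e) = e \<bullet> (S *v (S *v e))"
        by (rule symmetric_matrix_inner[OF S(1)])
      then have "S *v e = 0" using SS True by simp
      then show ?thesis using \<mu> True by simp
    next
      case False
      then have "\<mu> > 0" using \<open>\<mu> \<ge> 0\<close> by simp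
      have "0 \<le> - (\<mu> * (w \<bullet> w))" using S(2)[of w] by (simp add: Sw)
      then have "w \<bullet> w \<le> 0" using \<open>\<mu> > 0\<close> by (simp add: zero_le_mult_iff mult_le_0_iff)
      then have "w = 0" by (metis inner_gt_zero_iff linorder_not_less)
      then show ?thesis using \<mu> by (simp add: w_def)
    qed
  qed
  then have "S *v x = T *v x" for x
    using linear_eq_on[of "(*v) S" "(*v) T" x E] by (simp add: E(3))
  then show ?thesis by (simp add: matrix_eq)
qed

text \<open>Existence and uniqueness together give the definite description in
  \<open>mat_sqrt\<close> its meaning for positive definite matrices.\<close>

lemma mat_sqrt:
  fixes M :: "real ^ 'n ^ 'n"
  assumes "posdef M"
  shows "posdef (mat_sqrt M)" "mat_sqrt M ** mat_sqrt M = M"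
proof -
  obtain S where S: "posdef S" "S ** S = M" using posdef_sqrt_exists[OF assms] .
  have psd: "0 \<le> x \<bullet> (S *v x)" for x
  proof (cases "x = 0")
    case False
    then have "0 < (S *v x) \<bullet> x" using S(1) by (simp add: posdef_def)
    then show ?thesis by (simp add: inner_commute)
  qed simp
  have sym: "transpose S = S" using S(1) by (simp add: posdef_def)
  have "mat_sqrt M = S"
    unfolding mat_sqrt_def
  proof (rule the_equality)
    fix T assume T: "transpose T = T \<and> (\<forall>\<xi>. 0 \<le> \<xi> \<bullet> (T *v \<xi>)) \<and> T ** T = M"
    show "T = S" by (rule psd_sqrt_unique) (use T S sym psd in auto)
  qed (use S sym psd in auto)
  with S show "posdef (mat_sqrt M)" "mat_sqrt M ** mat_sqrt M = M" by auto
qed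

section \<open>Inverses and determinants\<close>

lemma posdef_invertible:
  fixes M :: "real ^ 'n ^ 'n"
  assumes "posdef M"
  shows "invertible M"
proof -
  have "x = 0" if "M *v x = 0" for x
    using assms that unfolding posdef_def by force
  then show ?thesis
    by (auto simp: invertible_left_inverse matrix_left_invertible_ker)
qed

lemma matrix_inv_mult:
  fixes M :: "real ^ 'n ^ 'n"
  assumes "invertible M"
  shows matrix_inv_left: "matrix_inv M ** M = mat 1" and matrix_inv_right: "M ** matrix_inv M = mat 1"
  using someI_ex[OF assms[unfolded invertible_def]] unfolding matrix_inv_def by auto

lemma matrix_inv_cancel:
  fixes M :: "real ^ 'n ^ 'n"
  assumes "invertible M"
  shows "matrix_inv M *v (M *v x) = x" "M *v (matrix_inv M *v x) = x"
  using assms by (simp_all add: matrix_vector_mul_assoc matrix_inv_left matrix_inv_right)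

lemma posdef_matrix_inv:
  fixes M :: "real ^ 'n ^ 'n"
  assumes "posdef M"
  shows "posdef (matrix_inv M)"
proof -
  note c = matrix_inv_cancel[OF posdef_invertible[OF assms]]
  have sym: "transpose M = M" using assms by (simp add: posdef_def)
  have "(matrix_inv M *v x) \<bullet> y = x \<bullet> (matrix_inv M *v y)" for x y
    using symmetric_matrix_inner[OF sym, of "matrix_inv M *v x" "matrix_inv M *v y"]
    by (simp add: c)
  moreover have "0 < (matrix_inv M *v x) \<bullet> x" if "x \<noteq> 0" for x
  proof -
    have "matrix_inv M *v x \<noteq> 0" using c(2)[of x] that by (metis matrix_vector_mult_0_right)
    then show ?thesis using assms c(2)[of x] by (metis inner_commute posdef_def)
  qed
  ultimately show ?thesis unfolding posdef_def by (auto intro: symmetric_matrixI)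
qed

lemma posdef_det_pos:
  fixes M :: "real ^ 'n ^ 'n"
  assumes "posdef M"
  shows "det M > 0"
proof -
  obtain S where S: "posdef S" "S ** S = M" using posdef_sqrt_exists[OF assms] .
  have "det S \<noteq> 0" using posdef_invertible[OF S(1)] by (simp add: invertible_det_nz)
  then show ?thesis using S(2) by (metis det_mul not_real_square_gt_zero)
qed

lemma det_matrix_inv:
  fixes M :: "real ^ 'n ^ 'n"
  assumes "invertible M"
  shows "det (matrix_inv M) = inverse (det M)"
  using matrix_inv_left[OF assms] by (metis det_I det_mul inverse_unique mult.commute)

text \<open>Cramer's rule for the columns of the inverse. As quotients of determinants the entries
  depend continuously on the matrix, which \<open>tendsto_matrix_inv\<close> exploits.\<close>

lemma matrix_inv_nth:
  fixes M :: "real ^ 'n ^ 'n"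
  assumes "det M \<noteq> 0"
  shows "matrix_inv M $ k $ l = det (\<chi> i j. if j = k then axis l 1 $ i else M $ i $ j) / det M"
proof -
  have "M *v (matrix_inv M *v axis l 1) = axis l 1"
    using assms by (simp add: matrix_inv_cancel invertible_det_nz)
  then have "matrix_inv M *v axis l 1 =
      (\<chi> k. det (\<chi> i j. if j = k then axis l 1 $ i else M $ i $ j) / det M)"
    using cramer[OF assms] by blast
  then have "(matrix_inv M *v axis l 1) $ k
      = det (\<chi> i j. if j = k then axis l 1 $ i else M $ i $ j) / det M" by simp
  then show ?thesis by (simp add: matrix_vector_mult_basis column_def)
qed

lemma tendsto_det:
  fixes M :: "'a \<Rightarrow> real ^ 'n ^ 'n"
  assumes "\<And>i j. ((\<lambda>z. M z $ i $ j) \<longlongrightarrow> L $ i $ j) F"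
  shows "((\<lambda>z. det (M z)) \<longlongrightarrow> det L) F"
  unfolding det_def by (intro tendsto_intros assms)

lemma tendsto_matrix_inv:
  fixes M :: "'a \<Rightarrow> real ^ 'n ^ 'n"
  assumes M: "(M \<longlongrightarrow> L) F" and L: "det L \<noteq> 0"
  shows "((\<lambda>z. matrix_inv (M z)) \<longlongrightarrow> matrix_inv L) F"
proof (intro vec_tendstoI)
  fix k l
  have nth: "((\<lambda>z. M z $ i $ j) \<longlongrightarrow> L $ i $ j) F" for i j
    by (intro tendsto_vec_nth M)
  have d: "((\<lambda>z. det (M z)) \<longlongrightarrow> det L) F" by (rule tendsto_det) (rule nth)
  have ev: "\<forall>\<^sub>F z in F. det (M z) \<noteq> 0" by (rule tendsto_imp_eventually_ne[OF d L])
  have "((\<lambda>z. det (\<chi> i j. if j = k then axis l 1 $ i else M z $ i $ j) / det (M z))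
      \<longlongrightarrow> det (\<chi> i j. if j = k then axis l 1 $ i else L $ i $ j) / det L) F"
  proof (intro tendsto_divide d L tendsto_det)
    fix i j
    show "((\<lambda>z. (\<chi> i j. if j = k then axis l 1 $ i else M z $ i $ j) $ i $ j)
      \<longlongrightarrow> (\<chi> i j. if j = k then axis l (1::real) $ i else L $ i $ j) $ i $ j) F"
      using nth[of i j] by (cases "j = k") auto
  qed
  then show "((\<lambda>z. matrix_inv (M z) $ k $ l) \<longlongrightarrow> matrix_inv L $ k $ l) F"
    unfolding matrix_inv_nth[OF L]
    by (rule tendsto_cong[THEN iffD1, rotated])
      (use ev in \<open>eventually_elim, simp add: matrix_inv_nth\<close>)
qed

text \<open>Leibniz expansion: n! products of n entries. It is applied to the inverse of a
  covariance matrix, whose determinant governs the height of the Gaussian.\<close>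

lemma abs_det_le:
  fixes M :: "real ^ 'n ^ 'n"
  assumes "\<And>i j. \<bar>M $ i $ j\<bar> \<le> b"
  shows "\<bar>det M\<bar> \<le> fact CARD('n) * b ^ CARD('n)"
proof -
  have "\<bar>det M\<bar> \<le> (\<Sum>p | p permutes UNIV. \<bar>of_int (sign p) * (\<Prod>i\<in>UNIV. M $ i $ p i)\<bar>)"
    unfolding det_def by (rule sum_abs)
  also have "\<dots> \<le> (\<Sum>p | p permutes (UNIV :: 'n set). b ^ CARD('n))"
  proof (rule sum_mono)
    fix p :: "'n \<Rightarrow> 'n"
    have "\<bar>of_int (sign p) * (\<Prod>i\<in>UNIV. M $ i $ p i)\<bar> = (\<Prod>i\<in>UNIV. \<bar>M $ i $ p i\<bar>)"
      by (simp add: abs_mult abs_prod sign_def)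
    also have "\<dots> \<le> (\<Prod>i\<in>(UNIV::'n set). b)" by (intro prod_mono) (auto simp: assms)
    finally show "\<bar>of_int (sign p) * (\<Prod>i\<in>UNIV. M $ i $ p i)\<bar> \<le> b ^ CARD('n)" by simp
  qed
  also have "\<dots> = fact CARD('n) * b ^ CARD('n)"
    by (simp add: card_permutations)
  finally show ?thesis .
qed

text \<open>Jacobi's formula: the derivative of the determinant replaces one row at a time, and
  Cramer's rule evaluates the resulting determinants.\<close>

lemma has_field_derivative_det:
  fixes M :: "real \<Rightarrow> real ^ 'n ^ 'n"
  assumes M: "\<And>i j. ((\<lambda>s. M s $ i $ j) has_field_derivative M' $ i $ j) (at s0)"
    and inv: "invertible (M s0)"
  shows "((\<lambda>s. det (M s)) has_field_derivative
    det (M s0) * (\<Sum>i\<in>UNIV. \<Sum>j\<in>UNIV. M' $ i $ j * matrix_inv (M s0) $ j $ i)) (at s0)"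
proof -
  let ?A = "M s0" and ?B = "matrix_inv (M s0)"
  have deriv: "((\<lambda>s. det (M s)) has_field_derivative
    (\<Sum>p | p permutes UNIV. of_int (sign p) *
      (\<Sum>k\<in>UNIV. M' $ k $ p k * (\<Prod>i\<in>UNIV - {k}. ?A $ i $ p i)))) (at s0)"
    unfolding det_def
    by (intro DERIV_sum DERIV_cmult has_field_derivative_prod) (rule M)
  have row: "(\<Sum>p | p permutes UNIV. of_int (sign p) * (M' $ k $ p k * (\<Prod>i\<in>UNIV - {k}. ?A $ i $ p i)))
      = det ?A * (\<Sum>j\<in>UNIV. M' $ k $ j * ?B $ j $ k)" for k
  proof -
    define x :: "real ^ 'n" where "x = transpose ?B *v (M' $ k)"
    have x: "x $ i = (\<Sum>j\<in>UNIV. M' $ k $ j * ?B $ j $ i)" for i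
      by (simp add: x_def matrix_vector_mult_def transpose_def mult.commute)
    have "transpose ?A *v x = M' $ k"
      unfolding x_def matrix_vector_mul_assoc matrix_transpose_mul[symmetric]
      by (simp add: matrix_inv_left[OF inv])
    then have comb: "(\<Sum>i\<in>UNIV. x $ i *s row i ?A) = M' $ k"
      by (simp add: matrix_vector_mult_def transpose_def vec_eq_iff row_def mult.commute)
    have "(\<Sum>p | p permutes UNIV. of_int (sign p) * (M' $ k $ p k * (\<Prod>i\<in>UNIV - {k}. ?A $ i $ p i)))
      = det (\<chi> i. if i = k then M' $ k else row i ?A)"
      unfolding det_def
    proof (rule sum.cong[OF refl])
      fix p :: "'n \<Rightarrow> 'n"
      have "(\<Prod>i\<in>UNIV. (\<chi> i. if i = k then M' $ k else row i ?A) $ i $ p i)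
        = M' $ k $ p k * (\<Prod>i\<in>UNIV - {k}. ?A $ i $ p i)"
        by (subst prod.remove[of _ k]) (auto simp: row_def intro!: prod.cong)
      then show "of_int (sign p) * (M' $ k $ p k * (\<Prod>i\<in>UNIV - {k}. ?A $ i $ p i)) =
         of_int (sign p) * (\<Prod>i\<in>UNIV. (\<chi> i. if i = k then M' $ k else row i ?A) $ i $ p i)" by simp
    qed
    also have "\<dots> = x $ k * det ?A"
      using cramer_lemma_transpose[of k x ?A] unfolding comb .
    finally show ?thesis by (simp add: x mult.commute)
  qed
  have "(\<Sum>p | p permutes UNIV. of_int (sign p) *
      (\<Sum>k\<in>UNIV. M' $ k $ p k * (\<Prod>i\<in>UNIV - {k}. ?A $ i $ p i)))
      = (\<Sum>k\<in>UNIV. det ?A * (\<Sum>j\<in>UNIV. M' $ k $ j * ?B $ j $ k))"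
    unfolding sum_distrib_left[of "of_int _"] by (subst sum.swap) (simp add: row)
  then show ?thesis using deriv by (simp add: sum_distrib_left)
qed

lemma tendsto_matrix_vector_mult [tendsto_intros]:
  fixes M :: "'a \<Rightarrow> real ^ 'n ^ 'm"
  assumes "(M \<longlongrightarrow> L) F" "(v \<longlongrightarrow> w) F"
  shows "((\<lambda>z. M z *v v z) \<longlongrightarrow> L *v w) F"
  unfolding matrix_vector_mult_def
  by (intro vec_tendstoI) (auto intro!: tendsto_sum tendsto_mult tendsto_vec_nth assms)

text \<open>With B the inverse of M, the resolvent identity B_s - B_0 = - B_s (M_s - M_0) B_0 turns
  the difference quotient into an expression whose limit follows from the continuity of the
  inverse.\<close>

lemma has_field_derivative_matrix_inv_quad:
  fixes M :: "real \<Rightarrow> real ^ 'n ^ 'n"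
  assumes M: "\<And>i j. ((\<lambda>s. M s $ i $ j) has_field_derivative M' $ i $ j) (at s0)" and pd: "\<forall>\<^sub>F s in nhds s0. posdef (M s)"
  shows "((\<lambda>s. (matrix_inv (M s) *v y) \<bullet> y) has_field_derivative
    - ((M' *v (matrix_inv (M s0) *v y)) \<bullet> (matrix_inv (M s0) *v y))) (at s0)"
proof -
  let ?B = "\<lambda>s. matrix_inv (M s)" and ?w = "matrix_inv (M s0) *v y"
  have pd0: "posdef (M s0)" using pd by (rule eventually_nhds_x_imp_x)
  have lim: "(M \<longlongrightarrow> M s0) (at s0)"
    by (intro vec_tendstoI) (use DERIV_isCont[OF M] in \<open>simp add: isCont_def\<close>)
  have quot: "((\<lambda>s. (M s - M s0) /\<^sub>R (s - s0)) \<longlongrightarrow> M') (at s0)"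
    by (intro vec_tendstoI)
      (use M in \<open>simp add: has_field_derivative_iff divide_inverse mult.commute\<close>)
  have "((\<lambda>s. - ((((M s - M s0) /\<^sub>R (s - s0)) *v ?w) \<bullet> (?B s *v y))) \<longlongrightarrow>
      - ((M' *v ?w) \<bullet> ?w)) (at s0)"
    by (intro tendsto_intros quot tendsto_matrix_inv lim)
      (use posdef_det_pos[OF pd0] in auto)
  moreover have "\<forall>\<^sub>F s in at s0. - ((((M s - M s0) /\<^sub>R (s - s0)) *v ?w) \<bullet> (?B s *v y))
      = ((?B s *v y) \<bullet> y - (?B s0 *v y) \<bullet> y) / (s - s0)"
  proof -
    have "\<forall>\<^sub>F s in at s0. posdef (M s)"
      using pd by (auto simp: eventually_at_filter elim: eventually_mono)
    then show ?thesis
    proof eventually_elim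
      case (elim s)
      have symB: "(?B s *v x) \<bullet> z = x \<bullet> (?B s *v z)" for x z
        using posdef_matrix_inv[OF elim] by (intro symmetric_matrix_inner) (simp add: posdef_def)
      have "((M s - M s0) *v ?w) \<bullet> (?B s *v y) = (M s *v ?w) \<bullet> (?B s *v y) - y \<bullet> (?B s *v y)"
        by (simp add: matrix_vector_mult_diff_rdistrib inner_diff_left
            matrix_inv_cancel posdef_invertible[OF pd0])
      also have "(M s *v ?w) \<bullet> (?B s *v y) = ?w \<bullet> y"
        by (simp add: symB[symmetric] matrix_inv_cancel posdef_invertible[OF elim])
      finally have "((?B s *v y) \<bullet> y - (?B s0 *v y) \<bullet> y) = - (((M s - M s0) *v ?w) \<bullet> (?B s *v y))"
        by (simp add: inner_commute)
      moreover have "((M s - M s0) /\<^sub>R (s - s0)) *v ?w = ((M s - M s0) *v ?w) /\<^sub>R (s - s0)"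
        by (simp add: scaleR_matrix_vector_assoc)
      ultimately show ?case by (simp add: divide_inverse mult.commute)
    qed
  qed
  ultimately have "((\<lambda>s. ((?B s *v y) \<bullet> y - (?B s0 *v y) \<bullet> y) / (s - s0)) \<longlongrightarrow>
      - ((M' *v ?w) \<bullet> ?w)) (at s0)"
    by (rule Lim_transform_eventually)
  then show ?thesis by (simp add: has_field_derivative_iff)
qed

section \<open>Linear changes of variables for Lebesgue measure\<close>

lemma nn_integral_lborel_translate:
  fixes f :: "'a::euclidean_space \<Rightarrow> ennreal"
  assumes "f \<in> borel_measurable borel"
  shows "(\<integral>\<^sup>+x. f (c + x) \<partial>lborel) = (\<integral>\<^sup>+x. f x \<partial>lborel)"
proof -
  have "(\<integral>\<^sup>+x. f x \<partial>lborel) = (\<integral>\<^sup>+x. f x \<partial>distr lborel borel ((+) c))"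
    by (simp add: lborel_distr_plus)
  then show ?thesis using assms by (simp add: nn_integral_distr)
qed

lemma borel_measurable_matrix_vector [measurable]:
  fixes A :: "real ^ 'n ^ 'm"
  shows "(*v) A \<in> borel_measurable borel"
  by (intro borel_measurable_continuous_onI linear_continuous_on matrix_vector_mul_bounded_linear)

text \<open>Uniqueness of Haar measure, in the form needed for a linear image of Lebesgue measure.\<close>

lemma nn_integral_linear_const:
  fixes A :: "real ^ 'n ^ 'n"
  assumes "invertible A"
  shows "\<exists>C. \<forall>f\<in>borel_measurable borel.
    (\<integral>\<^sup>+x. f (A *v x) \<partial>lborel) = C * (\<integral>\<^sup>+x. f x \<partial>lborel)"
proof (intro exI ballI)
  fix f :: "real ^ 'n \<Rightarrow> ennreal" assume [measurable]: "f \<in> borel_measurable borel"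
  \<comment> \<open>An auxiliary weight of integral one. Translating x by A^{-1} y and then y by -A
    x moves the dependence on A from f to h; after one more translation of x the constant is the
    integral of h(-A x).\<close>
  define h :: "real ^ 'n \<Rightarrow> ennreal" where "h = indicator (cbox 0 One)"
  have h [measurable]: "h \<in> borel_measurable borel" by (simp add: h_def)
  have h1: "(\<integral>\<^sup>+x. h x \<partial>lborel) = 1" by (simp add: h_def emeasure_lborel_cbox)
  let ?B = "matrix_inv A"
  have AB: "A *v (?B *v y + x) = y + A *v x" for x y
    by (simp add: matrix_vector_right_distrib matrix_inv_cancel assms)
  have "(\<integral>\<^sup>+x. f (A *v x) \<partial>lborel) = (\<integral>\<^sup>+y. (\<integral>\<^sup>+x. f (A *v x) \<partial>lborel) * h y \<partial>lborel)"
    by (simp add: nn_integral_cmult h1)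
  also have "\<dots> = (\<integral>\<^sup>+y. \<integral>\<^sup>+x. f (y + A *v x) * h y \<partial>lborel \<partial>lborel)"
  proof (rule nn_integral_cong)
    fix y :: "real ^ 'n"
    show "(\<integral>\<^sup>+x. f (A *v x) \<partial>lborel) * h y = (\<integral>\<^sup>+x. f (y + A *v x) * h y \<partial>lborel)"
      using nn_integral_lborel_translate[of "\<lambda>x. f (A *v x)" "?B *v y"]
      by (simp add: AB nn_integral_multc)
  qed
  also have "\<dots> = (\<integral>\<^sup>+x. \<integral>\<^sup>+y. f (y + A *v x) * h y \<partial>lborel \<partial>lborel)"
    by (rule lborel_pair.Fubini') simp
  also have "\<dots> = (\<integral>\<^sup>+x. \<integral>\<^sup>+y. f y * h (y - A *v x) \<partial>lborel \<partial>lborel)"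
  proof (rule nn_integral_cong)
    fix x :: "real ^ 'n"
    show "(\<integral>\<^sup>+y. f (y + A *v x) * h y \<partial>lborel) = (\<integral>\<^sup>+y. f y * h (y - A *v x) \<partial>lborel)"
      using nn_integral_lborel_translate[of "\<lambda>y. f y * h (y - A *v x)" "A *v x"]
      by (simp add: add.commute)
  qed
  also have "\<dots> = (\<integral>\<^sup>+y. \<integral>\<^sup>+x. f y * h (y - A *v x) \<partial>lborel \<partial>lborel)"
    by (rule lborel_pair.Fubini'[symmetric]) simp
  also have "\<dots> = (\<integral>\<^sup>+y. f y * (\<integral>\<^sup>+x. h (- (A *v x)) \<partial>lborel) \<partial>lborel)"
  proof (rule nn_integral_cong)
    fix y :: "real ^ 'n"
    show "(\<integral>\<^sup>+x. f y * h (y - A *v x) \<partial>lborel) = f y * (\<integral>\<^sup>+x. h (- (A *v x)) \<partial>lborel)"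
      using nn_integral_lborel_translate[of "\<lambda>x. h (y - A *v x)" "?B *v y"]
      by (simp add: AB nn_integral_cmult)
  qed
  also have "\<dots> = (\<integral>\<^sup>+x. h (- (A *v x)) \<partial>lborel) * (\<integral>\<^sup>+x. f x \<partial>lborel)"
    by (simp add: nn_integral_multc mult.commute)
  finally show "(\<integral>\<^sup>+x. f (A *v x) \<partial>lborel)
      = (\<integral>\<^sup>+x. indicator (cbox 0 One) (- (A *v x)) \<partial>lborel) * (\<integral>\<^sup>+x. f x \<partial>lborel)"
    by (simp add: h_def)
qed

text \<open>Applying the constant C of \<open>nn_integral_linear_const\<close> twice gives C^2 = 1,
  and C is nonnegative, so C = 1; also det A is 1 or -1. Swaps and shears are reduced to this case
  in \<open>nn_integral_linear\<close>.\<close>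

lemma nn_integral_linear_involution:
  fixes A :: "real ^ 'n ^ 'n"
  assumes A: "A ** A = mat 1" and f [measurable]: "f \<in> borel_measurable borel"
  shows "ennreal \<bar>det A\<bar> * (\<integral>\<^sup>+x. f (A *v x) \<partial>lborel) = (\<integral>\<^sup>+x. f x \<partial>lborel)"
proof -
  have "invertible A" using A unfolding invertible_def by blast
  then obtain C where C: "\<And>f. f \<in> borel_measurable borel \<Longrightarrow>
      (\<integral>\<^sup>+x. f (A *v x) \<partial>lborel) = C * (\<integral>\<^sup>+x. f x \<partial>lborel)"
    using nn_integral_linear_const[of A] by blast
  have "det A * det A = 1" using A by (metis det_I det_mul)
  then have "det A = 1 \<or> det A = - 1" by (simp add: square_eq_1_iff)
  then have d: "\<bar>det A\<bar> = 1" by auto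
  let ?h = "indicator (cbox 0 One) :: real ^ 'n \<Rightarrow> ennreal"
  have "1 = (\<integral>\<^sup>+x. ?h (A *v (A *v x)) \<partial>lborel)"
    by (simp add: matrix_vector_mul_assoc A emeasure_lborel_cbox)
  also have "\<dots> = C * (C * (\<integral>\<^sup>+x. ?h x \<partial>lborel))"
    by (subst C[of "\<lambda>x. ?h (A *v x)"], measurable) (subst C[of ?h], simp_all)
  also have "\<dots> = C * C" by (simp add: emeasure_lborel_cbox)
  finally have CC: "C * C = 1" by simp
  have "C = 1"
  proof (cases C)
    case (real r)
    then have "r * r = 1" using CC by (simp flip: ennreal_mult ennreal_1)
    then have "r = 1 \<or> r = - 1" by (simp add: square_eq_1_iff)
    then have "r = 1" using real(1) by auto
    then show ?thesis using real by simp
  next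
    case top
    then show ?thesis using CC by simp
  qed
  then show ?thesis by (simp add: C d)
qed

text \<open>The property is multiplicative, so elementary factors suffice: diagonal matrices reduce
  to \<open>lborel_affine_euclidean\<close>, swaps are involutions, shears are products of two
  involutions. With the condition on the determinant inside \<open>P\<close>, the case of a zero row
  is vacuous.\<close>

lemma nn_integral_linear:
  fixes A :: "real ^ 'n ^ 'n"
  assumes "det A \<noteq> 0" "f \<in> borel_measurable borel"
  shows "ennreal \<bar>det A\<bar> * (\<integral>\<^sup>+x. f (A *v x) \<partial>lborel) = (\<integral>\<^sup>+x. f x \<partial>lborel)"
proof -
  define P where "P A \<longleftrightarrow> (det A \<noteq> 0 \<longrightarrow> (\<forall>f\<in>borel_measurable borel.
    ennreal \<bar>det A\<bar> * (\<integral>\<^sup>+x. f (A *v x) \<partial>lborel) = (\<integral>\<^sup>+x. f x \<partial>lborel)))"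
    for A :: "real ^ 'n ^ 'n"
  have inv: "P A" if "A ** A = mat 1" for A
    using nn_integral_linear_involution[OF that] by (simp add: P_def)
  have mult: "P (A ** B)" if "P A" "P B" for A B
    unfolding P_def
  proof (intro impI ballI)
    fix f :: "real ^ 'n \<Rightarrow> ennreal" assume f [measurable]: "f \<in> borel_measurable borel" and d: "det (A ** B) \<noteq> 0"
    have dA: "det A \<noteq> 0" and dB: "det B \<noteq> 0" using d by (auto simp: det_mul)
    have "ennreal \<bar>det (A ** B)\<bar> * (\<integral>\<^sup>+x. f (A ** B *v x) \<partial>lborel)
      = ennreal \<bar>det A\<bar> * (ennreal \<bar>det B\<bar> * (\<integral>\<^sup>+x. f (A *v (B *v x)) \<partial>lborel))"
      by (simp add: det_mul abs_mult ennreal_mult matrix_vector_mul_assoc mult.assoc)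
    also have "\<dots> = ennreal \<bar>det A\<bar> * (\<integral>\<^sup>+x. f (A *v x) \<partial>lborel)"
    proof -
      have "(\<lambda>x. f (A *v x)) \<in> borel_measurable borel" by measurable
      then have "ennreal \<bar>det B\<bar> * (\<integral>\<^sup>+x. f (A *v (B *v x)) \<partial>lborel)
        = (\<integral>\<^sup>+x. f (A *v x) \<partial>lborel)"
        by (rule that(2)[unfolded P_def, rule_format, OF dB])
      then show ?thesis by simp
    qed
    also have "\<dots> = (\<integral>\<^sup>+x. f x \<partial>lborel)"
      using that(1) dA by (simp add: P_def)
    finally show "ennreal \<bar>det (A ** B)\<bar> * (\<integral>\<^sup>+x. f (A ** B *v x) \<partial>lborel) = (\<integral>\<^sup>+x. f x \<partial>lborel)" .
  qed
  have diag: "P A" if A: "\<And>i j. i \<noteq> j \<Longrightarrow> A $ i $ j = 0" for A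
    unfolding P_def
  proof (intro impI ballI)
    fix f :: "real ^ 'n \<Rightarrow> ennreal" assume f [measurable]: "f \<in> borel_measurable borel" and d: "det A \<noteq> 0"
    have detA: "det A = (\<Prod>i\<in>UNIV. A $ i $ i)" by (rule det_diagonal) (rule A)
    then have nz: "A $ i $ i \<noteq> 0" for i using d by auto
    define c where "c b = (A *v b) \<bullet> b" for b
    have c_axis: "c (axis i 1) = A $ i $ i" for i
      by (simp add: c_def matrix_vector_mult_basis inner_axis column_def)
    have ax: "axis j (1::real) $ i = (if i = j then 1 else 0)" for i j :: 'n
      by (simp add: axis_def)
    have B: "(Basis :: (real ^ 'n) set) = (\<lambda>i. axis i 1) ` UNIV" by (auto simp: Basis_vec_def)
    have inj: "inj_on (\<lambda>i. axis i (1::real) :: real ^ 'n) UNIV"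
      by (auto simp: inj_on_def axis_eq_axis)
    have T: "0 + (\<Sum>j\<in>Basis. (c j * (x \<bullet> j)) *\<^sub>R j) = A *v x" for x
    proof -
      have "(A *v x) $ i = A $ i $ i * x $ i" for i
      proof -
        have "(A *v x) $ i = (\<Sum>j\<in>UNIV. A $ i $ j * x $ j)" by (simp add: matrix_vector_mult_def)
        also have "\<dots> = (\<Sum>j\<in>UNIV. if i = j then A $ i $ i * x $ i else 0)"
          by (rule sum.cong) (use A in auto)
        finally show ?thesis by simp
      qed
      then show ?thesis
        unfolding B by (subst sum.reindex[OF inj])
          (simp add: vec_eq_iff c_axis inner_axis ax if_distrib[of "\<lambda>x. _ * x"] cong: if_cong)
    qed
    have c0: "c j \<noteq> 0" if "j \<in> Basis" for j using that nz by (auto simp: B c_axis)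
    have "(lborel :: (real ^ 'n) measure) = density (distr lborel borel (\<lambda>x. A *v x)) (\<lambda>_. (\<Prod>j\<in>Basis. \<bar>c j\<bar>))"
      using lborel_affine_euclidean[of c 0, OF c0] unfolding T by simp
    then have "(\<integral>\<^sup>+x. f x \<partial>lborel) = (\<integral>\<^sup>+x. f x \<partial>density (distr lborel borel (\<lambda>x. A *v x)) (\<lambda>_. (\<Prod>j\<in>Basis. \<bar>c j\<bar>)))"
      by simp
    also have "\<dots> = ennreal (\<Prod>j\<in>Basis. \<bar>c j\<bar>) * (\<integral>\<^sup>+x. f (A *v x) \<partial>lborel)"
      by (simp add: nn_integral_density nn_integral_distr nn_integral_cmult)
    also have "(\<Prod>j\<in>Basis. \<bar>c j\<bar>) = \<bar>det A\<bar>"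
      unfolding B by (subst prod.reindex[OF inj]) (simp add: c_axis detA abs_prod)
    finally show "ennreal \<bar>det A\<bar> * (\<integral>\<^sup>+x. f (A *v x) \<partial>lborel) = (\<integral>\<^sup>+x. f x \<partial>lborel)" by simp
  qed
  have "P A"
  proof (rule induct_matrix_elementary_alt[of P])
    show "P A" if "row i A = 0" for A i
      using det_zero_row(1)[of i A] that by (simp add: P_def)
    show "P (\<chi> i j. mat 1 $ i $ Transposition.transpose m n j)" if "m \<noteq> n" for m n :: 'n
    proof (rule inv)
      show "(\<chi> i j. mat 1 $ i $ Transposition.transpose m n j) **
          (\<chi> i j. mat 1 $ i $ Transposition.transpose m n j) = (mat 1 :: real ^ 'n ^ 'n)"
      proof -
        let ?\<sigma> = "Transposition.transpose m n"
        define E :: "real ^ 'n ^ 'n" where "E = (\<chi> i j. mat 1 $ i $ ?\<sigma> j)"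
        have E: "E $ i $ k = (if k = ?\<sigma> i then 1 else 0)" for i k
        proof -
          have "i = ?\<sigma> k \<longleftrightarrow> k = ?\<sigma> i" by (metis transpose_involutory)
          then show ?thesis by (simp add: E_def mat_def)
        qed
        have "(E ** E) $ i $ k = mat 1 $ i $ k" for i k
        proof -
          have "(E ** E) $ i $ k = (\<Sum>j\<in>UNIV. if j = ?\<sigma> i then E $ j $ k else 0)"
            unfolding matrix_matrix_mult_def vec_lambda_beta by (rule sum.cong) (simp_all add: E)
          also have "\<dots> = E $ ?\<sigma> i $ k" by simp
          also have "\<dots> = mat 1 $ i $ k" by (simp add: E mat_def eq_commute)
          finally show ?thesis .
        qed
        then show ?thesis by (simp add: vec_eq_iff E_def)
      qed
    qed
    show "P (\<chi> i j. of_bool (i = m \<and> j = n \<or> i = j))" if "m \<noteq> n" for m n :: 'n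
    proof -
      let ?S = "\<chi> i j. of_bool (i = m \<and> j = n \<or> i = j) :: real ^ 'n ^ 'n"
      \<comment> \<open>Reflection of the m-th coordinate. Both \<open>?D\<close> and
        \<open>?S ** ?D\<close> square to the identity, and the shear is the product of
        \<open>?S ** ?D\<close> and \<open>?D\<close>.\<close>
      let ?D = "\<chi> i j. if i = j then (if i = m then -1 else 1) else 0 :: real ^ 'n ^ 'n"
      have D: "(M ** ?D) $ i $ j = M $ i $ j * (if j = m then -1 else 1)" for M :: "real ^ 'n ^ 'n" and i j
        by (simp add: matrix_matrix_mult_def if_distrib[of "\<lambda>x. _ * x"] cong: if_cong)
      have DD: "?D ** ?D = mat 1" by (simp add: vec_eq_iff D mat_def)
      have "(?S ** ?D) ** (?S ** ?D) = mat 1"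
      proof -
        have "((?S ** ?D) ** (?S ** ?D)) $ i $ k = mat 1 $ i $ k" for i k
        proof -
          have "((?S ** ?D) ** (?S ** ?D)) $ i $ k =
            (\<Sum>j\<in>UNIV. (of_bool (i = m \<and> j = n \<or> i = j) * (if j = m then -1 else 1)) * ((?S ** ?D) $ j $ k))"
            unfolding matrix_matrix_mult_def[of "?S ** ?D"] by (simp add: D)
          also have "\<dots> = (\<Sum>j\<in>UNIV. (if j = i then (if i = m then -1 else 1) * ((?S ** ?D) $ i $ k) else 0)
              + (if j = n then (if i = m then (?S ** ?D) $ n $ k else 0) else 0))"
            using that by (intro sum.cong) auto
          also have "\<dots> = (if i = m then -1 else 1) * ((?S ** ?D) $ i $ k) + (if i = m then (?S ** ?D) $ n $ k else 0)"
            by (simp add: sum.distrib)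
          also have "\<dots> = mat 1 $ i $ k" using that by (auto simp: D mat_def)
          finally show ?thesis .
        qed
        then show ?thesis by (simp add: vec_eq_iff)
      qed
      then have "P (?S ** ?D)" by (rule inv)
      moreover have "P ?D" by (rule inv) (rule DD)
      ultimately have "P ((?S ** ?D) ** ?D)" by (rule mult)
      then show ?thesis by (simp add: matrix_mul_assoc[symmetric] DD)
    qed
  qed (fact mult diag)+
  with assms show ?thesis by (simp add: P_def)
qed

lemma nn_integral_exp_minus_square_real:
  "(\<integral>\<^sup>+x. ennreal (exp (- x\<^sup>2)) \<partial>lborel) = ennreal (sqrt pi)"
proof -
  \<comment> \<open>Variance 1/2 turns the normal density into exp(-x^2) / sqrt \<pi>.\<close>
  have "prob_space (density lborel (normal_density 0 (sqrt (1/2))))"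
    by (rule prob_space_normal_density) simp
  then have "(\<integral>\<^sup>+x. ennreal (normal_density 0 (sqrt (1/2)) x) \<partial>lborel) = 1"
    using prob_space.emeasure_space_1 by (fastforce simp: emeasure_density)
  moreover have "ennreal (normal_density 0 (sqrt (1/2)) x) = ennreal (1 / sqrt pi) * ennreal (exp (- x\<^sup>2))" for x
    by (simp add: normal_density_def flip: ennreal_mult)
  ultimately have "ennreal (1 / sqrt pi) * (\<integral>\<^sup>+x. ennreal (exp (- x\<^sup>2)) \<partial>lborel) = 1"
    by (simp add: nn_integral_cmult)
  then have "ennreal (sqrt pi) * (ennreal (1 / sqrt pi) * (\<integral>\<^sup>+x. ennreal (exp (- x\<^sup>2)) \<partial>lborel)) = ennreal (sqrt pi)"
    by simp
  then show ?thesis by (simp add: mult.assoc[symmetric] flip: ennreal_mult)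
qed

lemma nn_integral_exp_minus_norm_square:
  "(\<integral>\<^sup>+x. ennreal (exp (- (norm (x :: real ^ 'n))\<^sup>2)) \<partial>lborel) = ennreal (pi powr (real CARD('n) / 2))"
proof -
  have "ennreal (exp (- (norm x)\<^sup>2)) = (\<Prod>b\<in>Basis. ennreal (exp (- (x \<bullet> b)\<^sup>2)))" for x :: "real ^ 'n"
    by (subst prod_ennreal) (simp_all add: euclidean_dist_l2 norm_eq_sqrt_inner euclidean_inner[of x x]
        power2_eq_square exp_sum[symmetric] sum_negf sum_nonneg)
  then have "(\<integral>\<^sup>+x. ennreal (exp (- (norm (x :: real ^ 'n))\<^sup>2)) \<partial>lborel) = ennreal (sqrt pi) ^ CARD('n)"
    by (simp add: nn_integral_lborel_prod[where f="\<lambda>b x. ennreal (exp (- x\<^sup>2))"] nn_integral_exp_minus_square_real)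
  also have "\<dots> = ennreal (pi powr (real CARD('n) / 2))"
    by (simp add: ennreal_power powr_half_sqrt[symmetric] powr_powr flip: powr_realpow)
  finally show ?thesis .
qed

section \<open>Gaussian kernels\<close>

text \<open>For positive definite \<open>M\<close> this is the density of the centred normal law
  with covariance 2 M, that is, the heat kernel after accumulated diffusion \<open>M\<close>. The
  determinant of the inverse is kept so that \<open>kern\<close> matches it literally.\<close>

definition gauss :: "real ^ 'n ^ 'n \<Rightarrow> real ^ 'n \<Rightarrow> real" where
  "gauss M x = exp (- (1 / 4) * ((matrix_inv M *v x) \<bullet> x)) /
     ((4 * pi) powr (real CARD('n) / 2) * det (matrix_inv M) powr (- (1 / 2)))"

text \<open>Closed forms of the first and second partial derivatives; bounds, limits and scaling are
  read off from them. In \<open>gauss2\<close> the outer derivative is the one in direction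
  \<open>i\<close>.\<close>

definition gauss1 :: "real ^ 'n ^ 'n \<Rightarrow> 'n \<Rightarrow> real ^ 'n \<Rightarrow> real" where
  "gauss1 M j x = - (1 / 2) * (matrix_inv M *v x) $ j * gauss M x"

definition gauss2 :: "real ^ 'n ^ 'n \<Rightarrow> 'n \<Rightarrow> 'n \<Rightarrow> real ^ 'n \<Rightarrow> real" where
  "gauss2 M i j x = ((1 / 4) * (matrix_inv M *v x) $ i * (matrix_inv M *v x) $ j
      - (1 / 2) * matrix_inv M $ i $ j) * gauss M x"

lemma kern_eq_gauss: "kern a t \<tau> x = (if \<tau> > 0 then exp (- \<tau>) * gauss (Amat a t \<tau>) x else 0)"
  by (simp add: kern_def gauss_def Bmat_def)

lemma gauss_nonneg [simp]: "0 \<le> gauss M x"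
  by (simp add: gauss_def)

lemma inverse_powr_minus_half: "d > 0 \<Longrightarrow> inverse d powr (- (1 / 2)) = d powr (1 / 2)" for d :: real
  by (simp add: powr_def ln_inverse)

lemma gauss_det:
  fixes M :: "real ^ 'n ^ 'n"
  assumes "posdef M"
  shows "gauss M x = exp (- (1 / 4) * ((matrix_inv M *v x) \<bullet> x)) * det M powr (- (1 / 2))
     / (4 * pi) powr (real CARD('n) / 2)"
proof -
  let ?c = "(4 * pi) powr (real CARD('n) / 2)" and ?E = "exp (- (1 / 4) * ((matrix_inv M *v x) \<bullet> x))"
  have "gauss M x = ?E / (?c * det M powr (1 / 2))"
    unfolding gauss_def det_matrix_inv[OF posdef_invertible[OF assms]]
      inverse_powr_minus_half[OF posdef_det_pos[OF assms]] ..
  also have "\<dots> = ?E * inverse (det M powr (1 / 2)) / ?c"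
    by (simp only: divide_inverse inverse_mult_distrib mult_ac)
  finally show ?thesis unfolding powr_minus .
qed

lemma borel_measurable_gauss [measurable]: "gauss M \<in> borel_measurable borel"
  unfolding gauss_def by measurable

lemma det_scaleR_matrix:
  fixes M :: "real ^ 'n ^ 'n"
  shows "det (c *\<^sub>R M) = c ^ CARD('n) * det M"
  by (simp add: det_def prod.distrib sum_distrib_left mult_ac)

text \<open>The substitution x = 2 S w normalises the Gaussian: <M^{-1} S w, S w> = |w|^2, and |det
  (2 S)| cancels the prefactor up to \<pi>^{n/2}. It is also the substitution that brings I and J
  into their form with a(t)^{1/2}.\<close>

lemma nn_integral_gauss_sqrt:
  fixes M S :: "real ^ 'n ^ 'n"
  assumes S: "posdef S" "S ** S = M" and M: "posdef M" and f [measurable]: "f \<in> borel_measurable borel"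
  shows "(\<integral>\<^sup>+x. ennreal (gauss M x) * f x \<partial>lborel) =
    (\<integral>\<^sup>+w. ennreal (exp (- (norm w)\<^sup>2) / pi powr (real CARD('n) / 2)) * f (2 *\<^sub>R (S *v w)) \<partial>lborel)"
proof -
  let ?n = "real CARD('n)"
  have dS: "det S > 0" using S(1) by (rule posdef_det_pos)
  have d2: "det (2 *\<^sub>R S) > 0" using dS by (simp add: det_scaleR_matrix)
  have A: "(2 *\<^sub>R S) *v w = 2 *\<^sub>R (S *v w)" for w by (simp add: scaleR_matrix_vector_assoc)
  have symS: "transpose S = S" using S(1) by (simp add: posdef_def)
  have quad: "(matrix_inv M *v (S *v w)) \<bullet> (S *v w) = (norm w)\<^sup>2" for w
  proof -
    let ?y = "matrix_inv M *v (S *v w)"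
    have "M *v ?y = S *v w" by (rule matrix_inv_cancel[OF posdef_invertible[OF M]])
    then have "matrix_inv S *v (S *v (S *v ?y)) = matrix_inv S *v (S *v w)"
      by (simp add: S(2)[symmetric] flip: matrix_vector_mul_assoc)
    then have "S *v ?y = w" by (simp add: matrix_inv_cancel[OF posdef_invertible[OF S(1)]])
    then have "?y \<bullet> (S *v w) = w \<bullet> w" using symmetric_matrix_inner[OF symS, of ?y w] by simp
    then show ?thesis by (simp add: dot_square_norm)
  qed
  have "det M powr (- (1/2)) = 1 / det S"
  proof -
    have "det M = (det S)\<^sup>2" using S(2) by (metis det_mul power2_eq_square)
    then show ?thesis using dS by (simp add: powr_minus powr_half_sqrt inverse_eq_divide)
  qed
  moreover have "(4 * pi) powr (?n / 2) = 2 ^ CARD('n) * pi powr (?n / 2)"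
  proof -
    have "(4::real) powr (?n / 2) = (2 powr 2) powr (?n / 2)" by simp
    also have "\<dots> = 2 ^ CARD('n)" unfolding powr_powr by (simp add: powr_realpow)
    finally show ?thesis by (simp add: powr_mult)
  qed
  ultimately have val: "\<bar>det (2 *\<^sub>R S)\<bar> * gauss M ((2 *\<^sub>R S) *v w) = exp (- (norm w)\<^sup>2) / pi powr (?n / 2)" for w
    using dS d2 unfolding gauss_det[OF M] A
    by (simp add: matrix_vector_mult_scaleR quad det_scaleR_matrix abs_mult field_simps)
  have "(\<integral>\<^sup>+x. ennreal (gauss M x) * f x \<partial>lborel) =
      ennreal \<bar>det (2 *\<^sub>R S)\<bar> * (\<integral>\<^sup>+w. ennreal (gauss M ((2 *\<^sub>R S) *v w)) * f ((2 *\<^sub>R S) *v w) \<partial>lborel)"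
    by (rule nn_integral_linear[symmetric]) (use d2 in auto)
  also have "\<dots> = (\<integral>\<^sup>+w. ennreal \<bar>det (2 *\<^sub>R S)\<bar> * (ennreal (gauss M ((2 *\<^sub>R S) *v w)) * f ((2 *\<^sub>R S) *v w)) \<partial>lborel)"
    by (rule nn_integral_cmult[symmetric]) measurable
  also have "\<dots> = (\<integral>\<^sup>+w. ennreal (exp (- (norm w)\<^sup>2) / pi powr (?n / 2)) * f (2 *\<^sub>R (S *v w)) \<partial>lborel)"
    by (rule nn_integral_cong) (simp only: mult.assoc[symmetric] ennreal_mult[symmetric] abs_ge_zero gauss_nonneg val, simp only: A)
  finally show ?thesis .
qed

lemma nn_integral_std_gauss:
  "(\<integral>\<^sup>+w. ennreal (exp (- (norm w)\<^sup>2) / pi powr (real CARD('n) / 2)) \<partial>(lborel :: (real ^ 'n) measure)) = 1"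
proof -
  have "ennreal (exp (- (norm w)\<^sup>2) / pi powr (real CARD('n) / 2)) =
     ennreal (1 / pi powr (real CARD('n) / 2)) * ennreal (exp (- (norm w)\<^sup>2))" for w :: "real ^ 'n"
    by (subst ennreal_mult[symmetric]) auto
  then have "(\<integral>\<^sup>+w. ennreal (exp (- (norm w)\<^sup>2) / pi powr (real CARD('n) / 2)) \<partial>(lborel :: (real ^ 'n) measure))
    = ennreal (1 / pi powr (real CARD('n) / 2)) * ennreal (pi powr (real CARD('n) / 2))"
    by (simp add: nn_integral_cmult nn_integral_exp_minus_norm_square)
  also have "\<dots> = ennreal (1 / pi powr (real CARD('n) / 2) * pi powr (real CARD('n) / 2))"
    by (rule ennreal_mult[symmetric]) auto
  finally show ?thesis by simp
qed

lemma nn_integral_gauss: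
  assumes "posdef M"
  shows "(\<integral>\<^sup>+x. ennreal (gauss M x) \<partial>lborel) = 1"
  using nn_integral_gauss_sqrt[OF mat_sqrt[OF assms] assms, of "\<lambda>_. 1"]
  by (simp add: nn_integral_std_gauss)

lemma integrable_gauss:
  assumes "posdef M"
  shows "integrable lborel (gauss M)" and integral_gauss: "integral\<^sup>L lborel (gauss M) = 1"
proof -
  show "integrable lborel (gauss M)"
    by (rule integrableI_bounded) (simp_all add: nn_integral_gauss[OF assms])
  show "integral\<^sup>L lborel (gauss M) = 1"
    by (subst integral_eq_nn_integral) (simp_all add: nn_integral_gauss[OF assms])
qed

text \<open>Rephrasing the substitution as an equality of measures yields the Bochner version at
  once, also for integrands that are not integrable.\<close>

lemma integral_gauss_sqrt:
  fixes M :: "real ^ 'n ^ 'n" and f :: "real ^ 'n \<Rightarrow> real"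
  assumes M: "posdef M" and f [measurable]: "f \<in> borel_measurable borel"
  shows "(\<integral>x. gauss M x * f x \<partial>lborel) =
    (\<integral>w. exp (- (norm w)\<^sup>2) / pi powr (real CARD('n) / 2) * f (2 *\<^sub>R (mat_sqrt M *v w)) \<partial>lborel)"
proof -
  let ?g = "\<lambda>w :: real ^ 'n. exp (- (norm w)\<^sup>2) / pi powr (real CARD('n) / 2)"
  let ?T = "\<lambda>w. 2 *\<^sub>R (mat_sqrt M *v w)"
  have "density lborel (gauss M) = distr (density lborel ?g) borel ?T"
  proof (rule measure_eqI)
    fix X assume "X \<in> sets (density lborel (gauss M))"
    then have [measurable]: "X \<in> sets borel" by simp
    have "emeasure (density lborel (gauss M)) X = (\<integral>\<^sup>+x. ennreal (gauss M x) * indicator X x \<partial>lborel)"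
      by (simp add: emeasure_density)
    also have "\<dots> = (\<integral>\<^sup>+w. ennreal (?g w) * indicator X (?T w) \<partial>lborel)"
      by (rule nn_integral_gauss_sqrt[OF mat_sqrt[OF M] M]) measurable
    also have "\<dots> = (\<integral>\<^sup>+w. ennreal (?g w) * indicator (?T -` X) w \<partial>lborel)"
      by (simp add: indicator_def)
    also have "\<dots> = emeasure (density lborel ?g) (?T -` X)"
      by (rule emeasure_density[symmetric]) (auto intro: measurable_sets_borel[where M=borel])
    also have "\<dots> = emeasure (distr (density lborel ?g) borel ?T) X"
      by (simp add: emeasure_distr)
    finally show "emeasure (density lborel (gauss M)) X = emeasure (distr (density lborel ?g) borel ?T) X" .
  qed simp
  then have "integral\<^sup>L (density lborel (gauss M)) f = integral\<^sup>L (distr (density lborel ?g) borel ?T) f"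
    by simp
  then show ?thesis by (simp add: integral_density integral_distr)
qed

section \<open>Bounds for Gaussians of elliptic covariance\<close>

definition ell :: "real \<Rightarrow> real \<Rightarrow> real ^ 'n ^ 'n \<Rightarrow> bool" where
  "ell \<alpha> \<beta> M \<longleftrightarrow> transpose M = M \<and>
    (\<forall>x. \<alpha> * (norm x)\<^sup>2 \<le> (M *v x) \<bullet> x \<and> (M *v x) \<bullet> x \<le> \<beta> * (norm x)\<^sup>2)"

lemma ell_posdef: "ell \<alpha> \<beta> M \<Longrightarrow> \<alpha> > 0 \<Longrightarrow> posdef M"
  unfolding ell_def posdef_def by (metis less_le_trans mult_pos_pos zero_less_norm_iff zero_less_power)

lemma norm_matrix_inv_le:
  fixes M :: "real ^ 'n ^ 'n"
  assumes M: "ell \<alpha> \<beta> M" and "\<alpha> > 0"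
  shows "norm (matrix_inv M *v x) \<le> norm x / \<alpha>"
proof -
  let ?y = "matrix_inv M *v x"
  have My: "M *v ?y = x"
    by (rule matrix_inv_cancel[OF posdef_invertible[OF ell_posdef[OF M \<open>\<alpha> > 0\<close>]]])
  have "\<alpha> * (norm ?y)\<^sup>2 \<le> x \<bullet> ?y" using M My unfolding ell_def by metis
  also have "\<dots> \<le> norm x * norm ?y" by (rule norm_cauchy_schwarz)
  finally have "norm ?y * (\<alpha> * norm ?y) \<le> norm ?y * norm x" by (simp add: power2_eq_square mult_ac)
  then have "\<alpha> * norm ?y \<le> norm x" by (cases "norm ?y = 0") (auto simp: mult_le_cancel_left)
  then show ?thesis using \<open>\<alpha> > 0\<close> by (simp add: field_simps)
qed

lemma matrix_inv_entry_le:
  fixes M :: "real ^ 'n ^ 'n"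
  assumes M: "ell \<alpha> \<beta> M" and "\<alpha> > 0"
  shows "\<bar>matrix_inv M $ i $ j\<bar> \<le> 1 / \<alpha>"
proof -
  have "matrix_inv M $ i $ j = (matrix_inv M *v axis j 1) $ i"
    by (simp add: matrix_vector_mult_basis column_def)
  also have "\<bar>\<dots>\<bar> \<le> norm (matrix_inv M *v axis j 1)" by (rule component_le_norm_cart)
  also have "\<dots> \<le> 1 / \<alpha>" using norm_matrix_inv_le[OF assms, of "axis j 1"] by simp
  finally show ?thesis .
qed

text \<open>With S the square root of M one has |x|^2 = <S x, S M^{-1} x>, and Cauchy-Schwarz gives
  |x|^4 \<le> <M x, x> <M^{-1} x, x>.\<close>

lemma matrix_inv_quad_ge:
  fixes M :: "real ^ 'n ^ 'n"
  assumes M: "ell \<alpha> \<beta> M" and "\<alpha> > 0" "\<beta> > 0"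
  shows "(norm x)\<^sup>2 / \<beta> \<le> (matrix_inv M *v x) \<bullet> x"
proof -
  have pd: "posdef M" by (rule ell_posdef[OF M \<open>\<alpha> > 0\<close>])
  obtain S where S: "posdef S" "S ** S = M" using posdef_sqrt_exists[OF pd] .
  have symS: "transpose S = S" using S(1) by (simp add: posdef_def)
  let ?y = "matrix_inv M *v x"
  have My: "M *v ?y = x" by (rule matrix_inv_cancel[OF posdef_invertible[OF pd]])
  have SS: "(S *v u) \<bullet> (S *v v) = u \<bullet> (M *v v)" for u v
    by (simp add: symmetric_matrix_inner[OF symS] matrix_vector_mul_assoc S(2))
  have "(norm x)\<^sup>2 = (S *v x) \<bullet> (S *v ?y)" by (simp add: SS My dot_square_norm)
  also have "\<dots> \<le> norm (S *v x) * norm (S *v ?y)" by (rule norm_cauchy_schwarz)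
  finally have "((norm x)\<^sup>2)\<^sup>2 \<le> (norm (S *v x) * norm (S *v ?y))\<^sup>2" by (rule power_mono) simp
  also have "\<dots> = ((M *v x) \<bullet> x) * (?y \<bullet> x)"
    by (simp add: power_mult_distrib SS My inner_commute flip: dot_square_norm)
  also have "\<dots> \<le> (\<beta> * (norm x)\<^sup>2) * (?y \<bullet> x)"
  proof (rule mult_right_mono)
    show "(M *v x) \<bullet> x \<le> \<beta> * (norm x)\<^sup>2" using M by (simp add: ell_def)
    show "0 \<le> ?y \<bullet> x"
      using posdef_matrix_inv[OF pd] unfolding posdef_def by (cases "x = 0") (auto intro: less_imp_le)
  qed
  finally have "(norm x)\<^sup>2 * (norm x)\<^sup>2 \<le> (norm x)\<^sup>2 * (\<beta> * (?y \<bullet> x))" by (simp add: power2_eq_square mult_ac)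
  then have "(norm x)\<^sup>2 \<le> \<beta> * (?y \<bullet> x)"
    by (cases "x = 0") (simp, erule mult_left_le_imp_le, simp)
  then show ?thesis using \<open>\<beta> > 0\<close> by (simp add: field_simps)
qed

text \<open>With x = l q / 8 one has x \<le> exp x and x^2 \<le> 2 exp x; the coefficients 8 / l and
  128 / l^2 come from q = 8 x / l.\<close>

lemma quadratic_le_exp:
  fixes l q :: real
  assumes "l > 0" "q \<ge> 0"
  shows "1 + q + q\<^sup>2 \<le> (1 + 8 / l + 128 / l\<^sup>2) * exp (l / 8 * q)"
proof -
  define x where "x = l / 8 * q"
  have x: "x \<ge> 0" and q: "q = 8 / l * x" using assms by (auto simp: x_def)
  have e: "1 + x + x\<^sup>2 / 2 \<le> exp x" by (rule exp_lower_Taylor_quadratic[OF x])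
  have "1 \<le> exp x" using x by simp
  moreover have "x \<le> exp x" "x\<^sup>2 \<le> 2 * exp x" using e x zero_le_power2[of x] by linarith+
  ultimately have "1 + (8 / l) * x + (64 / l\<^sup>2) * x\<^sup>2 \<le> exp x + (8 / l) * exp x + (64 / l\<^sup>2) * (2 * exp x)"
    using assms by (intro add_mono mult_left_mono) auto
  then show ?thesis unfolding x_def[symmetric] by (simp add: q power_mult_distrib power_divide algebra_simps)
qed

lemma ell_scaled_id: "c > 0 \<Longrightarrow> ell c c (c *\<^sub>R (mat 1 :: real ^ 'n ^ 'n))"
  by (simp add: ell_def scaleR_matrix_vector_assoc[symmetric] dot_square_norm transpose_scalar)

lemma matrix_inv_scaled_id:
  assumes "c > 0"
  shows "matrix_inv (c *\<^sub>R (mat 1 :: real ^ 'n ^ 'n)) = (1 / c) *\<^sub>R mat 1"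
proof -
  have "invertible (c *\<^sub>R (mat 1 :: real ^ 'n ^ 'n))"
    by (rule posdef_invertible[OF ell_posdef[OF ell_scaled_id[OF assms] assms]])
  then have "matrix_inv (c *\<^sub>R (mat 1 :: real ^ 'n ^ 'n)) ** (c *\<^sub>R mat 1) = mat 1"
    by (rule matrix_inv_left)
  then have "c *\<^sub>R matrix_inv (c *\<^sub>R (mat 1 :: real ^ 'n ^ 'n)) = mat 1"
    by (simp add: matrix_scalar_ac scalar_matrix_assoc)
  then have "(1 / c) *\<^sub>R (c *\<^sub>R matrix_inv (c *\<^sub>R (mat 1 :: real ^ 'n ^ 'n))) = (1 / c) *\<^sub>R mat 1"
    by simp
  then show ?thesis using assms by simp
qed

text \<open>Every Gaussian with covariance comparable to \<open>\<tau>\<close> is dominated by a fixed isotropic one;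
  the loss in the exponent absorbs polynomial factors in \<open>\<bar>x\<bar>\<^sup>2 / \<tau>\<close>.\<close>

definition heat_bound :: "real \<Rightarrow> real \<Rightarrow> real ^ 'n \<Rightarrow> real" where
  "heat_bound l \<tau> = gauss ((2 * \<tau> / l) *\<^sub>R mat 1)"

lemma heat_bound_posdef: "l > 0 \<Longrightarrow> \<tau> > 0 \<Longrightarrow> posdef ((2 * \<tau> / l) *\<^sub>R mat 1)"
  using ell_posdef[OF ell_scaled_id[of "2 * \<tau> / l"]] by auto

lemma heat_bound_eq:
  assumes "l > 0" "\<tau> > 0"
  shows "heat_bound l \<tau> (x :: real ^ 'n) = exp (- (l / 8) * ((norm x)\<^sup>2 / \<tau>)) * ((l / (2 * \<tau>)) ^ CARD('n)) powr (1 / 2)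
     / (4 * pi) powr (real CARD('n) / 2)"
proof -
  have "matrix_inv ((2 * \<tau> / l) *\<^sub>R (mat 1 :: real ^ 'n ^ 'n)) = (l / (2 * \<tau>)) *\<^sub>R mat 1"
    using matrix_inv_scaled_id[of "2 * \<tau> / l"] assms by simp
  then show ?thesis using assms
    by (simp add: heat_bound_def gauss_def det_scaleR_matrix scaleR_matrix_vector_assoc[symmetric]
       dot_square_norm powr_minus divide_simps)
qed

text \<open>The exponent of \<open>gauss M\<close> is at most -(l / 4) |x|^2 / \<tau>. Half of it is
  the exponent of \<open>heat_bound\<close>; the other half stays available to absorb polynomials in
  |x|^2 / \<tau>.\<close>

lemma gauss_le_heat_bound_exp:
  fixes l :: real
  assumes "l > 0"
  obtains K where "K \<ge> 0" "\<And>(M :: real ^ 'n ^ 'n) \<tau> x. \<tau> > 0 \<Longrightarrow> ell (l * \<tau>) (\<tau> / l) M \<Longrightarrow>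
     gauss M x \<le> K * heat_bound l \<tau> x * exp (- (l / 8) * ((norm x)\<^sup>2 / \<tau>))"
proof
  \<comment> \<open>The entries of the inverse are at most 1 / (l \<tau>), which is 2 / l^2 times
    the quantity l / (2 \<tau>) occurring in \<open>heat_bound\<close>; \<open>abs_det_le\<close>
    supplies the factorial.\<close>
  define c :: real where "c = fact CARD('n) * (2 / l\<^sup>2) ^ CARD('n)"
  have "c > 0" using assms by (simp add: c_def)
  show "c powr (1 / 2) \<ge> 0" by simp
  fix M :: "real ^ 'n ^ 'n" and \<tau> x assume "\<tau> > 0" and M: "ell (l * \<tau>) (\<tau> / l) M"
  have lt: "l * \<tau> > 0" using assms \<open>\<tau> > 0\<close> by simp
  have pd: "posdef M" by (rule ell_posdef[OF M lt])
  let ?B = "matrix_inv M"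
  have dB: "det ?B > 0" by (rule posdef_det_pos[OF posdef_matrix_inv[OF pd]])
  have "\<bar>det ?B\<bar> \<le> fact CARD('n) * (1 / (l * \<tau>)) ^ CARD('n)"
    by (rule abs_det_le) (rule matrix_inv_entry_le[OF M lt])
  also have "(1 / (l * \<tau>)) = (2 / l\<^sup>2) * (l / (2 * \<tau>))"
    using assms \<open>\<tau> > 0\<close> by (simp add: power2_eq_square)
  finally have "det ?B \<le> c * (l / (2 * \<tau>)) ^ CARD('n)"
    unfolding c_def power_mult_distrib using dB by simp
  then have d: "det ?B powr (1 / 2) \<le> c powr (1 / 2) * ((l / (2 * \<tau>)) ^ CARD('n)) powr (1 / 2)"
    using dB by (subst powr_mult[symmetric]) (auto intro: powr_mono2)
  have q: "(l * ((norm x)\<^sup>2 / \<tau>)) \<le> (?B *v x) \<bullet> x"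
    using matrix_inv_quad_ge[OF M lt, of x] assms \<open>\<tau> > 0\<close> by (simp add: field_simps)
  have "gauss M x = exp (- (1 / 4) * ((?B *v x) \<bullet> x)) * det ?B powr (1 / 2) / (4 * pi) powr (real CARD('n) / 2)"
    using dB by (simp add: gauss_def powr_minus divide_simps)
  also have "\<dots> \<le> exp (- (1 / 4) * (l * ((norm x)\<^sup>2 / \<tau>))) * (c powr (1 / 2) * ((l / (2 * \<tau>)) ^ CARD('n)) powr (1 / 2))
      / (4 * pi) powr (real CARD('n) / 2)"
    using d q by (intro divide_right_mono mult_mono) auto
  also have "exp (- (1 / 4) * (l * ((norm x)\<^sup>2 / \<tau>))) = exp (- (l / 8) * ((norm x)\<^sup>2 / \<tau>)) * exp (- (l / 8) * ((norm x)\<^sup>2 / \<tau>))"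
    by (simp flip: exp_add)
  finally show "gauss M x \<le> c powr (1 / 2) * heat_bound l \<tau> x * exp (- (l / 8) * ((norm x)\<^sup>2 / \<tau>))"
    using assms \<open>\<tau> > 0\<close> by (simp add: heat_bound_eq mult_ac)
qed

text \<open>Parabolic scaling: each derivative costs \<tau>^{-1/2}, and for the second derivatives
  the factor 1 / \<tau> may be traded for |x|^{-2}. The last bound is the one that survives in the
  part of \<open>Omega\<close> where \<tau> is small but |x| is not.\<close>

lemma gauss_bounds:
  fixes l :: real
  assumes "l > 0"
  obtains K where "K \<ge> 0" "\<And>(M :: real ^ 'n ^ 'n) \<tau> x. \<tau> > 0 \<Longrightarrow> ell (l * \<tau>) (\<tau> / l) M \<Longrightarrow>
     gauss M x \<le> K * heat_bound l \<tau> x"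
    "\<And>(M :: real ^ 'n ^ 'n) \<tau> x j. \<tau> > 0 \<Longrightarrow> ell (l * \<tau>) (\<tau> / l) M \<Longrightarrow>
     \<bar>gauss1 M j x\<bar> * sqrt \<tau> \<le> K * heat_bound l \<tau> x"
    "\<And>(M :: real ^ 'n ^ 'n) \<tau> x i j. \<tau> > 0 \<Longrightarrow> ell (l * \<tau>) (\<tau> / l) M \<Longrightarrow>
     \<bar>gauss2 M i j x\<bar> * \<tau> \<le> K * heat_bound l \<tau> x"
    "\<And>(M :: real ^ 'n ^ 'n) \<tau> x i j. \<tau> > 0 \<Longrightarrow> ell (l * \<tau>) (\<tau> / l) M \<Longrightarrow>
     \<bar>gauss2 M i j x\<bar> * (norm x)\<^sup>2 \<le> K * heat_bound l \<tau> x"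
proof -
  obtain K where K: "K \<ge> 0" "\<And>(M :: real ^ 'n ^ 'n) \<tau> x. \<tau> > 0 \<Longrightarrow> ell (l * \<tau>) (\<tau> / l) M \<Longrightarrow>
     gauss M x \<le> K * heat_bound l \<tau> x * exp (- (l / 8) * ((norm x)\<^sup>2 / \<tau>))"
    using gauss_le_heat_bound_exp[OF assms, where 'n='n] by blast
  define C where "C = K * (1 + 8 / l + 128 / l\<^sup>2)"
  have "C \<ge> 0" using K(1) assms by (simp add: C_def)
  have main: "(1 + q + q\<^sup>2) * gauss M x \<le> C * heat_bound l \<tau> x"
    if "\<tau> > 0" "ell (l * \<tau>) (\<tau> / l) M" "q = (norm x)\<^sup>2 / \<tau>" for M :: "real ^ 'n ^ 'n" and \<tau> x q
  proof -
    have q: "q \<ge> 0" using that by simp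
    have "(1 + q + q\<^sup>2) * gauss M x \<le> ((1 + 8 / l + 128 / l\<^sup>2) * exp (l / 8 * q)) *
        (K * heat_bound l \<tau> x * exp (- (l / 8) * q))"
      unfolding that(3) using K(2)[OF that(1,2), of x] quadratic_le_exp[OF assms q] that(3) assms q
      by (intro mult_mono) auto
    also have "\<dots> = C * heat_bound l \<tau> x * (exp (l / 8 * q) * exp (- (l / 8) * q))"
      by (simp add: C_def mult_ac)
    also have "exp (l / 8 * q) * exp (- (l / 8) * q) = 1" by (simp flip: exp_add)
    finally show ?thesis by simp
  qed
  \<comment> \<open>Large enough for all four bounds: 1 for \<open>gauss\<close>, 1 / (2 l) for
    \<open>gauss1\<close>, and 1 / (4 l^2) + 1 / (2 l) for \<open>gauss2\<close>.\<close>
  define c where "c = 1 + 1 / (4 * l\<^sup>2) + 1 / (2 * l)"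
  have c1: "c \<ge> 1" "1 / (4 * l\<^sup>2) + 1 / (2 * l) \<le> c" "1 / (2 * l) \<le> c" using assms by (auto simp: c_def)
  have bd: "p * gauss M x \<le> c * C * heat_bound l \<tau> x"
    if "\<tau> > 0" "ell (l * \<tau>) (\<tau> / l) M" "p \<le> c * (1 + (norm x)\<^sup>2 / \<tau> + ((norm x)\<^sup>2 / \<tau>)\<^sup>2)" for M :: "real ^ 'n ^ 'n" and \<tau> x p
  proof -
    have "p * gauss M x \<le> c * (1 + (norm x)\<^sup>2 / \<tau> + ((norm x)\<^sup>2 / \<tau>)\<^sup>2) * gauss M x"
      by (rule mult_right_mono[OF that(3)]) simp
    also have "\<dots> \<le> c * (C * heat_bound l \<tau> x)"
      unfolding mult.assoc using c1 by (intro mult_left_mono main that) auto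
    finally show ?thesis by simp
  qed
  have g2: "\<bar>gauss2 M i j x\<bar> \<le> ((norm x)\<^sup>2 / (4 * l\<^sup>2 * \<tau>\<^sup>2) + 1 / (2 * l * \<tau>)) * gauss M x"
    if "\<tau> > 0" "ell (l * \<tau>) (\<tau> / l) M" for M :: "real ^ 'n ^ 'n" and \<tau> x i j
  proof -
    have lt: "l * \<tau> > 0" using assms that(1) by simp
    let ?y = "matrix_inv M *v x"
    have y: "\<bar>?y $ k\<bar> \<le> norm x / (l * \<tau>)" for k
      using component_le_norm_cart[of ?y k] norm_matrix_inv_le[OF that(2) lt, of x] by linarith
    have "\<bar>?y $ i\<bar> * \<bar>?y $ j\<bar> \<le> (norm x / (l * \<tau>)) * (norm x / (l * \<tau>))"
      using lt by (intro mult_mono y) auto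
    then have "\<bar>(1 / 4) * ?y $ i * ?y $ j\<bar> \<le> (norm x)\<^sup>2 / (4 * l\<^sup>2 * \<tau>\<^sup>2)"
      by (simp add: abs_mult power2_eq_square mult_ac)
    moreover have "\<bar>(1 / 2) * matrix_inv M $ i $ j\<bar> \<le> 1 / (2 * l * \<tau>)"
      using matrix_inv_entry_le[OF that(2) lt, of i j] by (simp add: abs_mult)
    ultimately have "\<bar>(1 / 4) * ?y $ i * ?y $ j - (1 / 2) * matrix_inv M $ i $ j\<bar>
       \<le> (norm x)\<^sup>2 / (4 * l\<^sup>2 * \<tau>\<^sup>2) + 1 / (2 * l * \<tau>)" by linarith
    then show ?thesis unfolding gauss2_def abs_mult by (intro mult_mono) auto
  qed
  show thesis
  proof (rule that[of "c * C"])
    show "0 \<le> c * C" using c1 \<open>C \<ge> 0\<close> by simp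
  next
    fix M :: "real ^ 'n ^ 'n" and \<tau> and x :: "real ^ 'n" assume a: "\<tau> > 0" "ell (l * \<tau>) (\<tau> / l) M"
    have "1 \<le> c * (1 + (norm x)\<^sup>2 / \<tau> + ((norm x)\<^sup>2 / \<tau>)\<^sup>2)"
      using c1 a(1) mult_mono[of 1 c 1 "1 + (norm x)\<^sup>2 / \<tau> + ((norm x)\<^sup>2 / \<tau>)\<^sup>2"] by simp
    from bd[OF a this] show "gauss M x \<le> c * C * heat_bound l \<tau> x" by simp
  next
    fix M :: "real ^ 'n ^ 'n" and \<tau> and x :: "real ^ 'n" and j :: 'n assume a: "\<tau> > 0" "ell (l * \<tau>) (\<tau> / l) M"
    define r where "r = norm x / sqrt \<tau>"
    have r2: "(norm x)\<^sup>2 / \<tau> = r\<^sup>2" using a by (simp add: r_def power_divide)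
    have "r \<ge> 0" using a by (simp add: r_def)
    have lt: "l * \<tau> > 0" using assms a(1) by simp
    let ?y = "matrix_inv M *v x"
    have y: "\<bar>?y $ j\<bar> \<le> norm x / (l * \<tau>)"
      using component_le_norm_cart[of ?y j] norm_matrix_inv_le[OF a(2) lt, of x] by linarith
    have "\<bar>gauss1 M j x\<bar> * sqrt \<tau> = (1 / 2 * \<bar>?y $ j\<bar> * sqrt \<tau>) * gauss M x"
      using a(1) by (simp add: gauss1_def abs_mult)
    also have "\<dots> \<le> c * C * heat_bound l \<tau> x"
    proof (rule bd[OF a])
      have "1 / 2 * \<bar>?y $ j\<bar> * sqrt \<tau> \<le> 1 / 2 * (norm x / (l * \<tau>)) * sqrt \<tau>"
        using y a(1) by (intro mult_right_mono mult_left_mono) auto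
      also have "\<dots> = 1 / (2 * l) * r"
        using a(1) assms real_sqrt_mult_self[of \<tau>] by (simp add: r_def field_simps)
      also have "\<dots> \<le> c * (1 + r\<^sup>2 + (r\<^sup>2)\<^sup>2)"
      proof (rule mult_mono)
        have "0 \<le> (r - 1)\<^sup>2" by simp
        then have "2 * r \<le> 1 + r\<^sup>2" by (simp add: power2_eq_square algebra_simps)
        then have "r \<le> 1 + r\<^sup>2" using \<open>r \<ge> 0\<close> by linarith
        then show "r \<le> 1 + r\<^sup>2 + (r\<^sup>2)\<^sup>2" using zero_le_power2[of "r\<^sup>2"] by linarith
      qed (use c1 \<open>r \<ge> 0\<close> in auto)
      finally show "1 / 2 * \<bar>?y $ j\<bar> * sqrt \<tau> \<le> c * (1 + (norm x)\<^sup>2 / \<tau> + ((norm x)\<^sup>2 / \<tau>)\<^sup>2)"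
        by (simp add: r2)
    qed
    finally show "\<bar>gauss1 M j x\<bar> * sqrt \<tau> \<le> c * C * heat_bound l \<tau> x" .
  next
    fix M :: "real ^ 'n ^ 'n" and \<tau> and x :: "real ^ 'n" and i j :: 'n assume a: "\<tau> > 0" "ell (l * \<tau>) (\<tau> / l) M"
    define q where "q = (norm x)\<^sup>2 / \<tau>"
    have q: "q \<ge> 0" "(norm x)\<^sup>2 = q * \<tau>" using a by (auto simp: q_def)
    define e where "e = 1 / (4 * l\<^sup>2)"
    define f where "f = 1 / (2 * l)"
    have ef: "e \<ge> 0" "f \<ge> 0" "e + f \<le> c" using assms c1 by (auto simp: e_def f_def)
    \<comment> \<open>In terms of q = |x|^2 / \<tau> the bound for \<open>gauss2\<close> is (e q +
      f) / \<tau>. Multiplication by \<tau> leaves degree one in q, multiplication by |x|^2 degree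
      two; hence the square in \<open>quadratic_le_exp\<close>.\<close>
    have co: "(norm x)\<^sup>2 / (4 * l\<^sup>2 * \<tau>\<^sup>2) + 1 / (2 * l * \<tau>) = (e * q + f) / \<tau>"
      unfolding q(2) e_def f_def using a(1) assms by (simp add: power2_eq_square field_simps)
    have 1: "e * q + f \<le> c * (1 + q + q\<^sup>2)"
    proof -
      have "e * q + f * 1 \<le> e * (1 + q + q\<^sup>2) + f * (1 + q + q\<^sup>2)"
        using q(1) ef by (intro add_mono mult_left_mono) auto
      also have "\<dots> \<le> c * (1 + q + q\<^sup>2)"
        unfolding distrib_right[symmetric] using ef q(1) by (intro mult_right_mono) auto
      finally show ?thesis by simp
    qed
    have 2: "(e * q + f) * q \<le> c * (1 + q + q\<^sup>2)"
    proof -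
      have "(e * q + f) * q = e * q\<^sup>2 + f * q" by (simp add: power2_eq_square algebra_simps)
      also have "\<dots> \<le> e * (1 + q + q\<^sup>2) + f * (1 + q + q\<^sup>2)"
        using q(1) ef by (intro add_mono mult_left_mono) auto
      also have "\<dots> \<le> c * (1 + q + q\<^sup>2)"
        unfolding distrib_right[symmetric] using ef q(1) by (intro mult_right_mono) auto
      finally show ?thesis .
    qed
    have "\<bar>gauss2 M i j x\<bar> * \<tau> \<le> (e * q + f) / \<tau> * gauss M x * \<tau>"
      using g2[OF a, of i j x] a(1) unfolding co by (intro mult_right_mono) auto
    also have "\<dots> = (e * q + f) * gauss M x" using a(1) by simp
    also have "\<dots> \<le> c * C * heat_bound l \<tau> x" by (rule bd[OF a]) (use 1 in \<open>simp add: q_def\<close>)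
    finally show "\<bar>gauss2 M i j x\<bar> * \<tau> \<le> c * C * heat_bound l \<tau> x" .
    have "\<bar>gauss2 M i j x\<bar> * (norm x)\<^sup>2 \<le> (e * q + f) / \<tau> * gauss M x * (norm x)\<^sup>2"
      using g2[OF a, of i j x] a(1) unfolding co by (intro mult_right_mono) auto
    also have "\<dots> = (e * q + f) * q * gauss M x" using a(1) by (simp add: q(2))
    also have "\<dots> \<le> c * C * heat_bound l \<tau> x" by (rule bd[OF a]) (use 2 in \<open>simp add: q_def\<close>)
    finally show "\<bar>gauss2 M i j x\<bar> * (norm x)\<^sup>2 \<le> c * C * heat_bound l \<tau> x" .
  qed
qed

section \<open>Dependence of Gaussians on position and covariance\<close>

lemma tendsto_gauss:
  fixes M :: "'a \<Rightarrow> real ^ 'n ^ 'n"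
  assumes "(M \<longlongrightarrow> L) F" "(v \<longlongrightarrow> x) F" "posdef L"
  shows "((\<lambda>z. gauss (M z) (v z)) \<longlongrightarrow> gauss L x) F"
proof -
  have d: "det L \<noteq> 0" "det (matrix_inv L) \<noteq> 0"
    using posdef_det_pos[OF assms(3)] posdef_det_pos[OF posdef_matrix_inv[OF assms(3)]] by auto
  note inv = tendsto_matrix_inv[OF assms(1) d(1)]
  have "((\<lambda>z. det (matrix_inv (M z))) \<longlongrightarrow> det (matrix_inv L)) F"
    by (intro tendsto_det tendsto_vec_nth inv)
  then show ?thesis
    unfolding gauss_def using d(2) by (intro tendsto_intros inv assms(2)) auto
qed

lemma tendsto_gauss1:
  fixes M :: "'a \<Rightarrow> real ^ 'n ^ 'n"
  assumes "(M \<longlongrightarrow> L) F" "(v \<longlongrightarrow> x) F" "posdef L"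
  shows "((\<lambda>z. gauss1 (M z) j (v z)) \<longlongrightarrow> gauss1 L j x) F"
  unfolding gauss1_def
  by (intro tendsto_intros tendsto_vec_nth tendsto_gauss tendsto_matrix_inv assms)
    (use posdef_det_pos[OF assms(3)] in auto)

lemma tendsto_gauss2:
  fixes M :: "'a \<Rightarrow> real ^ 'n ^ 'n"
  assumes "(M \<longlongrightarrow> L) F" "(v \<longlongrightarrow> x) F" "posdef L"
  shows "((\<lambda>z. gauss2 (M z) i j (v z)) \<longlongrightarrow> gauss2 L i j x) F"
  unfolding gauss2_def
  by (intro tendsto_intros tendsto_vec_nth tendsto_gauss tendsto_matrix_inv assms)
    (use posdef_det_pos[OF assms(3)] in auto)

lemma gauss_has_derivative_axis:
  fixes M :: "real ^ 'n ^ 'n"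
  assumes "posdef M"
  shows "((\<lambda>s. gauss M (x + s *\<^sub>R axis j 1)) has_field_derivative gauss1 M j (x + s *\<^sub>R axis j 1)) (at s)"
proof -
  let ?B = "matrix_inv M" and ?e = "axis j 1 :: real ^ 'n"
  have sym: "transpose ?B = ?B" using posdef_matrix_inv[OF assms] by (simp add: posdef_def)
  have q: "(?B *v (x + s *\<^sub>R ?e)) \<bullet> (x + s *\<^sub>R ?e)
      = (?B *v x) \<bullet> x + 2 * s * (?B *v x) $ j + s\<^sup>2 * (?B *v ?e) $ j" for s
    using symmetric_matrix_inner[OF sym, of ?e x]
    by (simp add: matrix_vector_right_distrib matrix_vector_mult_scaleR inner_add_left inner_add_right
        inner_axis inner_axis' power2_eq_square algebra_simps)
  have nth: "(?B *v (x + s *\<^sub>R ?e)) $ j = (?B *v x) $ j + s * (?B *v ?e) $ j"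
    by (simp add: matrix_vector_right_distrib matrix_vector_mult_scaleR)
  have "((\<lambda>s. - (1 / 4) * ((?B *v x) \<bullet> x + 2 * s * (?B *v x) $ j + s\<^sup>2 * (?B *v ?e) $ j))
      has_field_derivative - (1 / 2) * (?B *v (x + s *\<^sub>R ?e)) $ j) (at s)"
    unfolding nth by (auto intro!: derivative_eq_intros simp: algebra_simps)
  from DERIV_cdivide[OF DERIV_exp[THEN DERIV_chain2, OF this]]
  show ?thesis
    unfolding gauss1_def gauss_def q by (rule DERIV_cong) (simp add: mult_ac)
qed

lemma gauss1_has_derivative_axis:
  fixes M :: "real ^ 'n ^ 'n"
  assumes "posdef M"
  shows "((\<lambda>s. gauss1 M j (x + s *\<^sub>R axis i 1)) has_field_derivative gauss2 M i j (x + s *\<^sub>R axis i 1)) (at s)"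
proof -
  let ?B = "matrix_inv M"
  have "transpose ?B = ?B" using posdef_matrix_inv[OF assms] by (simp add: posdef_def)
  then have sym: "?B $ j $ i = ?B $ i $ j" by (simp add: transpose_def vec_eq_iff)
  have nth: "(?B *v (x + s *\<^sub>R axis i 1)) $ k = (?B *v x) $ k + s * ?B $ k $ i" for k s
    by (simp add: matrix_vector_right_distrib matrix_vector_mult_scaleR matrix_vector_mult_basis column_def)
  have "((\<lambda>s. - (1 / 2) * (?B *v (x + s *\<^sub>R axis i 1)) $ j) has_field_derivative - (1 / 2) * ?B $ j $ i) (at s)"
    unfolding nth by (auto intro!: derivative_eq_intros)
  from DERIV_mult[OF this gauss_has_derivative_axis[OF assms, of x i s]]
  show ?thesis
    unfolding gauss1_def by (rule DERIV_cong) (simp add: gauss2_def sym algebra_simps)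
qed

lemma partial_eqI:
  assumes "((\<lambda>s. g (x + s *\<^sub>R axis i 1)) has_field_derivative d) (at 0)"
  shows "has_partial i g x" "partial i g x = d"
  using assms by (auto simp: has_partial_def partial_def DERIV_imp_deriv real_differentiable_def)

text \<open>With B the inverse of M, the exponential contributes <M' B x, B x> / 4 and, by Jacobi's
  formula, the power of the determinant contributes -tr(M' B) / 2. Together they are the contraction
  of M' with the Hessian: the heat equation with the covariance in place of time.\<close>

lemma gauss_has_derivative_param:
  fixes M :: "real \<Rightarrow> real ^ 'n ^ 'n"
  assumes M: "\<And>i j. ((\<lambda>s. M s $ i $ j) has_field_derivative M' $ i $ j) (at s0)"
    and pd: "\<forall>\<^sub>F s in nhds s0. posdef (M s)"
  shows "((\<lambda>s. gauss (M s) x) has_field_derivative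
    (\<Sum>i\<in>UNIV. \<Sum>j\<in>UNIV. M' $ i $ j * gauss2 (M s0) i j x)) (at s0)"
proof -
  have pd0: "posdef (M s0)" using pd by (rule eventually_nhds_x_imp_x)
  let ?B = "matrix_inv (M s0)" and ?c = "(4 * pi) powr (real CARD('n) / 2)"
  have "transpose ?B = ?B" using posdef_matrix_inv[OF pd0] by (simp add: posdef_def)
  then have sym: "?B $ j $ i = ?B $ i $ j" for i j by (simp add: transpose_def vec_eq_iff)
  have dpos: "det (M s0) > 0" by (rule posdef_det_pos[OF pd0])
  let ?T = "\<Sum>i\<in>UNIV. \<Sum>j\<in>UNIV. M' $ i $ j * ?B $ j $ i"
  let ?Q = "(M' *v (?B *v x)) \<bullet> (?B *v x)"
  have dexp: "((\<lambda>s. exp (- (1 / 4) * ((matrix_inv (M s) *v x) \<bullet> x))) has_field_derivative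
      exp (- (1 / 4) * ((?B *v x) \<bullet> x)) * (1 / 4 * ?Q)) (at s0)"
    by (auto intro!: derivative_eq_intros has_field_derivative_matrix_inv_quad[OF M pd])
  have ddet: "((\<lambda>s. det (M s) powr (- (1 / 2))) has_field_derivative
      det (M s0) powr (- (1 / 2)) * (- (1 / 2) * ?T)) (at s0)"
  proof -
    have p: "det (M s0) powr (- (1 / 2) - 1) * det (M s0) = det (M s0) powr (- (1 / 2))"
      using powr_mult_base[of "det (M s0)" "- (1 / 2) - 1"] dpos by (simp add: mult.commute)
    have "((\<lambda>s. det (M s) powr (- (1 / 2))) has_field_derivative
      - (1 / 2) * det (M s0) powr (- (1 / 2) - 1) * (det (M s0) * ?T)) (at s0)"
      by (rule DERIV_chain2[OF has_real_derivative_powr[OF dpos]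
          has_field_derivative_det[where M'=M', OF M posdef_invertible[OF pd0]]])
    also have "- (1 / 2) * det (M s0) powr (- (1 / 2) - 1) * (det (M s0) * ?T)
      = (det (M s0) powr (- (1 / 2) - 1) * det (M s0)) * (- (1 / 2) * ?T)" by (simp only: mult_ac)
    finally show ?thesis unfolding p .
  qed
  have "((\<lambda>s. exp (- (1 / 4) * ((matrix_inv (M s) *v x) \<bullet> x)) * det (M s) powr (- (1 / 2)) / ?c)
    has_field_derivative (1 / 4 * ?Q - 1 / 2 * ?T) * gauss (M s0) x) (at s0)"
    unfolding gauss_det[OF pd0]
    by (rule DERIV_cong[OF DERIV_cdivide[OF DERIV_mult[OF dexp ddet]]]) (simp add: field_simps)
  moreover have "(1 / 4 * ?Q - 1 / 2 * ?T) * gauss (M s0) x = (\<Sum>i\<in>UNIV. \<Sum>j\<in>UNIV. M' $ i $ j * gauss2 (M s0) i j x)"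
  proof -
    have "?Q = (\<Sum>i\<in>UNIV. \<Sum>j\<in>UNIV. M' $ i $ j * ((?B *v x) $ i * (?B *v x) $ j))"
      by (simp add: inner_vec_def matrix_vector_mult_def[of M'] sum_distrib_right sum_distrib_left mult_ac)
    then have "1 / 4 * ?Q - 1 / 2 * ?T = (\<Sum>i\<in>UNIV. \<Sum>j\<in>UNIV. M' $ i $ j *
        (1 / 4 * (?B *v x) $ i * (?B *v x) $ j - 1 / 2 * ?B $ i $ j))"
      by (simp add: sum_distrib_left sum_subtractf sym algebra_simps)
    then show ?thesis by (simp add: gauss2_def sum_distrib_right mult.assoc)
  qed
  ultimately have *: "((\<lambda>s. exp (- (1 / 4) * ((matrix_inv (M s) *v x) \<bullet> x)) * det (M s) powr (- (1 / 2)) / ?c)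
    has_field_derivative (\<Sum>i\<in>UNIV. \<Sum>j\<in>UNIV. M' $ i $ j * gauss2 (M s0) i j x)) (at s0)" by simp
  \<comment> \<open>The form of \<open>gauss\<close> with the determinant of M itself is available
    for positive definite matrices, hence the passage to a neighbourhood of
    \<open>s0\<close>.\<close>
  have "\<forall>\<^sub>F s in nhds s0. exp (- (1 / 4) * ((matrix_inv (M s) *v x) \<bullet> x)) * det (M s) powr (- (1 / 2)) / ?c = gauss (M s) x"
    using pd by eventually_elim (simp add: gauss_det)
  from DERIV_cong_ev[OF refl this refl] * show ?thesis by blast
qed

lemma matrix_inv_scaleR:
  fixes M :: "real ^ 'n ^ 'n"
  assumes "invertible M" "c \<noteq> 0"
  shows "matrix_inv (c *\<^sub>R M) = (1 / c) *\<^sub>R matrix_inv M"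
proof -
  have "invertible (c *\<^sub>R M)"
    using assms by (simp add: invertible_det_nz det_scaleR_matrix)
  then have 1: "(c *\<^sub>R M) *v (matrix_inv (c *\<^sub>R M) *v x) = x" for x
    by (rule matrix_inv_cancel)
  have "(c *\<^sub>R M) *v ((1 / c) *\<^sub>R (matrix_inv M *v x)) = x" for x
    using assms by (simp add: matrix_inv_cancel scaleR_matrix_vector_assoc[symmetric] matrix_vector_mult_scaleR)
  with 1 have "(c *\<^sub>R M) *v ((1 / c) *\<^sub>R (matrix_inv M *v x)) = (c *\<^sub>R M) *v (matrix_inv (c *\<^sub>R M) *v x)" for x
    by simp
  then have "(1 / c) *\<^sub>R (matrix_inv M *v x) = matrix_inv (c *\<^sub>R M) *v x" for x
    using matrix_inv_cancel(1)[OF \<open>invertible (c *\<^sub>R M)\<close>] by metis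
  then show ?thesis by (simp add: matrix_eq scaleR_matrix_vector_assoc)
qed

text \<open>When lengths scale by c and the covariance by c^2, the density loses c^n, and each of
  the two derivatives one further power of c.\<close>

lemma gauss_scale:
  fixes M :: "real ^ 'n ^ 'n"
  assumes M: "posdef M" and c: "c > 0"
  shows "gauss (c\<^sup>2 *\<^sub>R M) (c *\<^sub>R x) = gauss M x / c ^ CARD('n)"
    and "gauss2 (c\<^sup>2 *\<^sub>R M) i j (c *\<^sub>R x) = gauss2 M i j x / c ^ (CARD('n) + 2)"
proof -
  note inv = matrix_inv_scaleR[OF posdef_invertible[OF M], of "c\<^sup>2"]
  have dB: "det (matrix_inv M) > 0" by (rule posdef_det_pos[OF posdef_matrix_inv[OF M]])
  have "((1 / c\<^sup>2) ^ CARD('n)) powr (- (1 / 2)) = c ^ CARD('n)"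
  proof -
    have "(1 / c\<^sup>2) ^ CARD('n) = inverse ((c ^ CARD('n))\<^sup>2)"
      by (simp add: power_divide power_even_eq[symmetric] power_mult[symmetric] mult.commute inverse_eq_divide)
    also have "\<dots> powr (- (1 / 2)) = c ^ CARD('n)"
      using c by (subst inverse_powr_minus_half) (simp_all add: powr_half_sqrt)
    finally show ?thesis .
  qed
  then have "det ((1 / c\<^sup>2) *\<^sub>R matrix_inv M) powr (- (1 / 2)) = c ^ CARD('n) * det (matrix_inv M) powr (- (1 / 2))"
    using dB c by (simp add: det_scaleR_matrix powr_mult)
  moreover have Bx: "((1 / c\<^sup>2) *\<^sub>R matrix_inv M) *v (c *\<^sub>R x) = (1 / c) *\<^sub>R (matrix_inv M *v x)"
    using c by (simp add: scaleR_matrix_vector_assoc[symmetric] matrix_vector_mult_scaleR power2_eq_square)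
  ultimately show g: "gauss (c\<^sup>2 *\<^sub>R M) (c *\<^sub>R x) = gauss M x / c ^ CARD('n)"
    using c by (simp add: gauss_def inv)
  show "gauss2 (c\<^sup>2 *\<^sub>R M) i j (c *\<^sub>R x) = gauss2 M i j x / c ^ (CARD('n) + 2)"
  proof -
    have "matrix_inv (c\<^sup>2 *\<^sub>R M) *v (c *\<^sub>R x) = (1 / c) *\<^sub>R (matrix_inv M *v x)"
      "matrix_inv (c\<^sup>2 *\<^sub>R M) $ i $ j = (1 / c\<^sup>2) * matrix_inv M $ i $ j"
      using c Bx by (simp_all add: inv)
    then show ?thesis
      using c unfolding gauss2_def g by (simp add: power_add power2_eq_square divide_simps)
  qed
qed

section \<open>The primitive of the coefficients\<close>

text \<open>\<open>integrable_ccontinuous_explicit\<close> differentiates along intervals to the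
  right of a point. Applied to f and to its reflection it yields both one-sided derivatives, outside
  a null set and the mirror image of another one.\<close>

lemma AE_has_derivative_indefinite_integral:
  fixes f F :: "real \<Rightarrow> real"
  assumes int: "\<And>b c. f integrable_on {b..c}"
    and F: "\<And>b c. b \<le> c \<Longrightarrow> F c - F b = integral {b..c} f"
  shows "AE t in lebesgue. (F has_field_derivative f t) (at t)"
proof -
  have int': "\<And>b c. f integrable_on cbox b c" using int by simp
  obtain N1 where N1: "negligible N1" "\<And>x e. x \<notin> N1 \<Longrightarrow> 0 < e \<Longrightarrow>
      \<exists>d>0. \<forall>h. 0 < h \<and> h < d \<longrightarrow> norm (integral (cbox x (x + h *\<^sub>R One)) f /\<^sub>R h ^ DIM(real) - f x) < e"
    using integrable_ccontinuous_explicit[OF int'] by metis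
  have int2: "(\<lambda>x. f (- x)) integrable_on cbox b c" for b c
    using int[of "- c" "- b"] Henstock_Kurzweil_Integration.integrable_reflect_real[where f=f and a="- c" and b="- b"] by simp
  obtain N2 where N2: "negligible N2" "\<And>x e. x \<notin> N2 \<Longrightarrow> 0 < e \<Longrightarrow>
      \<exists>d>0. \<forall>h. 0 < h \<and> h < d \<longrightarrow> norm (integral (cbox x (x + h *\<^sub>R One)) (\<lambda>x. f (- x)) /\<^sub>R h ^ DIM(real) - f (- x)) < e"
    using integrable_ccontinuous_explicit[OF int2] by metis
  have "negligible (uminus ` N2)"
    by (intro negligible_differentiable_image_negligible N2 linear_imp_differentiable_on)
      (simp_all add: linear_iff)
  then have N: "N1 \<union> uminus ` N2 \<in> null_sets lebesgue"
    using N1(1) by (simp flip: negligible_iff_null_sets)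
  have D: "(F has_field_derivative f t) (at t)" if "t \<notin> N1 \<union> uminus ` N2" for t
    unfolding has_field_derivative_iff LIM_eq
  proof (intro allI impI)
    fix e :: real assume "e > 0"
    have t: "t \<notin> N1" "- t \<notin> N2" using that by (auto simp: image_iff)
    obtain d1 where d1: "d1 > 0" "\<And>h. 0 < h \<Longrightarrow> h < d1 \<Longrightarrow> \<bar>integral {t..t + h} f / h - f t\<bar> < e"
      using N1(2)[OF t(1) \<open>e > 0\<close>] by (auto simp: divide_inverse mult.commute)
    obtain d2 where d2: "d2 > 0" "\<And>h. 0 < h \<Longrightarrow> h < d2 \<Longrightarrow> \<bar>integral {- t..- t + h} (\<lambda>x. f (- x)) / h - f t\<bar> < e"
      using N2(2)[OF t(2) \<open>e > 0\<close>] by (auto simp: divide_inverse mult.commute)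
    show "\<exists>d>0. \<forall>y. y \<noteq> t \<and> norm (y - t) < d \<longrightarrow> norm ((F y - F t) / (y - t) - f t) < e"
    proof (intro exI[of _ "min d1 d2"] conjI allI impI)
      show "0 < min d1 d2" using d1 d2 by simp
      fix y assume y: "y \<noteq> t \<and> norm (y - t) < min d1 d2"
      show "norm ((F y - F t) / (y - t) - f t) < e"
      proof (cases "y > t")
        case True
        then show ?thesis using d1(2)[of "y - t"] y F[of t y] by simp
      next
        case False
        then have "y < t" using y by simp
        then have "F t - F y = integral {- t..- y} (\<lambda>x. f (- x))"
          using F[of y t] Henstock_Kurzweil_Integration.integral_reflect_real[where f=f and a=y and b=t] by simp
        moreover have "(F y - F t) / (y - t) = (F t - F y) / (t - y)"
          by (metis minus_diff_eq minus_divide_divide)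
        ultimately show ?thesis using d2(2)[of "t - y"] y \<open>y < t\<close> by simp
      qed
    qed
  qed
  show ?thesis by (rule AE_I'[OF N]) (use D in blast)
qed

lemma matrix_quad_form:
  "(A *v x) \<bullet> x = (\<Sum>i\<in>UNIV. \<Sum>j\<in>UNIV. A $ i $ j * x $ i * x $ j)"
  for A :: "real ^ 'n ^ 'n"
  by (simp add: inner_vec_def matrix_vector_mult_def sum_distrib_right sum_distrib_left mult_ac)

text \<open>The kernel sees \<open>a\<close> only through increments of \<open>F\<close>.
  Integration has absorbed the null sets: \<open>Amat_eq\<close>, \<open>ell_F\<close> and
  \<open>F_lipschitz\<close> hold at all times, and exceptional times enter solely through
  \<open>AE_F_derivative\<close>. The number \<open>l\<close> is the ellipticity constant
  \<Lambda>.\<close>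

locale primitive_coeff =
  fixes a F :: "real \<Rightarrow> real ^ 'n ^ 'n" and l K :: real
  assumes l_pos: "l > 0"
    and Amat_eq: "\<And>t \<tau>. \<tau> \<ge> 0 \<Longrightarrow> Amat a t \<tau> = F t - F (t - \<tau>)"
    and ell_F: "\<And>s t. s < t \<Longrightarrow> ell (l * (t - s)) ((t - s) / l) (F t - F s)"
    and F_lipschitz: "\<And>s t i j. \<bar>F t $ i $ j - F s $ i $ j\<bar> \<le> K * \<bar>t - s\<bar>"
    and AE_F_derivative: "AE t in lebesgue.
      (\<forall>i j. ((\<lambda>s. F s $ i $ j) has_field_derivative a t $ i $ j) (at t)) \<and> ell l (1 / l) (a t)"

lemma elliptic_coeff_primitive:
  assumes "elliptic_coeff (a :: real \<Rightarrow> real ^ 'n ^ 'n)"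
  obtains F l K where "primitive_coeff a F l K"
proof -
  obtain K0 \<Lambda> where am [measurable]: "a \<in> borel_measurable lebesgue"
    and bd: "AE t in lebesgue. \<forall>i j. \<bar>a t $ i $ j\<bar> \<le> K0"
    and sym: "AE t in lebesgue. \<forall>i j. a t $ i $ j = a t $ j $ i"
    and \<Lambda>: "\<Lambda> > 0" and el: "AE t in lebesgue. \<forall>\<xi>::real ^ 'n.
        \<Lambda> * (norm \<xi>)\<^sup>2 \<le> (\<Sum>i\<in>UNIV. \<Sum>j\<in>UNIV. a t $ i $ j * \<xi> $ i * \<xi> $ j) \<and>
        (\<Sum>i\<in>UNIV. \<Sum>j\<in>UNIV. a t $ i $ j * \<xi> $ i * \<xi> $ j) \<le> inverse \<Lambda> * (norm \<xi>)\<^sup>2"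
    using assms unfolding elliptic_coeff_def by blast
  define K where "K = max K0 0"
  have bdK: "AE t in lebesgue. \<bar>a t $ i $ j\<bar> \<le> K" for i j
    using bd by eventually_elim (auto simp: K_def le_max_iff_disj)
  have meas [measurable]: "(\<lambda>t. a t $ i $ j) \<in> borel_measurable lebesgue" for i j
    by (rule measurable_compose[OF am]) (intro borel_measurable_continuous_onI continuous_intros)
  have ind: "integrable lebesgue (indicat_real {b..c})" for b c :: real
    by (simp add: lmeasurable_iff_integrable[symmetric])
  have si: "set_integrable lebesgue {b..c} (\<lambda>t. a t $ i $ j)" for b c i j
    unfolding set_integrable_def
  proof (rule Bochner_Integration.integrable_bound[OF integrable_mult_right[OF ind[of b c], of K]])
    show "(\<lambda>x. indicat_real {b..c} x *\<^sub>R a x $ i $ j) \<in> borel_measurable lebesgue"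
      by (rule borel_measurable_scaleR[OF borel_measurable_indicator meas]) simp
    show "AE x in lebesgue. norm (indicat_real {b..c} x *\<^sub>R a x $ i $ j) \<le> norm (K * indicat_real {b..c} x)"
      using bdK[of i j] by eventually_elim (simp add: indicator_def K_def)
  qed
  have si': "integrable lebesgue (\<lambda>r. indicat_real {b..c} r * a r $ i $ j)" for b c i j
    using si[of b c i j] by (simp add: set_integrable_def)
  have int: "(\<lambda>t. a t $ i $ j) integrable_on {b..c}" for b c i j
    by (rule set_lebesgue_integral_eq_integral(1)[OF si])
  have LI: "(LINT r:{b..c}|lebesgue. a r $ i $ j) = integral {b..c} (\<lambda>r. a r $ i $ j)" for b c i j
    by (rule set_lebesgue_integral_eq_integral(2)[OF si])
  \<comment> \<open>A signed primitive from 0: for either sign of t at least one of the two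
    intervals is empty or a single point, and its integral vanishes.\<close>
  define F :: "real \<Rightarrow> real ^ 'n ^ 'n"
    where "F t = (\<chi> i j. integral {0..t} (\<lambda>r. a r $ i $ j) - integral {t..0} (\<lambda>r. a r $ i $ j))" for t
  have Fd: "F c $ i $ j - F b $ i $ j = integral {b..c} (\<lambda>r. a r $ i $ j)" if "b \<le> c" for b c i j
  proof -
    note comb = Henstock_Kurzweil_Integration.integral_combine[OF _ _ int, of _ _ _ i j]
    have neg: "integral {x..y} (\<lambda>r. a r $ i $ j) = 0" if "y \<le> x" for x y
      using that by (cases "x = y") auto
    consider "0 \<le> b" | "b < 0" "0 \<le> c" | "c < 0" by linarith
    then show ?thesis
      using comb[of 0 b c] comb[of b 0 c] comb[of b c 0] that
      by cases (auto simp: F_def neg)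
  qed
  have "primitive_coeff a F \<Lambda> K"
  proof
    show "\<Lambda> > 0" by (fact \<Lambda>)
    show "Amat a t \<tau> = F t - F (t - \<tau>)" if "\<tau> \<ge> 0" for t \<tau>
      using that by (simp add: Amat_def vec_eq_iff LI Fd)
    have lip: "\<bar>F c $ i $ j - F b $ i $ j\<bar> \<le> K * (c - b)" if "b \<le> c" for b c i j
    proof -
      have "F c $ i $ j - F b $ i $ j = (LINT r:{b..c}|lebesgue. a r $ i $ j)" by (simp add: Fd that LI)
      also have "\<bar>\<dots>\<bar> \<le> (\<integral>r. norm (indicat_real {b..c} r *\<^sub>R a r $ i $ j) \<partial>lebesgue)"
        unfolding set_lebesgue_integral_def real_norm_def[symmetric] by (rule integral_norm_bound)
      also have "\<dots> \<le> (\<integral>r. K * indicat_real {b..c} r \<partial>lebesgue)"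
      proof (rule integral_mono_AE[OF integrable_norm integrable_mult_right[OF ind]])
        show "integrable lebesgue (\<lambda>r. indicat_real {b..c} r *\<^sub>R a r $ i $ j)"
          using si by (simp add: set_integrable_def)
        show "AE r in lebesgue. norm (indicat_real {b..c} r *\<^sub>R a r $ i $ j) \<le> K * indicat_real {b..c} r"
          using bdK[of i j] by eventually_elim (simp add: indicator_def K_def)
      qed
      also have "\<dots> = K * (c - b)" using that by simp
      finally show ?thesis .
    qed
    show "\<bar>F t $ i $ j - F s $ i $ j\<bar> \<le> K * \<bar>t - s\<bar>" for s t i j
      using lip[of s t i j] lip[of t s i j] by (cases "s \<le> t") (auto simp: abs_minus_commute)
    show "ell (\<Lambda> * (t - s)) ((t - s) / \<Lambda>) (F t - F s)" if "s < t" for s t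
      unfolding ell_def
    proof (intro conjI allI)
      have "(F t - F s) $ i $ j = (F t - F s) $ j $ i" for i j
      proof -
        have "(LINT r:{s..t}|lebesgue. a r $ i $ j) = (LINT r:{s..t}|lebesgue. a r $ j $ i)"
          unfolding set_lebesgue_integral_def
        proof (rule integral_cong_AE)
          show "AE r in lebesgue. indicat_real {s..t} r *\<^sub>R a r $ i $ j = indicat_real {s..t} r *\<^sub>R a r $ j $ i"
            using sym by eventually_elim simp
        qed (rule borel_measurable_integrable[OF si[unfolded set_integrable_def]])+
        then show ?thesis using that by (simp add: Fd LI)
      qed
      then show "transpose (F t - F s) = F t - F s" by (simp add: transpose_def vec_eq_iff)
      fix \<xi> :: "real ^ 'n"
      let ?q = "\<lambda>r. \<Sum>i\<in>UNIV. \<Sum>j\<in>UNIV. a r $ i $ j * \<xi> $ i * \<xi> $ j"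
      have intq: "integrable lebesgue (\<lambda>r. indicat_real {s..t} r * ?q r)"
      proof -
        have "integrable lebesgue (\<lambda>r. \<Sum>i\<in>UNIV. \<Sum>j\<in>UNIV. (indicat_real {s..t} r * a r $ i $ j) * (\<xi> $ i * \<xi> $ j))"
          by (intro Bochner_Integration.integrable_sum Bochner_Integration.integrable_mult_left si')
        then show ?thesis by (simp add: sum_distrib_left mult_ac)
      qed
      \<comment> \<open>The quadratic form is a finite linear combination of the entries, so it
        commutes with the integral; the ellipticity of \<open>a\<close> can then be integrated over
        [s, t].\<close>
      have q: "((F t - F s) *v \<xi>) \<bullet> \<xi> = (\<integral>r. indicat_real {s..t} r * ?q r \<partial>lebesgue)"
      proof -
        have "((F t - F s) *v \<xi>) \<bullet> \<xi> = (\<Sum>i\<in>UNIV. \<Sum>j\<in>UNIV. (\<integral>r. indicat_real {s..t} r * a r $ i $ j \<partial>lebesgue) * (\<xi> $ i * \<xi> $ j))"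
          using that by (simp add: matrix_quad_form Fd LI[symmetric] set_lebesgue_integral_def mult.assoc)
        also have "\<dots> = (\<integral>r. (\<Sum>i\<in>UNIV. \<Sum>j\<in>UNIV. (indicat_real {s..t} r * a r $ i $ j) * (\<xi> $ i * \<xi> $ j)) \<partial>lebesgue)"
          using si' by (simp add: Bochner_Integration.integral_sum Bochner_Integration.integrable_sum)
        also have "\<dots> = (\<integral>r. indicat_real {s..t} r * ?q r \<partial>lebesgue)"
          by (simp add: sum_distrib_left mult_ac)
        finally show ?thesis .
      qed
      have c: "(\<integral>r. C * indicat_real {s..t} r \<partial>lebesgue) = C * (t - s)" for C
        using that by simp
      have "(\<integral>r. (\<Lambda> * (norm \<xi>)\<^sup>2) * indicat_real {s..t} r \<partial>lebesgue) \<le> (\<integral>r. indicat_real {s..t} r * ?q r \<partial>lebesgue)"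
        by (rule integral_mono_AE[OF integrable_mult_right[OF ind] intq])
          (use el in \<open>auto elim!: eventually_mono simp: indicator_def\<close>)
      then show "\<Lambda> * (t - s) * (norm \<xi>)\<^sup>2 \<le> ((F t - F s) *v \<xi>) \<bullet> \<xi>"
        unfolding q c by (simp add: mult_ac)
      have "(\<integral>r. indicat_real {s..t} r * ?q r \<partial>lebesgue) \<le> (\<integral>r. (inverse \<Lambda> * (norm \<xi>)\<^sup>2) * indicat_real {s..t} r \<partial>lebesgue)"
        by (rule integral_mono_AE[OF intq integrable_mult_right[OF ind]])
          (use el in \<open>auto elim!: eventually_mono simp: indicator_def\<close>)
      then show "((F t - F s) *v \<xi>) \<bullet> \<xi> \<le> (t - s) / \<Lambda> * (norm \<xi>)\<^sup>2"
        unfolding q c by (simp add: divide_inverse mult_ac)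
    qed
    have "AE t in lebesgue. ((\<lambda>s. F s $ i $ j) has_field_derivative a t $ i $ j) (at t)" for i j
      by (rule AE_has_derivative_indefinite_integral[OF int Fd])
    then have "AE t in lebesgue. \<forall>i\<in>UNIV. \<forall>j\<in>UNIV. ((\<lambda>s. F s $ i $ j) has_field_derivative a t $ i $ j) (at t)"
      by (intro AE_finite_allI) auto
    with el sym show "AE t in lebesgue.
      (\<forall>i j. ((\<lambda>s. F s $ i $ j) has_field_derivative a t $ i $ j) (at t)) \<and> ell \<Lambda> (1 / \<Lambda>) (a t)"
      by eventually_elim (auto simp: ell_def matrix_quad_form transpose_def vec_eq_iff inverse_eq_divide)
  qed
  then show thesis by (rule that)
qed

section \<open>Measurability and total mass of the kernel\<close>

lemma nn_integral_gauss_exp: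
  fixes M :: "real \<Rightarrow> real ^ 'n ^ 'n"
  assumes M: "\<And>\<tau>. \<tau> > 0 \<Longrightarrow> posdef (M \<tau>)"
    and k: "k = (\<lambda>(\<tau>, y). if \<tau> > 0 then exp (- \<tau>) * gauss (M \<tau>) y else 0)"
    and meas [measurable]: "k \<in> borel_measurable borel"
  shows "(\<integral>\<^sup>+z. ennreal (k z) \<partial>lborel) = 1"
proof -
  have [measurable]: "k \<in> borel_measurable (borel \<Otimes>\<^sub>M borel)" by (simp add: borel_prod)
  have "(\<integral>\<^sup>+z. ennreal (k z) \<partial>lborel) = (\<integral>\<^sup>+\<tau>. \<integral>\<^sup>+y. ennreal (k (\<tau>, y)) \<partial>lborel \<partial>lborel)"
    unfolding lborel_prod[symmetric] by (subst lborel.nn_integral_fst[symmetric]) simp_all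
  also have "\<dots> = (\<integral>\<^sup>+\<tau>. ennreal (\<tau> ^ 0 * exp (- \<tau>)) * indicator {0..} \<tau> \<partial>lborel)"
  proof (rule nn_integral_cong_AE)
    have "AE \<tau> in lborel. \<tau> \<noteq> (0::real)" by (rule AE_lborel_singleton)
    then show "AE \<tau> in lborel. (\<integral>\<^sup>+y. ennreal (k (\<tau>, y)) \<partial>lborel) = ennreal (\<tau> ^ 0 * exp (- \<tau>)) * indicator {0..} \<tau>"
    proof eventually_elim
      case (elim \<tau>)
      show ?case
      proof (cases "\<tau> > 0")
        case True
        have "(\<integral>\<^sup>+y. ennreal (k (\<tau>, y)) \<partial>lborel) = (\<integral>\<^sup>+y. ennreal (exp (- \<tau>)) * ennreal (gauss (M \<tau>) y) \<partial>lborel)"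
          using True by (simp add: k ennreal_mult)
        also have "\<dots> = ennreal (exp (- \<tau>))"
          by (simp add: nn_integral_cmult nn_integral_gauss M True)
        finally show ?thesis using True by simp
      qed (use elim in \<open>simp add: k\<close>)
    qed
  qed
  also have "\<dots> = 1" by (subst nn_intergal_power_times_exp_Ici) simp
  finally show ?thesis .
qed

lemma integrable_gauss_exp:
  assumes "\<And>\<tau>. \<tau> > 0 \<Longrightarrow> posdef (M \<tau>)"
    and k: "k = (\<lambda>(\<tau>, y). if \<tau> > 0 then exp (- \<tau>) * gauss (M \<tau>) y else 0)"
    and "k \<in> borel_measurable borel"
  shows "integrable lborel k" and "integral\<^sup>L lborel k = 1"
proof -
  note nn = nn_integral_gauss_exp[OF assms]
  have nonneg: "0 \<le> k z" for z by (simp add: k split: prod.split)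
  show "integrable lborel k"
    by (rule integrableI_bounded) (use assms(3) nonneg nn in simp_all)
  show "integral\<^sup>L lborel k = 1"
    by (subst integral_eq_nn_integral) (use assms(3) nonneg nn in simp_all)
qed

text \<open>Continuity of \<open>gauss\<close> is available where the matrix is positive definite,
  so measurability is obtained on the open set \<open>U\<close> and the function is extended by
  zero.\<close>

lemma borel_measurable_gauss_param:
  fixes M :: "'a::euclidean_space \<Rightarrow> real ^ 'n ^ 'n"
  assumes M: "continuous_on U M" and U: "open U" "\<And>z. z \<in> U \<Longrightarrow> posdef (M z)"
    and y: "continuous_on U y" and c: "continuous_on U c"
  shows "(\<lambda>z. if z \<in> U then c z * gauss (M z) (y z) else 0) \<in> borel_measurable borel"
    and "(\<lambda>z. if z \<in> U then c z * gauss2 (M z) i j (y z) else 0) \<in> borel_measurable borel"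
proof -
  have "continuous_on U (\<lambda>z. gauss (M z) (y z))"
    unfolding continuous_on_def
    by (intro ballI tendsto_gauss) (use M y U in \<open>auto simp: continuous_on_def\<close>)
  then show "(\<lambda>z. if z \<in> U then c z * gauss (M z) (y z) else 0) \<in> borel_measurable borel"
    using U(1) c by (intro borel_measurable_continuous_on_if) (auto intro!: continuous_intros)
  have "continuous_on U (\<lambda>z. gauss2 (M z) i j (y z))"
    unfolding continuous_on_def
    by (intro ballI tendsto_gauss2) (use M y U in \<open>auto simp: continuous_on_def\<close>)
  then show "(\<lambda>z. if z \<in> U then c z * gauss2 (M z) i j (y z) else 0) \<in> borel_measurable borel"
    using U(1) c by (intro borel_measurable_continuous_on_if) (auto intro!: continuous_intros)
qed

context primitive_coeff
begin

lemma posdef_F: "s < t \<Longrightarrow> posdef (F t - F s)"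
  using ell_posdef[OF ell_F[of s t]] l_pos by simp

lemma K_nonneg: "K \<ge> 0"
  using order_trans[OF abs_ge_zero F_lipschitz[of 1 undefined undefined 0]] by simp

lemma tendsto_F: "(F \<longlongrightarrow> F t) (at t within S)"
proof (intro vec_tendstoI)
  fix i j
  have "((\<lambda>s. K * \<bar>s - t\<bar>) \<longlongrightarrow> K * \<bar>t - t\<bar>) (at t within S)" by (intro tendsto_intros)
  then have *: "((\<lambda>s. K * \<bar>s - t\<bar>) \<longlongrightarrow> 0) (at t within S)" by simp
  show "((\<lambda>s. F s $ i $ j) \<longlongrightarrow> F t $ i $ j) (at t within S)"
    by (rule Lim_null[THEN iffD2], rule Lim_null_comparison[OF _ *]) (use F_lipschitz in auto)
qed

lemma continuous_on_F: "continuous_on S F"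
  by (simp add: continuous_on_def tendsto_F)

lemma continuous_on_F' [continuous_intros]: "continuous_on S g \<Longrightarrow> continuous_on S (\<lambda>x. F (g x))"
  by (rule continuous_on_compose2[OF continuous_on_F[of UNIV]]) auto

lemma kern_eq: "kern a t \<tau> x = (if \<tau> > 0 then exp (- \<tau>) * gauss (F t - F (t - \<tau>)) x else 0)"
  by (simp add: kern_eq_gauss Amat_eq)

lemma kern_nonneg [simp]: "0 \<le> kern a t \<tau> x"
  by (simp add: kern_eq)

lemma kern_measurable_joint: "(\<lambda>(t, \<tau>, y). kern a t \<tau> y) \<in> borel_measurable borel"
proof -
  let ?U = "{z :: real \<times> real \<times> (real ^ 'n). 0 < fst (snd z)}"
  have "open ?U" by (intro open_Collect_less continuous_intros)
  have "(\<lambda>z. if z \<in> ?U then exp (- fst (snd z)) * gauss (F (fst z) - F (fst z - fst (snd z))) (snd (snd z)) else 0)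
      \<in> borel_measurable borel"
    by (rule borel_measurable_gauss_param(1)[OF _ \<open>open ?U\<close>])
      (auto intro!: continuous_intros posdef_F)
  then show ?thesis by (simp add: kern_eq case_prod_beta' cong: if_cong)
qed

lemma kern_measurable [measurable (raw)]:
  assumes [measurable]: "f \<in> borel_measurable M" "g \<in> borel_measurable M" "h \<in> borel_measurable M"
  shows "(\<lambda>x. kern a (f x) (g x) (h x)) \<in> borel_measurable M"
proof -
  have "(\<lambda>x. (f x, g x, h x)) \<in> measurable M borel" by measurable
  from measurable_compose[OF this kern_measurable_joint] show ?thesis by simp
qed

lemma kern_slice:
  shows "(\<lambda>z. kern a t (fst z) (snd z)) = (\<lambda>(\<tau>, y). if \<tau> > 0 then exp (- \<tau>) * gauss (F t - F (t - \<tau>)) y else 0)"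
  "(\<lambda>z. kern a t (fst z) (snd z)) \<in> borel_measurable borel"
   apply (simp add: kern_eq fun_eq_iff)
  apply (rule kern_measurable)
    apply (simp_all add: borel_measurable_continuous_onI continuous_on_fst continuous_on_snd)
  done

lemma nn_integral_kern: "(\<integral>\<^sup>+z. ennreal (kern a t (fst z) (snd z)) \<partial>lborel) = 1"
  by (rule nn_integral_gauss_exp[OF _ kern_slice]) (simp add: posdef_F)

lemma integrable_kern: "integrable lborel (\<lambda>z. kern a t (fst z) (snd z))"
  by (rule integrable_gauss_exp[OF _ kern_slice]) (simp add: posdef_F)

lemma integral_kern: "(\<integral>z. kern a t (fst z) (snd z) \<partial>lborel) = 1"
  by (rule integrable_gauss_exp[OF _ kern_slice]) (simp add: posdef_F)

text \<open>Mass of a time slice. That the value is free of t makes up for the lack of translation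
  invariance in time when the solution is integrated over t.\<close>

lemma nn_integral_kern_space:
  "(\<integral>\<^sup>+y. ennreal (kern a t \<tau> y) \<partial>lborel) = ennreal (exp (- \<tau>)) * indicator {0<..} \<tau>"
proof (cases "\<tau> > 0")
  case True
  then have "(\<integral>\<^sup>+y. ennreal (kern a t \<tau> y) \<partial>lborel)
      = (\<integral>\<^sup>+y. ennreal (exp (- \<tau>)) * ennreal (gauss (F t - F (t - \<tau>)) y) \<partial>lborel)"
    by (simp add: kern_eq ennreal_mult)
  then show ?thesis using True by (simp add: nn_integral_cmult nn_integral_gauss posdef_F)
qed (simp add: kern_eq)

end

text \<open>An integrable majorant for all the kernels at once, with no dependence on t; it
  dominates in the limits where t varies or the scale \<epsilon> shrinks.\<close>

definition heat_kern :: "real \<Rightarrow> real \<times> (real ^ 'n) \<Rightarrow> real" where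
  "heat_kern l = (\<lambda>(\<tau>, y). if \<tau> > 0 then exp (- \<tau>) * heat_bound l \<tau> y else 0)"

lemma heat_kern_measurable [measurable]:
  assumes "l > 0"
  shows "heat_kern l \<in> borel_measurable borel"
proof -
  let ?U = "{z :: real \<times> (real ^ 'n). 0 < fst z}"
  have "open ?U" by (intro open_Collect_less continuous_intros)
  have "(\<lambda>z. if z \<in> ?U then exp (- fst z) * gauss ((2 * fst z / l) *\<^sub>R mat 1) (snd z) else 0)
      \<in> borel_measurable borel"
    by (rule borel_measurable_gauss_param(1)[OF _ \<open>open ?U\<close>])
      (use assms in \<open>auto intro!: continuous_intros heat_bound_posdef\<close>)
  then show ?thesis by (simp add: heat_kern_def heat_bound_def case_prod_beta' cong: if_cong)
qed

lemma heat_kern_nonneg [simp]: "0 \<le> heat_kern l z"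
  by (simp add: heat_kern_def heat_bound_def split: prod.split)

lemma integrable_heat_kern:
  assumes "l > 0"
  shows "integrable lborel (heat_kern l)"
  by (rule integrable_gauss_exp(1)[where M="\<lambda>\<tau>. (2 * \<tau> / l) *\<^sub>R mat 1"])
    (use assms heat_kern_measurable[OF assms] in \<open>auto simp: heat_bound_posdef heat_kern_def heat_bound_def\<close>)

section \<open>Bounds in Lebesgue spaces\<close>

lemma borel_measurable_fst_snd [measurable (raw)]:
  fixes f :: "'c \<Rightarrow> 'a::topological_space \<times> 'b::topological_space"
  assumes f: "f \<in> borel_measurable M"
  shows "(\<lambda>x. fst (f x)) \<in> borel_measurable M" "(\<lambda>x. snd (f x)) \<in> borel_measurable M"
  by (rule measurable_compose[OF f], intro borel_measurable_continuous_onI continuous_intros)+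

lemma distr_lborel_reflect:
  fixes c :: "'a::euclidean_space"
  shows "distr lborel borel (\<lambda>x. c - x) = lborel"
  using lborel_affine[of "-1" c] by (simp add: density_1)

lemma AE_lborel_reflect:
  fixes c :: "'a::euclidean_space"
  assumes "AE x in lborel. P x"
  shows "AE x in lborel. P (c - x)"
proof -
  obtain N where N: "{x. \<not> P x} \<subseteq> N" "emeasure lborel N = 0" "N \<in> sets lborel"
    using assms by (auto elim!: AE_E)
  have [measurable]: "N \<in> sets borel" using N(3) by simp
  have "emeasure lborel ((\<lambda>x. c - x) -` N) = emeasure (distr lborel borel (\<lambda>x. c - x)) N"
    by (simp add: emeasure_distr)
  then have "emeasure lborel ((\<lambda>x. c - x) -` N) = 0" by (simp add: distr_lborel_reflect N(2))
  moreover have "(\<lambda>x. c - x) -` N \<in> sets borel"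
    by (rule measurable_sets_borel[where M=borel]) auto
  ultimately have "(\<lambda>x. c - x) -` N \<in> null_sets lborel" by auto
  then show ?thesis by (rule AE_I') (use N(1) in auto)
qed

text \<open>The completed measure measures every subset of a Borel null set, so altering a Borel
  function there is harmless.\<close>

lemma borel_measurable_lebesgue_AE:
  fixes f g :: "'a::euclidean_space \<Rightarrow> 'b::topological_space"
  assumes g: "g \<in> borel_measurable borel" and eq: "AE x in lborel. f x = g x"
  shows "f \<in> borel_measurable lebesgue"
proof (rule measurableI)
  fix A :: "'b set" assume A: "A \<in> sets borel"
  obtain N where N: "{x. f x \<noteq> g x} \<subseteq> N" "emeasure lborel N = 0" "N \<in> sets lborel"
    using eq by (auto elim!: AE_E)
  then have N0: "N \<in> null_sets lborel" by (simp add: null_setsI)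
  have sub: "B \<in> sets lebesgue" if "B \<subseteq> N" for B
    using null_sets_completion_subset[OF that] N0 null_sets_completionI by blast
  have "g -` A \<in> sets borel" using measurable_sets_borel[OF g A] by simp
  then have "g -` A \<in> sets lebesgue" by simp
  moreover have "f -` A \<inter> space lebesgue = (g -` A - N) \<union> (f -` A \<inter> N)" using N(1) by auto
  moreover have "(g -` A - N) \<union> (f -` A \<inter> N) \<in> sets lebesgue" if "g -` A \<in> sets lebesgue"
    by (intro sets.Un sets.Diff that sub) auto
  ultimately show "f -` A \<inter> space lebesgue \<in> sets lebesgue" by simp
qed auto

text \<open>Bridge between \<open>lebesgue\<close>, in which the statements are phrased, and
  \<open>lborel\<close>, where Tonelli, translations and scalings are applied to a Borel
  representative.\<close>

lemma lebesgue_lborel_AE: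
  fixes f g :: "'a::euclidean_space \<Rightarrow> real"
  assumes g: "g \<in> borel_measurable borel" and eq: "AE x in lborel. f x = g x"
  shows "integrable lebesgue f \<longleftrightarrow> integrable lborel g" "integral\<^sup>L lebesgue f = integral\<^sup>L lborel g"
proof -
  have f: "f \<in> borel_measurable lebesgue" by (rule borel_measurable_lebesgue_AE[OF assms])
  have g': "g \<in> borel_measurable lebesgue" using g by (simp add: measurable_completion)
  have eq': "AE x in lebesgue. f x = g x" by (rule AE_completion[OF eq])
  show "integrable lebesgue f \<longleftrightarrow> integrable lborel g"
    using integrable_cong_AE[OF f g' eq'] integrable_completion[of g lborel] g by simp
  show "integral\<^sup>L lebesgue f = integral\<^sup>L lborel g"
    using integral_cong_AE[OF f g' eq'] integral_completion[of g lborel] g by simp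
qed

lemma lebesgue_lborel:
  fixes f :: "'a::euclidean_space \<Rightarrow> real"
  assumes "f \<in> borel_measurable borel"
  shows "integrable lebesgue f \<longleftrightarrow> integrable lborel f" "integral\<^sup>L lebesgue f = integral\<^sup>L lborel f"
  using lebesgue_lborel_AE[OF assms] by auto

text \<open>Jensen's inequality for \<open>x \<mapsto> x\<^sup>r\<close>, obtained by integrating Young's inequality.\<close>

lemma weighted_powr_mean:
  fixes k h :: "'a \<Rightarrow> real"
  assumes k: "integrable M k" "\<And>x. 0 \<le> k x" "integral\<^sup>L M k = 1"
    and h: "h \<in> borel_measurable M" "\<And>x. 0 \<le> h x"
    and int: "integrable M (\<lambda>x. k x * h x powr r)" and r: "1 \<le> r"
  shows "integrable M (\<lambda>x. k x * h x)"
    and "(\<integral>x. k x * h x \<partial>M) powr r \<le> (\<integral>x. k x * h x powr r \<partial>M)"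
proof -
  have km: "k \<in> borel_measurable M" using k(1) by (rule borel_measurable_integrable)
  have le: "h x \<le> 1 + h x powr r" for x
  proof (cases "h x \<le> 1")
    case False
    then have "h x powr 1 \<le> h x powr r" using r by (intro powr_mono) auto
    then show ?thesis using False by simp
  qed (simp add: add_increasing2)
  show kh: "integrable M (\<lambda>x. k x * h x)"
  proof (rule Bochner_Integration.integrable_bound[OF Bochner_Integration.integrable_add[OF k(1) int]])
    show "(\<lambda>x. k x * h x) \<in> borel_measurable M" using km h(1) by measurable
    have "k x * h x \<le> k x + k x * h x powr r" for x
      using mult_left_mono[OF le[of x] k(2)[of x]] by (simp add: algebra_simps)
    then show "AE x in M. norm (k x * h x) \<le> norm (k x + k x * h x powr r)"
      using k(2) h(2) by (auto simp: abs_mult)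
  qed
  define c where "c = (\<integral>x. k x * h x \<partial>M)"
  define J where "J = (\<integral>x. k x * h x powr r \<partial>M)"
  have c0: "0 \<le> c" unfolding c_def using k(2) h(2) by (intro integral_nonneg_AE) auto
  have J0: "0 \<le> J" unfolding J_def using k(2) by (intro integral_nonneg_AE) auto
  have "c powr r \<le> J"
  proof (cases "c = 0")
    case False
    then have cp: "c > 0" using c0 by simp
    \<comment> \<open>Young's inequality with weights 1 / r and 1 - 1 / r for
      \<open>h x powr r\<close> and \<open>c powr r\<close>, where c is the mean of h. Integrated
      against k it gives c^r \<le> J / r + (1 - 1 / r) c^r.\<close>
    have young: "h x * c powr (r - 1) \<le> (1 / r) * h x powr r + (1 - 1 / r) * c powr r" for x
    proof (cases "h x = 0")
      case True
      then show ?thesis using r by simp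
    next
      case False
      then have hp: "h x > 0" using h(2)[of x] by simp
      have "(h x powr r) powr (1 / r) * (c powr r) powr (1 - 1 / r) \<le> (1 / r) * h x powr r + (1 - 1 / r) * c powr r"
        using r hp cp by (intro Youngs_inequality_0) auto
      moreover have "r * (1 - 1 / r) = r - 1" using r by (simp add: field_simps)
      ultimately show ?thesis using r hp by (simp add: powr_powr)
    qed
    have "(\<integral>x. c powr (r - 1) * (k x * h x) \<partial>M) \<le> (\<integral>x. (1 / r) * (k x * h x powr r) + ((1 - 1 / r) * c powr r) * k x \<partial>M)"
    proof (rule integral_mono)
      fix x
      show "c powr (r - 1) * (k x * h x) \<le> (1 / r) * (k x * h x powr r) + ((1 - 1 / r) * c powr r) * k x"
        using mult_left_mono[OF young[of x] k(2)[of x]] by (simp add: algebra_simps)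
    qed (intro integrable_mult_right kh int k(1) Bochner_Integration.integrable_add)+
    also have "\<dots> = (1 / r) * J + (1 - 1 / r) * c powr r"
      using int k by (simp add: J_def)
    finally have "c powr (r - 1) * c \<le> (1 / r) * J + (1 - 1 / r) * c powr r"
      using kh by (simp add: c_def)
    moreover have "c powr (r - 1) * c = c powr r"
      using powr_mult_base[OF c0, of "r - 1"] by (simp add: mult.commute)
    ultimately have "(1 / r) * c powr r \<le> (1 / r) * J" by (simp add: algebra_simps)
    then show ?thesis using r by (simp add: divide_le_cancel)
  qed (use J0 r in simp)
  then show "(\<integral>x. k x * h x \<partial>M) powr r \<le> (\<integral>x. k x * h x powr r \<partial>M)"
    by (simp add: c_def J_def)
qed

context primitive_coeff
begin

abbreviation kz :: "real \<Rightarrow> real \<times> (real ^ 'n) \<Rightarrow> real" where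
  "kz t z \<equiv> kern a t (fst z) (snd z)"

text \<open>Tonelli with x integrated first: by translation the space integral of h loses its
  dependence on y, the y-integral of the kernel is exp(-\<tau>), and what remains is a convolution
  in time with a probability density.\<close>

lemma nn_integral_sol_kernel:
  fixes h :: "real \<times> (real ^ 'n) \<Rightarrow> ennreal"
  assumes [measurable]: "h \<in> borel_measurable borel"
  shows "(\<integral>\<^sup>+p. \<integral>\<^sup>+z. ennreal (kz (fst p) z) * h (p - z) \<partial>lborel \<partial>lborel) = (\<integral>\<^sup>+p. h p \<partial>lborel)"
proof -
  have [measurable]: "h \<in> borel_measurable (borel \<Otimes>\<^sub>M borel)" by (simp add: borel_prod)
  define E where "E \<tau> = ennreal (exp (- \<tau>)) * indicator {0<..} \<tau>" for \<tau> :: real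
  have [measurable]: "E \<in> borel_measurable borel" unfolding E_def by measurable
  define H where "H s = (\<integral>\<^sup>+x. h (s, x) \<partial>lborel)" for s
  have [measurable]: "H \<in> borel_measurable borel" unfolding H_def by measurable
  have tr: "(\<integral>\<^sup>+x. h (s, x - y) \<partial>lborel) = H s" for s y
    using nn_integral_lborel_translate[of "\<lambda>x. h (s, x)" "- y"] by (simp add: H_def)
  have inner: "(\<integral>\<^sup>+x. \<integral>\<^sup>+z. ennreal (kz t z) * h ((t, x) - z) \<partial>lborel \<partial>lborel)
      = (\<integral>\<^sup>+\<tau>. E \<tau> * H (t - \<tau>) \<partial>lborel)" for t
  proof -
    have "(\<integral>\<^sup>+x. \<integral>\<^sup>+z. ennreal (kz t z) * h ((t, x) - z) \<partial>lborel \<partial>lborel)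
      = (\<integral>\<^sup>+z. \<integral>\<^sup>+x. ennreal (kz t z) * h (t - fst z, x - snd z) \<partial>lborel \<partial>lborel)"
      by (subst lborel_pair.Fubini') (auto simp: minus_prod_def)
    also have "\<dots> = (\<integral>\<^sup>+z. ennreal (kz t z) * H (t - fst z) \<partial>lborel)"
      by (subst nn_integral_cmult) (simp_all add: tr)
    also have "\<dots> = (\<integral>\<^sup>+\<tau>. \<integral>\<^sup>+y. ennreal (kern a t \<tau> y) * H (t - \<tau>) \<partial>lborel \<partial>lborel)"
      unfolding lborel_prod[symmetric] by (subst lborel.nn_integral_fst[symmetric]) simp_all
    also have "\<dots> = (\<integral>\<^sup>+\<tau>. E \<tau> * H (t - \<tau>) \<partial>lborel)"
      by (subst nn_integral_multc) (simp_all add: nn_integral_kern_space E_def)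
    finally show ?thesis .
  qed
  have E1: "(\<integral>\<^sup>+\<tau>. E \<tau> \<partial>lborel) = 1"
  proof -
    have "(\<integral>\<^sup>+\<tau>. E \<tau> \<partial>lborel) = (\<integral>\<^sup>+z. ennreal (kz 0 z) \<partial>lborel)"
      unfolding lborel_prod[symmetric]
      by (subst lborel.nn_integral_fst[symmetric]) (simp_all add: nn_integral_kern_space[folded E_def])
    then show ?thesis by (simp add: nn_integral_kern)
  qed
  define Q where "Q p = (\<integral>\<^sup>+z. ennreal (kz (fst p) z) * h (p - z) \<partial>lborel)" for p
  have [measurable]: "Q \<in> borel_measurable borel" unfolding Q_def by measurable
  then have [measurable]: "Q \<in> borel_measurable (borel \<Otimes>\<^sub>M borel)" by (simp add: borel_prod)
  have "(\<integral>\<^sup>+p. Q p \<partial>lborel) = (\<integral>\<^sup>+t. \<integral>\<^sup>+x. Q (t, x) \<partial>lborel \<partial>lborel)"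
    unfolding lborel_prod[symmetric] by (subst lborel.nn_integral_fst[symmetric]) simp_all
  then have "(\<integral>\<^sup>+p. \<integral>\<^sup>+z. ennreal (kz (fst p) z) * h (p - z) \<partial>lborel \<partial>lborel)
      = (\<integral>\<^sup>+t. \<integral>\<^sup>+x. \<integral>\<^sup>+z. ennreal (kz t z) * h ((t, x) - z) \<partial>lborel \<partial>lborel \<partial>lborel)"
    by (simp add: Q_def)
  also have "\<dots> = (\<integral>\<^sup>+t. \<integral>\<^sup>+\<tau>. E \<tau> * H (t - \<tau>) \<partial>lborel \<partial>lborel)"
    by (simp only: inner)
  also have "\<dots> = (\<integral>\<^sup>+\<tau>. \<integral>\<^sup>+t. E \<tau> * H (t - \<tau>) \<partial>lborel \<partial>lborel)"
    by (rule lborel_pair.Fubini') simp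
  also have "\<dots> = (\<integral>\<^sup>+\<tau>. E \<tau> * (\<integral>\<^sup>+t. H t \<partial>lborel) \<partial>lborel)"
  proof (rule nn_integral_cong)
    fix \<tau> :: real
    show "(\<integral>\<^sup>+t. E \<tau> * H (t - \<tau>) \<partial>lborel) = E \<tau> * (\<integral>\<^sup>+t. H t \<partial>lborel)"
      using nn_integral_lborel_translate[of H "- \<tau>"] by (simp add: nn_integral_cmult)
  qed
  also have "\<dots> = (\<integral>\<^sup>+t. H t \<partial>lborel)" by (simp add: nn_integral_multc E1)
  also have "\<dots> = (\<integral>\<^sup>+p. h p \<partial>lborel)"
    unfolding lborel_prod[symmetric] H_def by (subst lborel.nn_integral_fst) simp_all
  finally show ?thesis .
qed

text \<open>For each fixed point p the reflection z \<mapsto> p - z preserves null sets. So f may be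
  replaced by a Borel representative in the integral at every point, not merely at almost every
  one.\<close>

lemma sol_eq_lborel:
  assumes g: "g \<in> borel_measurable borel" and eq: "AE z in lborel. f z = g z"
  shows "sol a f p = (\<integral>z. kz (fst p) z * g (p - z) \<partial>lborel)"
    and "integrable lebesgue (\<lambda>(\<tau>, y). kern a (fst p) \<tau> y * f (fst p - \<tau>, snd p - y)) \<longleftrightarrow>
      integrable lborel (\<lambda>z. kz (fst p) z * g (p - z))"
proof -
  have [measurable]: "g \<in> borel_measurable borel" by (rule g)
  have fz: "(\<lambda>(\<tau>, y). kern a (fst p) \<tau> y * f (fst p - \<tau>, snd p - y)) = (\<lambda>z. kz (fst p) z * f (p - z))"
    by (auto simp: minus_prod_def)
  have m: "(\<lambda>z. kz (fst p) z * g (p - z)) \<in> borel_measurable borel" by measurable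
  have "AE z in lborel. f (p - z) = g (p - z)" by (rule AE_lborel_reflect[OF eq])
  then have e: "AE z in lborel. kz (fst p) z * f (p - z) = kz (fst p) z * g (p - z)"
    by eventually_elim simp
  note L = lebesgue_lborel_AE[OF m e]
  show "sol a f p = (\<integral>z. kz (fst p) z * g (p - z) \<partial>lborel)"
  proof -
    have "sol a f p = (LINT (\<tau>, y)|lebesgue. kern a (fst p) \<tau> y * f (fst p - \<tau>, snd p - y))"
      by (simp add: sol_def case_prod_beta)
    then show ?thesis unfolding fz L(2) .
  qed
  show "integrable lebesgue (\<lambda>(\<tau>, y). kern a (fst p) \<tau> y * f (fst p - \<tau>, snd p - y)) \<longleftrightarrow>
      integrable lborel (\<lambda>z. kz (fst p) z * g (p - z))"
    unfolding fz by (rule L(1))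
qed

lemma sol_Lp_bounds:
  fixes f :: "real \<times> (real ^ 'n) \<Rightarrow> real"
  assumes p: "1 \<le> p" and f: "f \<in> Lp p"
  shows "(AE (t, x) in lebesgue. integrable lebesgue (\<lambda>(\<tau>, y). kern a t \<tau> y * f (t - \<tau>, x - y)))
    \<and> sol a f \<in> Lp p \<and> Lp_norm p (sol a f) \<le> Lp_norm p f"
proof -
  have fm: "f \<in> borel_measurable lebesgue" using f by (simp add: Lp_def)
  then obtain g where g0: "g \<in> borel_measurable lborel" and eq: "AE z in lborel. f z = g z"
    using completion_ex_borel_measurable_real by blast
  have g [measurable]: "g \<in> borel_measurable borel" using g0 by simp
  define U where "U p = (\<integral>z. kz (fst p) z * g (p - z) \<partial>lborel)" for p
  have solU: "sol a f = U" by (rule ext) (simp add: U_def sol_eq_lborel(1)[OF g eq])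
  have [measurable]: "U \<in> borel_measurable borel" unfolding U_def by measurable
  have U_leb: "U \<in> borel_measurable lebesgue" by (simp add: measurable_completion)
  have AEint: "AE (t, x) in lebesgue. integrable lebesgue (\<lambda>(\<tau>, y). kern a t \<tau> y * f (t - \<tau>, x - y))"
    if "AE p in lborel. integrable lborel (\<lambda>z. kz (fst p) z * g (p - z))"
    using AE_completion[OF that]
    by eventually_elim (use sol_eq_lborel(2)[OF g eq] in \<open>auto simp: case_prod_beta\<close>)
  show ?thesis
  proof (cases "p = top")
    case True
    define S where "S = esssup lebesgue (\<lambda>z. ereal \<bar>f z\<bar>)"
    have fabs: "(\<lambda>z. ereal \<bar>f z\<bar>) \<in> borel_measurable lebesgue" using fm by measurable
    have Sfin: "S < \<infinity>" using f True by (simp add: Lp_def S_def)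
    have ne: "emeasure lebesgue (space lebesgue :: (real \<times> (real ^ 'n)) set) \<noteq> 0" by simp
    \<comment> \<open>The essential supremum lives in the extended reals; its sign and finiteness
      are settled before it is read as a real number.\<close>
    have S0: "0 \<le> S"
    proof -
      have "esssup lebesgue (\<lambda>z :: real \<times> (real ^ 'n). 0 :: ereal) \<le> S"
        unfolding S_def by (rule esssup_mono) auto
      then show ?thesis by (simp add: esssup_const[OF ne])
    qed
    then obtain M where M: "S = ereal M" "M \<ge> 0" using Sfin by (cases S) auto
    have "AE z in lebesgue. ereal \<bar>f z\<bar> \<le> S" unfolding S_def by (rule esssup_AE)
    then have "AE z in lborel. \<bar>f z\<bar> \<le> M" by (simp add: AE_completion_iff M)
    with eq have gM: "AE z in lborel. \<bar>g z\<bar> \<le> M" by eventually_elim simp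
    have bd: "AE z in lborel. norm (kz t z * g (p - z)) \<le> norm (M * kz t z)" for t p
      using AE_lborel_reflect[OF gM, of p]
      by eventually_elim (use M(2) in \<open>simp add: abs_mult mult.commute mult_right_mono\<close>)
    have int: "integrable lborel (\<lambda>z. kz (fst p) z * g (p - z))" for p
      by (rule Bochner_Integration.integrable_bound[OF integrable_mult_right[OF integrable_kern[of "fst p"], of M]])
        (simp, rule bd)
    have UM: "\<bar>U p\<bar> \<le> M" for p
    proof -
      have "\<bar>U p\<bar> \<le> (\<integral>z. norm (kz (fst p) z * g (p - z)) \<partial>lborel)"
        unfolding U_def real_norm_def[symmetric] by (rule integral_norm_bound)
      also have "\<dots> \<le> (\<integral>z. M * kz (fst p) z \<partial>lborel)"
        by (rule integral_mono_AE[OF integrable_norm[OF int] integrable_mult_right[OF integrable_kern]])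
          (use bd[of "fst p" p] M(2) in \<open>auto elim!: eventually_mono simp: abs_mult\<close>)
      also have "\<dots> = M" by (simp add: integral_kern)
      finally show ?thesis .
    qed
    have Uabs: "(\<lambda>z. ereal \<bar>U z\<bar>) \<in> borel_measurable lebesgue" using U_leb by measurable
    have leS: "esssup lebesgue (\<lambda>z. ereal \<bar>U z\<bar>) \<le> S"
      by (rule esssup_I[OF Uabs]) (simp add: M UM)
    have ge0: "0 \<le> esssup lebesgue (\<lambda>z. ereal \<bar>U z\<bar>)"
    proof -
      have "esssup lebesgue (\<lambda>z :: real \<times> (real ^ 'n). 0 :: ereal) \<le> esssup lebesgue (\<lambda>z. ereal \<bar>U z\<bar>)"
        by (rule esssup_mono) auto
      then show ?thesis by (simp add: esssup_const[OF ne])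
    qed
    have "U \<in> Lp p" using True le_less_trans[OF leS Sfin] U_leb by (simp add: Lp_def)
    moreover have "Lp_norm p U \<le> Lp_norm p f"
      using True leS ge0 Sfin unfolding Lp_norm_def S_def[symmetric]
      by (auto intro: real_of_ereal_positive_mono)
    ultimately show ?thesis using AEint int by (simp add: solU)
  next
    case False
    define r where "r = enn2real p"
    have r: "1 \<le> r"
      using p False unfolding r_def by (cases p) (auto simp: ennreal_le_iff2 simp flip: ennreal_1)
    define h where "h z = \<bar>g z\<bar> powr r" for z
    have [measurable]: "h \<in> borel_measurable borel" unfolding h_def by measurable
    have eqh: "AE z in lborel. \<bar>f z\<bar> powr r = h z" using eq by eventually_elim (simp add: h_def)
    note Lh = lebesgue_lborel_AE[OF \<open>h \<in> borel_measurable borel\<close> eqh]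
    have hint: "integrable lborel h" using f False Lh(1) by (simp add: Lp_def r_def)
    have nnh: "(\<integral>\<^sup>+z. ennreal (h z) \<partial>lborel) = ennreal (integral\<^sup>L lborel h)"
      by (rule nn_integral_eq_integral[OF hint]) (simp add: h_def)
    \<comment> \<open>A finite total makes the inner integral finite for almost every p. This yields
      both the existence of the integral defining the solution and, after Jensen at these points,
      the norm bound.\<close>
    have tot: "(\<integral>\<^sup>+p. \<integral>\<^sup>+z. ennreal (kz (fst p) z * h (p - z)) \<partial>lborel \<partial>lborel) = ennreal (integral\<^sup>L lborel h)"
      using nn_integral_sol_kernel[of "\<lambda>z. ennreal (h z)"] nnh by (simp add: ennreal_mult h_def)
    have "AE p in lborel. (\<integral>\<^sup>+z. ennreal (kz (fst p) z * h (p - z)) \<partial>lborel) \<noteq> \<infinity>"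
      by (rule nn_integral_PInf_AE) (simp_all add: tot)
    then have good: "AE p in lborel. integrable lborel (\<lambda>z. kz (fst p) z * h (p - z))"
    proof eventually_elim
      case (elim p)
      show ?case
        by (rule integrableI_bounded) (use elim in \<open>simp_all add: h_def less_top abs_mult\<close>)
    qed
    have J: "integrable lborel (\<lambda>z. kz (fst p) z * g (p - z))"
      "\<bar>U p\<bar> powr r \<le> (\<integral>z. kz (fst p) z * h (p - z) \<partial>lborel)"
      if "integrable lborel (\<lambda>z. kz (fst p) z * h (p - z))" for p
    proof -
      note W = weighted_powr_mean[OF integrable_kern[of "fst p"] _ integral_kern[of "fst p"], of "\<lambda>z. \<bar>g (p - z)\<bar>" r]
      have 1: "integrable lborel (\<lambda>z. kz (fst p) z * \<bar>g (p - z)\<bar>)"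
        by (rule W(1)) (use that r in \<open>auto simp: h_def\<close>)
      have 2: "(\<integral>z. kz (fst p) z * \<bar>g (p - z)\<bar> \<partial>lborel) powr r \<le> (\<integral>z. kz (fst p) z * h (p - z) \<partial>lborel)"
        unfolding h_def by (rule W(2)) (use that r in \<open>auto simp: h_def\<close>)
      show "integrable lborel (\<lambda>z. kz (fst p) z * g (p - z))"
        by (rule Bochner_Integration.integrable_bound[OF 1]) (auto simp: abs_mult)
      have "\<bar>U p\<bar> \<le> (\<integral>z. norm (kz (fst p) z * g (p - z)) \<partial>lborel)"
        unfolding U_def real_norm_def[symmetric] by (rule integral_norm_bound)
      also have "\<dots> = (\<integral>z. kz (fst p) z * \<bar>g (p - z)\<bar> \<partial>lborel)" by (simp add: abs_mult)
      finally have "\<bar>U p\<bar> powr r \<le> (\<integral>z. kz (fst p) z * \<bar>g (p - z)\<bar> \<partial>lborel) powr r"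
        using r by (intro powr_mono2) auto
      with 2 show "\<bar>U p\<bar> powr r \<le> (\<integral>z. kz (fst p) z * h (p - z) \<partial>lborel)" by linarith
    qed
    have "(\<integral>\<^sup>+p. ennreal (\<bar>U p\<bar> powr r) \<partial>lborel) \<le> (\<integral>\<^sup>+p. \<integral>\<^sup>+z. ennreal (kz (fst p) z * h (p - z)) \<partial>lborel \<partial>lborel)"
    proof (rule nn_integral_mono_AE)
      show "AE p in lborel. ennreal (\<bar>U p\<bar> powr r) \<le> (\<integral>\<^sup>+z. ennreal (kz (fst p) z * h (p - z)) \<partial>lborel)"
        using good
      proof eventually_elim
        case (elim p)
        show ?case
          by (subst nn_integral_eq_integral[OF elim]) (use J(2)[OF elim] in \<open>auto simp: h_def intro!: ennreal_leI\<close>)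
      qed
    qed
    then have Unn: "(\<integral>\<^sup>+p. ennreal (\<bar>U p\<bar> powr r) \<partial>lborel) \<le> ennreal (integral\<^sup>L lborel h)"
      by (simp add: tot)
    have Uint: "integrable lborel (\<lambda>p. \<bar>U p\<bar> powr r)"
      by (rule integrableI_bounded) (use Unn in \<open>auto intro: le_less_trans\<close>)
    have Ule: "(\<integral>p. \<bar>U p\<bar> powr r \<partial>lborel) \<le> integral\<^sup>L lborel h"
    proof -
      have "0 \<le> integral\<^sup>L lborel h" by (rule integral_nonneg_AE) (simp add: h_def)
      then show ?thesis using Unn nn_integral_eq_integral[OF Uint] by (simp add: ennreal_le_iff)
    qed
    have mU: "(\<lambda>p. \<bar>U p\<bar> powr r) \<in> borel_measurable borel" by measurable
    note LU = lebesgue_lborel[OF mU]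
    have "U \<in> Lp p" using False U_leb Uint LU(1) by (simp add: Lp_def r_def)
    moreover have "Lp_norm p U \<le> Lp_norm p f"
      using False Ule Lh(2) LU(2) r unfolding Lp_norm_def r_def[symmetric]
      by (auto intro!: powr_mono2 integral_nonneg_AE)
    moreover have "AE p in lborel. integrable lborel (\<lambda>z. kz (fst p) z * g (p - z))"
      using good by eventually_elim (rule J(1))
    ultimately show ?thesis using AEint by (simp add: solU)
  qed
qed

end

section \<open>Derivatives of the solution\<close>

text \<open>Differentiability is asked only at \<open>s0\<close> and for almost every y, with a
  Lipschitz bound as majorant of the difference quotients. A version asking for derivatives
  throughout a neighbourhood would not apply in time, where they exist only at almost every
  t.\<close>

lemma has_field_derivative_integral_dominated:
  fixes f :: "real \<Rightarrow> 'a \<Rightarrow> real"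
  assumes r: "r > 0" and int: "\<And>s. \<bar>s - s0\<bar> < r \<Longrightarrow> integrable M (f s)"
    and deriv: "AE y in M. ((\<lambda>s. f s y) has_field_derivative f' y) (at s0)"
    and bound: "\<And>s. \<bar>s - s0\<bar> < r \<Longrightarrow> AE y in M. \<bar>f s y - f s0 y\<bar> \<le> \<bar>s - s0\<bar> * g y"
    and g: "integrable M g" and f': "f' \<in> borel_measurable M"
  shows "((\<lambda>s. \<integral>y. f s y \<partial>M) has_field_derivative (\<integral>y. f' y \<partial>M)) (at s0)"
  unfolding has_field_derivative_iff tendsto_at_iff_sequentially comp_def
proof (intro allI impI)
  fix X :: "nat \<Rightarrow> real" assume X: "\<forall>i. X i \<in> UNIV - {s0}" "X \<longlonglongrightarrow> s0"
  then obtain N where N: "\<And>i. i \<ge> N \<Longrightarrow> \<bar>X i - s0\<bar> < r"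
    using r unfolding lim_sequentially dist_real_def by blast
  define Y where "Y i = X (i + N)" for i
  have Y: "Y \<longlonglongrightarrow> s0" "\<And>i. Y i \<noteq> s0" "\<And>i. \<bar>Y i - s0\<bar> < r"
    unfolding Y_def using LIMSEQ_ignore_initial_segment[OF X(2), of N] X(1) N by auto
  have int0: "integrable M (f s0)" using int[of s0] r by simp
  have L: "(\<lambda>i. \<integral>y. (f (Y i) y - f s0 y) / (Y i - s0) \<partial>M) \<longlonglongrightarrow> (\<integral>y. f' y \<partial>M)"
  proof (rule integral_dominated_convergence[where w=g])
    show "(\<lambda>y. (f (Y i) y - f s0 y) / (Y i - s0)) \<in> borel_measurable M" for i
      using borel_measurable_integrable[OF int[OF Y(3)[of i]]] borel_measurable_integrable[OF int0] by measurable
    show "AE y in M. (\<lambda>i. (f (Y i) y - f s0 y) / (Y i - s0)) \<longlonglongrightarrow> f' y"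
      using deriv
    proof eventually_elim
      case (elim y)
      then show ?case
        using Y(1,2) unfolding has_field_derivative_iff tendsto_at_iff_sequentially comp_def by auto
    qed
    show "AE y in M. norm ((f (Y i) y - f s0 y) / (Y i - s0)) \<le> g y" for i
      using bound[OF Y(3)[of i]]
      by eventually_elim (use Y(2)[of i] in \<open>simp add: abs_divide divide_le_eq mult.commute\<close>)
  qed (fact f' g)+
  have q: "(\<integral>y. (f (Y i) y - f s0 y) / (Y i - s0) \<partial>M)
      = ((\<integral>y. f (Y i) y \<partial>M) - (\<integral>y. f s0 y \<partial>M)) / (Y i - s0)" for i
    using int[OF Y(3)[of i]] int0 by simp
  have "(\<lambda>i. ((\<integral>y. f (X (i + N)) y \<partial>M) - (\<integral>y. f s0 y \<partial>M)) / (X (i + N) - s0)) \<longlonglongrightarrow> (\<integral>y. f' y \<partial>M)"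
    using L unfolding q unfolding Y_def .
  then show "(\<lambda>i. ((\<integral>y. f (X i) y \<partial>M) - (\<integral>y. f s0 y \<partial>M)) / (X i - s0)) \<longlonglongrightarrow> (\<integral>y. f' y \<partial>M)"
    by (rule LIMSEQ_offset)
qed

lemma lborel_translate:
  fixes f :: "'a::euclidean_space \<Rightarrow> real"
  assumes f: "f \<in> borel_measurable borel"
  shows "(\<integral>x. f (c + x) \<partial>lborel) = (\<integral>x. f x \<partial>lborel)"
    and "integrable lborel (\<lambda>x. f (c + x)) \<longleftrightarrow> integrable lborel f"
proof -
  have "(\<integral>x. f x \<partial>lborel) = (\<integral>x. f x \<partial>distr lborel borel ((+) c))" by (simp add: lborel_distr_plus)
  then show "(\<integral>x. f (c + x) \<partial>lborel) = (\<integral>x. f x \<partial>lborel)" using f by (simp add: integral_distr)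
  have "integrable lborel f \<longleftrightarrow> integrable (distr lborel borel ((+) c)) f" by (simp add: lborel_distr_plus)
  then show "integrable lborel (\<lambda>x. f (c + x)) \<longleftrightarrow> integrable lborel f"
    using f by (simp add: integrable_distr_eq)
qed

text \<open>Integration by parts along a direction, as differentiation of the constant
  \<open>s \<mapsto> \<integral>\<phi>(y + s e) dy\<close>; this avoids slicing the space into lines.\<close>

lemma integral_directional_derivative_eq_0:
  fixes \<phi> \<psi> :: "'a::euclidean_space \<Rightarrow> real"
  assumes \<phi>: "\<phi> \<in> borel_measurable borel" "integrable lborel \<phi>" and \<psi>: "\<psi> \<in> borel_measurable borel"
    and deriv: "AE y in lborel. ((\<lambda>s. \<phi> (y + s *\<^sub>R e)) has_field_derivative \<psi> y) (at 0)"
    and bound: "\<And>s. \<bar>s\<bar> < 1 \<Longrightarrow> AE y in lborel. \<bar>\<phi> (y + s *\<^sub>R e) - \<phi> y\<bar> \<le> \<bar>s\<bar> * b y"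
    and b: "integrable lborel b"
  shows "(\<integral>y. \<psi> y \<partial>lborel) = 0"
proof -
  have int: "integrable lborel (\<lambda>y. \<phi> (y + s *\<^sub>R e))" for s
    using lborel_translate(2)[OF \<phi>(1), of "s *\<^sub>R e"] \<phi>(2) by (simp add: add.commute)
  have "((\<lambda>s. \<integral>y. \<phi> (y + s *\<^sub>R e) \<partial>lborel) has_field_derivative (\<integral>y. \<psi> y \<partial>lborel)) (at 0)"
    by (rule has_field_derivative_integral_dominated[where r=1 and g=b])
      (use int \<psi> deriv bound b in simp_all)
  moreover have "(\<integral>y. \<phi> (y + s *\<^sub>R e) \<partial>lborel) = (\<integral>y. \<phi> y \<partial>lborel)" for s
    using lborel_translate(1)[OF \<phi>(1), of "s *\<^sub>R e"] by (simp add: add.commute)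
  ultimately have "((\<lambda>s. \<integral>y. \<phi> y \<partial>lborel) has_field_derivative (\<integral>y. \<psi> y \<partial>lborel)) (at (0::real))"
    by simp
  from DERIV_unique[OF this DERIV_const] show ?thesis .
qed

lemma continuous_compact_support_bounded:
  fixes g :: "'a::euclidean_space \<Rightarrow> real"
  assumes "continuous_on UNIV g" "\<And>z. norm z > R \<Longrightarrow> g z = 0"
  obtains B where "B \<ge> 0" "\<And>z. \<bar>g z\<bar> \<le> B"
proof -
  have "compact (g ` cball 0 R)"
    by (intro compact_continuous_image continuous_on_subset[OF assms(1)]) auto
  from compact_imp_bounded[OF this] obtain B where "\<forall>y\<in>g ` cball 0 R. norm y \<le> B"
    unfolding bounded_iff by (elim exE)
  then have B: "norm (g z) \<le> B" if "z \<in> cball 0 R" for z using that by simp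
  have "\<bar>g z\<bar> \<le> max B 0" for z
    using B[of z] assms(2)[of z] by (cases "norm z \<le> R") auto
  then show thesis by (intro that[of "max B 0"]) auto
qed

lemma integrable_indicator_cball: "integrable lborel (indicat_real (cball (c::'a::euclidean_space) R))"
  using emeasure_bounded_finite[OF bounded_cball, of c R] by (intro integrable_real_indicator) simp_all

lemma integrable_continuous_compact_support:
  fixes g :: "'a::euclidean_space \<Rightarrow> real"
  assumes "continuous_on UNIV g" "\<And>z. norm z > R \<Longrightarrow> g z = 0"
  shows "integrable lborel g"
proof -
  obtain B where B: "B \<ge> 0" "\<And>z. \<bar>g z\<bar> \<le> B" using continuous_compact_support_bounded[OF assms] by metis
  show ?thesis
  proof (rule Bochner_Integration.integrable_bound[OF integrable_mult_right[OF integrable_indicator_cball[of 0 R], of B]])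
    show "g \<in> borel_measurable lborel" using assms(1) by (simp add: borel_measurable_continuous_onI)
    show "AE z in lborel. norm (g z) \<le> norm (B * indicat_real (cball 0 R) z)"
    proof (intro always_eventually allI)
      fix z show "norm (g z) \<le> norm (B * indicat_real (cball 0 R) z)"
        using B(1) B(2)[of z] assms(2)[of z] by (cases "norm z \<le> R") simp_all
    qed
  qed
qed

lemma integral_directional_derivative_compact:
  fixes \<phi> \<psi> :: "'a::euclidean_space \<Rightarrow> real"
  assumes cont: "continuous_on UNIV \<phi>" "continuous_on UNIV \<psi>"
    and deriv: "\<And>y s. ((\<lambda>s. \<phi> (y + s *\<^sub>R e)) has_field_derivative \<psi> (y + s *\<^sub>R e)) (at s)"
    and supp: "\<And>y. norm y > R \<Longrightarrow> \<phi> y = 0"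
  shows "(\<integral>y. \<psi> y \<partial>lborel) = 0"
proof -
  \<comment> \<open>Increments vanish for y outside the ball of radius R + |e|, and a point inside
    it moves by at most |e|; so \<psi> has to be bounded on radius R + 2 |e|.\<close>
  have "compact (\<psi> ` cball 0 (R + 2 * norm e))"
    by (intro compact_continuous_image continuous_on_subset[OF cont(2)]) auto
  from compact_imp_bounded[OF this] obtain B0 where "\<forall>y\<in>\<psi> ` cball 0 (R + 2 * norm e). norm y \<le> B0"
    unfolding bounded_iff by (elim exE)
  then have B0: "norm (\<psi> z) \<le> B0" if "z \<in> cball 0 (R + 2 * norm e)" for z using that by simp
  define B where "B = max B0 0"
  have B: "norm (\<psi> z) \<le> B" if "norm z \<le> R + 2 * norm e" for z using B0[of z] that by (simp add: B_def)
  show ?thesis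
  proof (rule integral_directional_derivative_eq_0[where e=e and \<phi>=\<phi> and b="\<lambda>y. B * indicat_real (cball 0 (R + norm e)) y"])
    show "AE y in lborel. ((\<lambda>s. \<phi> (y + s *\<^sub>R e)) has_field_derivative \<psi> y) (at 0)"
      using deriv[of _ 0] by simp
    fix s :: real assume s: "\<bar>s\<bar> < 1"
    have se: "norm (s *\<^sub>R e) \<le> norm e" using s mult_right_mono[of "\<bar>s\<bar>" 1 "norm e"] by simp
    have "\<bar>\<phi> (y + s *\<^sub>R e) - \<phi> y\<bar> \<le> \<bar>s\<bar> * (B * indicat_real (cball 0 (R + norm e)) y)" for y
    proof (cases "norm y \<le> R + norm e")
      case True
      have "norm ((\<lambda>s. \<phi> (y + s *\<^sub>R e)) s - (\<lambda>s. \<phi> (y + s *\<^sub>R e)) 0) \<le> B * norm (s - 0)"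
      proof (rule field_differentiable_bound[where S="{-1..1}" and f'="\<lambda>s. \<psi> (y + s *\<^sub>R e)"])
        fix z :: real assume z: "z \<in> {-1..1}"
        show "((\<lambda>s. \<phi> (y + s *\<^sub>R e)) has_field_derivative \<psi> (y + z *\<^sub>R e)) (at z within {-1..1})"
          by (rule has_field_derivative_at_within[OF deriv])
        have "norm (y + z *\<^sub>R e) \<le> norm y + \<bar>z\<bar> * norm e" using norm_triangle_ineq[of y "z *\<^sub>R e"] by simp
        also have "\<bar>z\<bar> * norm e \<le> 1 * norm e" using z by (intro mult_right_mono) auto
        finally show "norm (\<psi> (y + z *\<^sub>R e)) \<le> B" using True by (intro B) simp
      qed (use s in auto)
      then show ?thesis using True by (simp add: indicator_def mult.commute)
    next
      case False
      have "norm y \<le> norm (y + s *\<^sub>R e) + norm (s *\<^sub>R e)" using norm_triangle_ineq4[of "y + s *\<^sub>R e" "s *\<^sub>R e"] by simp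
      then have "norm (y + s *\<^sub>R e) > R" "norm y > R" using False se norm_ge_zero[of e] by linarith+
      then show ?thesis by (simp add: supp B_def)
    qed
    then show "AE y in lborel. \<bar>\<phi> (y + s *\<^sub>R e) - \<phi> y\<bar> \<le> \<bar>s\<bar> * (B * indicat_real (cball 0 (R + norm e)) y)"
      by simp
  qed (use cont integrable_continuous_compact_support[OF cont(1) supp] integrable_indicator_cball
      in \<open>auto intro!: borel_measurable_continuous_onI\<close>)
qed

lemma lipschitz_along_axis:
  fixes g g' :: "real \<times> (real ^ 'n) \<Rightarrow> real"
  assumes d: "\<And>t x s. ((\<lambda>s. g (t, x + s *\<^sub>R axis i 1)) has_field_derivative g' (t, x + s *\<^sub>R axis i 1)) (at s)"
    and B: "\<And>z. \<bar>g' z\<bar> \<le> B"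
  shows "\<bar>g (t, x + s *\<^sub>R axis i 1) - g (t, x + s' *\<^sub>R axis i 1)\<bar> \<le> B * \<bar>s - s'\<bar>"
proof -
  have "norm ((\<lambda>s. g (t, x + s *\<^sub>R axis i 1)) s - (\<lambda>s. g (t, x + s *\<^sub>R axis i 1)) s') \<le> B * norm (s - s')"
    by (rule field_differentiable_bound[where S=UNIV and f'="\<lambda>s. g' (t, x + s *\<^sub>R axis i 1)"])
      (use d B in auto)
  then show ?thesis by simp
qed

section \<open>Continuity and space derivatives of the solution\<close>

context primitive_coeff
begin

text \<open>The bound is uniform in t, so it serves as majorant when t itself varies, as in
  \<open>sol_continuous\<close>.\<close>

lemma kern_le_heat_kern:
  obtains C where "C \<ge> 0" "\<And>t z. kz t z \<le> C * heat_kern l z"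
proof -
  obtain C where C: "C \<ge> 0" "\<And>(M :: real ^ 'n ^ 'n) \<tau> x. \<tau> > 0 \<Longrightarrow> ell (l * \<tau>) (\<tau> / l) M \<Longrightarrow>
     gauss M x \<le> C * heat_bound l \<tau> x"
    using gauss_bounds[OF l_pos, where 'n='n] by metis
  have "kz t z \<le> C * heat_kern l z" for t z
  proof (cases "fst z > 0")
    case True
    have "ell (l * fst z) (fst z / l) (F t - F (t - fst z))" using ell_F[of "t - fst z" t] True by simp
    from C(2)[OF True this, of "snd z"]
    have "exp (- fst z) * gauss (F t - F (t - fst z)) (snd z) \<le> exp (- fst z) * (C * heat_bound l (fst z) (snd z))"
      by (intro mult_left_mono) auto
    then show ?thesis using True by (simp add: kern_eq heat_kern_def case_prod_beta mult_ac)
  qed (simp add: kern_eq C(1))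
  with C(1) show thesis by (rule that)
qed

lemma sol_eq:
  assumes "g \<in> borel_measurable borel"
  shows "sol a g p = (\<integral>z. kz (fst p) z * g (p - z) \<partial>lborel)"
  by (rule sol_eq_lborel(1)[OF assms]) simp

lemma integrable_kz_bounded:
  fixes h :: "real \<times> (real ^ 'n) \<Rightarrow> real"
  assumes [measurable]: "h \<in> borel_measurable borel" and B: "\<And>z. \<bar>h z\<bar> \<le> B"
  shows "integrable lborel (\<lambda>z. kz t z * h z)"
proof (rule Bochner_Integration.integrable_bound[OF integrable_mult_right[OF integrable_kern[of t], of B]])
  have "0 \<le> B" using B[of 0] by linarith
  then show "AE z in lborel. norm (kz t z * h z) \<le> norm (B * kz t z)"
    using B by (auto simp: abs_mult mult.commute intro!: mult_right_mono)
qed simp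

lemma sol_bounded:
  assumes g [measurable]: "g \<in> borel_measurable borel" and B: "\<And>z. \<bar>g z\<bar> \<le> B"
  shows "\<bar>sol a g p\<bar> \<le> B"
proof -
  have "\<bar>sol a g p\<bar> \<le> (\<integral>z. norm (kz (fst p) z * g (p - z)) \<partial>lborel)"
    unfolding sol_eq[OF g] real_norm_def[symmetric] by (rule integral_norm_bound)
  also have "\<dots> \<le> (\<integral>z. B * kz (fst p) z \<partial>lborel)"
  proof (rule integral_mono)
    show "integrable lborel (\<lambda>z. norm (kz (fst p) z * g (p - z)))"
      by (intro integrable_norm integrable_kz_bounded[of _ B]) (use B in auto)
    show "norm (kz (fst p) z * g (p - z)) \<le> B * kz (fst p) z" for z
      using B by (simp add: abs_mult mult.commute mult_right_mono)
  qed (simp add: integrable_kern)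
  also have "\<dots> = B" by (simp add: integral_kern)
  finally show ?thesis .
qed

lemma tendsto_kz: "((\<lambda>t. kz t z) \<longlongrightarrow> kz t0 z) (at t0)"
proof (cases "fst z > 0")
  case True
  have "((\<lambda>t. F (t - fst z)) \<longlongrightarrow> F (t0 - fst z)) (at t0)"
  proof -
    have "continuous_on UNIV (\<lambda>t. F (t - fst z))" by (intro continuous_intros)
    then show ?thesis by (simp add: continuous_on_def)
  qed
  then show ?thesis using True
    by (auto simp: kern_eq intro!: tendsto_intros tendsto_gauss tendsto_F posdef_F)
qed (simp add: kern_eq)

lemma sol_continuous:
  assumes cont: "continuous_on UNIV g" and B: "\<And>z. \<bar>g z\<bar> \<le> B"
  shows "continuous_on UNIV (sol a g)"
proof -
  have [measurable]: "g \<in> borel_measurable borel" using cont by (rule borel_measurable_continuous_onI)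
  obtain C where C: "C \<ge> 0" "\<And>t z. kz t z \<le> C * heat_kern l z" using kern_le_heat_kern by metis
  have B0: "0 \<le> B" using B[of 0] by linarith
  have "isCont (sol a g) p" for p
    unfolding continuous_at_sequentially comp_def
  proof (intro allI impI)
    fix X :: "nat \<Rightarrow> real \<times> (real ^ 'n)" assume X: "X \<longlonglongrightarrow> p"
    have "(\<lambda>i. \<integral>z. kz (fst (X i)) z * g (X i - z) \<partial>lborel) \<longlonglongrightarrow> (\<integral>z. kz (fst p) z * g (p - z) \<partial>lborel)"
    proof (rule integral_dominated_convergence[where w="\<lambda>z. (C * B) * heat_kern l z"])
      show "integrable lborel (\<lambda>z. (C * B) * heat_kern l z)"
        by (intro integrable_mult_right integrable_heat_kern l_pos)
      show "AE z in lborel. norm (kz (fst (X i)) z * g (X i - z)) \<le> (C * B) * heat_kern l z" for i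
      proof (intro always_eventually allI)
        fix z
        have "kz (fst (X i)) z * \<bar>g (X i - z)\<bar> \<le> (C * heat_kern l z) * B"
          by (intro mult_mono C B) (simp_all add: C)
        then show "norm (kz (fst (X i)) z * g (X i - z)) \<le> (C * B) * heat_kern l z"
          by (simp add: abs_mult mult_ac)
      qed
      show "AE z in lborel. (\<lambda>i. kz (fst (X i)) z * g (X i - z)) \<longlonglongrightarrow> kz (fst p) z * g (p - z)"
      proof (intro always_eventually allI tendsto_mult)
        fix z
        have "isCont (\<lambda>t. kz t z) (fst p)" using tendsto_kz by (simp add: isCont_def)
        then show "(\<lambda>i. kz (fst (X i)) z) \<longlonglongrightarrow> kz (fst p) z"
          by (rule isCont_tendsto_compose) (intro tendsto_intros X)
        have "isCont g (p - z)" using cont by (metis continuous_on_eq_continuous_at open_UNIV UNIV_I)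
        then show "(\<lambda>i. g (X i - z)) \<longlonglongrightarrow> g (p - z)"
          by (rule isCont_tendsto_compose) (intro tendsto_intros X)
      qed
    qed measurable
    then show "(\<lambda>i. sol a g (X i)) \<longlonglongrightarrow> sol a g p" by (simp add: sol_eq)
  qed
  then show ?thesis by (simp add: continuous_on_eq_continuous_at)
qed

text \<open>A shift in space acts on g alone, since the kernel depends on the base point through its
  time only; the Lipschitz bound of g along the axis gives the majorant.\<close>

lemma sol_has_derivative_axis:
  fixes g g' :: "real \<times> (real ^ 'n) \<Rightarrow> real"
  assumes cont: "continuous_on UNIV g" "continuous_on UNIV g'"
    and d: "\<And>t x s. ((\<lambda>s. g (t, x + s *\<^sub>R axis i 1)) has_field_derivative g' (t, x + s *\<^sub>R axis i 1)) (at s)"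
    and B: "\<And>z. \<bar>g z\<bar> \<le> B" "\<And>z. \<bar>g' z\<bar> \<le> B"
  shows "((\<lambda>s. sol a g (t, x + s *\<^sub>R axis i 1)) has_field_derivative sol a g' (t, x + s *\<^sub>R axis i 1)) (at s)"
proof -
  have [measurable]: "g \<in> borel_measurable borel" "g' \<in> borel_measurable borel"
    using cont by (auto intro: borel_measurable_continuous_onI)
  have sh: "(t, x + s *\<^sub>R axis i 1) - z = (t - fst z, (x - snd z) + s *\<^sub>R axis i 1)" for s z
    by (cases z) (simp add: algebra_simps)
  have "((\<lambda>s. \<integral>z. kz t z * g ((t, x + s *\<^sub>R axis i 1) - z) \<partial>lborel) has_field_derivative
      (\<integral>z. kz t z * g' ((t, x + s *\<^sub>R axis i 1) - z) \<partial>lborel)) (at s)"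
  proof (rule has_field_derivative_integral_dominated[where r=1 and g="\<lambda>z. B * kz t z"])
    show "integrable lborel (\<lambda>z. kz t z * g ((t, x + s *\<^sub>R axis i 1) - z))" for s
      by (rule integrable_kz_bounded[of _ B]) (use B in auto)
    show "AE z in lborel. ((\<lambda>s. kz t z * g ((t, x + s *\<^sub>R axis i 1) - z)) has_field_derivative
        kz t z * g' ((t, x + s *\<^sub>R axis i 1) - z)) (at s)"
      unfolding sh by (intro always_eventually allI DERIV_cmult d)
    fix s' :: real
    show "AE z in lborel. \<bar>kz t z * g ((t, x + s' *\<^sub>R axis i 1) - z) - kz t z * g ((t, x + s *\<^sub>R axis i 1) - z)\<bar>
        \<le> \<bar>s' - s\<bar> * (B * kz t z)"
    proof (intro always_eventually allI)
      fix z
      have "kz t z * \<bar>g ((t, x + s' *\<^sub>R axis i 1) - z) - g ((t, x + s *\<^sub>R axis i 1) - z)\<bar> \<le> kz t z * (B * \<bar>s' - s\<bar>)"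
        unfolding sh by (intro mult_left_mono lipschitz_along_axis[OF d] B) simp
      then show "\<bar>kz t z * g ((t, x + s' *\<^sub>R axis i 1) - z) - kz t z * g ((t, x + s *\<^sub>R axis i 1) - z)\<bar>
        \<le> \<bar>s' - s\<bar> * (B * kz t z)"
        by (simp add: abs_mult mult_ac flip: right_diff_distrib)
    qed
  qed (use integrable_kern in \<open>auto\<close>)
  then show ?thesis by (simp add: sol_eq)
qed

end

text \<open>The coordinate form of \<open>C2c\<close>, with one radius and one bound common to f and
  its space derivatives, so that the same lemmas on \<open>sol\<close> apply to each of
  them.\<close>

locale C2c_data =
  fixes f :: "real \<times> (real ^ 'n) \<Rightarrow> real"
    and fi :: "'n \<Rightarrow> real \<times> (real ^ 'n) \<Rightarrow> real"
    and fij :: "'n \<Rightarrow> 'n \<Rightarrow> real \<times> (real ^ 'n) \<Rightarrow> real" and R B :: real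
  assumes cont: "continuous_on UNIV f" "\<And>i. continuous_on UNIV (fi i)" "\<And>i j. continuous_on UNIV (fij i j)"
    and d1: "\<And>i t x s. ((\<lambda>s. f (t, x + s *\<^sub>R axis i 1)) has_field_derivative fi i (t, x + s *\<^sub>R axis i 1)) (at s)"
    and d2: "\<And>i j t x s. ((\<lambda>s. fi j (t, x + s *\<^sub>R axis i 1)) has_field_derivative fij i j (t, x + s *\<^sub>R axis i 1)) (at s)"
    and supp: "\<And>z. norm z > R \<Longrightarrow> f z = 0" "\<And>i z. norm z > R \<Longrightarrow> fi i z = 0" "\<And>i j z. norm z > R \<Longrightarrow> fij i j z = 0"
    and bnd: "\<And>z. \<bar>f z\<bar> \<le> B" "\<And>i z. \<bar>fi i z\<bar> \<le> B" "\<And>i j z. \<bar>fij i j z\<bar> \<le> B"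

lemma derivative_zero_outside:
  fixes g g' :: "real \<times> (real ^ 'n) \<Rightarrow> real"
  assumes d: "\<And>t x s. ((\<lambda>s. g (t, x + s *\<^sub>R axis i 1)) has_field_derivative g' (t, x + s *\<^sub>R axis i 1)) (at s)"
    and z: "\<And>z. norm z > R \<Longrightarrow> g z = 0" and "norm z0 > R"
  shows "g' z0 = 0"
proof -
  obtain t x where tx: "z0 = (t, x)" by (cases z0)
  have "open {s :: real. norm (t, x + s *\<^sub>R axis i (1::real)) > R}"
    by (intro open_Collect_less continuous_intros)
  moreover have "(0::real) \<in> {s. norm (t, x + s *\<^sub>R axis i (1::real)) > R}" using \<open>norm z0 > R\<close> tx by simp
  ultimately have "((\<lambda>s. 0) has_field_derivative g' (t, x + 0 *\<^sub>R axis i 1)) (at 0)"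
    by (rule has_field_derivative_transform_within_open[OF d]) (use z in auto)
  from DERIV_unique[OF this DERIV_const] show ?thesis by (simp add: tx)
qed

lemma C2c_dataI:
  fixes f :: "real \<times> (real ^ 'n) \<Rightarrow> real"
  assumes "C2c f"
  obtains fi fij R B where "C2c_data f fi fij R B"
proof -
  obtain f' :: "real \<times> (real ^ 'n) \<Rightarrow> (real \<times> (real ^ 'n)) \<Rightarrow>\<^sub>L real" and f''
    where f': "\<And>z. (f has_derivative blinfun_apply (f' z)) (at z)"
      and f'': "\<And>z. (f' has_derivative blinfun_apply (f'' z)) (at z)"
      and c'': "continuous_on UNIV f''" and comp: "compact (closure {z. f z \<noteq> 0})"
    using assms unfolding C2c_def by blast
  define e :: "'n \<Rightarrow> real \<times> (real ^ 'n)" where "e i = (0, axis i 1)" for i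
  define fi where "fi i z = f' z (e i)" for i z
  define fij where "fij i j z = f'' z (e i) (e j)" for i j z
  have c': "continuous_on UNIV f'"
    using f'' has_derivative_continuous by (fastforce simp: continuous_on_eq_continuous_at)
  have c: "continuous_on UNIV f"
    using f' has_derivative_continuous by (fastforce simp: continuous_on_eq_continuous_at)
  have line: "((\<lambda>s. (t, x + s *\<^sub>R axis i (1::real))) has_derivative (\<lambda>h. h *\<^sub>R e i)) (at s)" for t :: real and x :: "real ^ 'n" and i s
    unfolding e_def by (auto intro!: derivative_eq_intros simp: scaleR_prod_def)
  have d1: "((\<lambda>s. f (t, x + s *\<^sub>R axis i 1)) has_field_derivative fi i (t, x + s *\<^sub>R axis i 1)) (at s)" for i t x s
    using has_derivative_compose[OF line f'] unfolding has_field_derivative_def fi_def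
    by (rule has_derivative_eq_rhs) (simp add: fun_eq_iff blinfun.scaleR_right mult.commute)
  have d2: "((\<lambda>s. fi j (t, x + s *\<^sub>R axis i 1)) has_field_derivative fij i j (t, x + s *\<^sub>R axis i 1)) (at s)" for i j t x s
  proof -
    have "((\<lambda>s. f' (t, x + s *\<^sub>R axis i 1)) has_derivative (\<lambda>h. f'' (t, x + s *\<^sub>R axis i 1) (h *\<^sub>R e i))) (at s)"
      by (rule has_derivative_compose[OF line f''])
    then have "((\<lambda>s. f' (t, x + s *\<^sub>R axis i 1) (e j)) has_derivative (\<lambda>h. f'' (t, x + s *\<^sub>R axis i 1) (h *\<^sub>R e i) (e j))) (at s)"
      by (rule bounded_linear.has_derivative[OF blinfun.bounded_linear_left])
    then show ?thesis unfolding has_field_derivative_def fi_def fij_def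
      by (rule has_derivative_eq_rhs) (simp add: fun_eq_iff blinfun.scaleR_right blinfun.scaleR_left mult.commute)
  qed
  obtain R where "\<And>z. z \<in> closure {z. f z \<noteq> 0} \<Longrightarrow> norm z \<le> R"
    using compact_imp_bounded[OF comp] unfolding bounded_iff by blast
  then have s0: "f z = 0" if "norm z > R" for z
    using that closure_subset[of "{z. f z \<noteq> 0}"] by (meson mem_Collect_eq not_less subsetD)
  have s1: "fi i z = 0" if "norm z > R" for i z by (rule derivative_zero_outside[OF d1 s0 that])
  have s2: "fij i j z = 0" if "norm z > R" for i j z by (rule derivative_zero_outside[OF d2 s1 that])
  have ci: "continuous_on UNIV (fi i)" for i unfolding fi_def by (intro continuous_intros c')
  have cij: "continuous_on UNIV (fij i j)" for i j unfolding fij_def by (intro continuous_intros c'')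
  obtain B0 where B0: "\<And>z. \<bar>f z\<bar> \<le> B0" using continuous_compact_support_bounded[OF c s0] by metis
  have "\<exists>b. \<forall>z. \<bar>fi i z\<bar> \<le> b" for i using continuous_compact_support_bounded[OF ci s1] by metis
  then obtain B1 where B1: "\<And>i z. \<bar>fi i z\<bar> \<le> B1 i" by metis
  have "\<exists>b. \<forall>z. \<bar>fij i j z\<bar> \<le> b" for i j using continuous_compact_support_bounded[OF cij s2] by metis
  then obtain B2 where B2: "\<And>i j z. \<bar>fij i j z\<bar> \<le> B2 i j" by metis
  define Bm where "Bm = \<bar>B0\<bar> + (\<Sum>i\<in>UNIV. \<bar>B1 i\<bar>) + (\<Sum>i\<in>UNIV. \<Sum>j\<in>UNIV. \<bar>B2 i j\<bar>)"
  have p1: "\<bar>B1 i\<bar> \<le> (\<Sum>i\<in>UNIV. \<bar>B1 i\<bar>)" for i by (rule member_le_sum) auto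
  have p2: "\<bar>B2 i j\<bar> \<le> (\<Sum>i\<in>UNIV. \<Sum>j\<in>UNIV. \<bar>B2 i j\<bar>)" for i j
  proof -
    have "\<bar>B2 i j\<bar> \<le> (\<Sum>j\<in>UNIV. \<bar>B2 i j\<bar>)" by (rule member_le_sum) auto
    also have "\<dots> \<le> (\<Sum>i\<in>UNIV. \<Sum>j\<in>UNIV. \<bar>B2 i j\<bar>)" by (rule member_le_sum) (auto intro: sum_nonneg)
    finally show ?thesis .
  qed
  have nn: "0 \<le> (\<Sum>i\<in>UNIV. \<bar>B1 i\<bar>)" "0 \<le> (\<Sum>i\<in>UNIV. \<Sum>j\<in>UNIV. \<bar>B2 i j\<bar>)"
    by (auto intro!: sum_nonneg)
  have "C2c_data f fi fij R Bm"
  proof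
    show "\<bar>f z\<bar> \<le> Bm" for z using B0[of z] nn unfolding Bm_def by linarith
    show "\<bar>fi i z\<bar> \<le> Bm" for i z using B1[of i z] p1[of i] nn unfolding Bm_def by linarith
    show "\<bar>fij i j z\<bar> \<le> Bm" for i j z using B2[of i j z] p2[of i j] nn unfolding Bm_def by linarith
  qed (fact c ci cij d1 d2 s0 s1 s2)+
  then show thesis by (rule that)
qed

locale parabolic = primitive_coeff a F l K + C2c_data f fi fij R B
  for a F :: "real \<Rightarrow> real ^ 'n ^ 'n" and l K and f :: "real \<times> (real ^ 'n) \<Rightarrow> real" and fi fij R B
begin

lemma sol_f_partial:
  "has_partial i (\<lambda>z. sol a f (t, z)) x" "partial i (\<lambda>z. sol a f (t, z)) = (\<lambda>x. sol a (fi i) (t, x))"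
proof -
  have "((\<lambda>s. sol a f (t, x + s *\<^sub>R axis i 1)) has_field_derivative sol a (fi i) (t, x)) (at 0)" for x
    using sol_has_derivative_axis[OF cont(1) cont(2) d1 bnd(1) bnd(2), of t x i 0] by simp
  from partial_eqI[OF this] show "has_partial i (\<lambda>z. sol a f (t, z)) x"
    "partial i (\<lambda>z. sol a f (t, z)) = (\<lambda>x. sol a (fi i) (t, x))" by (auto intro: ext)
qed

lemma sol_f_partial2:
  "has_partial i (partial j (\<lambda>z. sol a f (t, z))) x"
  "partial i (partial j (\<lambda>z. sol a f (t, z))) = (\<lambda>x. sol a (fij i j) (t, x))"
  unfolding sol_f_partial(2)
proof -
  have "((\<lambda>s. sol a (fi j) (t, x + s *\<^sub>R axis i 1)) has_field_derivative sol a (fij i j) (t, x)) (at 0)" for x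
    using sol_has_derivative_axis[where g="fi j" and g'="fij i j" and i=i and t=t and x=x and s=0, OF cont(2) cont(3) d2 bnd(2) bnd(3)] by simp
  from partial_eqI[OF this] show "has_partial i (\<lambda>x. sol a (fi j) (t, x)) x"
    "partial i (\<lambda>x. sol a (fi j) (t, x)) = (\<lambda>x. sol a (fij i j) (t, x))" by (auto intro: ext)
qed

end

section \<open>Gaussian averages as functions of the covariance\<close>

lemma ell_mono: "ell \<alpha> \<beta> M \<Longrightarrow> \<alpha>' \<le> \<alpha> \<Longrightarrow> \<beta> \<le> \<beta>' \<Longrightarrow> ell \<alpha>' \<beta>' M"
  unfolding ell_def by (meson mult_right_mono order_trans zero_le_power2)

lemma gauss2_commute:
  assumes "posdef M"
  shows "gauss2 M i j = gauss2 M j i"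
proof -
  have "transpose (matrix_inv M) = matrix_inv M" using posdef_matrix_inv[OF assms] by (simp add: posdef_def)
  then have "matrix_inv M $ i $ j = matrix_inv M $ j $ i" by (simp add: transpose_def vec_eq_iff)
  then show ?thesis by (simp add: gauss2_def fun_eq_iff mult_ac)
qed

lemma continuous_on_gauss:
  assumes "posdef M"
  shows "continuous_on S (gauss M)" "continuous_on S (gauss1 M j)" "continuous_on S (gauss2 M i j)"
  using assms by (auto simp: continuous_on_def intro!: tendsto_gauss tendsto_gauss1 tendsto_gauss2 tendsto_ident_at)

lemma integrable_gauss_mult:
  fixes h :: "real ^ 'n \<Rightarrow> real"
  assumes M: "posdef M" and [measurable]: "h \<in> borel_measurable borel" and B: "\<And>y. \<bar>h y\<bar> \<le> B"
  shows "integrable lborel (\<lambda>y. gauss M y * h y)" and "\<bar>\<integral>y. gauss M y * h y \<partial>lborel\<bar> \<le> B"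
proof -
  have B0: "0 \<le> B" using B[of 0] by linarith
  have le: "norm (gauss M y * h y) \<le> B * gauss M y" for y
    using B by (simp add: abs_mult mult.commute mult_right_mono)
  show int: "integrable lborel (\<lambda>y. gauss M y * h y)"
    by (rule Bochner_Integration.integrable_bound[OF integrable_mult_right[OF integrable_gauss(1)[OF M], of B]])
      (use le B0 in \<open>auto simp: abs_mult\<close>)
  have "\<bar>\<integral>y. gauss M y * h y \<partial>lborel\<bar> \<le> (\<integral>y. norm (gauss M y * h y) \<partial>lborel)"
    unfolding real_norm_def[symmetric] by (rule integral_norm_bound)
  also have "\<dots> \<le> (\<integral>y. B * gauss M y \<partial>lborel)"
    by (rule integral_mono[OF integrable_norm[OF int] integrable_mult_right[OF integrable_gauss(1)[OF M]]]) (rule le)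
  also have "\<dots> = B" by (simp add: integral_gauss[OF M])
  finally show "\<bar>\<integral>y. gauss M y * h y \<partial>lborel\<bar> \<le> B" .
qed

lemma lborel_scale:
  fixes f :: "'a::euclidean_space \<Rightarrow> real"
  assumes [measurable]: "f \<in> borel_measurable borel" and c: "c > 0"
  shows "(\<integral>x. f (c *\<^sub>R x) \<partial>lborel) = (\<integral>x. f x \<partial>lborel) / c ^ DIM('a)"
proof -
  have "(\<integral>x. f x \<partial>lborel) = (\<integral>x. f x \<partial>density (distr lborel borel (\<lambda>x. 0 + c *\<^sub>R x)) (\<lambda>_. ennreal (\<bar>c\<bar> ^ DIM('a))))"
    using lborel_affine[of c "0 :: 'a"] c by simp
  also have "\<dots> = (\<integral>x. c ^ DIM('a) * f (c *\<^sub>R x) \<partial>lborel)"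
    using c by (subst integral_density) (simp_all add: integral_distr)
  finally show ?thesis using c by simp
qed

lemma lborel_integral_eq_cbox:
  fixes g :: "'a::euclidean_space \<Rightarrow> real"
  assumes "integrable lborel g" "\<And>y. y \<notin> cbox u v \<Longrightarrow> g y = 0"
  shows "(\<integral>y. g y \<partial>lborel) = integral (cbox u v) g"
proof -
  have "(\<integral>y. g y \<partial>lborel) = integral UNIV g" using integral_lborel[OF assms(1)] by simp
  also have "\<dots> = integral UNIV (\<lambda>y. if y \<in> cbox u v then g y else 0)"
    by (rule arg_cong[where f="integral UNIV"]) (use assms(2) in auto)
  also have "\<dots> = integral (cbox u v) g" by (rule integral_restrict_UNIV)
  finally show ?thesis .
qed

context C2c_data
begin

lemma B_nonneg: "0 \<le> B"
  using bnd(1)[of 0] by linarith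

lemma f_measurable [measurable]: "f \<in> borel_measurable borel" "fi i \<in> borel_measurable borel" "fij i j \<in> borel_measurable borel"
  using cont by (auto intro: borel_measurable_continuous_onI)

lemma slice_continuous:
  "continuous_on S (\<lambda>y. f (s, x - y))" "continuous_on S (\<lambda>y. fi i (s, x - y))" "continuous_on S (\<lambda>y. fij i j (s, x - y))"
  by (rule continuous_on_compose2[OF cont(1)] continuous_on_compose2[OF cont(2)] continuous_on_compose2[OF cont(3)];
      auto intro!: continuous_intros)+

lemma slice_supp:
  assumes "norm y > R + norm x"
  shows "f (s, x - y) = 0" "fi i (s, x - y) = 0" "fij i j (s, x - y) = 0"
proof -
  have "norm y - norm x \<le> norm (x - y)" by (metis norm_minus_commute norm_triangle_ineq2)
  also have "\<dots> \<le> norm (s, x - y)" by (simp add: norm_Pair real_le_rsqrt)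
  finally have "norm (s, x - y) > R" using assms by linarith
  then show "f (s, x - y) = 0" "fi i (s, x - y) = 0" "fij i j (s, x - y) = 0" using supp by auto
qed

lemma slice_derivative:
  "((\<lambda>\<sigma>. f (s, x - (y + \<sigma> *\<^sub>R axis i 1))) has_field_derivative - fi i (s, x - (y + \<sigma> *\<^sub>R axis i 1))) (at \<sigma>)"
  "((\<lambda>\<sigma>. fi j (s, x - (y + \<sigma> *\<^sub>R axis i 1))) has_field_derivative - fij i j (s, x - (y + \<sigma> *\<^sub>R axis i 1))) (at \<sigma>)"
  using DERIV_mirror[THEN iffD1, OF d1[of s "x - y" i "- \<sigma>"]] DERIV_mirror[THEN iffD1, OF d2[of j s "x - y" i "- \<sigma>"]]
  by (simp_all add: diff_diff_eq)

text \<open>Two integrations by parts; the products have compact support because f has, so there are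
  no boundary terms. The minus sign of each integration by parts cancels that of differentiating y
  \<mapsto> f(s, x - y).\<close>

lemma gauss_ibp:
  assumes M: "posdef M"
  shows "(\<integral>y. gauss2 M i j y * f (s, x - y) \<partial>lborel) = (\<integral>y. gauss M y * fij i j (s, x - y) \<partial>lborel)"
proof -
  note cg = continuous_on_gauss[OF M, of UNIV]
  note sc = slice_continuous[of UNIV]
  have i1: "(\<integral>y. gauss2 M j i y * f (s, x - y) + gauss1 M i y * (- fi j (s, x - y)) \<partial>lborel) = 0"
  proof (rule integral_directional_derivative_compact[where e="axis j 1" and R="R + norm x"])
    show "((\<lambda>\<sigma>. gauss1 M i (y + \<sigma> *\<^sub>R axis j 1) * f (s, x - (y + \<sigma> *\<^sub>R axis j 1))) has_field_derivative
      gauss2 M j i (y + \<sigma> *\<^sub>R axis j 1) * f (s, x - (y + \<sigma> *\<^sub>R axis j 1))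
       + gauss1 M i (y + \<sigma> *\<^sub>R axis j 1) * - fi j (s, x - (y + \<sigma> *\<^sub>R axis j 1))) (at \<sigma>)" for y \<sigma>
      by (rule DERIV_cong[OF DERIV_mult[OF gauss1_has_derivative_axis[OF M] slice_derivative(1)]]) (simp add: mult.commute)
  qed (use slice_supp in \<open>auto intro!: continuous_intros cg sc\<close>)
  have i2: "(\<integral>y. gauss1 M i y * fi j (s, x - y) + gauss M y * (- fij i j (s, x - y)) \<partial>lborel) = 0"
  proof (rule integral_directional_derivative_compact[where e="axis i 1" and R="R + norm x"])
    show "((\<lambda>\<sigma>. gauss M (y + \<sigma> *\<^sub>R axis i 1) * fi j (s, x - (y + \<sigma> *\<^sub>R axis i 1))) has_field_derivative
      gauss1 M i (y + \<sigma> *\<^sub>R axis i 1) * fi j (s, x - (y + \<sigma> *\<^sub>R axis i 1))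
       + gauss M (y + \<sigma> *\<^sub>R axis i 1) * - fij i j (s, x - (y + \<sigma> *\<^sub>R axis i 1))) (at \<sigma>)" for y \<sigma>
      by (rule DERIV_cong[OF DERIV_mult[OF gauss_has_derivative_axis[OF M] slice_derivative(2)]]) (simp add: mult.commute)
  qed (use slice_supp in \<open>auto intro!: continuous_intros cg sc\<close>)
  have int: "integrable lborel (\<lambda>y. gauss2 M j i y * f (s, x - y))" "integrable lborel (\<lambda>y. gauss1 M i y * fi j (s, x - y))"
    "integrable lborel (\<lambda>y. gauss M y * fij i j (s, x - y))"
    by (rule integrable_continuous_compact_support[where R="R + norm x"];
        use slice_supp in \<open>auto intro!: continuous_intros cg sc\<close>)+
  from i1 i2 show ?thesis using int by (simp add: gauss2_commute[OF M, of i j])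
qed

text \<open>The heat flow started from the slice of f at time s, after accumulated diffusion M;
  \<open>sol\<close> is the damped superposition of these over s
  (\<open>sol_slice_f\<close>).\<close>

definition gauss_mean :: "real ^ 'n ^ 'n \<Rightarrow> real \<Rightarrow> real ^ 'n \<Rightarrow> real" where
  "gauss_mean M s x = (\<integral>y. gauss M y * f (s, x - y) \<partial>lborel)"

definition gauss_mean2 :: "'n \<Rightarrow> 'n \<Rightarrow> real ^ 'n ^ 'n \<Rightarrow> real \<Rightarrow> real ^ 'n \<Rightarrow> real" where
  "gauss_mean2 i j M s x = (\<integral>y. gauss M y * fij i j (s, x - y) \<partial>lborel)"

lemma gauss_mean2_bound: "posdef M \<Longrightarrow> \<bar>gauss_mean2 i j M s x\<bar> \<le> B"
  unfolding gauss_mean2_def by (rule integrable_gauss_mult(2)) (use bnd in auto)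

lemma gauss_mean_bound: "posdef M \<Longrightarrow> \<bar>gauss_mean M s x\<bar> \<le> B"
  unfolding gauss_mean_def by (rule integrable_gauss_mult(2)) (use bnd in auto)

text \<open>Differentiation under the integral, followed by \<open>gauss_ibp\<close>. Moving the
  Hessian to f turns the singular quantity \<open>gauss2\<close> into an average of
  \<open>fij\<close>, bounded by B for every covariance.\<close>

lemma gauss_mean_line_derivative:
  fixes M0 H :: "real ^ 'n ^ 'n"
  assumes pd: "\<And>\<theta>. c < \<theta> \<Longrightarrow> \<theta> < d \<Longrightarrow> posdef (M0 + \<theta> *\<^sub>R H)" and \<theta>0: "c < \<theta>0" "\<theta>0 < d"
  shows "((\<lambda>\<theta>. gauss_mean (M0 + \<theta> *\<^sub>R H) s x) has_field_derivative
    (\<Sum>i\<in>UNIV. \<Sum>j\<in>UNIV. H $ i $ j * gauss_mean2 i j (M0 + \<theta>0 *\<^sub>R H) s x)) (at \<theta>0)"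
proof -
  let ?U = "{c<..<d}"
  let ?M = "\<lambda>\<theta>. M0 + \<theta> *\<^sub>R H"
  let ?D = "\<lambda>\<theta> y. (\<Sum>i\<in>UNIV. \<Sum>j\<in>UNIV. H $ i $ j * gauss2 (?M \<theta>) i j y) * f (s, x - y)"
  \<comment> \<open>A box, fixed for all \<theta>, outside which the integrand vanishes:
    differentiation then takes place over a compact domain.\<close>
  obtain v where v: "cball (0::real ^ 'n) (R + norm x) \<subseteq> cbox (- v) v"
    using bounded_subset_cbox_symmetric[OF bounded_cball] by metis
  have out: "f (s, x - y) = 0" if "y \<notin> cbox (- v) v" for y
    using that v slice_supp(1)[of x y s] by (meson mem_cball_0 not_less subsetD)
  have pd': "posdef (?M \<theta>)" if "\<theta> \<in> ?U" for \<theta> using pd that by auto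
  have i0: "integrable lborel (\<lambda>y. gauss (?M \<theta>) y * f (s, x - y))" if "\<theta> \<in> ?U" for \<theta>
    by (rule integrable_gauss_mult(1)[OF pd'[OF that]]) (use bnd in auto)
  have gauss_mean_cbox: "gauss_mean (?M \<theta>) s x = integral (cbox (- v) v) (\<lambda>y. gauss (?M \<theta>) y * f (s, x - y))" if "\<theta> \<in> ?U" for \<theta>
    unfolding gauss_mean_def by (rule lborel_integral_eq_cbox[OF i0[OF that]]) (simp add: out)
  have der: "((\<lambda>\<theta>. integral (cbox (- v) v) (\<lambda>y. gauss (?M \<theta>) y * f (s, x - y))) has_field_derivative
      integral (cbox (- v) v) (?D \<theta>0)) (at \<theta>0 within ?U)"
  proof (rule leibniz_rule_field_derivative)
    fix \<theta> y assume \<theta>: "\<theta> \<in> ?U"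
    have "((\<lambda>\<theta>. gauss (?M \<theta>) y) has_field_derivative (\<Sum>i\<in>UNIV. \<Sum>j\<in>UNIV. H $ i $ j * gauss2 (?M \<theta>) i j y)) (at \<theta>)"
    proof (rule gauss_has_derivative_param)
      show "((\<lambda>\<theta>. ?M \<theta> $ i $ j) has_field_derivative H $ i $ j) (at \<theta>)" for i j
        by (auto intro!: derivative_eq_intros)
      show "\<forall>\<^sub>F \<theta> in nhds \<theta>. posdef (?M \<theta>)"
        by (rule eventually_mono[OF eventually_nhds_in_open[of ?U]]) (use \<theta> pd' in auto)
    qed
    then show "((\<lambda>\<theta>. gauss (?M \<theta>) y * f (s, x - y)) has_field_derivative ?D \<theta> y) (at \<theta> within ?U)"
      by (rule has_field_derivative_at_within[OF DERIV_cmult_right])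
  next
    fix \<theta> assume \<theta>: "\<theta> \<in> ?U"
    show "(\<lambda>y. gauss (?M \<theta>) y * f (s, x - y)) integrable_on cbox (- v) v"
      by (intro integrable_continuous continuous_intros continuous_on_gauss pd'[OF \<theta>] slice_continuous)
  next
    have "continuous_on (?U \<times> cbox (- v) v) (\<lambda>z. gauss2 (?M (fst z)) i j (snd z))" for i j
      unfolding continuous_on_def
      by (intro ballI tendsto_gauss2 tendsto_intros) (auto intro: pd')
    moreover have "continuous_on (?U \<times> cbox (- v) v) (\<lambda>z. f (s, x - snd z))"
      by (rule continuous_on_compose2[OF cont(1)]) (auto intro!: continuous_intros)
    ultimately show "continuous_on (?U \<times> cbox (- v) v) (\<lambda>(\<theta>, y). ?D \<theta> y)"
      unfolding case_prod_beta by (intro continuous_intros)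
  qed (use \<theta>0 in auto)
  have p0: "posdef (?M \<theta>0)" using pd \<theta>0 by auto
  have i2: "integrable lborel (\<lambda>y. gauss2 (?M \<theta>0) i j y * f (s, x - y))" for i j
    by (rule integrable_continuous_compact_support[where R="R + norm x"])
      (use slice_supp in \<open>auto intro!: continuous_intros continuous_on_gauss p0 slice_continuous\<close>)
  have "integral (cbox (- v) v) (?D \<theta>0) = (\<integral>y. ?D \<theta>0 y \<partial>lborel)"
  proof (rule lborel_integral_eq_cbox[symmetric])
    have "integrable lborel (\<lambda>y. \<Sum>i\<in>UNIV. \<Sum>j\<in>UNIV. H $ i $ j * (gauss2 (?M \<theta>0) i j y * f (s, x - y)))"
      by (intro Bochner_Integration.integrable_sum integrable_mult_right i2)
    then show "integrable lborel (?D \<theta>0)" by (simp add: sum_distrib_right mult.assoc)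
  qed (simp add: out)
  also have "\<dots> = (\<integral>y. (\<Sum>i\<in>UNIV. \<Sum>j\<in>UNIV. H $ i $ j * (gauss2 (?M \<theta>0) i j y * f (s, x - y))) \<partial>lborel)"
    by (simp add: sum_distrib_right mult.assoc)
  also have "\<dots> = (\<Sum>i\<in>UNIV. \<Sum>j\<in>UNIV. H $ i $ j * gauss_mean2 i j (?M \<theta>0) s x)"
    using i2 by (simp add: Bochner_Integration.integral_sum Bochner_Integration.integrable_sum gauss_ibp[OF p0] gauss_mean2_def)
  finally have val: "integral (cbox (- v) v) (?D \<theta>0) = (\<Sum>i\<in>UNIV. \<Sum>j\<in>UNIV. H $ i $ j * gauss_mean2 i j (?M \<theta>0) s x)" .
  have der': "((\<lambda>\<theta>. integral (cbox (- v) v) (\<lambda>y. gauss (?M \<theta>) y * f (s, x - y))) has_field_derivative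
      (\<Sum>i\<in>UNIV. \<Sum>j\<in>UNIV. H $ i $ j * gauss_mean2 i j (?M \<theta>0) s x)) (at \<theta>0)"
    using der \<theta>0 unfolding val by (simp add: at_within_open[of \<theta>0 ?U])
  show ?thesis
    by (rule has_field_derivative_transform_within_open[OF der', of ?U]) (use \<theta>0 gauss_mean_cbox in auto)
qed

text \<open>Mean value theorem along the segment from M0 to M1. The numbers \<alpha> and \<beta>
  ensure that the segment stays positive definite but do not enter the constant, so the estimate
  persists as the matrices shrink to zero.\<close>

lemma gauss_mean_lipschitz:
  fixes M0 M1 :: "real ^ 'n ^ 'n"
  assumes M0: "ell \<alpha> \<beta> M0" and M1: "ell \<alpha> \<beta> M1" and \<alpha>: "\<alpha> > 0"
  shows "\<bar>gauss_mean M1 s x - gauss_mean M0 s x\<bar> \<le> B * (\<Sum>i\<in>UNIV. \<Sum>j\<in>UNIV. \<bar>M1 $ i $ j - M0 $ i $ j\<bar>)"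
proof -
  let ?H = "M1 - M0"
  define \<gamma> where "\<gamma> = \<bar>\<beta>\<bar> + 1"
  have \<gamma>: "\<gamma> > 0" "\<beta> \<le> \<gamma>" by (auto simp: \<gamma>_def)
  \<comment> \<open>The derivative formula is stated on an open interval, so positivity is required
    slightly beyond [0, 1]. Leaving the segment by \<delta> changes the quadratic form by at most
    \<delta> \<gamma> |x|^2 = \<alpha> |x|^2 / 2.\<close>
  define \<delta> where "\<delta> = \<alpha> / (2 * \<gamma>)"
  have \<delta>: "\<delta> > 0" using \<alpha> \<gamma> by (simp add: \<delta>_def)
  have pd: "posdef (M0 + \<theta> *\<^sub>R ?H)" if \<theta>: "- \<delta> < \<theta>" "\<theta> < 1 + \<delta>" for \<theta>
    unfolding posdef_def
  proof (intro conjI allI impI)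
    show "transpose (M0 + \<theta> *\<^sub>R ?H) = M0 + \<theta> *\<^sub>R ?H"
      using M0 M1 by (simp add: ell_def transpose_def vec_eq_iff)
    fix x :: "real ^ 'n" assume "x \<noteq> 0"
    then have N: "(norm x)\<^sup>2 > 0" by simp
    define p where "p = (M0 *v x) \<bullet> x"
    define q where "q = (M1 *v x) \<bullet> x"
    have pq: "\<alpha> * (norm x)\<^sup>2 \<le> p" "p \<le> \<beta> * (norm x)\<^sup>2" "\<alpha> * (norm x)\<^sup>2 \<le> q" "q \<le> \<beta> * (norm x)\<^sup>2"
      using M0 M1 by (auto simp: ell_def p_def q_def)
    have aN: "\<alpha> * (norm x)\<^sup>2 > 0" using \<alpha> N by simp
    have bN: "\<beta> * (norm x)\<^sup>2 \<le> \<gamma> * (norm x)\<^sup>2" using \<gamma> by (intro mult_right_mono) auto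
    have gd: "\<delta> * (\<gamma> * (norm x)\<^sup>2) = \<alpha> * (norm x)\<^sup>2 / 2" using \<gamma> by (simp add: \<delta>_def)
    have eq: "((M0 + \<theta> *\<^sub>R ?H) *v x) \<bullet> x = (1 - \<theta>) * p + \<theta> * q"
      by (simp add: p_def q_def matrix_vector_mult_add_rdistrib scaleR_matrix_vector_assoc[symmetric]
          matrix_vector_mult_diff_rdistrib inner_add_left inner_diff_left algebra_simps)
    consider "\<theta> < 0" | "0 \<le> \<theta>" "\<theta> \<le> 1" | "1 < \<theta>" by linarith
    then have "(1 - \<theta>) * p + \<theta> * q > 0"
    proof cases
      case 1
      have "(- \<theta>) * (q - p) \<le> (- \<theta>) * (\<gamma> * (norm x)\<^sup>2)"
        using 1 pq aN bN by (intro mult_left_mono) linarith+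
      also have "\<dots> \<le> \<delta> * (\<gamma> * (norm x)\<^sup>2)"
        using 1 \<theta> \<gamma> by (intro mult_right_mono) auto
      finally have "(- \<theta>) * (q - p) \<le> \<delta> * (\<gamma> * (norm x)\<^sup>2)" .
      then show ?thesis using pq aN gd by (simp add: algebra_simps)
    next
      case 2
      have "(1 - \<theta>) * (\<alpha> * (norm x)\<^sup>2) + \<theta> * (\<alpha> * (norm x)\<^sup>2) \<le> (1 - \<theta>) * p + \<theta> * q"
        using 2 pq by (intro add_mono mult_left_mono) auto
      then show ?thesis using aN by (simp add: algebra_simps)
    next
      case 3
      have "(\<theta> - 1) * (p - q) \<le> (\<theta> - 1) * (\<gamma> * (norm x)\<^sup>2)"
        using 3 pq aN bN by (intro mult_left_mono) linarith+
      also have "\<dots> \<le> \<delta> * (\<gamma> * (norm x)\<^sup>2)"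
        using 3 \<theta> \<gamma> by (intro mult_right_mono) auto
      finally have "(\<theta> - 1) * (p - q) \<le> \<delta> * (\<gamma> * (norm x)\<^sup>2)" .
      then show ?thesis using pq aN gd by (simp add: algebra_simps)
    qed
    then show "0 < ((M0 + \<theta> *\<^sub>R ?H) *v x) \<bullet> x" by (simp add: eq)
  qed
  let ?S = "\<Sum>i\<in>UNIV. \<Sum>j\<in>UNIV. \<bar>?H $ i $ j\<bar>"
  have "norm ((\<lambda>\<theta>. gauss_mean (M0 + \<theta> *\<^sub>R ?H) s x) 1 - (\<lambda>\<theta>. gauss_mean (M0 + \<theta> *\<^sub>R ?H) s x) 0) \<le> (B * ?S) * norm (1 - 0 :: real)"
  proof (rule field_differentiable_bound[where S="{0..1}"])
    fix \<theta> :: real assume \<theta>: "\<theta> \<in> {0..1}"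
    have \<theta>': "- \<delta> < \<theta>" "\<theta> < 1 + \<delta>" using \<theta> \<delta> by auto
    show "((\<lambda>\<theta>. gauss_mean (M0 + \<theta> *\<^sub>R ?H) s x) has_field_derivative
      (\<Sum>i\<in>UNIV. \<Sum>j\<in>UNIV. ?H $ i $ j * gauss_mean2 i j (M0 + \<theta> *\<^sub>R ?H) s x)) (at \<theta> within {0..1})"
      by (rule has_field_derivative_at_within[OF gauss_mean_line_derivative[OF pd \<theta>']])
    have "norm (\<Sum>i\<in>UNIV. \<Sum>j\<in>UNIV. ?H $ i $ j * gauss_mean2 i j (M0 + \<theta> *\<^sub>R ?H) s x)
      \<le> (\<Sum>i\<in>UNIV. norm (\<Sum>j\<in>UNIV. ?H $ i $ j * gauss_mean2 i j (M0 + \<theta> *\<^sub>R ?H) s x))" by (rule norm_sum)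
    also have "\<dots> \<le> (\<Sum>i\<in>UNIV. \<Sum>j\<in>UNIV. norm (?H $ i $ j * gauss_mean2 i j (M0 + \<theta> *\<^sub>R ?H) s x))"
      by (intro sum_mono norm_sum)
    also have "\<dots> \<le> (\<Sum>i\<in>UNIV. \<Sum>j\<in>UNIV. B * \<bar>?H $ i $ j\<bar>)"
    proof (intro sum_mono)
      fix i j
      have "\<bar>?H $ i $ j\<bar> * \<bar>gauss_mean2 i j (M0 + \<theta> *\<^sub>R ?H) s x\<bar> \<le> \<bar>?H $ i $ j\<bar> * B"
        by (intro mult_left_mono gauss_mean2_bound pd \<theta>') simp
      then show "norm (?H $ i $ j * gauss_mean2 i j (M0 + \<theta> *\<^sub>R ?H) s x) \<le> B * \<bar>?H $ i $ j\<bar>"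
        by (simp add: abs_mult mult.commute)
    qed
    also have "\<dots> = B * ?S" by (simp add: sum_distrib_left)
    finally show "norm (\<Sum>i\<in>UNIV. \<Sum>j\<in>UNIV. ?H $ i $ j * gauss_mean2 i j (M0 + \<theta> *\<^sub>R ?H) s x) \<le> B * ?S" .
  qed auto
  then show ?thesis by simp
qed

text \<open>Approximate identity: rescaling y by \<epsilon> makes the Gaussian fixed and puts
  \<epsilon> into the argument of f, where continuity and the bound B allow dominated
  convergence.\<close>

lemma gauss_mean_small_limit:
  assumes M: "posdef M"
  shows "(\<lambda>k. gauss_mean ((1 / real (Suc k))\<^sup>2 *\<^sub>R M) s x) \<longlonglongrightarrow> f (s, x)"
proof -
  let ?\<epsilon> = "\<lambda>k. 1 / real (Suc k)"
  have eq: "gauss_mean ((?\<epsilon> k)\<^sup>2 *\<^sub>R M) s x = (\<integral>y. gauss M y * f (s, x - ?\<epsilon> k *\<^sub>R y) \<partial>lborel)" for k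
  proof -
    have e: "?\<epsilon> k > 0" by simp
    have "(\<integral>y. gauss M y * f (s, x - ?\<epsilon> k *\<^sub>R y) \<partial>lborel)
      = (\<integral>y. (?\<epsilon> k) ^ CARD('n) * (gauss ((?\<epsilon> k)\<^sup>2 *\<^sub>R M) (?\<epsilon> k *\<^sub>R y) * f (s, x - ?\<epsilon> k *\<^sub>R y)) \<partial>lborel)"
      unfolding gauss_scale(1)[OF M e] using e by (intro Bochner_Integration.integral_cong) auto
    also have "\<dots> = (?\<epsilon> k) ^ CARD('n) * (\<integral>y. gauss ((?\<epsilon> k)\<^sup>2 *\<^sub>R M) (?\<epsilon> k *\<^sub>R y) * f (s, x - ?\<epsilon> k *\<^sub>R y) \<partial>lborel)"
      by simp
    also have "\<dots> = gauss_mean ((?\<epsilon> k)\<^sup>2 *\<^sub>R M) s x"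
      using e by (subst lborel_scale[OF _ e, where f="\<lambda>y. gauss ((?\<epsilon> k)\<^sup>2 *\<^sub>R M) y * f (s, x - y)"])
        (simp_all add: gauss_mean_def del: of_nat_Suc)
    finally show ?thesis by simp
  qed
  have "(\<lambda>k. \<integral>y. gauss M y * f (s, x - ?\<epsilon> k *\<^sub>R y) \<partial>lborel) \<longlonglongrightarrow> (\<integral>y. gauss M y * f (s, x) \<partial>lborel)"
  proof (rule integral_dominated_convergence[where w="\<lambda>y. B * gauss M y"])
    show "AE y in lborel. (\<lambda>k. gauss M y * f (s, x - ?\<epsilon> k *\<^sub>R y)) \<longlonglongrightarrow> gauss M y * f (s, x)"
    proof (intro always_eventually allI tendsto_mult tendsto_const)
      fix y
      have "?\<epsilon> \<longlonglongrightarrow> 0" by (rule LIMSEQ_Suc[OF lim_1_over_n])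
      then have "(\<lambda>k. (s, x - ?\<epsilon> k *\<^sub>R y)) \<longlonglongrightarrow> (s, x - 0 *\<^sub>R y)" by (intro tendsto_intros)
      then have lim: "(\<lambda>k. (s, x - ?\<epsilon> k *\<^sub>R y)) \<longlonglongrightarrow> (s, x)" by simp
      have "isCont f (s, x)" using cont(1) by (metis continuous_on_eq_continuous_at open_UNIV UNIV_I)
      then show "(\<lambda>k. f (s, x - ?\<epsilon> k *\<^sub>R y)) \<longlonglongrightarrow> f (s, x)" by (rule isCont_tendsto_compose[OF _ lim])
    qed
    show "AE y in lborel. norm (gauss M y * f (s, x - ?\<epsilon> k *\<^sub>R y)) \<le> B * gauss M y" for k
    proof (intro always_eventually allI)
      fix y show "norm (gauss M y * f (s, x - ?\<epsilon> k *\<^sub>R y)) \<le> B * gauss M y"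
        using mult_right_mono[OF bnd(1)[of "(s, x - ?\<epsilon> k *\<^sub>R y)"] gauss_nonneg[of M y]]
        by (simp add: abs_mult mult.commute)
    qed
  qed (use integrable_gauss[OF M] in auto)
  then show ?thesis unfolding eq by (simp add: integral_gauss[OF M])
qed

end

lemma lborel_integral_reflect:
  fixes f :: "'a::euclidean_space \<Rightarrow> real"
  assumes "integrable lborel f"
  shows "(\<integral>x. f (c - x) \<partial>lborel) = (\<integral>x. f x \<partial>lborel)" and "integrable lborel (\<lambda>x. f (c - x))"
proof -
  have [measurable]: "f \<in> borel_measurable borel" using assms by (simp add: borel_measurable_integrable)
  have "integral\<^sup>L lborel f = integral\<^sup>L (distr lborel borel (\<lambda>x. c - x)) f" by (simp add: distr_lborel_reflect)
  then show "(\<integral>x. f (c - x) \<partial>lborel) = (\<integral>x. f x \<partial>lborel)" by (simp add: integral_distr)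
  have "integrable (distr lborel borel (\<lambda>x. c - x)) f" using assms by (simp add: distr_lborel_reflect)
  then show "integrable lborel (\<lambda>x. f (c - x))" by (simp add: integrable_distr_eq)
qed

lemma abs_exp_diff_le:
  assumes "a \<le> 0" "b \<le> (0::real)"
  shows "\<bar>exp a - exp b\<bar> \<le> \<bar>a - b\<bar>"
proof -
  have "norm (exp a - exp b) \<le> 1 * norm (a - b)"
    by (rule field_differentiable_bound[where S="{..0}" and f'=exp])
      (use assms in \<open>auto intro!: has_field_derivative_at_within[OF DERIV_exp]\<close>)
  then show ?thesis by simp
qed

lemma ell_scaleR: "ell \<alpha> \<beta> M \<Longrightarrow> c \<ge> 0 \<Longrightarrow> ell (c * \<alpha>) (c * \<beta>) (c *\<^sub>R M)"
  by (auto simp: ell_def scaleR_matrix_vector_assoc[symmetric] transpose_def vec_eq_iff mult.assoc intro: mult_left_mono)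

section \<open>Differentiation in time\<close>

context primitive_coeff
begin

text \<open>Duhamel's form. With s = t - \<tau> the slice of g no longer moves with t, which then
  enters only through the range s < t, the damping and the covariance.\<close>

lemma sol_slice:
  fixes x :: "real ^ 'n"
  assumes g [measurable]: "g \<in> borel_measurable borel" and B: "\<And>z. \<bar>g z\<bar> \<le> B"
  defines "h \<equiv> \<lambda>t s. if s < t then exp (s - t) * (\<integral>y. gauss (F t - F s) y * g (s, x - y) \<partial>lborel) else 0"
  shows "sol a g (t, x) = (\<integral>s. h t s \<partial>lborel)" "integrable lborel (h t)"
proof -
  let ?k = "\<lambda>z. kz t z * g ((t, x) - z)"
  have int: "integrable lborel ?k" by (rule integrable_kz_bounded[of _ B]) (use B in auto)
  then have int': "integrable (lborel \<Otimes>\<^sub>M lborel) ?k" by (simp add: lborel_prod)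
  have "(\<integral>y. ?k (\<tau>, y) \<partial>lborel) = h t (t - \<tau>)" for \<tau>
    by (simp add: h_def kern_eq mult.assoc)
  then have h1: "integrable lborel (\<lambda>\<tau>. h t (t - \<tau>))" "(\<integral>\<tau>. h t (t - \<tau>) \<partial>lborel) = integral\<^sup>L lborel ?k"
    using lborel_pair.integrable_fst'[OF int'] lborel_pair.integral_fst'[OF int'] by (simp_all add: lborel_prod)
  show "integrable lborel (h t)" using lborel_integral_reflect(2)[OF h1(1), of t] by simp
  have "sol a g (t, x) = integral\<^sup>L lborel ?k" by (simp add: sol_eq)
  also have "\<dots> = (\<integral>s. h t s \<partial>lborel)"
    using lborel_integral_reflect(1)[OF h1(1), of t] h1(2) by simp
  finally show "sol a g (t, x) = (\<integral>s. h t s \<partial>lborel)" .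
qed

text \<open>The times at which the equation and the limit formulas are proved. The condition
  involves neither x nor f, so a single null set is discarded for all of them.\<close>

definition good_time :: "real \<Rightarrow> bool" where
  "good_time t \<longleftrightarrow> (\<forall>i j. ((\<lambda>s. F s $ i $ j) has_field_derivative a t $ i $ j) (at t)) \<and> ell l (1 / l) (a t)"

lemma AE_good_time: "AE t in lebesgue. good_time t"
  using AE_F_derivative by (simp add: good_time_def)

end

context parabolic
begin

text \<open>Lipschitz constant of the averages in t: the bound B of
  \<open>gauss_mean_lipschitz\<close> times the n^2 entries of F, each Lipschitz with constant
  K.\<close>

definition gauss_mean_const :: real where
  "gauss_mean_const = B * (real CARD('n) * (real CARD('n) * K))"

lemma gauss_mean_const_nonneg: "0 \<le> gauss_mean_const"
  using B_nonneg K_nonneg by (simp add: gauss_mean_const_def)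

lemma sum_F_increment_le: "B * (\<Sum>i\<in>UNIV. \<Sum>j\<in>UNIV. \<bar>F t $ i $ j - F s $ i $ j\<bar>) \<le> gauss_mean_const * \<bar>t - s\<bar>"
proof -
  have "(\<Sum>i\<in>UNIV. \<Sum>j\<in>UNIV. \<bar>F t $ i $ j - F s $ i $ j\<bar>) \<le> (\<Sum>i\<in>(UNIV::'n set). \<Sum>j\<in>(UNIV::'n set). K * \<bar>t - s\<bar>)"
    by (intro sum_mono F_lipschitz)
  also have "\<dots> = real CARD('n) * (real CARD('n) * K) * \<bar>t - s\<bar>" by simp
  finally show ?thesis
    using mult_left_mono[OF _ B_nonneg] by (fastforce simp: gauss_mean_const_def mult.assoc)
qed

lemma gauss_mean_F_lipschitz:
  assumes "s < t" "s < t'"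
  shows "\<bar>gauss_mean (F t' - F s) s x - gauss_mean (F t - F s) s x\<bar> \<le> gauss_mean_const * \<bar>t' - t\<bar>"
proof -
  let ?\<alpha> = "l * min (t - s) (t' - s)" and ?\<beta> = "max (t - s) (t' - s) / l"
  have e: "ell ?\<alpha> ?\<beta> (F t - F s)" "ell ?\<alpha> ?\<beta> (F t' - F s)"
    using l_pos by (auto intro!: ell_mono[OF ell_F] assms mult_left_mono divide_right_mono)
  have "?\<alpha> > 0" using l_pos assms by simp
  from gauss_mean_lipschitz[OF e this, of s x] show ?thesis using sum_F_increment_le[of t' t] by simp
qed

text \<open>The initial value is reached through the covariances \<epsilon>^2 M with \<epsilon> = 1
  / (k + 1): the Lipschitz constant does not depend on \<epsilon>, so the estimate passes to the
  limit of \<open>gauss_mean_small_limit\<close>.\<close>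

lemma gauss_mean_F_initial:
  assumes "s < t"
  shows "\<bar>gauss_mean (F t - F s) s x - f (s, x)\<bar> \<le> gauss_mean_const * (t - s)"
proof -
  let ?M = "F t - F s" and ?c = "\<lambda>k. (1 / real (Suc k))\<^sup>2"
  have M: "ell (l * (t - s)) ((t - s) / l) ?M" by (rule ell_F[OF assms])
  have \<alpha>: "l * (t - s) > 0" using l_pos assms by simp
  have lim: "(\<lambda>k. \<bar>gauss_mean ?M s x - gauss_mean (?c k *\<^sub>R ?M) s x\<bar>) \<longlonglongrightarrow> \<bar>gauss_mean ?M s x - f (s, x)\<bar>"
    by (intro tendsto_intros gauss_mean_small_limit posdef_F assms)
  have le: "\<bar>gauss_mean ?M s x - gauss_mean (?c k *\<^sub>R ?M) s x\<bar> \<le> gauss_mean_const * (t - s)" for k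
  proof -
    have c: "0 < ?c k" "?c k \<le> 1" by (simp_all add: power_le_one)
    have "ell (?c k * (l * (t - s))) ((t - s) / l) ?M"
    proof (rule ell_mono[OF M])
      show "?c k * (l * (t - s)) \<le> l * (t - s)" by (rule mult_left_le_one_le) (use c \<alpha> in linarith)+
    qed simp
    moreover have "ell (?c k * (l * (t - s))) ((t - s) / l) (?c k *\<^sub>R ?M)"
    proof (rule ell_mono[OF ell_scaleR[OF M]])
      show "?c k * ((t - s) / l) \<le> (t - s) / l"
        using c l_pos assms by (intro mult_left_le_one_le) auto
    qed (use c in auto)
    moreover have "?c k * (l * (t - s)) > 0" using c(1) \<alpha> by (rule mult_pos_pos)
    ultimately have "\<bar>gauss_mean ?M s x - gauss_mean (?c k *\<^sub>R ?M) s x\<bar> \<le> B * (\<Sum>i\<in>UNIV. \<Sum>j\<in>UNIV. \<bar>?M $ i $ j - (?c k *\<^sub>R ?M) $ i $ j\<bar>)"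
      by (intro gauss_mean_lipschitz)
    also have "\<dots> \<le> B * (\<Sum>i\<in>UNIV. \<Sum>j\<in>UNIV. \<bar>F t $ i $ j - F s $ i $ j\<bar>)"
    proof (intro mult_left_mono B_nonneg sum_mono)
      fix i j
      have "?M $ i $ j - (?c k *\<^sub>R ?M) $ i $ j = (1 - ?c k) * (F t $ i $ j - F s $ i $ j)"
        by (simp add: algebra_simps del: of_nat_Suc power_divide)
      then have "\<bar>?M $ i $ j - (?c k *\<^sub>R ?M) $ i $ j\<bar> = (1 - ?c k) * \<bar>F t $ i $ j - F s $ i $ j\<bar>"
        using c by (simp only: abs_mult abs_of_nonneg diff_ge_0_iff_ge)
      also have "\<dots> \<le> 1 * \<bar>F t $ i $ j - F s $ i $ j\<bar>" using c by (intro mult_right_mono) auto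
      finally show "\<bar>?M $ i $ j - (?c k *\<^sub>R ?M) $ i $ j\<bar> \<le> \<bar>F t $ i $ j - F s $ i $ j\<bar>" by simp
    qed
    also have "\<dots> \<le> gauss_mean_const * (t - s)" using sum_F_increment_le[of t s] assms by simp
    finally show ?thesis .
  qed
  show ?thesis by (rule LIMSEQ_le_const2[OF lim]) (use le in auto)
qed

text \<open>Derivatives of \<open>gauss_mean\<close> are known along straight lines of matrices
  only. The curve h \<mapsto> F(t + h) - F s is therefore compared with its tangent line
  \<open>?M + h *\<^sub>R a t\<close>: by the uniform Lipschitz bound the error divided by h is
  controlled by the difference quotients of F minus a(t), which tend to zero.\<close>

lemma gauss_mean_F_derivative:
  assumes t: "good_time t" and s: "s < t"
  shows "((\<lambda>t. gauss_mean (F t - F s) s x) has_field_derivative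
    (\<Sum>i\<in>UNIV. \<Sum>j\<in>UNIV. a t $ i $ j * gauss_mean2 i j (F t - F s) s x)) (at t)"
proof -
  let ?M = "F t - F s" and ?L = "\<Sum>i\<in>UNIV. \<Sum>j\<in>UNIV. a t $ i $ j * gauss_mean2 i j (F t - F s) s x"
  define \<alpha> where "\<alpha> = l * (t - s) / 2"
  define \<beta> where "\<beta> = 2 * (t - s) / l"
  \<comment> \<open>The first entry keeps t + h well after s and serves the upper bounds; with the
    second, h a(t), whose form is at most |h| / l, uses up at most half of the lower bound l (t -
    s).\<close>
  define \<delta> where "\<delta> = min ((t - s) / 2) (l\<^sup>2 * (t - s) / 2)"
  have \<alpha>: "\<alpha> > 0" and \<delta>: "\<delta> > 0" using l_pos s by (auto simp: \<alpha>_def \<delta>_def)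
  have e1: "ell \<alpha> \<beta> (F (t + h) - F s)" if "\<bar>h\<bar> < \<delta>" for h
  proof (rule ell_mono[OF ell_F])
    have "\<bar>h\<bar> < (t - s) / 2" using that by (simp add: \<delta>_def)
    then have h: "- h < (t - s) / 2" "h < (t - s) / 2" unfolding abs_less_iff by auto
    show "s < t + h" using h s by (simp add: field_simps)
    have "(t - s) / 2 \<le> t + h - s" using h by (simp add: field_simps)
    then have "l * ((t - s) / 2) \<le> l * (t + h - s)" using l_pos by (intro mult_left_mono) auto
    then show "\<alpha> \<le> l * (t + h - s)" by (simp add: \<alpha>_def)
    show "(t + h - s) / l \<le> \<beta>" unfolding \<beta>_def using l_pos h by (intro divide_right_mono) (auto simp: field_simps)
  qed
  have e2: "ell \<alpha> \<beta> (?M + h *\<^sub>R a t)" if "\<bar>h\<bar> < \<delta>" for h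
    unfolding ell_def
  proof (intro conjI allI)
    have at: "ell l (1 / l) (a t)" using t by (simp add: good_time_def)
    note M = ell_F[OF s]
    show "transpose (?M + h *\<^sub>R a t) = ?M + h *\<^sub>R a t"
      using at M by (simp add: ell_def transpose_def vec_eq_iff)
    fix \<xi> :: "real ^ 'n"
    define N where "N = (norm \<xi>)\<^sup>2"
    define p where "p = (?M *v \<xi>) \<bullet> \<xi>"
    define q where "q = (a t *v \<xi>) \<bullet> \<xi>"
    have N: "N \<ge> 0" by (simp add: N_def)
    have p: "l * (t - s) * N \<le> p" "p \<le> (t - s) / l * N" using M by (auto simp: ell_def p_def N_def)
    have q: "l * N \<le> q" "q \<le> 1 / l * N" using at unfolding ell_def q_def N_def by auto
    have q0: "0 \<le> q" using q(1) N l_pos by (meson mult_nonneg_nonneg less_imp_le order_trans)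
    have eq: "((?M + h *\<^sub>R a t) *v \<xi>) \<bullet> \<xi> = p + h * q"
      by (simp add: p_def q_def matrix_vector_mult_add_rdistrib scaleR_matrix_vector_assoc[symmetric] inner_add_left)
    have h: "\<bar>h\<bar> \<le> (t - s) / 2" "\<bar>h\<bar> \<le> l\<^sup>2 * (t - s) / 2" using that by (auto simp: \<delta>_def)
    have hq: "\<bar>h * q\<bar> \<le> \<bar>h\<bar> * (1 / l * N)" using q(2) q0 by (simp only: abs_mult) (intro mult_left_mono, auto)
    have "\<bar>h\<bar> * (1 / l * N) \<le> (l\<^sup>2 * (t - s) / 2) * (1 / l * N)" using h N l_pos by (intro mult_right_mono) auto
    also have "\<dots> = l * (t - s) / 2 * N" using l_pos by (simp add: power2_eq_square)
    finally have low: "\<bar>h * q\<bar> \<le> l * (t - s) / 2 * N" using hq by linarith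
    have "\<bar>h\<bar> * (1 / l * N) \<le> ((t - s) / 2) * (1 / l * N)" using h N l_pos by (intro mult_right_mono) auto
    then have up: "\<bar>h * q\<bar> \<le> (t - s) / 2 * (1 / l * N)" using hq by linarith
    have a1: "\<alpha> * N = l * (t - s) * N - l * (t - s) / 2 * N" by (simp add: \<alpha>_def field_simps)
    have a2: "(t - s) / l * N + (t - s) / 2 * (1 / l * N) \<le> \<beta> * N"
    proof -
      define X where "X = (t - s) / l * N"
      have "0 \<le> X" unfolding X_def using l_pos s N by auto
      have "(t - s) / l * N + (t - s) / 2 * (1 / l * N) = X + X / 2" by (simp add: X_def)
      also have "\<dots> \<le> 2 * X" using \<open>0 \<le> X\<close> by linarith
      also have "\<dots> = \<beta> * N" by (simp add: \<beta>_def X_def)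
      finally show ?thesis .
    qed
    show "\<alpha> * (norm \<xi>)\<^sup>2 \<le> ((?M + h *\<^sub>R a t) *v \<xi>) \<bullet> \<xi>"
      unfolding eq N_def[symmetric] using p(1) low a1 by linarith
    show "((?M + h *\<^sub>R a t) *v \<xi>) \<bullet> \<xi> \<le> \<beta> * (norm \<xi>)\<^sup>2"
      unfolding eq N_def[symmetric] using p(2) up a2 by linarith
  qed
  define \<zeta> where "\<zeta> h = gauss_mean (?M + h *\<^sub>R a t) s x" for h
  have dz: "(\<zeta> has_field_derivative ?L) (at 0)"
    using gauss_mean_line_derivative[of "- \<delta>" \<delta> ?M "a t" 0 s x] ell_posdef[OF e2 \<alpha>] \<delta>
    by (auto simp: \<zeta>_def[abs_def])
  define r where "r h = (gauss_mean (F (t + h) - F s) s x - \<zeta> h) / h" for h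
  have "(r \<longlongrightarrow> 0) (at 0)"
  proof (rule Lim_null_comparison)
    have "((\<lambda>h. \<bar>(F (t + h) $ i $ j - F t $ i $ j) / h - a t $ i $ j\<bar>) \<longlongrightarrow> 0) (at 0)" for i j
      using t by (intro tendsto_rabs_zero) (simp add: good_time_def DERIV_def LIM_zero_iff)
    then have "((\<lambda>h. B * (\<Sum>i\<in>UNIV. \<Sum>j\<in>UNIV. \<bar>(F (t + h) $ i $ j - F t $ i $ j) / h - a t $ i $ j\<bar>)) \<longlongrightarrow> B * (\<Sum>i\<in>(UNIV::'n set). \<Sum>j\<in>(UNIV::'n set). 0)) (at 0)"
      by (intro tendsto_intros)
    then show "((\<lambda>h. B * (\<Sum>i\<in>UNIV. \<Sum>j\<in>UNIV. \<bar>(F (t + h) $ i $ j - F t $ i $ j) / h - a t $ i $ j\<bar>)) \<longlongrightarrow> 0) (at 0)"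
      by simp
    show "\<forall>\<^sub>F h in at 0. norm (r h) \<le> B * (\<Sum>i\<in>UNIV. \<Sum>j\<in>UNIV. \<bar>(F (t + h) $ i $ j - F t $ i $ j) / h - a t $ i $ j\<bar>)"
      unfolding eventually_at
    proof (intro exI[of _ \<delta>] conjI \<delta> ballI impI)
      fix h :: real assume "h \<noteq> 0 \<and> dist h 0 < \<delta>"
      then have h: "h \<noteq> 0" "\<bar>h\<bar> < \<delta>" by auto
      have "\<bar>gauss_mean (F (t + h) - F s) s x - \<zeta> h\<bar> \<le> B * (\<Sum>i\<in>UNIV. \<Sum>j\<in>UNIV. \<bar>(F (t + h) - F s) $ i $ j - (?M + h *\<^sub>R a t) $ i $ j\<bar>)"
        unfolding \<zeta>_def by (rule gauss_mean_lipschitz[OF e2[OF h(2)] e1[OF h(2)] \<alpha>])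
      then have "\<bar>gauss_mean (F (t + h) - F s) s x - \<zeta> h\<bar> / \<bar>h\<bar> \<le> B * (\<Sum>i\<in>UNIV. \<Sum>j\<in>UNIV. \<bar>(F (t + h) - F s) $ i $ j - (?M + h *\<^sub>R a t) $ i $ j\<bar>) / \<bar>h\<bar>"
        using h by (intro divide_right_mono) auto
      also have "\<dots> = B * (\<Sum>i\<in>UNIV. \<Sum>j\<in>UNIV. \<bar>(F (t + h) - F s) $ i $ j - (?M + h *\<^sub>R a t) $ i $ j\<bar> / \<bar>h\<bar>)"
        by (simp only: sum_divide_distrib times_divide_eq_right[symmetric])
      also have "\<dots> = B * (\<Sum>i\<in>UNIV. \<Sum>j\<in>UNIV. \<bar>(F (t + h) $ i $ j - F t $ i $ j) / h - a t $ i $ j\<bar>)"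
      proof (intro arg_cong[where f="\<lambda>z. B * z"] sum.cong refl)
        fix i j
        have "((F (t + h) - F s) $ i $ j - (?M + h *\<^sub>R a t) $ i $ j) / h = (F (t + h) $ i $ j - F t $ i $ j) / h - a t $ i $ j"
          using h by (simp add: field_simps)
        then show "\<bar>(F (t + h) - F s) $ i $ j - (?M + h *\<^sub>R a t) $ i $ j\<bar> / \<bar>h\<bar> = \<bar>(F (t + h) $ i $ j - F t $ i $ j) / h - a t $ i $ j\<bar>"
          by (metis abs_divide)
      qed
      finally show "norm (r h) \<le> B * (\<Sum>i\<in>UNIV. \<Sum>j\<in>UNIV. \<bar>(F (t + h) $ i $ j - F t $ i $ j) / h - a t $ i $ j\<bar>)"
        by (simp add: r_def abs_divide)
    qed
  qed
  moreover have "((\<lambda>h. (\<zeta> h - \<zeta> 0) / h) \<longlongrightarrow> ?L) (at 0)" using dz by (simp add: DERIV_def)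
  ultimately have "((\<lambda>h. r h + (\<zeta> h - \<zeta> 0) / h) \<longlongrightarrow> 0 + ?L) (at 0)" by (rule tendsto_add)
  moreover have "r h + (\<zeta> h - \<zeta> 0) / h = (gauss_mean (F (t + h) - F s) s x - gauss_mean (F t - F s) s x) / h" for h
    by (simp add: r_def \<zeta>_def add_divide_distrib[symmetric])
  ultimately show ?thesis by (simp add: DERIV_def)
qed

text \<open>Subtracting \<open>f (s, x)\<close> closes the jump at \<open>s = t\<close>: the difference is Lipschitz in \<open>t\<close>, uniformly
  in \<open>s\<close>, so that it can be differentiated under the integral.\<close>

definition smoothing_gap :: "real ^ 'n \<Rightarrow> real \<Rightarrow> real \<Rightarrow> real" where
  "smoothing_gap x t s = (if s < t then exp (s - t) * gauss_mean (F t - F s) s x - f (s, x) else 0)"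

text \<open>If both times lie after s, the change comes from the covariance
  (\<open>gauss_mean_F_lipschitz\<close>) and from the damping factor, which costs B. If s lies
  between them, the earlier value is 0 and \<open>gauss_mean_F_initial\<close> measures how far the
  later one has moved away from 0.\<close>

lemma smoothing_gap_lipschitz: "\<bar>smoothing_gap x t' s - smoothing_gap x t s\<bar> \<le> (gauss_mean_const + B) * \<bar>t' - t\<bar>"
proof -
  have main: "\<bar>smoothing_gap x t' s - smoothing_gap x t s\<bar> \<le> (gauss_mean_const + B) * (t' - t)" if "t \<le> t'" for t t'
  proof -
    have nn: "0 \<le> gauss_mean_const + B" using gauss_mean_const_nonneg B_nonneg by simp
    consider "t' \<le> s" | "t \<le> s" "s < t'" | "s < t" by linarith
    then show ?thesis
    proof cases
      case 1
      then show ?thesis using that nn by (simp add: smoothing_gap_def)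
    next
      case 2
      let ?P = "gauss_mean (F t' - F s) s x"
      have "\<bar>exp (s - t') - exp 0\<bar> * \<bar>?P\<bar> \<le> \<bar>s - t' - 0\<bar> * B"
        by (intro mult_mono abs_exp_diff_le gauss_mean_bound posdef_F) (use 2 in auto)
      moreover have "exp (s - t') * ?P - f (s, x) = (exp (s - t') - exp 0) * ?P + (?P - f (s, x))"
        by (simp add: algebra_simps)
      ultimately have "\<bar>exp (s - t') * ?P - f (s, x)\<bar> \<le> (t' - s) * B + gauss_mean_const * (t' - s)"
        using gauss_mean_F_initial[of s t' x] 2 abs_triangle_ineq[of "(exp (s - t') - exp 0) * ?P" "?P - f (s, x)"]
        by (simp only: abs_mult) simp
      also have "\<dots> = (gauss_mean_const + B) * (t' - s)" by (simp add: algebra_simps)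
      also have "\<dots> \<le> (gauss_mean_const + B) * (t' - t)" using 2 nn by (intro mult_left_mono) auto
      finally show ?thesis using 2 by (simp add: smoothing_gap_def)
    next
      case 3
      let ?P = "gauss_mean (F t - F s) s x" and ?P' = "gauss_mean (F t' - F s) s x"
      have "\<bar>exp (s - t') - exp (s - t)\<bar> * \<bar>?P\<bar> \<le> \<bar>(s - t') - (s - t)\<bar> * B"
        by (intro mult_mono abs_exp_diff_le gauss_mean_bound posdef_F) (use 3 that in auto)
      moreover have "exp (s - t') * \<bar>?P' - ?P\<bar> \<le> 1 * (gauss_mean_const * \<bar>t' - t\<bar>)"
        by (intro mult_mono gauss_mean_F_lipschitz) (use 3 that in auto)
      moreover have "smoothing_gap x t' s - smoothing_gap x t s = exp (s - t') * (?P' - ?P) + (exp (s - t') - exp (s - t)) * ?P"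
        using 3 that by (simp add: smoothing_gap_def algebra_simps)
      ultimately have "\<bar>smoothing_gap x t' s - smoothing_gap x t s\<bar> \<le> gauss_mean_const * (t' - t) + (t' - t) * B"
        using that abs_triangle_ineq[of "exp (s - t') * (?P' - ?P)" "(exp (s - t') - exp (s - t)) * ?P"]
        by (simp only: abs_mult abs_exp_cancel) simp
      then show ?thesis by (simp add: algebra_simps)
    qed
  qed
  show ?thesis using main[of t t'] main[of t' t] by (cases "t \<le> t'") (auto simp: abs_minus_commute)
qed

lemma smoothing_gap_supp: "\<bar>s\<bar> > R \<Longrightarrow> smoothing_gap x t s = 0"
proof -
  assume s: "\<bar>s\<bar> > R"
  have "f (s, y) = 0" for y
  proof -
    have "\<bar>s\<bar> \<le> norm (s, y)" by (simp add: norm_Pair real_le_rsqrt)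
    then show ?thesis using s supp(1) by force
  qed
  then show ?thesis by (simp add: smoothing_gap_def gauss_mean_def)
qed

lemma integrable_time_slice: "integrable lborel (\<lambda>s. f (s, x))"
proof (rule integrable_continuous_compact_support[where R=R])
  show "continuous_on UNIV (\<lambda>s. f (s, x))"
    by (rule continuous_on_compose2[OF cont(1)]) (auto intro!: continuous_intros)
  show "f (s, x) = 0" if "norm s > R" for s
  proof -
    have "\<bar>s\<bar> \<le> norm (s, x)" by (simp add: norm_Pair real_le_rsqrt)
    then show ?thesis using that supp(1) by force
  qed
qed

text \<open>Collects the terms f(s, x) subtracted in \<open>smoothing_gap\<close>; its derivative is
  the right-hand side of the equation.\<close>

definition time_primitive :: "real ^ 'n \<Rightarrow> real \<Rightarrow> real" where
  "time_primitive x t = (\<integral>s. indicat_real {..<t} s * f (s, x) \<partial>lborel)"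

lemma time_primitive_integrable: "integrable lborel (\<lambda>s. indicat_real {..<t} s * f (s, x))"
  using integrable_mult_indicator[OF _ integrable_time_slice, of "{..<t}" x] by simp

lemma time_primitive_derivative: "(time_primitive x has_field_derivative f (t, x)) (at t)"
proof -
  \<comment> \<open>To the left of the support of f and strictly before t, so that near t the
    primitive is an ordinary integral starting at c, and t is interior to [c, t + 1].\<close>
  define c where "c = min (- \<bar>R\<bar> - 1) (t - 1)"
  have z: "f (s, x) = 0" if "s < c" for s
  proof -
    have "\<bar>s\<bar> \<le> norm (s, x)" by (simp add: norm_Pair real_le_rsqrt)
    moreover have "\<bar>s\<bar> > R"
    proof -
      have "s < - \<bar>R\<bar> - 1" using that by (simp add: c_def)
      moreover have "- s \<le> \<bar>s\<bar>" "R \<le> \<bar>R\<bar>" by auto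
      ultimately show ?thesis by linarith
    qed
    ultimately show ?thesis using supp(1) by force
  qed
  have cont': "continuous_on S (\<lambda>s. f (s, x))" for S
    by (rule continuous_on_compose2[OF cont(1)]) (auto intro!: continuous_intros)
  have Peq: "time_primitive x t' = integral {c..t'} (\<lambda>s. f (s, x))" if "t' > c" for t'
  proof -
    have "time_primitive x t' = integral UNIV (\<lambda>s. indicat_real {..<t'} s * f (s, x))"
      unfolding time_primitive_def using integral_lborel[OF time_primitive_integrable] by simp
    also have "\<dots> = integral UNIV (\<lambda>s. if s \<in> {c..t'} then f (s, x) else 0)"
      by (rule integral_spike[of "{t'}"]) (use z in \<open>auto simp: indicator_def not_le\<close>)
    also have "\<dots> = integral {c..t'} (\<lambda>s. f (s, x))" by (rule integral_restrict_UNIV)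
    finally show ?thesis .
  qed
  have "((\<lambda>u. integral {c..u} (\<lambda>s. f (s, x))) has_real_derivative f (t, x)) (at t within {c..t + 1})"
    by (rule integral_has_real_derivative[OF cont']) (auto simp: c_def)
  then have "((\<lambda>u. integral {c..u} (\<lambda>s. f (s, x))) has_real_derivative f (t, x)) (at t)"
    by (simp add: at_within_Icc_at c_def)
  then show ?thesis
    by (rule has_field_derivative_transform_within_open[of _ _ _ "{c<..}"]) (auto simp: Peq c_def)
qed

lemma time_primitive_lipschitz: "\<bar>time_primitive x t' - time_primitive x t\<bar> \<le> B * \<bar>t' - t\<bar>"
proof -
  have "norm (time_primitive x t' - time_primitive x t) \<le> B * norm (t' - t)"
    by (rule field_differentiable_bound[where S=UNIV and f'="\<lambda>t. f (t, x)"]) (use time_primitive_derivative bnd(1) in auto)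
  then show ?thesis by simp
qed

lemma sol_slice_f:
  "sol a f (t, x) = (\<integral>s. (if s < t then exp (s - t) * gauss_mean (F t - F s) s x else 0) \<partial>lborel)"
  "integrable lborel (\<lambda>s. if s < t then exp (s - t) * gauss_mean (F t - F s) s x else 0)"
  unfolding gauss_mean_def by (rule sol_slice[OF f_measurable(1) bnd(1)])+

lemma sol_slice_fij:
  "sol a (fij i j) (t, x) = (\<integral>s. (if s < t then exp (s - t) * gauss_mean2 i j (F t - F s) s x else 0) \<partial>lborel)"
  "integrable lborel (\<lambda>s. if s < t then exp (s - t) * gauss_mean2 i j (F t - F s) s x else 0)"
  unfolding gauss_mean2_def by (rule sol_slice[OF f_measurable(3) bnd(3)])+

lemma smoothing_gap_integrable: "integrable lborel (smoothing_gap x t)"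
proof -
  have "smoothing_gap x t = (\<lambda>s. (if s < t then exp (s - t) * gauss_mean (F t - F s) s x else 0) - indicat_real {..<t} s * f (s, x))"
    by (auto simp: smoothing_gap_def fun_eq_iff)
  then show ?thesis by (simp only:) (intro Bochner_Integration.integrable_diff sol_slice_f(2) time_primitive_integrable)
qed

lemma sol_eq_smoothing_gap: "sol a f (t, x) = (\<integral>s. smoothing_gap x t s \<partial>lborel) + time_primitive x t"
proof -
  have "sol a f (t, x) = (\<integral>s. smoothing_gap x t s + indicat_real {..<t} s * f (s, x) \<partial>lborel)"
    unfolding sol_slice_f(1) by (rule Bochner_Integration.integral_cong) (auto simp: smoothing_gap_def)
  then show ?thesis using smoothing_gap_integrable time_primitive_integrable by (simp add: time_primitive_def)
qed

lemma smoothing_gap_bound_integrable: "integrable lborel (\<lambda>s. (gauss_mean_const + B) * indicat_real {- R..R} s)"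
  by (intro integrable_mult_right integrable_real_indicator) (auto simp: emeasure_lborel_Icc_eq)

lemma smoothing_gap_lipschitz_ind: "\<bar>smoothing_gap x t' s - smoothing_gap x t s\<bar> \<le> \<bar>t' - t\<bar> * ((gauss_mean_const + B) * indicat_real {- R..R} s)"
proof (cases "\<bar>s\<bar> > R")
  case True
  then show ?thesis using gauss_mean_const_nonneg B_nonneg by (simp add: smoothing_gap_supp)
next
  case False
  then have "s \<in> {- R..R}" by auto
  then show ?thesis using smoothing_gap_lipschitz[of x t' s t] by (simp add: mult.commute)
qed

text \<open>\<open>smoothing_gap\<close> vanishes for |s| > R, so its uniform Lipschitz constant can
  be integrated over [-R, R]; the primitive adds B. Local absolute continuity in time
  follows.\<close>

lemma sol_lipschitz:
  obtains L where "L \<ge> 0" "\<And>t t' x. \<bar>sol a f (t', x) - sol a f (t, x)\<bar> \<le> L * \<bar>t' - t\<bar>"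
proof
  let ?I = "\<integral>s. (gauss_mean_const + B) * indicat_real {- R..R} s \<partial>lborel"
  have I0: "?I \<ge> 0" using gauss_mean_const_nonneg B_nonneg by (intro integral_nonneg_AE) auto
  show "?I + B \<ge> 0" using I0 B_nonneg by simp
  fix t t' x
  have "\<bar>(\<integral>s. smoothing_gap x t' s \<partial>lborel) - (\<integral>s. smoothing_gap x t s \<partial>lborel)\<bar> = \<bar>\<integral>s. smoothing_gap x t' s - smoothing_gap x t s \<partial>lborel\<bar>"
    using smoothing_gap_integrable by simp
  also have "\<dots> \<le> (\<integral>s. norm (smoothing_gap x t' s - smoothing_gap x t s) \<partial>lborel)"
    unfolding real_norm_def[symmetric] by (rule integral_norm_bound)
  also have "\<dots> \<le> (\<integral>s. \<bar>t' - t\<bar> * ((gauss_mean_const + B) * indicat_real {- R..R} s) \<partial>lborel)"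
  proof (rule integral_mono)
    show "integrable lborel (\<lambda>s. norm (smoothing_gap x t' s - smoothing_gap x t s))"
      by (intro integrable_norm Bochner_Integration.integrable_diff smoothing_gap_integrable)
    show "integrable lborel (\<lambda>s. \<bar>t' - t\<bar> * ((gauss_mean_const + B) * indicat_real {- R..R} s))"
      by (rule integrable_mult_right[OF smoothing_gap_bound_integrable])
    show "norm (smoothing_gap x t' s - smoothing_gap x t s) \<le> \<bar>t' - t\<bar> * ((gauss_mean_const + B) * indicat_real {- R..R} s)" for s
      unfolding real_norm_def by (rule smoothing_gap_lipschitz_ind)
  qed
  also have "\<dots> = ?I * \<bar>t' - t\<bar>" by simp
  finally show "\<bar>sol a f (t', x) - sol a f (t, x)\<bar> \<le> (?I + B) * \<bar>t' - t\<bar>"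
    unfolding sol_eq_smoothing_gap using time_primitive_lipschitz[of x t' t] by (simp only: distrib_right)
qed

text \<open>For s \<noteq> t the gap is differentiable at t: by
  \<open>gauss_mean_F_derivative\<close> if s < t, trivially if s > t. Its integral gives a^{ij}
  \<partial>_{ij} u - u, and the primitive gives f.\<close>

lemma sol_time_derivative:
  assumes t: "good_time t"
  shows "((\<lambda>t. sol a f (t, x)) has_field_derivative
    ((\<Sum>i\<in>UNIV. \<Sum>j\<in>UNIV. a t $ i $ j * sol a (fij i j) (t, x)) - sol a f (t, x) + f (t, x))) (at t)"
proof -
  let ?h = "\<lambda>s. if s < t then exp (s - t) * gauss_mean (F t - F s) s x else 0"
  let ?hij = "\<lambda>i j s. if s < t then exp (s - t) * gauss_mean2 i j (F t - F s) s x else 0"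
  let ?V' = "\<lambda>s. (\<Sum>i\<in>UNIV. \<Sum>j\<in>UNIV. a t $ i $ j * ?hij i j s) - ?h s"
  have int': "integrable lborel (\<lambda>s. \<Sum>i\<in>UNIV. \<Sum>j\<in>UNIV. a t $ i $ j * ?hij i j s)"
    by (intro Bochner_Integration.integrable_sum integrable_mult_right sol_slice_fij(2))
  have "((\<lambda>t. \<integral>s. smoothing_gap x t s \<partial>lborel) has_field_derivative (\<integral>s. ?V' s \<partial>lborel)) (at t)"
  proof (rule has_field_derivative_integral_dominated[where r=1 and g="\<lambda>s. (gauss_mean_const + B) * indicat_real {- R..R} s"])
    have "AE s in lborel. s \<noteq> t" by (rule AE_lborel_singleton)
    then show "AE s in lborel. ((\<lambda>t. smoothing_gap x t s) has_field_derivative ?V' s) (at t)"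
    proof eventually_elim
      case (elim s)
      show ?case
      proof (cases "s < t")
        case True
        have "((\<lambda>t. exp (s - t) * gauss_mean (F t - F s) s x - f (s, x)) has_field_derivative ?V' s) (at t)"
          using True
          by (auto intro!: derivative_eq_intros gauss_mean_F_derivative[OF t True] simp: sum_distrib_left mult_ac)
        then show ?thesis
          by (rule has_field_derivative_transform_within_open[of _ _ _ "{s<..}"]) (use True in \<open>auto simp: smoothing_gap_def\<close>)
      next
        case False
        then have "t < s" using elim by simp
        have "((\<lambda>t. 0) has_field_derivative ?V' s) (at t)" using False by simp
        then show ?thesis
          by (rule has_field_derivative_transform_within_open[of _ _ _ "{..<s}"]) (use \<open>t < s\<close> in \<open>auto simp: smoothing_gap_def\<close>)
      qed
    qed
    show "?V' \<in> borel_measurable lborel"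
      by (intro borel_measurable_diff borel_measurable_integrable int' sol_slice_f(2))
  qed (use smoothing_gap_integrable smoothing_gap_lipschitz_ind smoothing_gap_bound_integrable in auto)
  moreover have "(\<integral>s. ?V' s \<partial>lborel) = (\<Sum>i\<in>UNIV. \<Sum>j\<in>UNIV. a t $ i $ j * sol a (fij i j) (t, x)) - sol a f (t, x)"
    unfolding sol_slice_f(1) sol_slice_fij(1)
    using int' sol_slice_f(2) sol_slice_fij(2)
    by (simp add: Bochner_Integration.integral_sum Bochner_Integration.integrable_sum)
  ultimately have "((\<lambda>t. (\<integral>s. smoothing_gap x t s \<partial>lborel) + time_primitive x t) has_field_derivative
     ((\<Sum>i\<in>UNIV. \<Sum>j\<in>UNIV. a t $ i $ j * sol a (fij i j) (t, x)) - sol a f (t, x) + f (t, x))) (at t)"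
    using DERIV_add[OF _ time_primitive_derivative] by fastforce
  then show ?thesis by (simp add: sol_eq_smoothing_gap[abs_def, symmetric] flip: sol_eq_smoothing_gap)
qed

lemma loc_abs_cont_lipschitz:
  assumes "L \<ge> 0" "\<And>t t'. \<bar>g t' - g t\<bar> \<le> L * \<bar>t' - t\<bar>"
  shows "loc_abs_cont g"
  unfolding loc_abs_cont_def
proof (intro allI impI)
  fix b c \<epsilon> :: real assume "\<epsilon> > 0"
  show "\<exists>\<delta>>0. \<forall>D. D division_of \<Union>D \<and> \<Union>D \<subseteq> {b..c} \<and> (\<Sum>K\<in>D. Sup K - Inf K) < \<delta> \<longrightarrow>
        (\<Sum>K\<in>D. \<bar>g (Sup K) - g (Inf K)\<bar>) < \<epsilon>"
  \<comment> \<open>L + 1 instead of L, as L may be zero.\<close>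
  proof (intro exI[of _ "\<epsilon> / (L + 1)"] conjI allI impI)
    show "0 < \<epsilon> / (L + 1)" using \<open>\<epsilon> > 0\<close> assms(1) by simp
    fix D assume D: "D division_of \<Union>D \<and> \<Union>D \<subseteq> {b..c} \<and> (\<Sum>K\<in>D. Sup K - Inf K) < \<epsilon> / (L + 1)"
    have nn: "Inf K \<le> Sup K" if K: "K \<in> D" for K :: "real set"
    proof -
      have div: "D division_of \<Union>D" using D by blast
      obtain u v where "K = cbox u v" using division_ofD(4)[OF div K] by blast
      with division_ofD(3)[OF div K] show ?thesis by (auto simp: cbox_interval)
    qed
    have "(\<Sum>K\<in>D. \<bar>g (Sup K) - g (Inf K)\<bar>) \<le> (\<Sum>K\<in>D. L * (Sup K - Inf K))"
    proof (rule sum_mono)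
      fix K assume "K \<in> D"
      from nn[OF this] show "\<bar>g (Sup K) - g (Inf K)\<bar> \<le> L * (Sup K - Inf K)"
        using assms(2)[of "Sup K" "Inf K"] by simp
    qed
    also have "\<dots> = L * (\<Sum>K\<in>D. Sup K - Inf K)" by (simp add: sum_distrib_left)
    also have "\<dots> \<le> (L + 1) * (\<Sum>K\<in>D. Sup K - Inf K)"
      using nn by (intro mult_right_mono sum_nonneg) auto
    also have "\<dots> < \<epsilon>" using D assms(1) by (simp add: less_divide_eq mult.commute)
    finally show "(\<Sum>K\<in>D. \<bar>g (Sup K) - g (Inf K)\<bar>) < \<epsilon>" .
  qed
qed

lemma sol_classical: "bounded (range (sol a f))" "classical_solution a f (sol a f)"
proof -
  show "bounded (range (sol a f))"
    unfolding bounded_iff using sol_bounded[OF f_measurable(1) bnd(1)] by auto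
  obtain L where L: "L \<ge> 0" "\<And>t t' x. \<bar>sol a f (t', x) - sol a f (t, x)\<bar> \<le> L * \<bar>t' - t\<bar>"
    using sol_lipschitz by metis
  have eta: "(\<lambda>(t, x). sol a g (t, x)) = sol a g" for g by auto
  show "classical_solution a f (sol a f)"
    unfolding classical_solution_def
  proof (intro conjI allI)
    show "continuous_on UNIV (sol a f)" by (rule sol_continuous[OF cont(1) bnd(1)])
    show "has_partial i (\<lambda>z. sol a f (t, z)) x" for i t x by (rule sol_f_partial(1))
    show "continuous_on UNIV (\<lambda>(t, x). partial i (\<lambda>z. sol a f (t, z)) x)" for i
      unfolding sol_f_partial(2) eta by (rule sol_continuous[OF cont(2) bnd(2)])
    show "has_partial i (partial j (\<lambda>z. sol a f (t, z))) x" for i j t x by (rule sol_f_partial2(1))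
    show "continuous_on UNIV (\<lambda>(t, x). partial i (partial j (\<lambda>z. sol a f (t, z))) x)" for i j
      unfolding sol_f_partial2(2) eta by (rule sol_continuous[OF cont(3) bnd(3)])
    show "loc_abs_cont (\<lambda>t. sol a f (t, x))" for x by (rule loc_abs_cont_lipschitz[OF L(1)]) (rule L(2))
    show "AE t in lebesgue. \<forall>x. (\<lambda>s. sol a f (s, x)) differentiable at t \<and>
        deriv (\<lambda>s. sol a f (s, x)) t
          - (\<Sum>i\<in>UNIV. \<Sum>j\<in>UNIV. a t $ i $ j * partial i (partial j (\<lambda>z. sol a f (t, z))) x)
          + sol a f (t, x) = f (t, x)"
      using AE_good_time
    proof eventually_elim
      case (elim t)
      show ?case
      proof
        fix x
        note d = sol_time_derivative[OF elim, of x]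
        from DERIV_imp_deriv[OF d] d show "(\<lambda>s. sol a f (s, x)) differentiable at t \<and>
        deriv (\<lambda>s. sol a f (s, x)) t
          - (\<Sum>i\<in>UNIV. \<Sum>j\<in>UNIV. a t $ i $ j * partial i (partial j (\<lambda>z. sol a f (t, z))) x)
          + sol a f (t, x) = f (t, x)"
          unfolding sol_f_partial2(2) by (auto simp: real_differentiable_def)
      qed
    qed
  qed
qed

end

section \<open>Uniqueness\<close>

text \<open>The interiors are pairwise disjoint and have the same lengths as the intervals, so the
  lengths add up to the measure of a subset of U.\<close>

lemma division_length_le:
  fixes D :: "real set set"
  assumes D: "D division_of \<Union>D" and U: "\<Union>D \<subseteq> U" "open U" "emeasure lborel U \<le> ennreal \<delta>" and "\<delta> \<ge> 0"
  shows "(\<Sum>K\<in>D. Sup K - Inf K) \<le> \<delta>"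
proof -
  have ivl: "\<exists>u v. u \<le> v \<and> K = {u..v}" if K: "K \<in> D" for K
  proof -
    obtain u v where "K = cbox u v" using division_ofD(4)[OF D K] by blast
    moreover have "K \<noteq> {}" using division_ofD(3)[OF D K] .
    ultimately show ?thesis by (auto simp: cbox_interval)
  qed
  have len: "emeasure lborel (interior K) = ennreal (Sup K - Inf K)" "Inf K \<le> Sup K" if "K \<in> D" for K
    using ivl[OF that] by (auto simp: interior_atLeastAtMost_real)
  have fin: "finite D" by (rule division_of_finite[OF D])
  have "ennreal (\<Sum>K\<in>D. Sup K - Inf K) = (\<Sum>K\<in>D. ennreal (Sup K - Inf K))"
    by (rule sum_ennreal[symmetric]) (use len(2) in simp)
  also have "\<dots> = (\<Sum>K\<in>D. emeasure lborel (interior K))"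
    by (rule sum.cong) (simp_all add: len(1))
  also have "\<dots> = emeasure lborel (\<Union>K\<in>D. interior K)"
  proof (rule sum_emeasure[OF _ _ fin])
    show "disjoint_family_on interior D"
      using division_ofD(5)[OF D] by (auto simp: disjoint_family_on_def)
  qed auto
  also have "\<dots> \<le> emeasure lborel U"
    by (rule emeasure_mono) (use U interior_subset in \<open>auto\<close>)
  also have "\<dots> \<le> ennreal \<delta>" by (rule U(3))
  finally show ?thesis using \<open>\<delta> \<ge> 0\<close> by (simp add: ennreal_le_iff)
qed

text \<open>Tags in the exceptional null set are covered by short intervals, on which absolute continuity
  makes the increments negligible; elsewhere the derivative controls them.\<close>

lemma loc_abs_cont_increment_le:
  fixes g :: "real \<Rightarrow> real"
  assumes ac: "loc_abs_cont g" and N: "N \<in> null_sets lebesgue" and bc: "b \<le> c"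
    and der: "\<And>t. t \<in> {b..c} \<Longrightarrow> t \<notin> N \<Longrightarrow> \<exists>d\<le>C. (g has_field_derivative d) (at t)"
  shows "g c - g b \<le> C * (c - b)"
proof -
  have main: "g c - g b \<le> C * (c - b) + \<epsilon> * (c - b + 2)" if \<epsilon>: "\<epsilon> > 0" for \<epsilon>
  proof -
    from ac[unfolded loc_abs_cont_def, THEN spec, THEN spec, THEN spec, THEN mp, OF \<epsilon>, of b c]
    obtain \<delta>0 where AC0: "\<delta>0 > 0 \<and> (\<forall>D. D division_of \<Union>D \<and> \<Union>D \<subseteq> {b..c} \<and> (\<Sum>K\<in>D. Sup K - Inf K) < \<delta>0 \<longrightarrow>
        (\<Sum>K\<in>D. \<bar>g (Sup K) - g (Inf K)\<bar>) < \<epsilon>)"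
      by (rule exE)
    then have \<delta>0: "\<delta>0 > 0" by (rule conjunct1)
    have AC: "(\<Sum>K\<in>D. \<bar>g (Sup K) - g (Inf K)\<bar>) < \<epsilon>"
      if "D division_of \<Union>D" "\<Union>D \<subseteq> {b..c}" "(\<Sum>K\<in>D. Sup K - Inf K) < \<delta>0" for D
      using that by (intro AC0[THEN conjunct2, THEN spec, of D, THEN mp] conjI)
    \<comment> \<open>Half of \<delta>0 restores the strict inequality. The second entry bounds the
      error |C + \<epsilon>| \<delta> made by leaving the intervals tagged in N out of the main
      term; C may have either sign.\<close>
    define \<delta> where "\<delta> = min (\<delta>0 / 2) (\<epsilon> / (\<bar>C + \<epsilon>\<bar> + 1))"
    have \<delta>: "\<delta> > 0" "\<delta> < \<delta>0" using \<delta>0 \<epsilon> by (auto simp: \<delta>_def)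
    have \<delta>C: "\<bar>C + \<epsilon>\<bar> * \<delta> \<le> \<epsilon>"
    proof -
      have "\<bar>C + \<epsilon>\<bar> * \<delta> \<le> (\<bar>C + \<epsilon>\<bar> + 1) * (\<epsilon> / (\<bar>C + \<epsilon>\<bar> + 1))"
        using \<epsilon> \<delta>(1) by (intro mult_mono) (auto simp: \<delta>_def)
      also have "\<dots> = \<epsilon>" by (simp add: add_nonneg_eq_0_iff)
      finally show ?thesis .
    qed
    obtain U where U: "open U" "N \<subseteq> U" "emeasure lebesgue (U - N) < ennreal \<delta>"
      using sets_lebesgue_outer_open[OF null_setsD2[OF N] \<delta>(1)] by metis
    have "emeasure lebesgue U \<le> emeasure lebesgue ((U - N) \<union> N)"
      using U(1) N by (intro emeasure_mono) auto
    also have "\<dots> \<le> emeasure lebesgue (U - N) + emeasure lebesgue N"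
      using U(1) N by (intro emeasure_subadditive) auto
    also have "\<dots> \<le> ennreal \<delta>" using U(3) N by (simp add: null_setsD1)
    finally have Um: "emeasure lborel U \<le> ennreal \<delta>" using U(1) by simp
    \<comment> \<open>Radius of the gauge. For a tag x outside N the estimate concerns intervals
      [u, v] that contain x: adding the first-order expansions at x on both sides gives slope C +
      \<epsilon>.\<close>
    have "\<exists>r>0. (x \<in> N \<longrightarrow> ball x r \<subseteq> U) \<and> (x \<notin> N \<longrightarrow> x \<in> {b..c} \<longrightarrow>
        (\<forall>u v. x - r < u \<and> u \<le> x \<and> x \<le> v \<and> v < x + r \<longrightarrow> g v - g u \<le> (C + \<epsilon>) * (v - u)))" for x
    proof (cases "x \<in> N")
      case True
      then obtain r where "r > 0" "ball x r \<subseteq> U" using U openE by blast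
      then show ?thesis using True by blast
    next
      case False
      show ?thesis
      proof (cases "x \<in> {b..c}")
        case True
        then obtain d where d: "d \<le> C" "(g has_field_derivative d) (at x)" using der False by blast
        then have "(g has_derivative (\<lambda>h. d * h)) (at x)" by (simp add: has_field_derivative_def)
        then obtain r where r: "r > 0" "\<And>y. norm (y - x) < r \<Longrightarrow> norm (g y - g x - d * (y - x)) \<le> \<epsilon> * norm (y - x)"
          using \<epsilon> unfolding has_derivative_at_alt by blast
        have "g v - g u \<le> (C + \<epsilon>) * (v - u)" if "x - r < u" "u \<le> x" "x \<le> v" "v < x + r" for u v
        proof -
          have "g v - g x \<le> d * (v - x) + \<epsilon> * (v - x)" "g x - g u \<le> d * (x - u) + \<epsilon> * (x - u)"
            using r(2)[of v] r(2)[of u] that by (auto simp: algebra_simps abs_le_iff)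
          moreover have "d * (v - x) \<le> C * (v - x)" "d * (x - u) \<le> C * (x - u)"
            using d(1) that by (auto intro: mult_right_mono)
          ultimately show ?thesis by (simp add: algebra_simps)
        qed
        then show ?thesis using r(1) False by blast
      qed (use False in \<open>auto intro: exI[of _ 1]\<close>)
    qed
    then obtain r where r0: "\<And>x. r x > 0" and rN: "\<And>x. x \<in> N \<Longrightarrow> ball x (r x) \<subseteq> U"
      and rg: "\<And>x u v. x \<notin> N \<Longrightarrow> x \<in> {b..c} \<Longrightarrow> x - r x < u \<Longrightarrow> u \<le> x \<Longrightarrow> x \<le> v \<Longrightarrow> v < x + r x \<Longrightarrow>
        g v - g u \<le> (C + \<epsilon>) * (v - u)"
      by metis
    have gauge: "gauge (\<lambda>x. ball x (r x))" using r0 by (auto simp: gauge_def)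
    obtain p where p: "p tagged_division_of {b..c}" "(\<lambda>x. ball x (r x)) fine p"
      using fine_division_exists_real[OF gauge] by metis
    have pk: "\<exists>u v. u \<le> x \<and> x \<le> v \<and> k = {u..v} \<and> x \<in> {b..c} \<and> k \<subseteq> {b..c} \<and> k \<subseteq> ball x (r x)" if xk: "(x, k) \<in> p" for x k
    proof -
      obtain u v where "k = cbox u v" using tagged_division_ofD(4)[OF p(1) xk] by blast
      moreover have "x \<in> k" "k \<subseteq> {b..c}" using tagged_division_ofD(2,3)[OF p(1) xk] by auto
      moreover have "k \<subseteq> ball x (r x)" using p(2) xk by (auto simp: fine_def)
      ultimately show ?thesis by (auto simp: cbox_interval)
    qed
    define q where "q = {z \<in> p. fst z \<in> N}"
    have fin: "finite p" "finite q" using tagged_division_ofD(1)[OF p(1)] by (auto simp: q_def)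
    let ?d = "\<lambda>K. Sup K - Inf K" and ?g = "\<lambda>K. g (Sup K) - g (Inf K)"
    have tot: "g c - g b = (\<Sum>z\<in>p. ?g (snd z))"
      using additive_tagged_division_1[OF bc p(1), of g] by (simp add: case_prod_beta)
    have totl: "c - b = (\<Sum>z\<in>p. ?d (snd z))"
      using additive_tagged_division_1[OF bc p(1), of "\<lambda>x. x"] by (simp add: case_prod_beta)
    have "q tagged_partial_division_of {b..c}"
      using tagged_partial_division_subset[of p "{b..c}" q] p(1) by (auto simp: q_def tagged_division_of_def)
    then have qd: "q tagged_division_of \<Union>(snd ` q)" by (rule tagged_partial_division_of_Union_self)
    then have Dd: "(snd ` q) division_of \<Union>(snd ` q)" by (rule division_of_tagged_division)
    have DU: "\<Union>(snd ` q) \<subseteq> U" using pk rN by (force simp: q_def)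
    have Dbc: "\<Union>(snd ` q) \<subseteq> {b..c}" using pk by (force simp: q_def)
    have lenD: "(\<Sum>K\<in>snd ` q. ?d K) \<le> \<delta>"
      by (rule division_length_le[OF Dd DU U(1) Um]) (use \<delta> in simp)
    \<comment> \<open>Passage from a sum over tagged intervals to a sum over the intervals
      themselves. The lemma applied asks the summand to vanish on all degenerate boxes, the empty
      one included, hence \<open>h'\<close>.\<close>
    have over: "(\<Sum>z\<in>q. h (snd z)) = (\<Sum>K\<in>snd ` q. h K)" if h: "\<And>u. h {u} = 0" for h :: "real set \<Rightarrow> real"
    proof -
      define h' where "h' K = (if K = {} then 0 else h K)" for K
      have ne: "snd z \<noteq> {}" if "z \<in> q" for z using pk[of "fst z" "snd z"] that by (auto simp: q_def)
      have "(\<Sum>(x, K)\<in>q. h' K) = (\<Sum>K\<in>snd ` q. h' K)"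
      proof (rule sum.over_tagged_division_lemma[OF qd])
        fix u v :: real assume "box u v = {}"
        then have "cbox u v = {} \<or> cbox u v = {u}" by (auto simp: cbox_interval box_real)
        then show "h' (cbox u v) = 0" using h by (auto simp: h'_def)
      qed
      moreover have "(\<Sum>(x, K)\<in>q. h' K) = (\<Sum>z\<in>q. h (snd z))"
        unfolding case_prod_beta by (rule sum.cong) (use ne in \<open>auto simp: h'_def\<close>)
      moreover have "(\<Sum>K\<in>snd ` q. h' K) = (\<Sum>K\<in>snd ` q. h K)"
        by (rule sum.cong) (use ne in \<open>auto simp: h'_def\<close>)
      ultimately show ?thesis by simp
    qed
    have lenq: "(\<Sum>z\<in>q. ?d (snd z)) \<le> \<delta>" using over[of ?d] lenD by simp
    have lenq0: "0 \<le> (\<Sum>z\<in>q. ?d (snd z))"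
      by (rule sum_nonneg) (use pk in \<open>force simp: q_def\<close>)
    have "(\<Sum>z\<in>q. ?g (snd z)) \<le> (\<Sum>z\<in>q. \<bar>?g (snd z)\<bar>)" by (rule sum_mono) simp
    also have "\<dots> = (\<Sum>K\<in>snd ` q. \<bar>?g K\<bar>)" by (rule over) simp
    also have "\<dots> < \<epsilon>" using AC[OF Dd Dbc] lenD \<delta> by simp
    finally have sq: "(\<Sum>z\<in>q. ?g (snd z)) \<le> \<epsilon>" by simp
    have "(\<Sum>z\<in>p - q. ?g (snd z)) \<le> (\<Sum>z\<in>p - q. (C + \<epsilon>) * ?d (snd z))"
    proof (rule sum_mono)
      fix z assume z: "z \<in> p - q"
      then have zp: "(fst z, snd z) \<in> p" and zN: "fst z \<notin> N" by (auto simp: q_def)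
      obtain u v where uv: "u \<le> fst z" "fst z \<le> v" "snd z = {u..v}" "fst z \<in> {b..c}" "snd z \<subseteq> ball (fst z) (r (fst z))"
        using pk[OF zp] by blast
      have "u \<in> snd z" "v \<in> snd z" using uv(1-3) by auto
      then have "u \<in> ball (fst z) (r (fst z))" "v \<in> ball (fst z) (r (fst z))" using uv(5) by blast+
      then have "fst z - r (fst z) < u" "v < fst z + r (fst z)" using uv by (auto simp: dist_real_def)
      from rg[OF zN uv(4) this(1) uv(1,2) this(2)]
      show "?g (snd z) \<le> (C + \<epsilon>) * ?d (snd z)" using uv by simp
    qed
    also have "\<dots> = (C + \<epsilon>) * ((c - b) - (\<Sum>z\<in>q. ?d (snd z)))"
      unfolding totl sum_distrib_left[symmetric] by (subst sum_diff) (auto simp: fin q_def)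
    also have "\<dots> = (C + \<epsilon>) * (c - b) - (C + \<epsilon>) * (\<Sum>z\<in>q. ?d (snd z))" by (simp add: algebra_simps)
    also have "\<dots> \<le> (C + \<epsilon>) * (c - b) + \<bar>C + \<epsilon>\<bar> * \<delta>"
    proof -
      have "- (C + \<epsilon>) * (\<Sum>z\<in>q. ?d (snd z)) \<le> \<bar>C + \<epsilon>\<bar> * (\<Sum>z\<in>q. ?d (snd z))"
        using lenq0 by (intro mult_right_mono) auto
      also have "\<dots> \<le> \<bar>C + \<epsilon>\<bar> * \<delta>" using lenq by (intro mult_left_mono) auto
      finally show ?thesis by (simp add: algebra_simps)
    qed
    finally have sp: "(\<Sum>z\<in>p - q. ?g (snd z)) \<le> (C + \<epsilon>) * (c - b) + \<epsilon>" using \<delta>C by linarith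
    have "g c - g b = (\<Sum>z\<in>p - q. ?g (snd z)) + (\<Sum>z\<in>q. ?g (snd z))"
      unfolding tot by (rule sum.subset_diff) (auto simp: fin q_def)
    then show ?thesis using sp sq by (simp add: algebra_simps)
  qed
  show ?thesis
  proof (rule field_le_epsilon)
    fix e :: real assume "e > 0"
    then have "e / (c - b + 2) > 0" using bc by simp
    from main[OF this] show "g c - g b \<le> C * (c - b) + e" using bc by simp
  qed
qed

section \<open>Second derivatives at a spatial maximum\<close>

lemma has_derivative_partials:
  fixes g :: "real ^ 'n \<Rightarrow> real" and g' :: "'n \<Rightarrow> real ^ 'n \<Rightarrow> real"
  assumes d: "\<And>i x s. ((\<lambda>s. g (x + s *\<^sub>R axis i 1)) has_field_derivative g' i (x + s *\<^sub>R axis i 1)) (at s)"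
    and c: "\<And>i. continuous_on UNIV (g' i)"
  shows "(g has_derivative (\<lambda>h. \<Sum>i\<in>UNIV. g' i x * h $ i)) (at x)"
  unfolding has_derivative_at_alt
proof (intro conjI allI impI)
  show "bounded_linear (\<lambda>h :: real ^ 'n. \<Sum>i\<in>UNIV. g' i x * h $ i)"
    by (intro bounded_linear_sum bounded_linear_mult_right[THEN bounded_linear_compose] bounded_linear_vec_nth)
  fix e :: real assume e: "e > 0"
  define \<epsilon> where "\<epsilon> = e / real CARD('n)"
  have \<epsilon>: "\<epsilon> > 0" using e by (simp add: \<epsilon>_def)
  have "\<exists>r>0. \<forall>y. norm (y - x) < r \<longrightarrow> \<bar>g' i y - g' i x\<bar> < \<epsilon>" for i
    using c[of i] \<epsilon> unfolding continuous_on_iff by (auto simp: dist_norm)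
  then obtain r where r: "\<And>i. r i > 0" "\<And>i y. norm (y - x) < r i \<Longrightarrow> \<bar>g' i y - g' i x\<bar> < \<epsilon>" by metis
  define \<delta> where "\<delta> = Min (range r)"
  have \<delta>: "\<delta> > 0" using r(1) by (auto simp: \<delta>_def Min_gr_iff)
  have near: "\<bar>g' i y - g' i x\<bar> \<le> \<epsilon>" if "norm (y - x) < \<delta>" for i y
    using r(2)[of y i] that Min_le[of "range r" "r i"] by (auto simp: \<delta>_def less_imp_le)
  show "\<exists>d>0. \<forall>y. norm (y - x) < d \<longrightarrow>
      norm (g y - g x - (\<Sum>i\<in>UNIV. g' i x * (y - x) $ i)) \<le> e * norm (y - x)"
  proof (intro exI[of _ \<delta>] conjI \<delta> allI impI)
    fix y assume y: "norm (y - x) < \<delta>"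
    define h where "h = y - x"
    \<comment> \<open>The increment with only the coordinates in A switched on. Adding an index to A
      changes one coordinate: a one-dimensional mean value estimate at points that remain within
      distance |h| of x.\<close>
    define hA where "hA A = (\<chi> i. if i \<in> A then h $ i else 0)" for A
    have "\<bar>g (x + hA A) - g x - (\<Sum>i\<in>A. g' i x * h $ i)\<bar> \<le> real (card A) * (\<epsilon> * norm h)" for A :: "'n set"
    proof (induction A rule: finite_induct[OF finite])
      case 1
      have "hA {} = 0" by (simp add: hA_def vec_eq_iff)
      then show ?case by simp
    next
      case (2 k A)
      let ?\<phi> = "\<lambda>s. g ((x + hA A) + s *\<^sub>R axis k 1) - g' k x * s"
      have hins: "hA (insert k A) = hA A + (h $ k) *\<^sub>R axis k 1"
        using 2(2) by (auto simp: hA_def vec_eq_iff axis_def)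
      have "norm (?\<phi> (h $ k) - ?\<phi> 0) \<le> \<epsilon> * norm (h $ k - 0)"
      proof (rule field_differentiable_bound[where S="{- \<bar>h $ k\<bar>..\<bar>h $ k\<bar>}"])
        fix s assume s: "s \<in> {- \<bar>h $ k\<bar>..\<bar>h $ k\<bar>}"
        show "(?\<phi> has_field_derivative g' k ((x + hA A) + s *\<^sub>R axis k 1) - g' k x) (at s within {- \<bar>h $ k\<bar>..\<bar>h $ k\<bar>})"
          by (rule has_field_derivative_at_within) (auto intro!: derivative_eq_intros d)
        have "norm (hA A + s *\<^sub>R axis k 1) \<le> norm h"
          by (rule norm_le_componentwise_cart) (use s 2(2) in \<open>auto simp: hA_def axis_def\<close>)
        then show "norm (g' k ((x + hA A) + s *\<^sub>R axis k 1) - g' k x) \<le> \<epsilon>"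
          using y near[of "(x + hA A) + s *\<^sub>R axis k 1" k] by (simp add: h_def add.assoc)
      qed auto
      also have "\<dots> \<le> \<epsilon> * norm h" using component_le_norm_cart[of h k] \<epsilon> by simp
      finally have step: "\<bar>g (x + hA (insert k A)) - g (x + hA A) - g' k x * h $ k\<bar> \<le> \<epsilon> * norm h"
        by (simp add: hins add.assoc)
      have "\<bar>g (x + hA (insert k A)) - g x - (\<Sum>i\<in>insert k A. g' i x * h $ i)\<bar>
         \<le> \<epsilon> * norm h + real (card A) * (\<epsilon> * norm h)"
        using step 2(3) 2(1,2) by simp
      also have "\<dots> = real (card (insert k A)) * (\<epsilon> * norm h)" using 2(1,2) by (simp add: algebra_simps)
      finally show ?case .
    qed
    from this[of UNIV] have "\<bar>g (x + hA UNIV) - g x - (\<Sum>i\<in>UNIV. g' i x * h $ i)\<bar> \<le> e * norm h"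
      by (simp add: \<epsilon>_def)
    moreover have "x + hA UNIV = y" by (simp add: hA_def h_def vec_eq_iff)
    ultimately show "norm (g y - g x - (\<Sum>i\<in>UNIV. g' i x * (y - x) $ i)) \<le> e * norm (y - x)"
      by (simp add: h_def)
  qed
qed

text \<open>If D were positive, the first derivative, zero at 0, would be positive just to the
  right, and the mean value theorem would give a larger value there.\<close>

lemma second_derivative_at_max:
  fixes \<rho> :: "real \<Rightarrow> real"
  assumes d1: "\<And>s. (\<rho> has_field_derivative \<rho>' s) (at s)" and d2: "(\<rho>' has_field_derivative D) (at 0)"
    and max: "\<And>s. \<rho> s \<le> \<rho> 0"
  shows "D \<le> 0"
proof (rule ccontr)
  assume "\<not> D \<le> 0"
  then have "D > 0" by simp
  have z: "\<rho>' 0 = 0" by (rule DERIV_local_max[OF d1, of 1]) (use max in auto)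
  obtain d where d: "d > 0" "\<And>h. 0 < h \<Longrightarrow> h < d \<Longrightarrow> \<rho>' 0 < \<rho>' (0 + h)"
    using has_real_derivative_pos_inc_right[OF d2 \<open>D > 0\<close>] by auto
  obtain \<xi> where "0 < \<xi>" "\<xi> < d / 2" "\<rho> (d / 2) - \<rho> 0 = (d / 2 - 0) * \<rho>' \<xi>"
    using MVT2[of 0 "d / 2" \<rho> \<rho>'] d1 d(1) by auto
  moreover have "\<rho>' \<xi> > 0" using d(2)[of \<xi>] calculation d(1) z by simp
  ultimately have "\<rho> (d / 2) > \<rho> 0" using d(1) by (metis diff_gt_0_iff_gt diff_zero half_gt_zero mult_pos_pos)
  then show False using max[of "d / 2"] by simp
qed

text \<open>Second derivative of the penalised function along the line x1 + s \<xi>; the penalty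
  contributes 2 \<delta> |\<xi>|^2. For oblique directions \<xi> the axis derivatives are upgraded
  to total derivatives by \<open>has_derivative_partials\<close>.\<close>

lemma hessian_at_max:
  fixes g :: "real ^ 'n \<Rightarrow> real"
  assumes d1: "\<And>i x s. ((\<lambda>s. g (x + s *\<^sub>R axis i 1)) has_field_derivative g1 i (x + s *\<^sub>R axis i 1)) (at s)"
    and d2: "\<And>i j x s. ((\<lambda>s. g1 j (x + s *\<^sub>R axis i 1)) has_field_derivative g2 i j (x + s *\<^sub>R axis i 1)) (at s)"
    and c: "\<And>i. continuous_on UNIV (g1 i)" "\<And>i j. continuous_on UNIV (g2 i j)"
    and max: "\<And>x. g x - \<delta> * (norm x)\<^sup>2 \<le> g x1 - \<delta> * (norm x1)\<^sup>2"
  shows "(\<Sum>i\<in>UNIV. \<Sum>j\<in>UNIV. g2 i j x1 * \<xi> $ i * \<xi> $ j) \<le> 2 * \<delta> * (norm \<xi>)\<^sup>2"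
proof -
  let ?\<rho> = "\<lambda>s. g (x1 + s *\<^sub>R \<xi>) - \<delta> * (norm (x1 + s *\<^sub>R \<xi>))\<^sup>2"
  let ?\<rho>' = "\<lambda>s. (\<Sum>j\<in>UNIV. g1 j (x1 + s *\<^sub>R \<xi>) * \<xi> $ j) - \<delta> * (2 * (x1 \<bullet> \<xi>) + 2 * s * (\<xi> \<bullet> \<xi>))"
  have line: "((\<lambda>s. x1 + s *\<^sub>R \<xi>) has_derivative (\<lambda>h. h *\<^sub>R \<xi>)) (at s)" for s :: real
    by (auto intro!: derivative_eq_intros)
  have Dg: "((\<lambda>s. g (x1 + s *\<^sub>R \<xi>)) has_field_derivative (\<Sum>j\<in>UNIV. g1 j (x1 + s *\<^sub>R \<xi>) * \<xi> $ j)) (at s)" for s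
    unfolding has_field_derivative_def
    by (rule has_derivative_eq_rhs[OF has_derivative_compose[OF line has_derivative_partials[OF d1 c(1)]]])
      (simp add: fun_eq_iff sum_distrib_right sum_distrib_left mult_ac)
  have Dg1: "((\<lambda>s. g1 j (x1 + s *\<^sub>R \<xi>)) has_field_derivative (\<Sum>i\<in>UNIV. g2 i j (x1 + s *\<^sub>R \<xi>) * \<xi> $ i)) (at s)" for j s
    unfolding has_field_derivative_def
    by (rule has_derivative_eq_rhs[OF has_derivative_compose[OF line has_derivative_partials[OF d2 c(2)]]])
      (simp add: fun_eq_iff sum_distrib_right sum_distrib_left mult_ac)
  have n: "(norm (x1 + s *\<^sub>R \<xi>))\<^sup>2 = x1 \<bullet> x1 + 2 * s * (x1 \<bullet> \<xi>) + s\<^sup>2 * (\<xi> \<bullet> \<xi>)" for s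
    unfolding power2_norm_eq_inner
    by (simp add: inner_add_left inner_add_right inner_commute power2_eq_square algebra_simps)
  have 1: "(?\<rho> has_field_derivative ?\<rho>' s) (at s)" for s
    unfolding n by (auto intro!: derivative_eq_intros Dg simp: algebra_simps)
  have 2: "(?\<rho>' has_field_derivative ((\<Sum>j\<in>UNIV. (\<Sum>i\<in>UNIV. g2 i j (x1 + 0 *\<^sub>R \<xi>) * \<xi> $ i) * \<xi> $ j) - \<delta> * (2 * (\<xi> \<bullet> \<xi>)))) (at 0)"
    by (intro DERIV_diff DERIV_sum DERIV_cmult_right Dg1 DERIV_cmult) (auto intro!: derivative_eq_intros)
  have "(\<Sum>j\<in>UNIV. (\<Sum>i\<in>UNIV. g2 i j (x1 + 0 *\<^sub>R \<xi>) * \<xi> $ i) * \<xi> $ j) - \<delta> * (2 * (\<xi> \<bullet> \<xi>)) \<le> 0"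
    by (rule second_derivative_at_max[OF 1 2]) (use max in simp)
  moreover have "(\<Sum>j\<in>UNIV. (\<Sum>i\<in>UNIV. g2 i j x1 * \<xi> $ i) * \<xi> $ j) = (\<Sum>i\<in>UNIV. \<Sum>j\<in>UNIV. g2 i j x1 * \<xi> $ i * \<xi> $ j)"
    by (subst sum.swap) (simp add: sum_distrib_right)
  ultimately show ?thesis by (simp add: dot_square_norm)
qed

text \<open>Write A = S S with S symmetric: the left side is the sum of the quadratic form of H over
  the rows of S, and the squared norms of the rows add up to the trace of A.\<close>

lemma trace_product_le:
  fixes A :: "real ^ 'n ^ 'n"
  assumes A: "posdef A" and H: "\<And>\<xi> :: real ^ 'n. (\<Sum>i\<in>UNIV. \<Sum>j\<in>UNIV. H i j * \<xi> $ i * \<xi> $ j) \<le> c * (norm \<xi>)\<^sup>2"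
  shows "(\<Sum>i\<in>UNIV. \<Sum>j\<in>UNIV. A $ i $ j * H i j) \<le> c * (\<Sum>i\<in>UNIV. A $ i $ i)"
proof -
  obtain S where S: "posdef S" "S ** S = A" using posdef_sqrt_exists[OF A] .
  have sym: "S $ i $ j = S $ j $ i" for i j
  proof -
    have "transpose S $ j $ i = S $ j $ i" using S(1) by (simp add: posdef_def)
    then show ?thesis by (simp add: transpose_def)
  qed
  have Aij: "A $ i $ j = (\<Sum>k\<in>UNIV. S $ k $ i * S $ k $ j)" for i j
  proof -
    have "A $ i $ j = (\<Sum>k\<in>UNIV. S $ i $ k * S $ k $ j)"
      unfolding S(2)[symmetric] matrix_matrix_mult_def by simp
    also have "\<dots> = (\<Sum>k\<in>UNIV. S $ k $ i * S $ k $ j)"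
      by (rule sum.cong[OF refl]) (simp only: sym[of i])
    finally show ?thesis .
  qed
  have "(\<Sum>i\<in>UNIV. \<Sum>j\<in>UNIV. A $ i $ j * H i j) = (\<Sum>i\<in>UNIV. \<Sum>j\<in>UNIV. \<Sum>k\<in>UNIV. H i j * S $ k $ i * S $ k $ j)"
    unfolding Aij sum_distrib_right by (intro sum.cong refl) (simp only: mult_ac)
  also have "\<dots> = (\<Sum>i\<in>UNIV. \<Sum>k\<in>UNIV. \<Sum>j\<in>UNIV. H i j * S $ k $ i * S $ k $ j)"
    by (rule sum.cong[OF refl]) (rule sum.swap)
  also have "\<dots> = (\<Sum>k\<in>UNIV. \<Sum>i\<in>UNIV. \<Sum>j\<in>UNIV. H i j * S $ k $ i * S $ k $ j)"
    by (rule sum.swap)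
  also have "\<dots> \<le> (\<Sum>k\<in>UNIV. c * (norm (S $ k))\<^sup>2)" by (rule sum_mono) (rule H)
  also have "\<dots> = c * (\<Sum>k\<in>UNIV. \<Sum>i\<in>UNIV. S $ k $ i * S $ k $ i)"
    by (simp add: sum_distrib_left dot_square_norm[symmetric] inner_vec_def)
  also have "(\<Sum>k\<in>UNIV. \<Sum>i\<in>UNIV. S $ k $ i * S $ k $ i) = (\<Sum>i\<in>UNIV. A $ i $ i)"
    by (subst sum.swap) (simp add: Aij)
  finally show ?thesis .
qed

text \<open>Cauchy-Schwarz for the inner product <u, A v>, realised through the square root of A,
  together with the upper bound on the diagonal entries.\<close>

lemma ell_entry_bound:
  fixes A :: "real ^ 'n ^ 'n"
  assumes A: "ell \<alpha> \<beta> A" and "\<alpha> > 0"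
  shows "\<bar>A $ i $ j\<bar> \<le> \<beta>"
proof -
  obtain S where S: "posdef S" "S ** S = A" using posdef_sqrt_exists[OF ell_posdef[OF assms]] .
  have symS: "transpose S = S" using S(1) by (simp add: posdef_def)
  have SS: "(S *v u) \<bullet> (S *v v) = u \<bullet> (A *v v)" for u v
    by (simp add: symmetric_matrix_inner[OF symS] matrix_vector_mul_assoc S(2))
  have n: "norm (S *v axis k 1) \<le> sqrt \<beta>" for k
  proof (rule real_le_rsqrt)
    have "(norm (S *v axis k 1))\<^sup>2 = (A *v axis k 1) \<bullet> axis k 1" by (simp add: dot_square_norm[symmetric] SS inner_commute)
    also have "\<dots> \<le> \<beta> * (norm (axis k (1::real) :: real ^ 'n))\<^sup>2" using A unfolding ell_def by blast
    finally show "(norm (S *v axis k 1))\<^sup>2 \<le> \<beta>" by simp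
  qed
  have "0 \<le> \<beta>"
  proof -
    have "\<alpha> * (norm (axis i (1::real) :: real ^ 'n))\<^sup>2 \<le> \<beta> * (norm (axis i (1::real) :: real ^ 'n))\<^sup>2"
      using A unfolding ell_def by (meson order_trans)
    then have "\<alpha> \<le> \<beta>" by simp
    then show ?thesis using \<open>\<alpha> > 0\<close> by linarith
  qed
  have "A $ i $ j = axis i 1 \<bullet> (A *v axis j 1)"
    by (simp add: matrix_vector_mult_basis column_def inner_axis')
  also have "\<dots> = (S *v axis i 1) \<bullet> (S *v axis j 1)" by (simp add: SS)
  also have "\<bar>\<dots>\<bar> \<le> norm (S *v axis i 1) * norm (S *v axis j 1)" by (rule Cauchy_Schwarz_ineq2)
  also have "\<dots> \<le> sqrt \<beta> * sqrt \<beta>" using \<open>0 \<le> \<beta>\<close> by (intro mult_mono n) auto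
  also have "\<dots> = \<beta>" using \<open>0 \<le> \<beta>\<close> by simp
  finally show ?thesis .
qed

lemma loc_abs_cont_diff:
  assumes "loc_abs_cont g" "loc_abs_cont h"
  shows "loc_abs_cont (\<lambda>t. g t - h t)"
  unfolding loc_abs_cont_def
proof (intro allI impI)
  fix b c \<epsilon> :: real assume "\<epsilon> > 0"
  then have e: "\<epsilon> / 2 > 0" by simp
  from assms(1)[unfolded loc_abs_cont_def, THEN spec, THEN spec, THEN spec, THEN mp, OF e, of b c]
  obtain d1 where d1: "d1 > 0 \<and> (\<forall>D. D division_of \<Union>D \<and> \<Union>D \<subseteq> {b..c} \<and> (\<Sum>K\<in>D. Sup K - Inf K) < d1 \<longrightarrow>
        (\<Sum>K\<in>D. \<bar>g (Sup K) - g (Inf K)\<bar>) < \<epsilon> / 2)"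
    by (rule exE)
  from assms(2)[unfolded loc_abs_cont_def, THEN spec, THEN spec, THEN spec, THEN mp, OF e, of b c]
  obtain d2 where d2: "d2 > 0 \<and> (\<forall>D. D division_of \<Union>D \<and> \<Union>D \<subseteq> {b..c} \<and> (\<Sum>K\<in>D. Sup K - Inf K) < d2 \<longrightarrow>
        (\<Sum>K\<in>D. \<bar>h (Sup K) - h (Inf K)\<bar>) < \<epsilon> / 2)"
    by (rule exE)
  show "\<exists>\<delta>>0. \<forall>D. D division_of \<Union>D \<and> \<Union>D \<subseteq> {b..c} \<and> (\<Sum>K\<in>D. Sup K - Inf K) < \<delta> \<longrightarrow>
        (\<Sum>K\<in>D. \<bar>g (Sup K) - h (Sup K) - (g (Inf K) - h (Inf K))\<bar>) < \<epsilon>"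
  proof (intro exI[of _ "min d1 d2"] conjI allI impI)
    fix D assume D: "D division_of \<Union>D \<and> \<Union>D \<subseteq> {b..c} \<and> (\<Sum>K\<in>D. Sup K - Inf K) < min d1 d2"
    have "(\<Sum>K\<in>D. \<bar>g (Sup K) - h (Sup K) - (g (Inf K) - h (Inf K))\<bar>)
      \<le> (\<Sum>K\<in>D. \<bar>g (Sup K) - g (Inf K)\<bar> + \<bar>h (Sup K) - h (Inf K)\<bar>)"
      by (rule sum_mono) linarith
    also have "\<dots> < \<epsilon>"
      using d1[THEN conjunct2, THEN spec, of D] d2[THEN conjunct2, THEN spec, of D] D by (simp add: sum.distrib)
    finally show "(\<Sum>K\<in>D. \<bar>g (Sup K) - h (Sup K) - (g (Inf K) - h (Inf K))\<bar>) < \<epsilon>" .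
  qed (use d1 d2 in simp)
qed

lemma has_partial_derivative:
  assumes "\<And>x. has_partial i g x"
  shows "((\<lambda>s. g (x + s *\<^sub>R axis i 1)) has_field_derivative partial i g (x + s *\<^sub>R axis i 1)) (at s)"
proof -
  have "((\<lambda>h. g ((x + s *\<^sub>R axis i 1) + h *\<^sub>R axis i 1)) has_field_derivative partial i g (x + s *\<^sub>R axis i 1)) (at 0)"
    using assms[of "x + s *\<^sub>R axis i 1"] unfolding has_partial_def partial_def
    by (simp add: DERIV_deriv_iff_real_differentiable)
  then have "((\<lambda>h. g (x + (h + s) *\<^sub>R axis i 1)) has_field_derivative partial i g (x + s *\<^sub>R axis i 1)) (at 0)"
    by (simp add: algebra_simps)
  then show ?thesis using DERIV_shift[of "\<lambda>s. g (x + s *\<^sub>R axis i 1)" _ 0 s] by simp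
qed

lemma classical_solution_diff:
  fixes u v :: "real \<times> (real ^ 'n) \<Rightarrow> real"
  assumes u: "classical_solution a f u" and v: "classical_solution a f v"
  shows "classical_solution a (\<lambda>_. 0) (\<lambda>z. u z - v z)"
proof -
  note U = u[unfolded classical_solution_def] and V = v[unfolded classical_solution_def]
  have up: "has_partial i (\<lambda>z. u (t, z)) x" and vp: "has_partial i (\<lambda>z. v (t, z)) x" for i t x
    using U V by blast+
  have up2: "has_partial i (partial j (\<lambda>z. u (t, z))) x" and vp2: "has_partial i (partial j (\<lambda>z. v (t, z))) x" for i j t x
    using U V by blast+
  have d1: "((\<lambda>s. u (t, x + s *\<^sub>R axis i 1) - v (t, x + s *\<^sub>R axis i 1)) has_field_derivative
      partial i (\<lambda>z. u (t, z)) x - partial i (\<lambda>z. v (t, z)) x) (at 0)" for i t x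
    using DERIV_diff[OF has_partial_derivative[where g="\<lambda>z. u (t, z)" and i=i and x=x and s=0, OF up]
        has_partial_derivative[where g="\<lambda>z. v (t, z)" and i=i and x=x and s=0, OF vp]] by simp
  have p1: "partial i (\<lambda>z. u (t, z) - v (t, z)) = (\<lambda>x. partial i (\<lambda>z. u (t, z)) x - partial i (\<lambda>z. v (t, z)) x)" for i t
    by (rule ext) (rule partial_eqI(2)[OF d1])
  have d2: "((\<lambda>s. partial j (\<lambda>z. u (t, z)) (x + s *\<^sub>R axis i 1) - partial j (\<lambda>z. v (t, z)) (x + s *\<^sub>R axis i 1)) has_field_derivative
      partial i (partial j (\<lambda>z. u (t, z))) x - partial i (partial j (\<lambda>z. v (t, z))) x) (at 0)" for i j t x
    using DERIV_diff[OF has_partial_derivative[where g="partial j (\<lambda>z. u (t, z))" and i=i and x=x and s=0, OF up2]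
        has_partial_derivative[where g="partial j (\<lambda>z. v (t, z))" and i=i and x=x and s=0, OF vp2]] by simp
  have p2: "partial i (partial j (\<lambda>z. u (t, z) - v (t, z))) = (\<lambda>x. partial i (partial j (\<lambda>z. u (t, z))) x - partial i (partial j (\<lambda>z. v (t, z))) x)" for i j t
    unfolding p1 by (rule ext) (rule partial_eqI(2)[OF d2])
  show ?thesis
    unfolding classical_solution_def
  proof (intro conjI allI)
    show "continuous_on UNIV (\<lambda>z. u z - v z)" using U V by (intro continuous_on_diff) blast+
    show "has_partial i (\<lambda>z. u (t, z) - v (t, z)) x" for i t x by (rule partial_eqI(1)[OF d1])
    show "continuous_on UNIV (\<lambda>(t, x). partial i (\<lambda>z. u (t, z) - v (t, z)) x)" for i
    proof -
      have "continuous_on UNIV (\<lambda>(t, x). partial i (\<lambda>z. u (t, z)) x)" "continuous_on UNIV (\<lambda>(t, x). partial i (\<lambda>z. v (t, z)) x)"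
        using U V by blast+
      from continuous_on_diff[OF this] show ?thesis by (simp add: p1 case_prod_beta)
    qed
    show "has_partial i (partial j (\<lambda>z. u (t, z) - v (t, z))) x" for i j t x
      unfolding p1 by (rule partial_eqI(1)[OF d2])
    show "continuous_on UNIV (\<lambda>(t, x). partial i (partial j (\<lambda>z. u (t, z) - v (t, z))) x)" for i j
    proof -
      have "continuous_on UNIV (\<lambda>(t, x). partial i (partial j (\<lambda>z. u (t, z))) x)" "continuous_on UNIV (\<lambda>(t, x). partial i (partial j (\<lambda>z. v (t, z))) x)"
        using U V by blast+
      from continuous_on_diff[OF this] show ?thesis by (simp add: p2 case_prod_beta)
    qed
    show "loc_abs_cont (\<lambda>t. u (t, x) - v (t, x))" for x using U V by (intro loc_abs_cont_diff) blast+
    have AEu: "AE t in lebesgue. \<forall>x. (\<lambda>s. u (s, x)) differentiable at t \<and>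
        deriv (\<lambda>s. u (s, x)) t - (\<Sum>i\<in>UNIV. \<Sum>j\<in>UNIV. a t $ i $ j * partial i (partial j (\<lambda>z. u (t, z))) x) + u (t, x) = f (t, x)"
      and AEv: "AE t in lebesgue. \<forall>x. (\<lambda>s. v (s, x)) differentiable at t \<and>
        deriv (\<lambda>s. v (s, x)) t - (\<Sum>i\<in>UNIV. \<Sum>j\<in>UNIV. a t $ i $ j * partial i (partial j (\<lambda>z. v (t, z))) x) + v (t, x) = f (t, x)"
      using U V by blast+
    show "AE t in lebesgue. \<forall>x. (\<lambda>s. u (s, x) - v (s, x)) differentiable at t \<and>
        deriv (\<lambda>s. u (s, x) - v (s, x)) t
          - (\<Sum>i\<in>UNIV. \<Sum>j\<in>UNIV. a t $ i $ j * partial i (partial j (\<lambda>z. u (t, z) - v (t, z))) x)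
          + (u (t, x) - v (t, x)) = 0"
      using AEu AEv
    proof eventually_elim
      case (elim t)
      show ?case
      proof
        fix x
        have du: "((\<lambda>s. u (s, x)) has_field_derivative deriv (\<lambda>s. u (s, x)) t) (at t)"
          and dv: "((\<lambda>s. v (s, x)) has_field_derivative deriv (\<lambda>s. v (s, x)) t) (at t)"
          using elim by (auto simp: DERIV_deriv_iff_real_differentiable)
        note d = DERIV_diff[OF du dv]
        have "(\<lambda>s. u (s, x) - v (s, x)) differentiable at t" using d by (auto simp: real_differentiable_def)
        moreover have sw: "(\<Sum>i\<in>UNIV. \<Sum>j\<in>UNIV. a t $ i $ j * partial i (partial j (\<lambda>z. u (t, z) - v (t, z))) x)
          = (\<Sum>i\<in>UNIV. \<Sum>j\<in>UNIV. a t $ i $ j * partial i (partial j (\<lambda>z. u (t, z))) x)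
          - (\<Sum>i\<in>UNIV. \<Sum>j\<in>UNIV. a t $ i $ j * partial i (partial j (\<lambda>z. v (t, z))) x)"
          by (simp add: p2 right_diff_distrib sum_subtractf)
        moreover have "deriv (\<lambda>s. u (s, x)) t - (\<Sum>i\<in>UNIV. \<Sum>j\<in>UNIV. a t $ i $ j * partial i (partial j (\<lambda>z. u (t, z))) x) + u (t, x) = f (t, x)"
          "deriv (\<lambda>s. v (s, x)) t - (\<Sum>i\<in>UNIV. \<Sum>j\<in>UNIV. a t $ i $ j * partial i (partial j (\<lambda>z. v (t, z))) x) + v (t, x) = f (t, x)"
          using elim by blast+
        ultimately show "(\<lambda>s. u (s, x) - v (s, x)) differentiable at t \<and>
        deriv (\<lambda>s. u (s, x) - v (s, x)) t
          - (\<Sum>i\<in>UNIV. \<Sum>j\<in>UNIV. a t $ i $ j * partial i (partial j (\<lambda>z. u (t, z) - v (t, z))) x)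
          + (u (t, x) - v (t, x)) = 0"
          unfolding DERIV_imp_deriv[OF d] by (intro conjI) (assumption, linarith)
      qed
    qed
  qed
qed

context primitive_coeff
begin

text \<open>The perturbation \<open>w - \<delta>\<bar>x\<bar>\<^sup>2 - \<delta>\<bar>t\<bar>\<close> attains its maximum, say at \<open>(t\<^sub>1, x\<^sub>1)\<close>. The equation need
  not hold at time \<open>t\<^sub>1\<close>, but the Hessian of \<open>w\<close> is still almost nonpositive at \<open>x\<^sub>1\<close> shortly before
  \<open>t\<^sub>1\<close>, so \<open>w(\<cdot>, x\<^sub>1)\<close> decreases there too fast.\<close>

lemma bounded_solution_nonpos:
  fixes w :: "real \<times> (real ^ 'n) \<Rightarrow> real"
  assumes bw: "\<And>z. \<bar>w z\<bar> \<le> Mb" and cs: "classical_solution a (\<lambda>_. 0) w"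
  shows "w z0 \<le> 0"
proof (rule ccontr)
  assume "\<not> w z0 \<le> 0"
  then have m0: "w z0 > 0" by simp
  define m where "m = w z0"
  have m: "m > 0" using m0 by (simp add: m_def)
  note W = cs[unfolded classical_solution_def]
  have wc: "continuous_on UNIV w" using W by blast
  have wp: "has_partial i (\<lambda>z. w (t, z)) x" for i t x using W by blast
  have wp2: "has_partial i (partial j (\<lambda>z. w (t, z))) x" for i j t x using W by blast
  have wpc: "continuous_on UNIV (\<lambda>(t, x). partial i (\<lambda>z. w (t, z)) x)" for i using W by blast
  have wpc2: "continuous_on UNIV (\<lambda>(t, x). partial i (partial j (\<lambda>z. w (t, z))) x)" for i j using W by blast
  have wac: "loc_abs_cont (\<lambda>t. w (t, x))" for x using W by blast
  have wAE: "AE t in lebesgue. \<forall>x. (\<lambda>s. w (s, x)) differentiable at t \<and>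
        deriv (\<lambda>s. w (s, x)) t - (\<Sum>i\<in>UNIV. \<Sum>j\<in>UNIV. a t $ i $ j * partial i (partial j (\<lambda>z. w (t, z))) x) + w (t, x) = 0"
    using W by blast
  define n where "n = real CARD('n)"
  have n0: "n \<ge> 0" by (simp add: n_def)
  \<comment> \<open>\<delta> C1 is the room needed for the diffusion term: 2 \<delta> times the
    trace of a, at most n / l, plus n^2 entries of size at most 1 / l times an error \<delta> in the
    Hessian.\<close>
  define C1 where "C1 = (2 * n + n * n) / l"
  have C1: "C1 \<ge> 0" using n0 l_pos by (simp add: C1_def)
  define q where "q z = \<bar>fst z\<bar> + (norm (snd z))\<^sup>2" for z :: "real \<times> (real ^ 'n)"
  have q0: "q z \<ge> 0" for z by (simp add: q_def)
  \<comment> \<open>The first entry lets the penalty cost at most half of w(z0) = m at z0; the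
    second makes \<delta> and \<delta> C1 at most m / 16, small against w > m / 4 near the
    maximum.\<close>
  define \<delta> where "\<delta> = min (m / (2 * (q z0 + 1))) (m / (16 * (C1 + 1)))"
  have \<delta>: "\<delta> > 0" using m q0[of z0] C1 by (simp add: \<delta>_def)
  have \<delta>1: "\<delta> * q z0 \<le> m / 2"
  proof -
    have "\<delta> * q z0 \<le> (m / (2 * (q z0 + 1))) * (q z0 + 1)"
      using \<delta> q0[of z0] m by (intro mult_mono) (auto simp: \<delta>_def)
    also have "\<dots> = m / 2" using q0[of z0] by (simp add: field_simps)
    finally show ?thesis .
  qed
  have \<delta>2: "\<delta> * (C1 + 1) \<le> m / 16"
  proof -
    have "\<delta> * (C1 + 1) \<le> (m / (16 * (C1 + 1))) * (C1 + 1)"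
      using C1 by (intro mult_right_mono) (auto simp: \<delta>_def)
    also have "\<dots> = m / 16" using C1 by (simp add: field_simps)
    finally show ?thesis .
  qed
  have "0 \<le> \<delta> * C1" using \<delta> C1 by simp
  then have \<delta>C: "\<delta> * C1 \<le> m / 16" "\<delta> \<le> m / 16" using \<delta>2 \<delta> unfolding distrib_left by linarith+
  define \<zeta> where "\<zeta> z = w z - \<delta> * q z" for z
  have \<zeta>0: "\<zeta> z0 \<ge> m / 2" using \<delta>1 by (simp add: \<zeta>_def m_def)
  \<comment> \<open>Since |z| \<le> 1 + q z, beyond this radius the penalty exceeds the bound
    \<open>Mb\<close> of w.\<close>
  define R where "R = 1 + Mb / \<delta>"
  have far: "\<zeta> z < 0" if "norm z > R" for z
  proof -
    obtain t x where z: "z = (t, x)" by (cases z)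
    have "norm z \<le> \<bar>t\<bar> + norm x" using norm_Pair_le[of t x] by (simp add: z)
    also have "norm x \<le> 1 + (norm x)\<^sup>2"
    proof -
      have "0 \<le> (norm x - 1)\<^sup>2" by simp
      then have "2 * norm x \<le> 1 + (norm x)\<^sup>2" by (simp add: power2_eq_square algebra_simps)
      then show ?thesis using norm_ge_zero[of x] by linarith
    qed
    finally have "R < 1 + q z" using that by (simp add: z q_def)
    then have "Mb / \<delta> < q z" by (simp add: R_def)
    then have "Mb < \<delta> * q z" using \<delta> by (simp add: divide_less_eq mult.commute)
    then show ?thesis using bw[of z] by (simp add: \<zeta>_def)
  qed
  have z0R: "z0 \<in> cball 0 R" using far[of z0] \<zeta>0 m by (force simp: not_less)
  have \<zeta>c: "continuous_on (cball 0 R) \<zeta>"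
    unfolding \<zeta>_def q_def by (intro continuous_intros continuous_on_subset[OF wc]) auto
  obtain z1 where z1: "\<And>z. z \<in> cball 0 R \<Longrightarrow> \<zeta> z \<le> \<zeta> z1"
    using continuous_attains_sup[OF compact_cball _ \<zeta>c] z0R by blast
  have max: "\<zeta> z \<le> \<zeta> z1" for z
  proof (cases "z \<in> cball 0 R")
    case False
    then have "\<zeta> z < 0" by (intro far) simp
    then show ?thesis using z1[OF z0R] \<zeta>0 m by linarith
  qed (rule z1)
  obtain t1 x1 where tx: "z1 = (t1, x1)" by (cases z1)
  have w1: "w (t1, x1) \<ge> m / 2"
  proof -
    have "m / 2 \<le> \<zeta> z1" using max[of z0] \<zeta>0 by linarith
    moreover have "0 \<le> \<delta> * q z1" using \<delta> q0 by simp
    ultimately show ?thesis by (simp add: \<zeta>_def tx)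
  qed
  let ?H = "\<lambda>t i j. partial i (partial j (\<lambda>z. w (t, z))) x1"
  \<comment> \<open>On the slice t = t1 the penalty in time is constant, so the maximum in x is one
    of w - \<delta> |x|^2.\<close>
  have hess: "(\<Sum>i\<in>UNIV. \<Sum>j\<in>UNIV. ?H t1 i j * \<xi> $ i * \<xi> $ j) \<le> 2 * \<delta> * (norm \<xi>)\<^sup>2" for \<xi>
  proof (rule hessian_at_max[where g="\<lambda>z. w (t1, z)" and \<delta>=\<delta> and ?g1.0="\<lambda>i. partial i (\<lambda>z. w (t1, z))" and ?g2.0="\<lambda>i j. partial i (partial j (\<lambda>z. w (t1, z)))"])
    show "((\<lambda>s. w (t1, x + s *\<^sub>R axis i 1)) has_field_derivative partial i (\<lambda>z. w (t1, z)) (x + s *\<^sub>R axis i 1)) (at s)" for i x s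
      by (rule has_partial_derivative[OF wp])
    show "((\<lambda>s. partial j (\<lambda>z. w (t1, z)) (x + s *\<^sub>R axis i 1)) has_field_derivative partial i (partial j (\<lambda>z. w (t1, z))) (x + s *\<^sub>R axis i 1)) (at s)" for i j x s
      by (rule has_partial_derivative[OF wp2])
    show "continuous_on UNIV (partial i (\<lambda>z. w (t1, z)))" for i
      using continuous_on_compose2[OF wpc[of i], of UNIV "\<lambda>x. (t1, x)"] by (simp add: continuous_intros)
    show "continuous_on UNIV (partial i (partial j (\<lambda>z. w (t1, z))))" for i j
      using continuous_on_compose2[OF wpc2[of i j], of UNIV "\<lambda>x. (t1, x)"] by (simp add: continuous_intros)
    show "w (t1, x) - \<delta> * (norm x)\<^sup>2 \<le> w (t1, x1) - \<delta> * (norm x1)\<^sup>2" for x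
      using max[of "(t1, x)"] by (simp add: \<zeta>_def q_def tx algebra_simps)
  qed
  have ev1: "\<forall>\<^sub>F t in nhds t1. w (t, x1) > m / 4"
  proof -
    have "isCont (\<lambda>t. w (t, x1)) t1"
      using continuous_on_compose2[OF wc, of UNIV "\<lambda>t. (t, x1)"] by (simp add: continuous_intros continuous_on_eq_continuous_at)
    then have "((\<lambda>t. w (t, x1)) \<longlongrightarrow> w (t1, x1)) (nhds t1)"
      using tendsto_at_iff_tendsto_nhds[of "\<lambda>t. w (t, x1)" t1] by (simp add: isCont_def)
    then show ?thesis by (rule order_tendstoD(1)) (use w1 m in simp)
  qed
  have ev2: "\<forall>\<^sub>F t in nhds t1. \<forall>i j. \<bar>?H t i j - ?H t1 i j\<bar> \<le> \<delta>"
  proof -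
    have "\<forall>\<^sub>F t in nhds t1. \<bar>?H t i j - ?H t1 i j\<bar> \<le> \<delta>" for i j
    proof -
      have "isCont (\<lambda>t. ?H t i j) t1"
        using continuous_on_compose2[OF wpc2[of i j], of UNIV "\<lambda>t. (t, x1)"] by (simp add: continuous_intros continuous_on_eq_continuous_at)
      then have "((\<lambda>t. ?H t i j) \<longlongrightarrow> ?H t1 i j) (nhds t1)"
        using tendsto_at_iff_tendsto_nhds[of "\<lambda>t. ?H t i j" t1] by (simp add: isCont_def)
      from tendstoD[OF this \<delta>] show ?thesis by eventually_elim (simp add: dist_real_def)
    qed
    then have "\<forall>\<^sub>F t in nhds t1. \<forall>i\<in>UNIV. \<forall>j\<in>UNIV. \<bar>?H t i j - ?H t1 i j\<bar> \<le> \<delta>"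
      by (intro eventually_ball_finite finite ballI)
    then show ?thesis by simp
  qed
  \<comment> \<open>Both w and its Hessian are continuous in t, so these facts persist on an
    interval before t1, where the equation is available at almost every time.\<close>
  from eventually_conj[OF ev1 ev2] obtain d where d: "d > 0"
    "\<And>t. dist t t1 < d \<Longrightarrow> w (t, x1) > m / 4 \<and> (\<forall>i j. \<bar>?H t i j - ?H t1 i j\<bar> \<le> \<delta>)"
    unfolding eventually_nhds_metric by blast
  define h where "h = d / 2"
  have h: "h > 0" using d(1) by (simp add: h_def)
  define Q where "Q t \<longleftrightarrow> (\<forall>x. (\<lambda>s. w (s, x)) differentiable at t \<and>
        deriv (\<lambda>s. w (s, x)) t - (\<Sum>i\<in>UNIV. \<Sum>j\<in>UNIV. a t $ i $ j * partial i (partial j (\<lambda>z. w (t, z))) x) + w (t, x) = 0)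
      \<and> good_time t" for t
  have "AE t in lebesgue. Q t" using eventually_conj[OF wAE AE_good_time] by (simp add: Q_def)
  then obtain N where NQ: "{t \<in> space lebesgue. \<not> Q t} \<subseteq> N" "emeasure lebesgue N = 0" "N \<in> sets lebesgue"
    by (rule AE_E)
  have N: "N \<in> null_sets lebesgue" using NQ(2,3) by (rule null_setsI)
  \<comment> \<open>The slope is m / 16 - m / 4: the diffusion term is at most \<delta> C1 \<le> m /
    16, and the zero-order term w exceeds m / 4 on this time interval.\<close>
  have "w (t1, x1) - w (t1 - h, x1) \<le> - (3 * m / 16) * (t1 - (t1 - h))"
  proof (rule loc_abs_cont_increment_le[OF wac N])
    show "t1 - h \<le> t1" using h by simp
    fix t assume t: "t \<in> {t1 - h..t1}" "t \<notin> N"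
    then have "dist t t1 < d" using h by (auto simp: dist_real_def h_def)
    from d(2)[OF this] have wt: "w (t, x1) > m / 4" and Ht: "\<And>i j. \<bar>?H t i j - ?H t1 i j\<bar> \<le> \<delta>" by auto
    have eq: "(\<lambda>s. w (s, x1)) differentiable at t"
      "deriv (\<lambda>s. w (s, x1)) t - (\<Sum>i\<in>UNIV. \<Sum>j\<in>UNIV. a t $ i $ j * ?H t i j) + w (t, x1) = 0" and gt: "good_time t"
    proof -
      have "Q t" using NQ(1) t(2) by auto
      then show "(\<lambda>s. w (s, x1)) differentiable at t"
        "deriv (\<lambda>s. w (s, x1)) t - (\<Sum>i\<in>UNIV. \<Sum>j\<in>UNIV. a t $ i $ j * ?H t i j) + w (t, x1) = 0" "good_time t"
        by (auto simp: Q_def)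
    qed
    have at: "ell l (1 / l) (a t)" using gt by (simp add: good_time_def)
    have ab: "\<bar>a t $ i $ j\<bar> \<le> 1 / l" for i j by (rule ell_entry_bound[OF at l_pos])
    have "(\<Sum>i\<in>UNIV. \<Sum>j\<in>UNIV. a t $ i $ j * ?H t i j)
      = (\<Sum>i\<in>UNIV. \<Sum>j\<in>UNIV. a t $ i $ j * ?H t1 i j) + (\<Sum>i\<in>UNIV. \<Sum>j\<in>UNIV. a t $ i $ j * (?H t i j - ?H t1 i j))"
      by (simp add: sum.distrib[symmetric] distrib_left[symmetric])
    also have "\<dots> \<le> 2 * \<delta> * (\<Sum>i\<in>UNIV. a t $ i $ i) + (\<Sum>i\<in>(UNIV::'n set). \<Sum>j\<in>(UNIV::'n set). 1 / l * \<delta>)"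
    proof (intro add_mono trace_product_le[OF ell_posdef[OF at l_pos] hess] sum_mono)
      fix i j
      have "a t $ i $ j * (?H t i j - ?H t1 i j) \<le> \<bar>a t $ i $ j\<bar> * \<bar>?H t i j - ?H t1 i j\<bar>"
        by (simp flip: abs_mult)
      also have "\<dots> \<le> 1 / l * \<delta>" using l_pos by (intro mult_mono ab Ht) auto
      finally show "a t $ i $ j * (?H t i j - ?H t1 i j) \<le> 1 / l * \<delta>" .
    qed
    also have "\<dots> \<le> 2 * \<delta> * (\<Sum>i\<in>(UNIV::'n set). 1 / l) + (\<Sum>i\<in>(UNIV::'n set). \<Sum>j\<in>(UNIV::'n set). 1 / l * \<delta>)"
      using \<delta> ab l_pos by (intro add_mono mult_left_mono sum_mono) (auto simp: abs_le_iff less_imp_le)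
    also have "\<dots> = \<delta> * C1" using l_pos by (simp add: C1_def n_def field_simps)
    finally have "deriv (\<lambda>s. w (s, x1)) t \<le> m / 16 - m / 4" using eq(2) wt \<delta>C(1) by linarith
    then have "deriv (\<lambda>s. w (s, x1)) t \<le> - (3 * m / 16)" by simp
    then show "\<exists>d\<le>- (3 * m / 16). ((\<lambda>t. w (t, x1)) has_field_derivative d) (at t)"
      using eq(1) by (auto simp: DERIV_deriv_iff_real_differentiable)
  qed
  \<comment> \<open>Maximality allows w to gain at most \<delta> h going back in time, with \<delta>
    \<le> m / 16, whereas the slope forces a gain of 3 m h / 16.\<close>
  moreover have "w (t1 - h, x1) - w (t1, x1) \<le> \<delta> * h"
  proof -
    have "w (t1 - h, x1) - w (t1, x1) \<le> \<delta> * (\<bar>t1 - h\<bar> - \<bar>t1\<bar>)"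
      using max[of "(t1 - h, x1)"] by (simp add: \<zeta>_def q_def tx algebra_simps)
    also have "\<dots> \<le> \<delta> * h" using \<delta> h by (intro mult_left_mono) auto
    finally show ?thesis .
  qed
  moreover have "\<delta> * h \<le> m / 16 * h" using \<delta>C(2) h by (intro mult_right_mono) auto
  moreover have "- (3 * m / 16) * (t1 - (t1 - h)) = - 3 * (m / 16 * h)" by simp
  moreover have "m / 16 * h > 0" using m h by simp
  ultimately show False by linarith
qed

lemma bounded_solution_unique:
  fixes u v :: "real \<times> (real ^ 'n) \<Rightarrow> real"
  assumes "bounded (range u)" "bounded (range v)" "classical_solution a f u" "classical_solution a f v"
  shows "u = v"
proof -
  obtain Bu where Bu: "\<And>z. \<bar>u z\<bar> \<le> Bu" using assms(1) by (auto simp: bounded_iff)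
  obtain Bv where Bv: "\<And>z. \<bar>v z\<bar> \<le> Bv" using assms(2) by (auto simp: bounded_iff)
  have b1: "\<bar>u z - v z\<bar> \<le> Bu + Bv" and b2: "\<bar>v z - u z\<bar> \<le> Bu + Bv" for z
    using Bu[of z] Bv[of z] by linarith+
  have "u z - v z \<le> 0" for z
    by (rule bounded_solution_nonpos[OF b1 classical_solution_diff[OF assms(3,4)]])
  moreover have "v z - u z \<le> 0" for z
    by (rule bounded_solution_nonpos[OF b2 classical_solution_diff[OF assms(4,3)]])
  ultimately show ?thesis by (intro ext) (simp add: order_antisym)
qed

end

section \<open>The coefficients in the limit formulas\<close>

lemma heat_bound_one:
  fixes x :: "real ^ 'n"
  assumes "l > 0"
  shows "heat_bound l 1 x = exp (- (l / 8) * (norm x)\<^sup>2) * (((l / 2) ^ CARD('n)) powr (1 / 2) / (4 * pi) powr (real CARD('n) / 2))"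
  using heat_bound_eq[OF assms, of 1 x] by simp

text \<open>Up to a constant factor this is \<open>heat_bound\<close> with parameter 8 l at time 1,
  a Gaussian density.\<close>

lemma integrable_exp_minus_norm_square:
  assumes "l > 0"
  shows "integrable lborel (\<lambda>x :: real ^ 'n. exp (- l * (norm x)\<^sup>2))"
proof -
  define c where "c = (((8 * l) / 2) ^ CARD('n)) powr (1 / 2) / (4 * pi) powr (real CARD('n) / 2)"
  have c: "c > 0" using assms by (simp add: c_def)
  have "integrable lborel (\<lambda>x :: real ^ 'n. heat_bound (8 * l) 1 x)"
    unfolding heat_bound_def by (rule integrable_gauss(1)) (use assms heat_bound_posdef[of "8 * l" 1] in simp)
  moreover have "heat_bound (8 * l) 1 x = exp (- l * (norm x)\<^sup>2) * c" for x :: "real ^ 'n"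
    using heat_bound_one[of "8 * l" x] assms by (simp add: c_def)
  ultimately have "integrable lborel (\<lambda>x :: real ^ 'n. exp (- l * (norm x)\<^sup>2) * c / c)"
    by (intro integrable_divide) simp
  then show ?thesis using c by simp
qed

text \<open>The integral of 1 / \<sigma> over |w|^{-2} < \<sigma> \<le> 1, see
  \<open>has_integral_inverse_log_weight\<close>. Continuous and zero in the unit ball, it can be
  integrated by parts over the whole space without a term on the unit sphere.\<close>

definition log_weight :: "real ^ 'n \<Rightarrow> real" where
  "log_weight w = 2 * ln (max 1 (norm w))"

lemma log_weight_nonneg: "0 \<le> log_weight w"
  by (simp add: log_weight_def)

lemma log_weight_le: "log_weight w \<le> (norm w)\<^sup>2"
proof (cases "norm w \<le> 1")
  case False
  then have "ln (norm w) \<le> norm w - 1" by (intro ln_le_minus_one) auto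
  moreover have "0 \<le> (norm w - 1)\<^sup>2" by simp
  ultimately show ?thesis using False by (simp add: log_weight_def power2_eq_square algebra_simps)
qed (simp add: log_weight_def)

text \<open>The logarithm has slope at most 1 on [1, \<infinity>), and \<open>max 1\<close> and the
  norm do not increase distances.\<close>

lemma log_weight_lipschitz: "\<bar>log_weight v - log_weight w\<bar> \<le> 2 * norm (v - w)"
proof -
  have "norm (ln (max 1 (norm v)) - ln (max 1 (norm w))) \<le> 1 * norm (max 1 (norm v) - max 1 (norm w))"
  proof (rule field_differentiable_bound[where S="{1..}" and f'="\<lambda>x. 1 / x"])
    fix x :: real assume "x \<in> {1..}"
    then show "(ln has_field_derivative 1 / x) (at x within {1..})"
      by (intro has_field_derivative_at_within[OF DERIV_ln_divide]) auto
    show "norm (1 / x) \<le> 1" using \<open>x \<in> {1..}\<close> by simp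
  qed auto
  also have "\<dots> \<le> \<bar>norm v - norm w\<bar>" by simp
  also have "\<dots> \<le> norm (v - w)" by (rule norm_triangle_ineq3)
  finally have "\<bar>ln (max 1 (norm v)) - ln (max 1 (norm w))\<bar> \<le> norm (v - w)" by simp
  then show ?thesis by (simp add: log_weight_def)
qed

lemma borel_measurable_log_weight [measurable]: "log_weight \<in> borel_measurable borel"
  unfolding log_weight_def[abs_def] by measurable

lemma log_weight_derivative:
  fixes w :: "real ^ 'n"
  assumes "norm w \<noteq> 1"
  shows "((\<lambda>s. log_weight (w + s *\<^sub>R axis i 1)) has_field_derivative (if norm w \<ge> 1 then 2 * w $ i / (norm w)\<^sup>2 else 0)) (at 0)"
proof (cases "norm w > 1")
  case True
  let ?U = "{s :: real. norm (w + s *\<^sub>R axis i 1) > 1}"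
  have op: "open ?U" by (intro open_Collect_less continuous_intros)
  \<comment> \<open>Writing 2 ln |v| as ln |v|^2 makes the weight the logarithm of a polynomial in
    s.\<close>
  have n: "(norm (w + s *\<^sub>R axis i 1))\<^sup>2 = (norm w)\<^sup>2 + 2 * s * w $ i + s\<^sup>2" for s
    unfolding power2_norm_eq_inner
    by (simp add: inner_add_left inner_add_right inner_axis inner_axis' power2_eq_square algebra_simps)
  have "((\<lambda>s. ln ((norm w)\<^sup>2 + 2 * s * w $ i + s\<^sup>2)) has_field_derivative 2 * w $ i / (norm w)\<^sup>2) (at 0)"
  proof -
    have pos: "(norm w)\<^sup>2 > 0" using True by (intro zero_less_power) linarith
    then show ?thesis by (auto intro!: derivative_eq_intros simp: divide_simps)
  qed
  then have "((\<lambda>s. log_weight (w + s *\<^sub>R axis i 1)) has_field_derivative 2 * w $ i / (norm w)\<^sup>2) (at 0)"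
  proof (rule has_field_derivative_transform_within_open[OF _ op])
    fix s assume "s \<in> ?U"
    then show "ln ((norm w)\<^sup>2 + 2 * s * w $ i + s\<^sup>2) = log_weight (w + s *\<^sub>R axis i 1)"
      unfolding n[symmetric] by (simp add: log_weight_def ln_realpow)
  qed (use True in simp)
  then show ?thesis using True by simp
next
  case False
  then have lt: "norm w < 1" using assms by simp
  let ?U = "{s :: real. norm (w + s *\<^sub>R axis i 1) < 1}"
  have op: "open ?U" by (intro open_Collect_less continuous_intros)
  have "((\<lambda>s. 0) has_field_derivative 0) (at (0::real))" by simp
  then have "((\<lambda>s. log_weight (w + s *\<^sub>R axis i 1)) has_field_derivative 0) (at 0)"
    by (rule has_field_derivative_transform_within_open[OF _ op]) (use lt in \<open>auto simp: log_weight_def\<close>)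
  then show ?thesis using lt by simp
qed

lemma AE_norm_ne: "AE w in lborel. norm (w :: 'a::euclidean_space) \<noteq> r"
proof -
  have "sphere (0::'a) r \<in> null_sets lebesgue" using negligible_sphere negligible_iff_null_sets by blast
  then have "sphere (0::'a) r \<in> null_sets lborel" by (simp add: null_sets_completion_iff)
  then show ?thesis by (rule AE_I') (auto simp: dist_norm)
qed

text \<open>A displacement of length at most 1 from w to v is paid for by |w|^2 \<le> 2 |v|^2 + 2,
  which halves the rate l / 8 and costs a factor exp(l / 8). The bounds are uniform over the
  displacement, as difference quotients require.\<close>

lemma gauss_axis_bounds:
  fixes A :: "real ^ 'n ^ 'n"
  assumes A: "ell l (1 / l) A" and l: "l > 0"
  obtains C where "C \<ge> 0" "\<And>w \<theta> i j. \<bar>\<theta>\<bar> \<le> 1 \<Longrightarrow> \<bar>gauss1 A j (w + \<theta> *\<^sub>R axis i 1)\<bar> \<le> C * exp (- (l / 16) * (norm w)\<^sup>2)"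
    "\<And>w \<theta> i j. \<bar>\<theta>\<bar> \<le> 1 \<Longrightarrow> \<bar>gauss2 A i j (w + \<theta> *\<^sub>R axis i 1)\<bar> \<le> C * exp (- (l / 16) * (norm w)\<^sup>2)"
proof -
  obtain K where K: "K \<ge> 0" "\<And>(M :: real ^ 'n ^ 'n) \<tau> x j. \<tau> > 0 \<Longrightarrow> ell (l * \<tau>) (\<tau> / l) M \<Longrightarrow>
     \<bar>gauss1 M j x\<bar> * sqrt \<tau> \<le> K * heat_bound l \<tau> x"
    "\<And>(M :: real ^ 'n ^ 'n) \<tau> x i j. \<tau> > 0 \<Longrightarrow> ell (l * \<tau>) (\<tau> / l) M \<Longrightarrow>
     \<bar>gauss2 M i j x\<bar> * \<tau> \<le> K * heat_bound l \<tau> x"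
    using gauss_bounds[OF l, where 'n='n] by metis
  define c where "c = ((l / 2) ^ CARD('n)) powr (1 / 2) / (4 * pi) powr (real CARD('n) / 2)"
  have c: "c \<ge> 0" using l by (simp add: c_def)
  have hb: "heat_bound l 1 (w + \<theta> *\<^sub>R axis i 1) \<le> exp (l / 8) * c * exp (- (l / 16) * (norm w)\<^sup>2)"
    if "\<bar>\<theta>\<bar> \<le> 1" for w :: "real ^ 'n" and \<theta> i
  proof -
    let ?v = "w + \<theta> *\<^sub>R axis i 1"
    have "norm w \<le> norm ?v + 1"
    proof -
      have "norm (?v - \<theta> *\<^sub>R axis i 1) \<le> norm ?v + norm (\<theta> *\<^sub>R axis i (1::real) :: real ^ 'n)" by (rule norm_triangle_ineq4)
      then show ?thesis using that by simp
    qed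
    then have "(norm w)\<^sup>2 \<le> (norm ?v + 1)\<^sup>2" by (intro power_mono) auto
    also have "\<dots> \<le> 2 * (norm ?v)\<^sup>2 + 2"
      using zero_le_power2[of "norm ?v - 1"] by (simp add: power2_eq_square algebra_simps)
    finally have "- ((norm ?v)\<^sup>2) \<le> 1 - (norm w)\<^sup>2 / 2" by simp
    then have "(l / 8) * - ((norm ?v)\<^sup>2) \<le> (l / 8) * (1 - (norm w)\<^sup>2 / 2)" using l by (intro mult_left_mono) auto
    then have "- (l / 8) * (norm ?v)\<^sup>2 \<le> l / 8 + - (l / 16) * (norm w)\<^sup>2" by (simp add: algebra_simps)
    then have "exp (- (l / 8) * (norm ?v)\<^sup>2) \<le> exp (l / 8) * exp (- (l / 16) * (norm w)\<^sup>2)"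
      unfolding exp_add[symmetric] by (simp only: exp_le_cancel_iff)
    from mult_right_mono[OF this c] show ?thesis
      unfolding heat_bound_one[OF l] c_def by (simp add: mult_ac)
  qed
  show thesis
  proof (rule that[of "K * (exp (l / 8) * c)"])
    show "0 \<le> K * (exp (l / 8) * c)" using K(1) c by simp
    fix w :: "real ^ 'n" and \<theta> i j assume \<theta>: "\<bar>\<theta>\<bar> \<le> (1::real)"
    note m = mult_left_mono[OF hb[OF \<theta>, of w i] K(1)]
    show "\<bar>gauss1 A j (w + \<theta> *\<^sub>R axis i 1)\<bar> \<le> K * (exp (l / 8) * c) * exp (- (l / 16) * (norm w)\<^sup>2)"
      using K(2)[of 1 A j "w + \<theta> *\<^sub>R axis i 1"] A m by (simp add: mult_ac)
    show "\<bar>gauss2 A i j (w + \<theta> *\<^sub>R axis i 1)\<bar> \<le> K * (exp (l / 8) * c) * exp (- (l / 16) * (norm w)\<^sup>2)"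
      using K(3)[of 1 A i j "w + \<theta> *\<^sub>R axis i 1"] A m by (simp add: mult_ac)
  qed
qed

lemma borel_measurable_gauss12:
  assumes "posdef M"
  shows "gauss1 M j \<in> borel_measurable borel" "gauss2 M i j \<in> borel_measurable borel"
  using continuous_on_gauss[OF assms] by (auto intro: borel_measurable_continuous_onI)

lemma borel_measurable_matrix_vector_nth [measurable]:
  "(\<lambda>x. (M *v x) $ j) \<in> borel_measurable borel"
  for M :: "real ^ 'n ^ 'm"
  by (intro borel_measurable_continuous_onI continuous_intros)

text \<open>The weight grows at most quadratically; \<open>quadratic_le_exp\<close> with l / 4 costs
  exp(l |w|^2 / 32), half of the available decay.\<close>

lemma log_weight_exp_le:
  fixes l :: real
  assumes l: "l > 0"
  obtains C where "C \<ge> 0" "\<And>w :: real ^ 'n. (1 + log_weight w) * exp (- (l / 16) * (norm w)\<^sup>2) \<le> C * exp (- (l / 32) * (norm w)\<^sup>2)"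
proof -
  define C where "C = 1 + 8 / (l / 4) + 128 / (l / 4)\<^sup>2"
  have "(1 + log_weight w) * exp (- (l / 16) * (norm w)\<^sup>2) \<le> C * exp (- (l / 32) * (norm w)\<^sup>2)" for w :: "real ^ 'n"
  proof -
    have "1 + log_weight w \<le> 1 + (norm w)\<^sup>2 + ((norm w)\<^sup>2)\<^sup>2" using log_weight_le[of w] zero_le_power2[of "(norm w)\<^sup>2"] by linarith
    also have "\<dots> \<le> C * exp (l / 4 / 8 * (norm w)\<^sup>2)"
      unfolding C_def by (rule quadratic_le_exp) (use l in auto)
    finally have "(1 + log_weight w) * exp (- (l / 16) * (norm w)\<^sup>2) \<le> C * exp (l / 4 / 8 * (norm w)\<^sup>2) * exp (- (l / 16) * (norm w)\<^sup>2)"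
      by (rule mult_right_mono) simp
    also have "\<dots> = C * exp (- (l / 32) * (norm w)\<^sup>2)"
      unfolding mult.assoc exp_add[symmetric] by (simp add: field_simps)
    finally show ?thesis .
  qed
  moreover have "C \<ge> 0" using l by (simp add: C_def)
  ultimately show thesis using that by blast
qed

lemma integrable_log_weight_gauss2:
  fixes A :: "real ^ 'n ^ 'n"
  assumes A: "ell l (1 / l) A" and l: "l > 0"
  shows "integrable lborel (\<lambda>w. log_weight w * gauss2 A i j w)"
proof -
  obtain C where C: "C \<ge> 0"
    "\<And>w \<theta> i j. \<bar>\<theta>\<bar> \<le> 1 \<Longrightarrow> \<bar>gauss2 A i j (w + \<theta> *\<^sub>R axis i 1)\<bar> \<le> C * exp (- (l / 16) * (norm w)\<^sup>2)"
    using gauss_axis_bounds[OF A l] by metis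
  obtain D where D: "D \<ge> 0" "\<And>w :: real ^ 'n. (1 + log_weight w) * exp (- (l / 16) * (norm w)\<^sup>2) \<le> D * exp (- (l / 32) * (norm w)\<^sup>2)"
    using log_weight_exp_le[OF l, where 'n='n] by metis
  note [measurable] = borel_measurable_gauss12[OF ell_posdef[OF A l]]
  show ?thesis
  proof (rule Bochner_Integration.integrable_bound[OF integrable_mult_right[OF integrable_exp_minus_norm_square[of "l / 32"], of "C * D"]])
    show "AE w in lborel. norm (log_weight w * gauss2 A i j w) \<le> norm (C * D * exp (- (l / 32) * (norm w)\<^sup>2))"
    proof (intro always_eventually allI)
      fix w :: "real ^ 'n"
      have g: "\<bar>gauss2 A i j w\<bar> \<le> C * exp (- (l / 16) * (norm w)\<^sup>2)" using C(2)[of 0 i j w] by simp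
      have "log_weight w * \<bar>gauss2 A i j w\<bar> \<le> (1 + log_weight w) * (C * exp (- (l / 16) * (norm w)\<^sup>2))"
        using g log_weight_nonneg[of w] by (intro mult_mono) auto
      also have "\<dots> = C * ((1 + log_weight w) * exp (- (l / 16) * (norm w)\<^sup>2))" by (simp add: mult_ac)
      also have "\<dots> \<le> C * (D * exp (- (l / 32) * (norm w)\<^sup>2))" by (rule mult_left_mono[OF D(2) C(1)])
      finally show "norm (log_weight w * gauss2 A i j w) \<le> norm (C * D * exp (- (l / 32) * (norm w)\<^sup>2))"
        using C(1) D(1) log_weight_nonneg[of w] by (simp add: abs_mult mult_ac)
    qed
  qed (use l in auto)
qed

text \<open>One derivative passes to the weight, whose gradient is 2 w / |w|^2 outside the unit
  ball. Since \<open>gauss1\<close> is -1/2 times the j-th component of A^{-1} w times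
  \<open>gauss\<close>, the factor 2 and the minus sign of the integration by parts cancel.\<close>

lemma log_weight_ibp:
  fixes A :: "real ^ 'n ^ 'n"
  assumes A: "ell l (1 / l) A" and l: "l > 0"
  shows "(\<integral>w. log_weight w * gauss2 A i j w \<partial>lborel) =
    (\<integral>w. gauss A w * (if norm w \<ge> 1 then w $ i * (matrix_inv A *v w) $ j / (norm w)\<^sup>2 else 0) \<partial>lborel)"
proof -
  have pd: "posdef A" by (rule ell_posdef[OF A l])
  obtain C where C: "C \<ge> 0" "\<And>w \<theta> i j. \<bar>\<theta>\<bar> \<le> 1 \<Longrightarrow> \<bar>gauss1 A j (w + \<theta> *\<^sub>R axis i 1)\<bar> \<le> C * exp (- (l / 16) * (norm w)\<^sup>2)"
    "\<And>w \<theta> i j. \<bar>\<theta>\<bar> \<le> 1 \<Longrightarrow> \<bar>gauss2 A i j (w + \<theta> *\<^sub>R axis i 1)\<bar> \<le> C * exp (- (l / 16) * (norm w)\<^sup>2)"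
    using gauss_axis_bounds[OF A l] by metis
  obtain D where D: "D \<ge> 0" "\<And>w :: real ^ 'n. (1 + log_weight w) * exp (- (l / 16) * (norm w)\<^sup>2) \<le> D * exp (- (l / 32) * (norm w)\<^sup>2)"
    using log_weight_exp_le[OF l, where 'n='n] by metis
  note [measurable] = borel_measurable_gauss12[OF pd]
  \<comment> \<open>Majorant for the difference quotients of the product: 2 is the Lipschitz
    constant of the weight, C bounds \<open>gauss1\<close> and \<open>gauss2\<close> near w, and D
    absorbs the factor 1 + \<open>log_weight w\<close>.\<close>
  define b where "b w = 2 * (C * D) * exp (- (l / 32) * (norm w)\<^sup>2)" for w :: "real ^ 'n"
  have bint: "integrable lborel b"
    unfolding b_def[abs_def] using integrable_exp_minus_norm_square[of "l / 32"] l by (intro integrable_mult_right) simp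
  define \<rho> where "\<rho> w = (if norm w \<ge> 1 then 2 * w $ i / (norm w)\<^sup>2 else 0)" for w :: "real ^ 'n"
  have [measurable]: "\<rho> \<in> borel_measurable borel" unfolding \<rho>_def[abs_def] by measurable
  let ?\<psi> = "\<lambda>w. \<rho> w * gauss1 A j w + log_weight w * gauss2 A i j w"
  have CD: "(1 + log_weight w) * (C * exp (- (l / 16) * (norm w)\<^sup>2)) \<le> C * D * exp (- (l / 32) * (norm w)\<^sup>2)" for w :: "real ^ 'n"
    using mult_left_mono[OF D(2)[of w] C(1)] by (simp add: mult_ac)
  have g1: "\<bar>gauss1 A j w\<bar> \<le> C * exp (- (l / 16) * (norm w)\<^sup>2)" for w using C(2)[of 0 j w undefined] by simp
  have intphi: "integrable lborel (\<lambda>w. log_weight w * gauss1 A j w)"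
  proof (rule Bochner_Integration.integrable_bound[OF bint])
    show "AE w in lborel. norm (log_weight w * gauss1 A j w) \<le> norm (b w)"
    proof (intro always_eventually allI)
      fix w :: "real ^ 'n"
      have "log_weight w * \<bar>gauss1 A j w\<bar> \<le> (1 + log_weight w) * (C * exp (- (l / 16) * (norm w)\<^sup>2))"
        using g1[of w] log_weight_nonneg[of w] by (intro mult_mono) auto
      also have "\<dots> \<le> b w" proof -
        define e where "e = C * D * exp (- (l / 32) * (norm w)\<^sup>2)"
        have "0 \<le> e" using C(1) D(1) by (simp add: e_def)
        moreover have "b w = 2 * e" by (simp add: b_def e_def)
        ultimately show ?thesis using CD[of w, folded e_def] by linarith
      qed
      finally show "norm (log_weight w * gauss1 A j w) \<le> norm (b w)" using log_weight_nonneg[of w] by (simp add: abs_mult)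
    qed
  qed simp
  have zero: "(\<integral>w. ?\<psi> w \<partial>lborel) = 0"
  proof (rule integral_directional_derivative_eq_0[where e="axis i 1" and b=b and \<phi>="\<lambda>w. log_weight w * gauss1 A j w"])
    show "AE w in lborel. ((\<lambda>s. log_weight (w + s *\<^sub>R axis i 1) * gauss1 A j (w + s *\<^sub>R axis i 1)) has_field_derivative ?\<psi> w) (at 0)"
      using AE_norm_ne[of 1]
    proof eventually_elim
      case (elim w)
      show ?case
        using DERIV_mult[OF log_weight_derivative[OF elim, of i] gauss1_has_derivative_axis[OF pd, of j w i 0]]
        by (simp add: \<rho>_def mult.commute)
    qed
    fix s :: real assume s: "\<bar>s\<bar> < 1"
    show "AE w in lborel. \<bar>log_weight (w + s *\<^sub>R axis i 1) * gauss1 A j (w + s *\<^sub>R axis i 1) - log_weight w * gauss1 A j w\<bar> \<le> \<bar>s\<bar> * b w"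
    proof (intro always_eventually allI)
      fix w :: "real ^ 'n"
      let ?v = "w + s *\<^sub>R axis i 1" and ?E = "C * exp (- (l / 16) * (norm w)\<^sup>2)"
      have "norm ((\<lambda>s. gauss1 A j (w + s *\<^sub>R axis i 1)) s - (\<lambda>s. gauss1 A j (w + s *\<^sub>R axis i 1)) 0) \<le> ?E * norm (s - 0)"
      proof (rule field_differentiable_bound[where S="{-1..1}" and f'="\<lambda>s. gauss2 A i j (w + s *\<^sub>R axis i 1)"])
        fix \<theta> :: real assume "\<theta> \<in> {-1..1}"
        then have "\<bar>\<theta>\<bar> \<le> 1" by auto
        then show "norm (gauss2 A i j (w + \<theta> *\<^sub>R axis i 1)) \<le> ?E" using C(3)[of \<theta> i j w] by simp
      qed (use s gauss1_has_derivative_axis[OF pd] in \<open>auto intro: has_field_derivative_at_within\<close>)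
      then have d1: "\<bar>gauss1 A j ?v - gauss1 A j w\<bar> \<le> ?E * \<bar>s\<bar>" by simp
      have d2: "\<bar>log_weight ?v - log_weight w\<bar> \<le> 2 * \<bar>s\<bar>" using log_weight_lipschitz[of ?v w] by simp
      have d3: "\<bar>gauss1 A j ?v\<bar> \<le> ?E" using C(2)[of s j w i] s by simp
      have "log_weight ?v * gauss1 A j ?v - log_weight w * gauss1 A j w
        = (log_weight ?v - log_weight w) * gauss1 A j ?v + log_weight w * (gauss1 A j ?v - gauss1 A j w)" by (simp add: algebra_simps)
      then have "\<bar>log_weight ?v * gauss1 A j ?v - log_weight w * gauss1 A j w\<bar>
        \<le> \<bar>log_weight ?v - log_weight w\<bar> * \<bar>gauss1 A j ?v\<bar> + log_weight w * \<bar>gauss1 A j ?v - gauss1 A j w\<bar>"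
        using abs_triangle_ineq[of "(log_weight ?v - log_weight w) * gauss1 A j ?v" "log_weight w * (gauss1 A j ?v - gauss1 A j w)"] log_weight_nonneg[of w]
        by (simp only: abs_mult abs_of_nonneg)
      also have "\<dots> \<le> (2 * \<bar>s\<bar>) * ?E + log_weight w * (?E * \<bar>s\<bar>)"
        using d1 d2 d3 log_weight_nonneg[of w] by (intro add_mono mult_mono mult_left_mono) auto
      also have "\<dots> \<le> \<bar>s\<bar> * (2 * ((1 + log_weight w) * ?E))"
        using log_weight_nonneg[of w] C(1) by (simp add: algebra_simps)
      also have "\<dots> \<le> \<bar>s\<bar> * b w"
        using CD[of w] by (intro mult_left_mono) (auto simp: b_def)
      finally show "\<bar>log_weight ?v * gauss1 A j ?v - log_weight w * gauss1 A j w\<bar> \<le> \<bar>s\<bar> * b w" .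
    qed
  qed (use intphi bint in auto)
  have intrho: "integrable lborel (\<lambda>w. \<rho> w * gauss1 A j w)"
  proof (rule Bochner_Integration.integrable_bound[OF bint])
    show "AE w in lborel. norm (\<rho> w * gauss1 A j w) \<le> norm (b w)"
    proof (intro always_eventually allI)
      fix w :: "real ^ 'n"
      have "\<bar>\<rho> w\<bar> \<le> 2"
      proof (cases "norm w \<ge> 1")
        case True
        have "\<bar>w $ i\<bar> \<le> norm w * norm w"
          using component_le_norm_cart[of w i] mult_right_mono[OF True norm_ge_zero[of w]] by simp
        moreover have "norm w * norm w > 0" using True by (intro mult_pos_pos) linarith+
        ultimately show ?thesis using True by (simp add: \<rho>_def abs_mult power2_eq_square divide_le_eq)
      qed (simp add: \<rho>_def)
      then have "\<bar>\<rho> w\<bar> * \<bar>gauss1 A j w\<bar> \<le> 2 * (C * exp (- (l / 16) * (norm w)\<^sup>2))"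
        by (intro mult_mono g1) auto
      also have "\<dots> \<le> 2 * ((1 + log_weight w) * (C * exp (- (l / 16) * (norm w)\<^sup>2)))"
        using log_weight_nonneg[of w] C(1) mult_right_mono[of 1 "1 + log_weight w" "C * exp (- (l / 16) * (norm w)\<^sup>2)"] by simp
      also have "\<dots> \<le> b w" using CD[of w] by (simp add: b_def)
      finally show "norm (\<rho> w * gauss1 A j w) \<le> norm (b w)" by (simp add: abs_mult)
    qed
  qed simp
  have "(\<integral>w. log_weight w * gauss2 A i j w \<partial>lborel) = - (\<integral>w. \<rho> w * gauss1 A j w \<partial>lborel)"
    using zero intrho integrable_log_weight_gauss2[OF A l, of i j] by simp
  also have "\<dots> = (\<integral>w. - (\<rho> w * gauss1 A j w) \<partial>lborel)" by simp
  also have "\<dots> = (\<integral>w. gauss A w * (if norm w \<ge> 1 then w $ i * (matrix_inv A *v w) $ j / (norm w)\<^sup>2 else 0) \<partial>lborel)"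
    by (rule Bochner_Integration.integral_cong) (auto simp: \<rho>_def gauss1_def)
  finally show ?thesis .
qed

text \<open>The substitution w = 2 a(t)^{1/2} x turns the domain into |w| \<ge> 1; the factor
  multiplying the Gaussian is homogeneous of degree zero, so the 2 cancels, and a^{-1} a^{1/2} =
  a^{-1/2}.\<close>

lemma Icoef_eq:
  fixes a :: "real \<Rightarrow> real ^ 'n ^ 'n"
  assumes A: "posdef (a t)"
  shows "Icoef a i j t = (\<integral>w. gauss (a t) w * (if norm w \<ge> 1 then w $ i * (matrix_inv (a t) *v w) $ j / (norm w)\<^sup>2 else 0) \<partial>lborel)"
proof -
  let ?A = "a t" and ?S = "mat_sqrt (a t)"
  let ?h = "\<lambda>w. if norm w \<ge> 1 then w $ i * (matrix_inv ?A *v w) $ j / (norm w)\<^sup>2 else 0"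
  let ?\<gamma> = "\<lambda>x :: real ^ 'n. exp (- (norm x)\<^sup>2) / pi powr (real CARD('n) / 2)"
  note S = mat_sqrt[OF A]
  have hm: "?h \<in> borel_measurable borel" by measurable
  have Sinv: "matrix_inv ?A *v (?S *v x) = matrix_inv ?S *v x" for x
  proof -
    let ?y = "matrix_inv ?S *v x"
    have "?A *v ?y = ?S *v x"
      using S(2) matrix_inv_cancel(2)[OF posdef_invertible[OF S(1)], of x] by (metis matrix_vector_mul_assoc)
    then show ?thesis using matrix_inv_cancel(1)[OF posdef_invertible[OF A], of ?y] by simp
  qed
  have "(\<integral>w. gauss ?A w * ?h w \<partial>lborel) = (\<integral>x. ?\<gamma> x * ?h (2 *\<^sub>R (?S *v x)) \<partial>lborel)"
    by (rule integral_gauss_sqrt[OF A hm])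
  also have "\<dots> = (\<integral>x. indicator {x. norm (2 *\<^sub>R (?S *v x)) \<ge> 1} x *\<^sub>R
     (?\<gamma> x * (((matrix_inv ?S *v x) $ j * (?S *v x) $ i) / (norm (?S *v x))\<^sup>2)) \<partial>lborel)"
    by (rule Bochner_Integration.integral_cong)
      (auto simp: matrix_vector_mult_scaleR Sinv power_mult_distrib mult_ac)
  also have "\<dots> = Icoef a i j t"
    unfolding Icoef_def set_lebesgue_integral_def by (rule lebesgue_lborel(2)[symmetric]) measurable
  finally show ?thesis by simp
qed

lemma Jcoef_eq:
  fixes a :: "real \<Rightarrow> real ^ 'n ^ 'n"
  assumes A: "posdef (a t)"
  shows "Jcoef a t = (\<integral>w. gauss (a t) w * indicator {w. norm w \<le> 1} w \<partial>lborel)"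
proof -
  have "(\<integral>w. gauss (a t) w * indicator {w. norm w \<le> 1} w \<partial>lborel)
    = (\<integral>x. exp (- (norm x)\<^sup>2) / pi powr (real CARD('n) / 2) * indicat_real {w. norm w \<le> 1} (2 *\<^sub>R (mat_sqrt (a t) *v x)) \<partial>lborel)"
    by (rule integral_gauss_sqrt[OF A]) measurable
  also have "\<dots> = (\<integral>x. indicator {x. norm (2 *\<^sub>R (mat_sqrt (a t) *v x)) \<le> 1} x *\<^sub>R (exp (- (norm x)\<^sup>2) / pi powr (real CARD('n) / 2)) \<partial>lborel)"
    by (rule Bochner_Integration.integral_cong) (auto simp: indicator_def)
  also have "\<dots> = Jcoef a t"
    unfolding Jcoef_def set_lebesgue_integral_def by (rule lebesgue_lborel(2)[symmetric]) measurable
  finally show ?thesis by simp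
qed

text \<open>Contracting a(t) with w_i (a(t)^{-1} w)_j gives |w|^2, so the double sum is the Gaussian
  mass of |w| \<ge> 1, while J is the mass of |w| \<le> 1; the sphere is a null set.\<close>

lemma Icoef_Jcoef_sum:
  fixes a :: "real \<Rightarrow> real ^ 'n ^ 'n"
  assumes A: "ell l (1 / l) (a t)" and l: "l > 0"
  shows "(\<Sum>i\<in>UNIV. \<Sum>j\<in>UNIV. a t $ i $ j * Icoef a i j t) + Jcoef a t = 1"
proof -
  let ?A = "a t"
  have pd: "posdef ?A" by (rule ell_posdef[OF A l])
  let ?h = "\<lambda>i j w. if norm w \<ge> 1 then w $ i * (matrix_inv ?A *v w) $ j / (norm w)\<^sup>2 else 0"
  have int: "integrable lborel (\<lambda>w. gauss ?A w * ?h i j w)" for i j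
  proof (rule integrable_gauss_mult(1)[OF pd, where B="1 / l"])
    fix w :: "real ^ 'n"
    show "\<bar>?h i j w\<bar> \<le> 1 / l"
    proof (cases "norm w \<ge> 1")
      case True
      have "\<bar>w $ i\<bar> * \<bar>(matrix_inv ?A *v w) $ j\<bar> \<le> norm w * (norm w / l)"
      proof (intro mult_mono component_le_norm_cart)
        show "\<bar>(matrix_inv ?A *v w) $ j\<bar> \<le> norm w / l"
          using component_le_norm_cart[of "matrix_inv ?A *v w" j] norm_matrix_inv_le[OF A l, of w] by linarith
      qed auto
      then have "\<bar>w $ i * (matrix_inv ?A *v w) $ j\<bar> / (norm w)\<^sup>2 \<le> norm w * (norm w / l) / (norm w)\<^sup>2"
        unfolding abs_mult by (intro divide_right_mono) auto
      also have "\<dots> = 1 / l" using True by (auto simp: power2_eq_square)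
      finally show ?thesis using True by (simp add: abs_divide)
    qed (use l in simp)
  qed measurable
  have intJ: "integrable lborel (\<lambda>w. gauss ?A w * indicat_real {w. norm w \<le> 1} w)"
    by (rule integrable_gauss_mult(1)[OF pd, where B=1]) (auto simp: indicator_def)
  have sum: "(\<Sum>i\<in>UNIV. \<Sum>j\<in>UNIV. ?A $ i $ j * ?h i j w) = indicat_real {w. norm w \<ge> 1} w" for w
  proof (cases "norm w \<ge> 1")
    case True
    have "(\<Sum>i\<in>UNIV. \<Sum>j\<in>UNIV. ?A $ i $ j * ?h i j w) = (\<Sum>i\<in>UNIV. w $ i * (?A *v (matrix_inv ?A *v w)) $ i) / (norm w)\<^sup>2"
      using True by (simp add: matrix_vector_mult_def[of ?A] sum_divide_distrib sum_distrib_left mult_ac)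
    also have "\<dots> = (w \<bullet> w) / (norm w)\<^sup>2"
      by (simp add: matrix_inv_cancel[OF posdef_invertible[OF pd]] inner_vec_def)
    also have "\<dots> = 1" using True by (auto simp: dot_square_norm)
    finally show ?thesis using True by simp
  qed simp
  have "(\<Sum>i\<in>UNIV. \<Sum>j\<in>UNIV. ?A $ i $ j * Icoef a i j t) = (\<Sum>i\<in>UNIV. \<Sum>j\<in>UNIV. (\<integral>w. ?A $ i $ j * (gauss ?A w * ?h i j w) \<partial>lborel))"
    by (simp add: Icoef_eq[of a t, OF pd])
  also have "\<dots> = (\<integral>w. (\<Sum>i\<in>UNIV. \<Sum>j\<in>UNIV. ?A $ i $ j * (gauss ?A w * ?h i j w)) \<partial>lborel)"
    using int by (subst Bochner_Integration.integral_sum, (intro Bochner_Integration.integrable_sum integrable_mult_right int))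
      (intro sum.cong refl Bochner_Integration.integral_sum[symmetric] integrable_mult_right int)
  also have "\<dots> = (\<integral>w. gauss ?A w * indicat_real {w. norm w \<ge> 1} w \<partial>lborel)"
    unfolding sum[symmetric] by (simp add: sum_distrib_left mult_ac)
  finally have I: "(\<Sum>i\<in>UNIV. \<Sum>j\<in>UNIV. ?A $ i $ j * Icoef a i j t) = (\<integral>w. gauss ?A w * indicat_real {w. norm w \<ge> 1} w \<partial>lborel)" .
  have intI: "integrable lborel (\<lambda>w. gauss ?A w * indicat_real {w. norm w \<ge> 1} w)"
    by (rule integrable_gauss_mult(1)[OF pd, where B=1]) (auto simp: indicator_def)
  have "(\<integral>w. gauss ?A w * indicat_real {w. norm w \<ge> 1} w \<partial>lborel) + (\<integral>w. gauss ?A w * indicat_real {w. norm w \<le> 1} w \<partial>lborel)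
    = (\<integral>w. gauss ?A w * indicat_real {w. norm w \<ge> 1} w + gauss ?A w * indicat_real {w. norm w \<le> 1} w \<partial>lborel)"
    using intI intJ by simp
  also have "\<dots> = (\<integral>w. gauss ?A w \<partial>lborel)"
    by (rule integral_cong_AE) (use AE_norm_ne[of 1] in \<open>auto elim!: eventually_mono simp: indicator_def\<close>)
  also have "\<dots> = 1" by (rule integral_gauss[OF pd])
  finally show ?thesis by (simp add: I Jcoef_eq[of a t, OF pd])
qed

section \<open>Limit formulas\<close>

lemma has_integral_inverse_log_weight:
  fixes w :: "real ^ 'n"
  shows "has_bochner_integral lborel (\<lambda>\<sigma>. if 0 < \<sigma> \<and> \<sigma> \<le> 1 \<and> \<sigma> * (norm w)\<^sup>2 > 1 then 1 / \<sigma> else 0) (log_weight w)"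
proof (cases "norm w > 1")
  case True
  define r where "r = 1 / (norm w)\<^sup>2"
  have n: "(norm w)\<^sup>2 > 1" using True by (intro one_less_power) auto
  then have r: "0 < r" "r \<le> 1" by (auto simp: r_def divide_le_eq)
  have "has_bochner_integral lborel (\<lambda>\<sigma>. 1 / \<sigma> * indicator {r..1} \<sigma>) (ln 1 - ln r)"
    by (rule has_bochner_integral_FTC_Icc_real) (use r in \<open>auto intro!: DERIV_ln_divide\<close>)
  moreover have "ln 1 - ln r = log_weight w"
    using True n by (simp add: r_def log_weight_def ln_div ln_realpow)
  moreover have "AE \<sigma> in lborel. 1 / \<sigma> * indicator {r..1} \<sigma> = (if 0 < \<sigma> \<and> \<sigma> \<le> 1 \<and> \<sigma> * (norm w)\<^sup>2 > 1 then 1 / \<sigma> else 0)"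
    using AE_lborel_singleton[of r]
  proof eventually_elim
    case (elim \<sigma>)
    have "w \<noteq> 0" using True by auto
    then have "r < \<sigma> \<longleftrightarrow> \<sigma> * (norm w)\<^sup>2 > 1" by (simp add: r_def pos_divide_less_eq)
    then show ?case using r elim by (auto simp: indicator_def)
  qed
  ultimately show ?thesis
    using has_bochner_integral_cong_AE[of "\<lambda>\<sigma>. 1 / \<sigma> * indicator {r..1} \<sigma>" lborel "\<lambda>\<sigma>. if 0 < \<sigma> \<and> \<sigma> \<le> 1 \<and> \<sigma> * (norm w)\<^sup>2 > 1 then 1 / \<sigma> else 0" "log_weight w"]
    by simp
next
  case False
  have "\<not> (\<sigma> \<le> 1 \<and> \<sigma> * (norm w)\<^sup>2 > 1)" if "0 < \<sigma>" for \<sigma>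
  proof -
    have "(norm w)\<^sup>2 \<le> 1" using False by (simp add: power_le_one)
    then have "\<sigma> * (norm w)\<^sup>2 \<le> \<sigma>" using that by (simp add: mult_left_le)
    then show ?thesis by linarith
  qed
  then have "(\<lambda>\<sigma>. if 0 < \<sigma> \<and> \<sigma> \<le> 1 \<and> \<sigma> * (norm w)\<^sup>2 > 1 then 1 / \<sigma> else 0) = (\<lambda>_. 0 :: real)" by auto
  then show ?thesis using False by (simp add: log_weight_def has_bochner_integral_zero)
qed

text \<open>Joins the last two estimates of \<open>gauss_bounds\<close>. For \<tau> > 0 the maximum
  of \<tau> and |y|^2 is exactly what exceeds \<epsilon>^2 on \<open>Omega\<close>; the exponential
  undoes the damping built into \<open>heat_kern\<close>.\<close>

lemma gauss2_heat_kern_bound: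
  assumes l: "l > 0"
  obtains C where "C \<ge> 0" "\<And>(M :: real ^ 'n ^ 'n) z i j. 0 < fst z \<Longrightarrow> ell (l * fst z) (fst z / l) M \<Longrightarrow>
    \<bar>gauss2 M i j (snd z)\<bar> * max (fst z) ((norm (snd z))\<^sup>2) \<le> C * exp (fst z) * heat_kern l z"
proof -
  obtain C where C: "C \<ge> 0" "\<And>(M :: real ^ 'n ^ 'n) \<tau> x i j. \<tau> > 0 \<Longrightarrow> ell (l * \<tau>) (\<tau> / l) M \<Longrightarrow>
     \<bar>gauss2 M i j x\<bar> * \<tau> \<le> C * heat_bound l \<tau> x"
    "\<And>(M :: real ^ 'n ^ 'n) \<tau> x i j. \<tau> > 0 \<Longrightarrow> ell (l * \<tau>) (\<tau> / l) M \<Longrightarrow>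
     \<bar>gauss2 M i j x\<bar> * (norm x)\<^sup>2 \<le> C * heat_bound l \<tau> x"
    using gauss_bounds[OF l, where 'n='n] by metis
  show thesis
  proof (rule that[OF C(1)])
    fix M :: "real ^ 'n ^ 'n" and z :: "real \<times> (real ^ 'n)" and i j
    assume z: "0 < fst z" and M: "ell (l * fst z) (fst z / l) M"
    have "heat_bound l (fst z) (snd z) = exp (fst z) * heat_kern l z"
      using z by (simp add: heat_kern_def case_prod_beta' exp_minus)
    moreover have "\<bar>gauss2 M i j (snd z)\<bar> * max (fst z) ((norm (snd z))\<^sup>2) \<le> C * heat_bound l (fst z) (snd z)"
      using C(2)[OF z M, of i j "snd z"] C(3)[OF z M, of i j "snd z"] by (simp add: max_def)
    ultimately show "\<bar>gauss2 M i j (snd z)\<bar> * max (fst z) ((norm (snd z))\<^sup>2) \<le> C * exp (fst z) * heat_kern l z"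
      by (simp add: mult.assoc)
  qed
qed

text \<open>Integrating out time first produces the weight \<open>log_weight\<close>, whose second derivatives are
  integrated by parts in \<open>log_weight_ibp\<close>; this is where the coefficients \<open>I\<^sub>i\<^sub>j\<close> come from.\<close>

lemma integral_gauss2_outer:
  fixes A :: "real ^ 'n ^ 'n" and i j :: 'n
  assumes A: "ell l (1 / l) A" and l: "l > 0"
  defines "g \<equiv> \<lambda>z. if 0 < fst z \<and> fst z \<le> 1 \<and> norm (snd z) > 1 then gauss2 (fst z *\<^sub>R A) i j (snd z) else 0"
  shows "integrable lborel g" and "(\<integral>z. g z \<partial>lborel) = (\<integral>w. log_weight w * gauss2 A i j w \<partial>lborel)"
proof -
  have pd: "posdef A" by (rule ell_posdef[OF A l])
  note [measurable] = borel_measurable_gauss12[OF pd]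
  have ellA: "ell (l * \<tau>) (\<tau> / l) (\<tau> *\<^sub>R A)" if "\<tau> > 0" for \<tau>
    using ell_scaleR[OF A, of \<tau>] that by (simp add: mult.commute)
  have pdA: "posdef (\<tau> *\<^sub>R A)" if "\<tau> > 0" for \<tau> using ell_posdef[OF ellA[OF that]] that l by simp
  let ?U = "{z :: real \<times> (real ^ 'n). 0 < fst z}"
  have oU: "open ?U" by (intro open_Collect_less continuous_intros)
  have [measurable]: "(\<lambda>z. if z \<in> ?U then 1 * gauss2 (fst z *\<^sub>R A) i j (snd z) else 0) \<in> borel_measurable borel"
    by (rule borel_measurable_gauss_param(2)[OF _ oU]) (auto intro!: continuous_intros pdA)
  have geq: "g = (\<lambda>z. if fst z \<le> 1 \<and> norm (snd z) > 1 then (if z \<in> ?U then 1 * gauss2 (fst z *\<^sub>R A) i j (snd z) else 0) else 0)"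
    by (auto simp: g_def)
  have gm [measurable]: "g \<in> borel_measurable borel" unfolding geq by measurable
  obtain C where C: "C \<ge> 0" "\<And>(M :: real ^ 'n ^ 'n) z i j. 0 < fst z \<Longrightarrow> ell (l * fst z) (fst z / l) M \<Longrightarrow>
    \<bar>gauss2 M i j (snd z)\<bar> * max (fst z) ((norm (snd z))\<^sup>2) \<le> C * exp (fst z) * heat_kern l z"
    using gauss2_heat_kern_bound[OF l, where 'n='n] by metis
  show int: "integrable lborel g"
  proof (rule Bochner_Integration.integrable_bound[OF integrable_mult_right[OF integrable_heat_kern[OF l], of "C * exp 1"]])
    show "AE z in lborel. norm (g z) \<le> norm (C * exp 1 * heat_kern l z)"
    proof (intro always_eventually allI)
      fix z :: "real \<times> (real ^ 'n)"
      show "norm (g z) \<le> norm (C * exp 1 * heat_kern l z)"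
      proof (cases "0 < fst z \<and> fst z \<le> 1 \<and> norm (snd z) > 1")
        case True
        have "1 \<le> (norm (snd z))\<^sup>2" using True by simp
        then have "\<bar>gauss2 (fst z *\<^sub>R A) i j (snd z)\<bar> * 1 \<le> \<bar>gauss2 (fst z *\<^sub>R A) i j (snd z)\<bar> * max (fst z) ((norm (snd z))\<^sup>2)"
          by (intro mult_left_mono) auto
        also have "\<dots> \<le> C * exp (fst z) * heat_kern l z" using True by (intro C(2) ellA) auto
        also have "\<dots> \<le> C * exp 1 * heat_kern l z" using True C(1) by (intro mult_right_mono mult_left_mono) auto
        finally show ?thesis using True C(1) by (simp add: g_def)
      qed (auto simp: g_def)
    qed
  qed simp
  \<comment> \<open>The integrand after y = \<sigma>^{1/2} w: the power \<sigma>^{-n/2-1} of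
    \<open>gauss_scale\<close> and the Jacobian \<sigma>^{n/2} leave 1 / \<sigma>, and |y| > 1
    becomes \<sigma> |w|^2 > 1.\<close>
  define G where "G w \<sigma> = (if 0 < \<sigma> \<and> \<sigma> \<le> 1 \<and> \<sigma> * (norm w)\<^sup>2 > 1 then 1 / \<sigma> else 0) * gauss2 A i j w" for w :: "real ^ 'n" and \<sigma> :: real
  have hG: "has_bochner_integral lborel (G w) (log_weight w * gauss2 A i j w)" for w
    unfolding G_def[abs_def] by (intro has_bochner_integral_mult_left has_integral_inverse_log_weight)
  have hGn: "has_bochner_integral lborel (\<lambda>\<sigma>. norm (G w \<sigma>)) (log_weight w * \<bar>gauss2 A i j w\<bar>)" for w
  proof -
    have "(\<lambda>\<sigma>. norm (G w \<sigma>)) = (\<lambda>\<sigma>. (if 0 < \<sigma> \<and> \<sigma> \<le> 1 \<and> \<sigma> * (norm w)\<^sup>2 > 1 then 1 / \<sigma> else 0) * \<bar>gauss2 A i j w\<bar>)"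
      by (auto simp: G_def abs_mult)
    then show ?thesis by (simp only:) (intro has_bochner_integral_mult_left has_integral_inverse_log_weight)
  qed
  \<comment> \<open>Justifies the interchange: the \<sigma>-integral of |G| is
    \<open>log_weight\<close> times the absolute value of \<open>gauss2\<close>, integrable by
    Gaussian decay.\<close>
  have "integrable (lborel \<Otimes>\<^sub>M lborel) (case_prod G)"
  proof (rule lborel_pair.Fubini_integrable)
    show "case_prod G \<in> borel_measurable (lborel \<Otimes>\<^sub>M lborel)" unfolding G_def[abs_def] by measurable
    have "integrable lborel (\<lambda>w. norm (log_weight w * gauss2 A i j w))"
      by (intro integrable_norm integrable_log_weight_gauss2[OF A l])
    then show "integrable lborel (\<lambda>w. \<integral>\<sigma>. norm (case_prod G (w, \<sigma>)) \<partial>lborel)"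
      by (simp add: has_bochner_integral_integral_eq[OF hGn, unfolded real_norm_def] abs_mult log_weight_nonneg)
    show "AE w in lborel. integrable lborel (\<lambda>\<sigma>. case_prod G (w, \<sigma>))"
      using integrable.intros[OF hG] by simp
  qed
  from lborel_pair.Fubini_integral[OF this]
  have swap: "(\<integral>\<sigma>. (\<integral>w. G w \<sigma> \<partial>lborel) \<partial>lborel) = (\<integral>w. log_weight w * gauss2 A i j w \<partial>lborel)"
    by (simp add: has_bochner_integral_integral_eq[OF hG])
  have inner: "(\<integral>y. g (\<sigma>, y) \<partial>lborel) = (\<integral>w. G w \<sigma> \<partial>lborel)" for \<sigma>
  proof (cases "0 < \<sigma> \<and> \<sigma> \<le> 1")
    case True
    define c where "c = sqrt \<sigma>"
    have c: "c > 0" "c\<^sup>2 = \<sigma>" using True by (simp_all add: c_def)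
    have *: "g (\<sigma>, c *\<^sub>R w) = G w \<sigma> / c ^ CARD('n)" for w
    proof -
      have "norm (c *\<^sub>R w) > 1 \<longleftrightarrow> \<sigma> * (norm w)\<^sup>2 > 1"
      proof -
        have "1 < c * norm w \<longleftrightarrow> 1 < (c * norm w)\<^sup>2"
          using real_sqrt_less_iff[of 1 "(c * norm w)\<^sup>2"] c(1) by simp
        then show ?thesis using c by (simp add: power_mult_distrib)
      qed
      then show ?thesis
        using True gauss_scale(2)[OF pd c(1), of i j w] c by (simp add: g_def G_def power_add power2_eq_square mult_ac)
    qed
    have "(\<integral>y. g (\<sigma>, y) \<partial>lborel) / c ^ CARD('n) = (\<integral>w. g (\<sigma>, c *\<^sub>R w) \<partial>lborel)"
      using lborel_scale[of "\<lambda>y. g (\<sigma>, y)" c] c(1) by simp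
    also have "\<dots> = (\<integral>w. G w \<sigma> \<partial>lborel) / c ^ CARD('n)" unfolding * by simp
    finally show ?thesis using c(1) by simp
  qed (auto simp: g_def G_def)
  have int': "integrable (lborel \<Otimes>\<^sub>M lborel) g" using int by (simp add: lborel_prod)
  have "(\<integral>z. g z \<partial>lborel) = (\<integral>\<sigma>. (\<integral>y. g (\<sigma>, y) \<partial>lborel) \<partial>lborel)"
    using lborel_pair.integral_fst'[OF int'] by (simp add: lborel_prod)
  then show "(\<integral>z. g z \<partial>lborel) = (\<integral>w. log_weight w * gauss2 A i j w \<partial>lborel)" by (simp add: inner swap)
qed

lemma Icoef_eq_outer:
  fixes a :: "real \<Rightarrow> real ^ 'n ^ 'n"
  assumes A: "ell l (1 / l) (a t)" and l: "l > 0"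
  shows "(\<integral>z. (if 0 < fst z \<and> fst z \<le> 1 \<and> norm (snd z) > 1 then gauss2 (fst z *\<^sub>R a t) i j (snd z) else 0) \<partial>lborel) = Icoef a i j t"
  unfolding integral_gauss2_outer(2)[OF A l] log_weight_ibp[OF A l] Icoef_eq[of a t, OF ell_posdef[OF A l]] ..

text \<open>Parabolic scaling uses different factors in time and space, so it is carried out slice
  by slice with \<open>lborel_scale\<close>.\<close>

lemma lborel_scale_pair:
  fixes \<phi> :: "real \<times> (real ^ 'n) \<Rightarrow> real"
  assumes \<phi>: "integrable lborel \<phi>" "integrable lborel (\<lambda>z. \<phi> (c * fst z, d *\<^sub>R snd z))" and c: "c > 0" "d > 0"
  shows "(\<integral>z. \<phi> (c * fst z, d *\<^sub>R snd z) \<partial>lborel) = (\<integral>z. \<phi> z \<partial>lborel) / (c * d ^ CARD('n))"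
proof -
  have [measurable]: "\<phi> \<in> borel_measurable borel" using \<phi>(1) by (simp add: borel_measurable_integrable)
  let ?h = "\<lambda>\<tau>. \<integral>y. \<phi> (\<tau>, y) \<partial>lborel"
  have hint: "integrable lborel ?h" "(\<integral>\<tau>. ?h \<tau> \<partial>lborel) = (\<integral>z. \<phi> z \<partial>lborel)"
    using lborel_pair.integrable_fst'[of \<phi>] lborel_pair.integral_fst'[of \<phi>] \<phi>(1) by (simp_all add: lborel_prod)
  have "(\<integral>z. \<phi> (c * fst z, d *\<^sub>R snd z) \<partial>lborel) = (\<integral>\<tau>. (\<integral>y. \<phi> (c * \<tau>, d *\<^sub>R y) \<partial>lborel) \<partial>lborel)"
    using lborel_pair.integral_fst'[of "\<lambda>z. \<phi> (c * fst z, d *\<^sub>R snd z)"] \<phi>(2) by (simp add: lborel_prod)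
  also have "\<dots> = (\<integral>\<tau>. ?h (c * \<tau>) / d ^ CARD('n) \<partial>lborel)"
    using lborel_scale[of "\<lambda>y. \<phi> (_, y)" d, OF _ c(2)] by simp
  also have "\<dots> = (\<integral>\<tau>. ?h \<tau> \<partial>lborel) / c / d ^ CARD('n)"
    using lborel_scale[of ?h c] hint(1) c(1) by (simp add: borel_measurable_integrable)
  finally show ?thesis by (simp add: hint(2))
qed

lemma Omega_eq: "Omega \<epsilon> = {z. max (sqrt \<bar>fst z\<bar>) (norm (snd z)) > \<epsilon>}"
  by (auto simp: Omega_def)

lemma Omega_borel [measurable]: "(Omega \<epsilon> :: (real \<times> (real ^ 'n)) set) \<in> sets borel"
  unfolding Omega_eq by measurable

text \<open>The two forms serve different ends: the first matches
  \<open>gauss2_heat_kern_bound\<close>, the second the splitting into late and early times.\<close>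

lemma Omega_max:
  assumes "\<epsilon> > 0" "fst z > 0"
  shows "z \<in> Omega \<epsilon> \<longleftrightarrow> \<epsilon>\<^sup>2 < max (fst z) ((norm (snd z))\<^sup>2)" "z \<in> Omega \<epsilon> \<longleftrightarrow> \<epsilon>\<^sup>2 < fst z \<or> \<epsilon> < norm (snd z)"
proof -
  have "\<epsilon> < sqrt (fst z) \<longleftrightarrow> \<epsilon>\<^sup>2 < fst z"
    using assms real_sqrt_less_iff[of "\<epsilon>\<^sup>2" "fst z"] by simp
  moreover have "\<epsilon> < norm (snd z) \<longleftrightarrow> \<epsilon>\<^sup>2 < (norm (snd z))\<^sup>2"
    using assms real_sqrt_less_iff[of "\<epsilon>\<^sup>2" "(norm (snd z))\<^sup>2"] by simp
  ultimately show "z \<in> Omega \<epsilon> \<longleftrightarrow> \<epsilon>\<^sup>2 < max (fst z) ((norm (snd z))\<^sup>2)" "z \<in> Omega \<epsilon> \<longleftrightarrow> \<epsilon>\<^sup>2 < fst z \<or> \<epsilon> < norm (snd z)"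
    using assms by (auto simp: Omega_eq less_max_iff_disj)
qed

lemma AE_lborel_fst:
  assumes "AE \<tau> in lborel. P \<tau>"
  shows "AE z in (lborel :: ('a::euclidean_space \<times> 'b::euclidean_space) measure). P (fst z)"
proof -
  obtain N where N: "{x. \<not> P x} \<subseteq> N" "emeasure lborel N = 0" "N \<in> sets lborel"
    using assms by (auto elim!: AE_E)
  then have "N \<times> (UNIV :: 'b set) \<in> null_sets (lborel \<Otimes>\<^sub>M lborel)"
    by (intro lborel.times_in_null_sets1) (auto simp: null_sets_def)
  then have "N \<times> (UNIV :: 'b set) \<in> null_sets lborel" by (simp only: lborel_prod)
  then show ?thesis by (rule AE_I') (use N(1) in auto)
qed

section \<open>Derivatives of the kernel\<close>

context primitive_coeff
begin

text \<open>Explicit value of the second space derivatives of the kernel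
  (\<open>partial2_kern\<close>), from which measurability and bounds can be read.\<close>

definition kern_d2 :: "real \<Rightarrow> 'n \<Rightarrow> 'n \<Rightarrow> real \<times> (real ^ 'n) \<Rightarrow> real" where
  "kern_d2 t i j z = (if 0 < fst z then exp (- fst z) * gauss2 (F t - F (t - fst z)) i j (snd z) else 0)"

lemma partial2_kern: "partial i (partial j (kern a t \<tau>)) y = kern_d2 t i j (\<tau>, y)"
proof (cases "\<tau> > 0")
  case True
  then have pd: "posdef (F t - F (t - \<tau>))" by (intro posdef_F) simp
  have "kern a t \<tau> = (\<lambda>x. exp (- \<tau>) * gauss (F t - F (t - \<tau>)) x)" using True by (simp add: kern_eq fun_eq_iff)
  moreover have "partial j (\<lambda>x. exp (- \<tau>) * gauss (F t - F (t - \<tau>)) x) = (\<lambda>x. exp (- \<tau>) * gauss1 (F t - F (t - \<tau>)) j x)"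
    by (intro ext partial_eqI(2) DERIV_cmult)
      (use gauss_has_derivative_axis[OF pd, of _ j 0] in simp)
  moreover have "partial i (\<lambda>x. exp (- \<tau>) * gauss1 (F t - F (t - \<tau>)) j x) y = exp (- \<tau>) * gauss2 (F t - F (t - \<tau>)) i j y"
    by (intro partial_eqI(2) DERIV_cmult)
      (use gauss1_has_derivative_axis[OF pd, of j _ i 0] in simp)
  ultimately show ?thesis using True by (simp add: kern_d2_def)
next
  case False
  then have "kern a t \<tau> = (\<lambda>x. 0)" by (simp add: kern_eq fun_eq_iff)
  moreover have "partial k (\<lambda>x. 0) = (\<lambda>x. 0)" for k :: 'n
    by (intro ext partial_eqI(2)) simp
  ultimately show ?thesis using False by (simp add: kern_d2_def)
qed

lemma kern_d2_measurable [measurable]: "kern_d2 t i j \<in> borel_measurable borel"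
proof -
  let ?U = "{z :: real \<times> (real ^ 'n). 0 < fst z}"
  have "open ?U" by (intro open_Collect_less continuous_intros)
  then have "(\<lambda>z. if z \<in> ?U then exp (- fst z) * gauss2 (F t - F (t - fst z)) i j (snd z) else 0) \<in> borel_measurable borel"
    by (rule borel_measurable_gauss_param(2)[rotated]) (auto intro!: continuous_intros posdef_F)
  then show ?thesis by (simp add: kern_d2_def[abs_def] cong: if_cong)
qed

text \<open>Away from the origin the singularity costs only a factor \<epsilon>^{-2}. This gives
  integrability on \<open>Omega\<close> for fixed \<epsilon>, with no uniformity as \<epsilon> tends
  to zero.\<close>

lemma kern_d2_Omega_bound:
  obtains C where "C \<ge> 0"
    "\<And>t z i j \<epsilon>. \<epsilon> > 0 \<Longrightarrow> \<bar>indicat_real (Omega \<epsilon>) z * kern_d2 t i j z\<bar> \<le> (C / \<epsilon>\<^sup>2) * heat_kern l z"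
proof -
  obtain C where C: "C \<ge> 0" "\<And>(M :: real ^ 'n ^ 'n) z i j. 0 < fst z \<Longrightarrow> ell (l * fst z) (fst z / l) M \<Longrightarrow>
    \<bar>gauss2 M i j (snd z)\<bar> * max (fst z) ((norm (snd z))\<^sup>2) \<le> C * exp (fst z) * heat_kern l z"
    using gauss2_heat_kern_bound[OF l_pos, where 'n='n] by metis
  show thesis
  proof (rule that[OF C(1)])
    fix t z i j and \<epsilon> :: real assume \<epsilon>: "\<epsilon> > 0"
    show "\<bar>indicat_real (Omega \<epsilon>) z * kern_d2 t i j z\<bar> \<le> (C / \<epsilon>\<^sup>2) * heat_kern l z"
    proof (cases "0 < fst z \<and> z \<in> Omega \<epsilon>")
      case True
      let ?g = "gauss2 (F t - F (t - fst z)) i j (snd z)"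
      have "\<bar>?g\<bar> * \<epsilon>\<^sup>2 \<le> \<bar>?g\<bar> * max (fst z) ((norm (snd z))\<^sup>2)"
        using Omega_max(1)[OF \<epsilon>, of z] True by (intro mult_left_mono) auto
      also have "\<dots> \<le> C * exp (fst z) * heat_kern l z"
        using ell_F[of "t - fst z" t] True by (intro C(2)) auto
      finally have "exp (- fst z) * (\<bar>?g\<bar> * \<epsilon>\<^sup>2) \<le> exp (- fst z) * (C * exp (fst z) * heat_kern l z)"
        by (intro mult_left_mono) auto
      also have "\<dots> = C * heat_kern l z" by (simp add: exp_minus)
      finally show ?thesis using True \<epsilon> by (simp add: kern_d2_def abs_mult pos_le_divide_eq mult_ac)
    next
      case False
      then show ?thesis using C(1) by (auto simp: kern_d2_def indicator_def)
    qed
  qed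
qed

lemma integrable_kern_d2_Omega:
  assumes \<epsilon>: "\<epsilon> > 0" and [measurable]: "h \<in> borel_measurable borel" and B: "\<And>z. \<bar>h z\<bar> \<le> B"
  shows "integrable lborel (\<lambda>z. indicat_real (Omega \<epsilon>) z * kern_d2 t i j z * h z)"
proof -
  obtain C where C: "C \<ge> 0"
    "\<And>t z i j \<epsilon>. \<epsilon> > 0 \<Longrightarrow> \<bar>indicat_real (Omega \<epsilon>) z * kern_d2 t i j z\<bar> \<le> (C / \<epsilon>\<^sup>2) * heat_kern l z"
    using kern_d2_Omega_bound by metis
  have B0: "0 \<le> B" using B[of undefined] by linarith
  show ?thesis
  proof (rule Bochner_Integration.integrable_bound[OF integrable_mult_right[OF integrable_heat_kern[OF l_pos], of "C / \<epsilon>\<^sup>2 * B"]])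
    show "AE z in lborel. norm (indicat_real (Omega \<epsilon>) z * kern_d2 t i j z * h z) \<le> norm (C / \<epsilon>\<^sup>2 * B * heat_kern l z)"
    proof (intro always_eventually allI)
      fix z
      have "\<bar>indicat_real (Omega \<epsilon>) z * kern_d2 t i j z\<bar> * \<bar>h z\<bar> \<le> (C / \<epsilon>\<^sup>2 * heat_kern l z) * B"
        by (intro mult_mono C(2) \<epsilon> B) (use C(1) in auto)
      then show "norm (indicat_real (Omega \<epsilon>) z * kern_d2 t i j z * h z) \<le> norm (C / \<epsilon>\<^sup>2 * B * heat_kern l z)"
        using C(1) B0 by (simp add: abs_mult mult_ac)
    qed
  qed simp
qed

text \<open>The covariance F t - F(t - \<tau>) has derivative a(t) - a(t - \<tau>) in t and a(t -
  \<tau>) in \<tau>. In the sum the values at t - \<tau> cancel, and the damping contributes minus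
  the kernel. The value \<tau> = 0, where the kernel is switched on, is set aside.\<close>

lemma kern_dt_dtau_eq:
  assumes t: "good_time t" "good_time (t - \<tau>)" and \<tau>: "\<tau> \<noteq> 0"
  shows "kern_dt_dtau a t \<tau> y = (\<Sum>i\<in>UNIV. \<Sum>j\<in>UNIV. a t $ i $ j * kern_d2 t i j (\<tau>, y)) - kern a t \<tau> y"
proof (cases "\<tau> > 0")
  case True
  let ?M = "F t - F (t - \<tau>)"
  let ?s = "\<lambda>A :: real ^ 'n ^ 'n. \<Sum>i\<in>UNIV. \<Sum>j\<in>UNIV. A $ i $ j * gauss2 ?M i j y"
  have Ft: "((\<lambda>s. F s $ i $ j) has_field_derivative a t $ i $ j) (at t)"
    and Ft': "((\<lambda>s. F s $ i $ j) has_field_derivative a (t - \<tau>) $ i $ j) (at (t - \<tau>))" for i j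
    using t by (auto simp: good_time_def)
  have sh: "((\<lambda>s. F (s - \<tau>) $ i $ j) has_field_derivative a (t - \<tau>) $ i $ j * 1) (at t)" for i j
    by (rule DERIV_chain2[where f="\<lambda>s. F s $ i $ j" and g="\<lambda>s. s - \<tau>", OF Ft']) (auto intro!: derivative_eq_intros)
  have rf: "((\<lambda>s. F (t - s) $ i $ j) has_field_derivative a (t - \<tau>) $ i $ j * (- 1)) (at \<tau>)" for i j
    by (rule DERIV_chain2[where f="\<lambda>s. F s $ i $ j" and g="\<lambda>s. t - s", OF Ft']) (auto intro!: derivative_eq_intros)
  have "((\<lambda>s. gauss (F s - F (s - \<tau>)) y) has_field_derivative ?s (a t - a (t - \<tau>))) (at t)"
  proof (rule gauss_has_derivative_param)
    show "((\<lambda>s. (F s - F (s - \<tau>)) $ i $ j) has_field_derivative (a t - a (t - \<tau>)) $ i $ j) (at t)" for i j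
      using DERIV_diff[OF Ft sh] by simp
  qed (use True in \<open>simp add: posdef_F\<close>)
  from DERIV_cmult[OF this, of "exp (- \<tau>)"]
  have d1: "deriv (\<lambda>s. kern a s \<tau> y) t = exp (- \<tau>) * ?s (a t - a (t - \<tau>))"
    using True by (intro DERIV_imp_deriv) (simp add: kern_eq)
  have "((\<lambda>s. gauss (F t - F (t - s)) y) has_field_derivative ?s (a (t - \<tau>))) (at \<tau>)"
  proof (rule gauss_has_derivative_param)
    show "((\<lambda>s. (F t - F (t - s)) $ i $ j) has_field_derivative a (t - \<tau>) $ i $ j) (at \<tau>)" for i j
      using DERIV_diff[OF DERIV_const rf] by simp
    show "\<forall>\<^sub>F s in nhds \<tau>. posdef (F t - F (t - s))"
      using eventually_nhds_in_open[of "{0<..}" \<tau>] True by (auto elim!: eventually_mono intro!: posdef_F)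
  qed
  moreover have "((\<lambda>s. exp (- s)) has_field_derivative - exp (- \<tau>)) (at \<tau>)" by (auto intro!: derivative_eq_intros)
  ultimately have "((\<lambda>s. exp (- s) * gauss (F t - F (t - s)) y) has_field_derivative
      - exp (- \<tau>) * gauss ?M y + ?s (a (t - \<tau>)) * exp (- \<tau>)) (at \<tau>)"
    by (rule DERIV_mult[rotated])
  then have "((\<lambda>s. kern a t s y) has_field_derivative - exp (- \<tau>) * gauss ?M y + ?s (a (t - \<tau>)) * exp (- \<tau>)) (at \<tau>)"
    by (rule has_field_derivative_transform_within_open[where S="{0<..}"]) (use True in \<open>auto simp: kern_eq\<close>)
  then have d2: "deriv (\<lambda>s. kern a t s y) \<tau> = - exp (- \<tau>) * gauss ?M y + ?s (a (t - \<tau>)) * exp (- \<tau>)"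
    by (rule DERIV_imp_deriv)
  have s: "?s (a t - a (t - \<tau>)) = ?s (a t) - ?s (a (t - \<tau>))"
    by (simp add: left_diff_distrib sum_subtractf)
  have "kern_dt_dtau a t \<tau> y = exp (- \<tau>) * ?s (a t) - exp (- \<tau>) * gauss ?M y"
    unfolding kern_dt_dtau_def d1 d2 s by (simp add: algebra_simps)
  also have "exp (- \<tau>) * ?s (a t) = (\<Sum>i\<in>UNIV. \<Sum>j\<in>UNIV. a t $ i $ j * kern_d2 t i j (\<tau>, y))"
    using True by (simp add: kern_d2_def sum_distrib_left mult_ac)
  finally show ?thesis using True by (simp add: kern_eq)
next
  case False
  then have \<tau>: "\<tau> < 0" using \<tau> by simp
  have "((\<lambda>s. 0) has_field_derivative 0) (at \<tau>)" by simp
  then have "((\<lambda>s. kern a t s y) has_field_derivative 0) (at \<tau>)"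
    by (rule has_field_derivative_transform_within_open[where S="{..<0}"]) (use \<tau> in \<open>auto simp: kern_eq\<close>)
  then have "deriv (\<lambda>s. kern a t s y) \<tau> = 0" by (rule DERIV_imp_deriv)
  moreover have "(\<lambda>s. kern a s \<tau> y) = (\<lambda>s. 0)" using \<tau> by (simp add: kern_eq)
  ultimately show ?thesis using \<tau> by (simp add: kern_dt_dtau_def kern_d2_def kern_eq)
qed

text \<open>For fixed t, the \<tau> for which t - \<tau> is not a good time form the reflection of a
  null set.\<close>

lemma AE_kern_dt_dtau:
  assumes t: "good_time t"
  shows "AE z in lborel. kern_dt_dtau a t (fst z) (snd z) = (\<Sum>i\<in>UNIV. \<Sum>j\<in>UNIV. a t $ i $ j * kern_d2 t i j z) - kz t z"
proof -
  have "AE \<tau> in lborel. good_time \<tau>" using AE_good_time by (simp add: AE_completion_iff)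
  from AE_lborel_reflect[OF this, of t] have "AE \<tau> in lborel. good_time (t - \<tau>) \<and> \<tau> \<noteq> 0"
    using AE_lborel_singleton[of "0 :: real"] by eventually_elim simp
  from AE_lborel_fst[OF this, where 'b="real ^ 'n"] show ?thesis
    by eventually_elim (simp add: kern_dt_dtau_eq[OF t])
qed

end

section \<open>Limits of the truncated integrals\<close>

context parabolic
begin

text \<open>For \<tau> > \<epsilon>^2 the singularity is cut off and \<open>gauss_ibp\<close>
  applies in each slice; once the derivatives are on f, a multiple of the kernel itself is a
  majorant and \<epsilon> may tend to zero.\<close>

lemma tendsto_kern_d2_late:
  assumes X: "\<And>k. X k > 0" "X \<longlonglongrightarrow> 0"
  shows "(\<lambda>k. \<integral>z. indicat_real {z. (X k)\<^sup>2 < fst z} z * kern_d2 t i j z * f ((t, x) - z) \<partial>lborel) \<longlonglongrightarrow> sol a (fij i j) (t, x)"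
proof -
  have eq: "(\<integral>z. indicat_real {z. \<epsilon>\<^sup>2 < fst z} z * kern_d2 t i j z * f ((t, x) - z) \<partial>lborel)
    = (\<integral>z. kz t z * (indicat_real {z. \<epsilon>\<^sup>2 < fst z} z * fij i j ((t, x) - z)) \<partial>lborel)" if \<epsilon>: "\<epsilon> > 0" for \<epsilon>
  proof -
    let ?L = "\<lambda>z. indicat_real {z. \<epsilon>\<^sup>2 < fst z} z * kern_d2 t i j z * f ((t, x) - z)"
    let ?R = "\<lambda>z. kz t z * (indicat_real {z. \<epsilon>\<^sup>2 < fst z} z * fij i j ((t, x) - z))"
    have "integrable lborel (\<lambda>z. indicat_real (Omega \<epsilon>) z * kern_d2 t i j z * (indicat_real {z. \<epsilon>\<^sup>2 < fst z} z * f ((t, x) - z)))"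
      by (rule integrable_kern_d2_Omega[OF \<epsilon>, where B=B]) (use bnd(1) B_nonneg in \<open>auto simp: indicator_def\<close>)
    moreover have "indicat_real (Omega \<epsilon>) z * kern_d2 t i j z * (indicat_real {z. \<epsilon>\<^sup>2 < fst z} z * f ((t, x) - z)) = ?L z" for z
      using Omega_max(2)[OF \<epsilon>, of z] by (cases "fst z > 0") (auto simp: indicator_def kern_d2_def)
    ultimately have iL: "integrable (lborel \<Otimes>\<^sub>M lborel) ?L" by (simp add: lborel_prod)
    have "integrable lborel ?R"
      by (rule integrable_kz_bounded[where B=B]) (use bnd(3) B_nonneg in \<open>auto simp: indicator_def\<close>)
    then have iR: "integrable (lborel \<Otimes>\<^sub>M lborel) ?R" by (simp add: lborel_prod)
    have "(\<integral>y. ?L (\<tau>, y) \<partial>lborel) = (\<integral>y. ?R (\<tau>, y) \<partial>lborel)" for \<tau>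
    proof (cases "\<epsilon>\<^sup>2 < \<tau>")
      case True
      then have \<tau>: "0 < \<tau>" using zero_le_power2[of \<epsilon>] by linarith
      have "(\<integral>y. ?L (\<tau>, y) \<partial>lborel) = exp (- \<tau>) * (\<integral>y. gauss2 (F t - F (t - \<tau>)) i j y * f (t - \<tau>, x - y) \<partial>lborel)"
        using True \<tau> by (simp add: kern_d2_def mult.assoc)
      also have "\<dots> = exp (- \<tau>) * (\<integral>y. gauss (F t - F (t - \<tau>)) y * fij i j (t - \<tau>, x - y) \<partial>lborel)"
        using \<tau> by (subst gauss_ibp) (simp_all add: posdef_F)
      also have "\<dots> = (\<integral>y. ?R (\<tau>, y) \<partial>lborel)" using True \<tau> by (simp add: kern_eq mult.assoc)
      finally show ?thesis .
    qed simp
    then show ?thesis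
      using lborel_pair.integral_fst'[OF iL] lborel_pair.integral_fst'[OF iR] by (simp add: lborel_prod)
  qed
  have "(\<lambda>k. \<integral>z. kz t z * (indicat_real {z. (X k)\<^sup>2 < fst z} z * fij i j ((t, x) - z)) \<partial>lborel)
    \<longlonglongrightarrow> (\<integral>z. kz t z * fij i j ((t, x) - z) \<partial>lborel)"
  proof (rule integral_dominated_convergence[where w="\<lambda>z. kz t z * B"])
    show "integrable lborel (\<lambda>z. kz t z * B)" using integrable_kern[of t] by simp
    show "AE z in lborel. (\<lambda>k. kz t z * (indicat_real {z. (X k)\<^sup>2 < fst z} z * fij i j ((t, x) - z))) \<longlonglongrightarrow> kz t z * fij i j ((t, x) - z)"
    proof (intro always_eventually allI)
      fix z :: "real \<times> (real ^ 'n)"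
      show "(\<lambda>k. kz t z * (indicat_real {z. (X k)\<^sup>2 < fst z} z * fij i j ((t, x) - z))) \<longlonglongrightarrow> kz t z * fij i j ((t, x) - z)"
      proof (cases "fst z > 0")
        case True
        have "(\<lambda>k. (X k)\<^sup>2) \<longlonglongrightarrow> 0\<^sup>2" by (intro tendsto_intros X)
        then have "\<forall>\<^sub>F k in sequentially. (X k)\<^sup>2 < fst z" using True by (intro order_tendstoD(2)[of _ 0]) auto
        then have "\<forall>\<^sub>F k in sequentially. kz t z * (indicat_real {z. (X k)\<^sup>2 < fst z} z * fij i j ((t, x) - z)) = kz t z * fij i j ((t, x) - z)"
          by eventually_elim simp
        then show ?thesis by (rule tendsto_eventually)
      qed (simp add: kern_eq)
    qed
    show "AE z in lborel. norm (kz t z * (indicat_real {z. (X k)\<^sup>2 < fst z} z * fij i j ((t, x) - z))) \<le> kz t z * B" for k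
      using bnd(3) B_nonneg by (auto simp: abs_mult indicator_def intro!: mult_left_mono)
  qed simp_all
  then show ?thesis using X(1) by (simp add: eq sol_eq)
qed

text \<open>Under (\<tau>, y) = (\<epsilon>^2 \<sigma>, \<epsilon> w) the region becomes 0 <
  \<sigma> \<le> 1, |w| > 1, and the Jacobian \<epsilon>^{n+2} exactly compensates the scaling of
  the Hessian. The rescaled covariance tends to \<sigma> a(t) by differentiability of F at the
  single time t, and its ellipticity is uniform in \<epsilon>, which provides the majorant.\<close>

lemma tendsto_kern_d2_early:
  assumes t: "good_time t" and X: "\<And>k. X k > 0" "X \<longlonglongrightarrow> 0"
  shows "(\<lambda>k. \<integral>z. indicat_real {z. fst z \<le> (X k)\<^sup>2 \<and> X k < norm (snd z)} z * kern_d2 t i j z * f ((t, x) - z) \<partial>lborel)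
    \<longlonglongrightarrow> f (t, x) * Icoef a i j t"
proof -
  have A: "ell l (1 / l) (a t)" using t by (simp add: good_time_def)
  define \<phi> where "\<phi> \<epsilon> z = indicat_real {z. fst z \<le> \<epsilon>\<^sup>2 \<and> \<epsilon> < norm (snd z)} z * kern_d2 t i j z * f ((t, x) - z)" for \<epsilon> z
  define \<Psi> where "\<Psi> \<epsilon> z = \<epsilon> ^ (CARD('n) + 2) * \<phi> \<epsilon> (\<epsilon>\<^sup>2 * fst z, \<epsilon> *\<^sub>R snd z)" for \<epsilon> z
  have \<phi>m [measurable]: "\<phi> \<epsilon> \<in> borel_measurable borel" for \<epsilon> unfolding \<phi>_def[abs_def] by measurable
  have \<Psi>m [measurable]: "\<Psi> \<epsilon> \<in> borel_measurable borel" for \<epsilon> unfolding \<Psi>_def[abs_def] by measurable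
  have i\<phi>: "integrable lborel (\<phi> \<epsilon>)" if \<epsilon>: "\<epsilon> > 0" for \<epsilon>
  proof -
    have "integrable lborel (\<lambda>z. indicat_real (Omega \<epsilon>) z * kern_d2 t i j z * (indicat_real {z. fst z \<le> \<epsilon>\<^sup>2 \<and> \<epsilon> < norm (snd z)} z * f ((t, x) - z)))"
      by (rule integrable_kern_d2_Omega[OF \<epsilon>, where B=B]) (use bnd(1) B_nonneg in \<open>auto simp: indicator_def\<close>)
    moreover have "indicat_real (Omega \<epsilon>) z * kern_d2 t i j z * (indicat_real {z. fst z \<le> \<epsilon>\<^sup>2 \<and> \<epsilon> < norm (snd z)} z * f ((t, x) - z)) = \<phi> \<epsilon> z" for z
      using Omega_max(2)[OF \<epsilon>, of z] by (cases "fst z > 0") (auto simp: indicator_def kern_d2_def \<phi>_def)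
    ultimately show ?thesis by simp
  qed
  \<comment> \<open>Rescaled covariance: \<sigma> times a difference quotient of F at t with step
    -\<epsilon>^2 \<sigma>.\<close>
  define Q where "Q \<epsilon> \<sigma> = (1 / \<epsilon>\<^sup>2) *\<^sub>R (F t - F (t - \<epsilon>\<^sup>2 * \<sigma>))" for \<epsilon> \<sigma> :: real
  have Qell: "ell (l * \<sigma>) (\<sigma> / l) (Q \<epsilon> \<sigma>)" if "\<epsilon> > 0" "\<sigma> > 0" for \<epsilon> \<sigma>
  proof -
    have "0 < \<epsilon>\<^sup>2 * \<sigma>" using that by simp
    then have "ell (1 / \<epsilon>\<^sup>2 * (l * (\<epsilon>\<^sup>2 * \<sigma>))) (1 / \<epsilon>\<^sup>2 * (\<epsilon>\<^sup>2 * \<sigma> / l)) (Q \<epsilon> \<sigma>)"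
      unfolding Q_def using ell_F[of "t - \<epsilon>\<^sup>2 * \<sigma>" t] by (intro ell_scaleR) auto
    moreover have "1 / \<epsilon>\<^sup>2 * (l * (\<epsilon>\<^sup>2 * \<sigma>)) = l * \<sigma>" "1 / \<epsilon>\<^sup>2 * (\<epsilon>\<^sup>2 * \<sigma> / l) = \<sigma> / l" using that by simp_all
    ultimately show ?thesis by (simp only:)
  qed
  have \<Psi>_eq: "\<Psi> \<epsilon> z = (if 0 < fst z \<and> fst z \<le> 1 \<and> norm (snd z) > 1 then
      exp (- (\<epsilon>\<^sup>2 * fst z)) * gauss2 (Q \<epsilon> (fst z)) i j (snd z) * f (t - \<epsilon>\<^sup>2 * fst z, x - \<epsilon> *\<^sub>R snd z) else 0)" if \<epsilon>: "\<epsilon> > 0" for \<epsilon> z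
  proof -
    have c1: "\<epsilon>\<^sup>2 * fst z \<le> \<epsilon>\<^sup>2 \<longleftrightarrow> fst z \<le> 1" "0 < \<epsilon>\<^sup>2 * fst z \<longleftrightarrow> 0 < fst z" using \<epsilon> by (simp_all add: zero_less_mult_iff)
    have c2: "\<epsilon> < norm (\<epsilon> *\<^sub>R snd z) \<longleftrightarrow> norm (snd z) > 1" using \<epsilon> by simp
    show ?thesis
    proof (cases "0 < fst z \<and> fst z \<le> 1 \<and> norm (snd z) > 1")
      case True
      have "posdef (Q \<epsilon> (fst z))" using ell_posdef[OF Qell[OF \<epsilon>]] True l_pos by simp
      note sc = gauss_scale(2)[OF this \<epsilon>, of i j "snd z"]
      have "\<epsilon>\<^sup>2 *\<^sub>R Q \<epsilon> (fst z) = F t - F (t - \<epsilon>\<^sup>2 * fst z)" using \<epsilon> by (simp add: Q_def)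
      then have sc': "\<epsilon> ^ (CARD('n) + 2) * gauss2 (F t - F (t - \<epsilon>\<^sup>2 * fst z)) i j (\<epsilon> *\<^sub>R snd z) = gauss2 (Q \<epsilon> (fst z)) i j (snd z)"
        using sc \<epsilon> by simp
      have "\<Psi> \<epsilon> z = exp (- (\<epsilon>\<^sup>2 * fst z)) * (\<epsilon> ^ (CARD('n) + 2) * gauss2 (F t - F (t - \<epsilon>\<^sup>2 * fst z)) i j (\<epsilon> *\<^sub>R snd z)) * f (t - \<epsilon>\<^sup>2 * fst z, x - \<epsilon> *\<^sub>R snd z)"
        using True c1 c2 by (simp add: \<Psi>_def \<phi>_def kern_d2_def del: power_add)
      then show ?thesis unfolding sc' using True by simp
    next
      case False
      then show ?thesis using c1 c2 by (auto simp: \<Psi>_def \<phi>_def kern_d2_def indicator_def)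
    qed
  qed
  obtain C where C: "C \<ge> 0" "\<And>(M :: real ^ 'n ^ 'n) z i j. 0 < fst z \<Longrightarrow> ell (l * fst z) (fst z / l) M \<Longrightarrow>
    \<bar>gauss2 M i j (snd z)\<bar> * max (fst z) ((norm (snd z))\<^sup>2) \<le> C * exp (fst z) * heat_kern l z"
    using gauss2_heat_kern_bound[OF l_pos, where 'n='n] by metis
  have \<Psi>_le: "norm (\<Psi> \<epsilon> z) \<le> C * exp 1 * B * heat_kern l z" if \<epsilon>: "\<epsilon> > 0" for \<epsilon> z
  proof (cases "0 < fst z \<and> fst z \<le> 1 \<and> norm (snd z) > 1")
    case True
    let ?g = "gauss2 (Q \<epsilon> (fst z)) i j (snd z)"
    have "1 \<le> (norm (snd z))\<^sup>2" using True by simp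
    then have "\<bar>?g\<bar> * 1 \<le> \<bar>?g\<bar> * max (fst z) ((norm (snd z))\<^sup>2)" by (intro mult_left_mono) auto
    also have "\<dots> \<le> C * exp (fst z) * heat_kern l z" using True \<epsilon> by (intro C(2) Qell) auto
    also have "\<dots> \<le> C * exp 1 * heat_kern l z" using True C(1) by (intro mult_right_mono mult_left_mono) auto
    finally have g: "\<bar>?g\<bar> \<le> C * exp 1 * heat_kern l z" by simp
    have "exp (- (\<epsilon>\<^sup>2 * fst z)) * \<bar>?g\<bar> * \<bar>f (t - \<epsilon>\<^sup>2 * fst z, x - \<epsilon> *\<^sub>R snd z)\<bar> \<le> 1 * (C * exp 1 * heat_kern l z) * B"
      by (intro mult_mono g bnd(1)) (use True C(1) in auto)
    then show ?thesis using True by (simp add: \<Psi>_eq[OF \<epsilon>] abs_mult mult_ac)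
  qed (use C(1) B_nonneg in \<open>auto simp: \<Psi>_eq[OF \<epsilon>]\<close>)
  have hk: "integrable lborel (\<lambda>z. C * exp 1 * B * heat_kern l z)" by (intro integrable_mult_right integrable_heat_kern l_pos)
  have eq: "(\<integral>z. \<phi> \<epsilon> z \<partial>lborel) = (\<integral>z. \<Psi> \<epsilon> z \<partial>lborel)" if \<epsilon>: "\<epsilon> > 0" for \<epsilon>
  proof -
    have "integrable lborel (\<Psi> \<epsilon>)"
    proof (rule Bochner_Integration.integrable_bound[OF hk])
      show "AE z in lborel. norm (\<Psi> \<epsilon> z) \<le> norm (C * exp 1 * B * heat_kern l z)"
        using \<Psi>_le[OF \<epsilon>] C(1) B_nonneg by simp
    qed simp
    then have "integrable lborel (\<lambda>z. \<Psi> \<epsilon> z / \<epsilon> ^ (CARD('n) + 2))" by simp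
    then have i: "integrable lborel (\<lambda>z. \<phi> \<epsilon> (\<epsilon>\<^sup>2 * fst z, \<epsilon> *\<^sub>R snd z))" using \<epsilon> by (simp add: \<Psi>_def del: power_add)
    show ?thesis
      using lborel_scale_pair[OF i\<phi>[OF \<epsilon>] i] \<epsilon> by (simp add: \<Psi>_def power_add power2_eq_square)
  qed
  have "(\<lambda>k. \<integral>z. \<Psi> (X k) z \<partial>lborel) \<longlonglongrightarrow>
    (\<integral>z. f (t, x) * (if 0 < fst z \<and> fst z \<le> 1 \<and> norm (snd z) > 1 then gauss2 (fst z *\<^sub>R a t) i j (snd z) else 0) \<partial>lborel)"
  proof (rule integral_dominated_convergence[OF _ _ hk])
    show "(\<lambda>z. f (t, x) * (if 0 < fst z \<and> fst z \<le> 1 \<and> norm (snd z) > 1 then gauss2 (fst z *\<^sub>R a t) i j (snd z) else 0)) \<in> borel_measurable lborel"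
      using borel_measurable_integrable[OF integral_gauss2_outer(1)[OF A l_pos, of i j]] by simp
    show "AE z in lborel. (\<lambda>k. \<Psi> (X k) z) \<longlonglongrightarrow>
      f (t, x) * (if 0 < fst z \<and> fst z \<le> 1 \<and> norm (snd z) > 1 then gauss2 (fst z *\<^sub>R a t) i j (snd z) else 0)"
    proof (intro always_eventually allI)
      fix z :: "real \<times> (real ^ 'n)"
      show "(\<lambda>k. \<Psi> (X k) z) \<longlonglongrightarrow>
        f (t, x) * (if 0 < fst z \<and> fst z \<le> 1 \<and> norm (snd z) > 1 then gauss2 (fst z *\<^sub>R a t) i j (snd z) else 0)"
      proof (cases "0 < fst z \<and> fst z \<le> 1 \<and> norm (snd z) > 1")
        case True
        then have z: "fst z > 0" by simp
        have X2: "(\<lambda>k. (X k)\<^sup>2 * fst z) \<longlonglongrightarrow> 0"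
          using tendsto_mult[OF tendsto_power[OF X(2), of 2] tendsto_const[of "fst z"]] by simp
        have Q: "(\<lambda>k. Q (X k) (fst z)) \<longlonglongrightarrow> fst z *\<^sub>R a t"
        proof (intro vec_tendstoI)
          fix p q
          have "((\<lambda>s. F s $ p $ q) has_field_derivative a t $ p $ q) (at t)" using t by (simp add: good_time_def)
          then have L: "((\<lambda>h. (F (t + h) $ p $ q - F t $ p $ q) / h) \<longlongrightarrow> a t $ p $ q) (at 0)" by (simp add: DERIV_def)
          have "filterlim (\<lambda>k. - ((X k)\<^sup>2 * fst z)) (at 0) sequentially"
            unfolding filterlim_at using tendsto_minus[OF X2] X(1) z
            by (auto simp: less_imp_neq[symmetric] intro!: always_eventually)
          from tendsto_mult[OF filterlim_compose[OF L this] tendsto_const[of "fst z"]]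
          have "(\<lambda>k. (F (t + - ((X k)\<^sup>2 * fst z)) $ p $ q - F t $ p $ q) / - ((X k)\<^sup>2 * fst z) * fst z) \<longlonglongrightarrow> a t $ p $ q * fst z" .
          moreover have "(F (t + - ((X k)\<^sup>2 * fst z)) $ p $ q - F t $ p $ q) / - ((X k)\<^sup>2 * fst z) * fst z = Q (X k) (fst z) $ p $ q" for k
            using z X(1)[of k] by (simp add: Q_def field_simps)
          ultimately show "(\<lambda>k. Q (X k) (fst z) $ p $ q) \<longlonglongrightarrow> (fst z *\<^sub>R a t) $ p $ q" by (simp add: mult.commute)
        qed
        have pd: "posdef (fst z *\<^sub>R a t)"
          using ell_posdef[OF ell_scaleR[OF A, of "fst z"]] z l_pos by simp
        have "(\<lambda>k. f (t - (X k)\<^sup>2 * fst z, x - X k *\<^sub>R snd z)) \<longlonglongrightarrow> f (t, x)"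
        proof (rule continuous_on_tendsto_compose[OF cont(1)])
          have "(\<lambda>k. (t - (X k)\<^sup>2 * fst z, x - X k *\<^sub>R snd z)) \<longlonglongrightarrow> (t - 0, x - 0 *\<^sub>R snd z)"
            by (intro tendsto_Pair tendsto_diff tendsto_const X2 tendsto_scaleR X(2))
          then show "(\<lambda>k. (t - (X k)\<^sup>2 * fst z, x - X k *\<^sub>R snd z)) \<longlonglongrightarrow> (t, x)" by simp
        qed auto
        moreover have "(\<lambda>k. exp (- ((X k)\<^sup>2 * fst z))) \<longlonglongrightarrow> exp (- 0)" by (intro tendsto_exp tendsto_minus X2)
        ultimately have "(\<lambda>k. exp (- ((X k)\<^sup>2 * fst z)) * gauss2 (Q (X k) (fst z)) i j (snd z) * f (t - (X k)\<^sup>2 * fst z, x - X k *\<^sub>R snd z))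
          \<longlonglongrightarrow> exp (- 0) * gauss2 (fst z *\<^sub>R a t) i j (snd z) * f (t, x)"
          by (intro tendsto_mult tendsto_gauss2[OF Q tendsto_const pd]) auto
        then show ?thesis using True X(1) by (simp add: \<Psi>_eq mult_ac)
      next
        case False
        then show ?thesis using X(1) by (auto simp: \<Psi>_eq)
      qed
    qed
    show "AE z in lborel. norm (\<Psi> (X k) z) \<le> C * exp 1 * B * heat_kern l z" for k
      using \<Psi>_le[OF X(1)] by simp
  qed simp
  then show ?thesis using X(1) unfolding \<phi>_def[symmetric] by (simp add: eq Icoef_eq_outer[of l a t, OF A l_pos])
qed

text \<open>The truncated integrals do not in general tend to \<partial>_{ij} u: the early part,
  with |y| > \<epsilon>, keeps the contribution f I_ij, which the formula of the theorem
  subtracts.\<close>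

lemma tendsto_kern_d2_Omega:
  assumes t: "good_time t"
  shows "((\<lambda>\<epsilon>. \<integral>z. indicat_real (Omega \<epsilon>) z * kern_d2 t i j z * f ((t, x) - z) \<partial>lborel)
    \<longlongrightarrow> sol a (fij i j) (t, x) + f (t, x) * Icoef a i j t) (at_right 0)"
  unfolding tendsto_at_iff_sequentially comp_def
proof (intro allI impI)
  fix X :: "nat \<Rightarrow> real" assume "\<forall>k. X k \<in> {0<..} - {0}" and X0: "X \<longlonglongrightarrow> 0"
  then have X: "X k > 0" for k by auto
  let ?S = "\<lambda>\<epsilon>. {z :: real \<times> (real ^ 'n). fst z \<le> \<epsilon>\<^sup>2 \<and> \<epsilon> < norm (snd z)}"
  let ?S' = "\<lambda>\<epsilon>. {z :: real \<times> (real ^ 'n). \<epsilon>\<^sup>2 < fst z}"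
  have "(\<integral>z. indicat_real (Omega \<epsilon>) z * kern_d2 t i j z * f ((t, x) - z) \<partial>lborel)
    = (\<integral>z. indicat_real (?S' \<epsilon>) z * kern_d2 t i j z * f ((t, x) - z) \<partial>lborel) + (\<integral>z. indicat_real (?S \<epsilon>) z * kern_d2 t i j z * f ((t, x) - z) \<partial>lborel)"
    if \<epsilon>: "\<epsilon> > 0" for \<epsilon>
  proof -
    have m [measurable]: "?S \<epsilon> \<in> sets borel" "?S' \<epsilon> \<in> sets borel" by measurable
    have i: "integrable lborel (\<lambda>z. indicat_real (Omega \<epsilon>) z * kern_d2 t i j z * (indicat_real T z * f ((t, x) - z)))"
      if [measurable]: "T \<in> sets borel" for T
      by (rule integrable_kern_d2_Omega[OF \<epsilon>, where B=B]) (use bnd(1) B_nonneg in \<open>auto simp: indicator_def\<close>)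
    \<comment> \<open>Where \<open>kern_d2\<close> is nonzero, \<open>Omega\<close> is the disjoint
      union of late times and early far points. The first two identities insert the indicator of
      \<open>Omega\<close> so that \<open>integrable_kern_d2_Omega\<close> applies to each
      part.\<close>
    have e: "indicat_real (Omega \<epsilon>) z * kern_d2 t i j z * (indicat_real (?S \<epsilon>) z * f ((t, x) - z)) = indicat_real (?S \<epsilon>) z * kern_d2 t i j z * f ((t, x) - z)"
      "indicat_real (Omega \<epsilon>) z * kern_d2 t i j z * (indicat_real (?S' \<epsilon>) z * f ((t, x) - z)) = indicat_real (?S' \<epsilon>) z * kern_d2 t i j z * f ((t, x) - z)"
      "indicat_real (Omega \<epsilon>) z * kern_d2 t i j z * f ((t, x) - z) = indicat_real (?S' \<epsilon>) z * kern_d2 t i j z * f ((t, x) - z) + indicat_real (?S \<epsilon>) z * kern_d2 t i j z * f ((t, x) - z)" for z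
      using Omega_max(2)[OF \<epsilon>, of z] by (cases "fst z > 0"; auto simp: indicator_def kern_d2_def)+
    show ?thesis unfolding e(3) by (intro Bochner_Integration.integral_add i[OF m(1), unfolded e] i[OF m(2), unfolded e])
  qed
  then show "(\<lambda>k. \<integral>z. indicat_real (Omega (X k)) z * kern_d2 t i j z * f ((t, x) - z) \<partial>lborel)
    \<longlonglongrightarrow> sol a (fij i j) (t, x) + f (t, x) * Icoef a i j t"
    using tendsto_add[OF tendsto_kern_d2_late[OF X X0, of t i j x] tendsto_kern_d2_early[OF t X X0, of i j x]] X by simp
qed

text \<open>The kernel itself is integrable, so truncating it leaves no residue.\<close>

lemma tendsto_kz_Omega:
  "((\<lambda>\<epsilon>. \<integral>z. indicat_real (Omega \<epsilon>) z * kz t z * f ((t, x) - z) \<partial>lborel) \<longlongrightarrow> sol a f (t, x)) (at_right 0)"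
  unfolding tendsto_at_iff_sequentially comp_def
proof (intro allI impI)
  fix X :: "nat \<Rightarrow> real" assume "\<forall>k. X k \<in> {0<..} - {0}" and X0: "X \<longlonglongrightarrow> 0"
  then have X: "X k > 0" for k by auto
  have "(\<lambda>k. \<integral>z. indicat_real (Omega (X k)) z * kz t z * f ((t, x) - z) \<partial>lborel) \<longlonglongrightarrow> (\<integral>z. kz t z * f ((t, x) - z) \<partial>lborel)"
  proof (rule integral_dominated_convergence[where w="\<lambda>z. kz t z * B"])
    show "integrable lborel (\<lambda>z. kz t z * B)" using integrable_kern[of t] by simp
    show "AE z in lborel. (\<lambda>k. indicat_real (Omega (X k)) z * kz t z * f ((t, x) - z)) \<longlonglongrightarrow> kz t z * f ((t, x) - z)"
    proof (intro always_eventually allI)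
      fix z :: "real \<times> (real ^ 'n)"
      show "(\<lambda>k. indicat_real (Omega (X k)) z * kz t z * f ((t, x) - z)) \<longlonglongrightarrow> kz t z * f ((t, x) - z)"
      proof (cases "fst z > 0")
        case True
        have "(\<lambda>k. (X k)\<^sup>2) \<longlonglongrightarrow> 0\<^sup>2" by (intro tendsto_intros X0)
        then have "\<forall>\<^sub>F k in sequentially. (X k)\<^sup>2 < fst z" using True by (intro order_tendstoD(2)[of _ 0]) auto
        then have "\<forall>\<^sub>F k in sequentially. indicat_real (Omega (X k)) z * kz t z * f ((t, x) - z) = kz t z * f ((t, x) - z)"
          by eventually_elim (simp add: Omega_max(2)[OF X True])
        then show ?thesis by (rule tendsto_eventually)
      qed (simp add: kern_eq)
    qed
    show "AE z in lborel. norm (indicat_real (Omega (X k)) z * kz t z * f ((t, x) - z)) \<le> kz t z * B" for k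
      using bnd(1) B_nonneg by (auto simp: abs_mult indicator_def intro!: mult_left_mono)
  qed simp_all
  then show "(\<lambda>k. \<integral>z. indicat_real (Omega (X k)) z * kz t z * f ((t, x) - z) \<partial>lborel) \<longlonglongrightarrow> sol a f (t, x)"
    by (simp add: sol_eq)
qed

lemma space_derivative_limit:
  assumes t: "good_time t"
  shows "\<epsilon> > 0 \<Longrightarrow> set_integrable lebesgue (Omega \<epsilon>) (\<lambda>(\<tau>, y). partial i (partial j (kern a t \<tau>)) y * f (t - \<tau>, x - y))"
    and "((\<lambda>\<epsilon>. (LINT (\<tau>, y):Omega \<epsilon>|lebesgue. partial i (partial j (kern a t \<tau>)) y * f (t - \<tau>, x - y)) - f (t, x) * Icoef a i j t)
      \<longlongrightarrow> partial i (partial j (\<lambda>z. sol a f (t, z))) x) (at_right 0)"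
proof -
  have eq: "indicat_real (Omega \<epsilon>) z *\<^sub>R (case z of (\<tau>, y) \<Rightarrow> partial i (partial j (kern a t \<tau>)) y * f (t - \<tau>, x - y))
    = indicat_real (Omega \<epsilon>) z * kern_d2 t i j z * f ((t, x) - z)" for \<epsilon> z
    by (cases z) (simp add: partial2_kern)
  have m: "(\<lambda>z. indicat_real (Omega \<epsilon>) z * kern_d2 t i j z * f ((t, x) - z)) \<in> borel_measurable borel" for \<epsilon> by measurable
  show "set_integrable lebesgue (Omega \<epsilon>) (\<lambda>(\<tau>, y). partial i (partial j (kern a t \<tau>)) y * f (t - \<tau>, x - y))" if "\<epsilon> > 0"
    unfolding set_integrable_def eq lebesgue_lborel(1)[OF m]
    by (rule integrable_kern_d2_Omega[OF that, where B=B]) (use bnd(1) in auto)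
  show "((\<lambda>\<epsilon>. (LINT (\<tau>, y):Omega \<epsilon>|lebesgue. partial i (partial j (kern a t \<tau>)) y * f (t - \<tau>, x - y)) - f (t, x) * Icoef a i j t)
      \<longlongrightarrow> partial i (partial j (\<lambda>z. sol a f (t, z))) x) (at_right 0)"
    unfolding set_lebesgue_integral_def eq lebesgue_lborel(2)[OF m] sol_f_partial2(2)
    using tendsto_diff[OF tendsto_kern_d2_Omega[OF t, of i j x] tendsto_const[of "f (t, x) * Icoef a i j t"]] by simp
qed

text \<open>By \<open>AE_kern_dt_dtau\<close> the integral tends to a^{ij} (\<partial>_{ij} u + f
  I_ij) - u. Since a^{ij} I_ij = 1 - J, adding f J gives a^{ij} \<partial>_{ij} u - u + f, which is
  the time derivative by \<open>sol_time_derivative\<close>.\<close>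

lemma time_derivative_limit:
  assumes t: "good_time t"
  shows "\<epsilon> > 0 \<Longrightarrow> set_integrable lebesgue (Omega \<epsilon>) (\<lambda>(\<tau>, y). kern_dt_dtau a t \<tau> y * f (t - \<tau>, x - y))"
    and "((\<lambda>\<epsilon>. (LINT (\<tau>, y):Omega \<epsilon>|lebesgue. kern_dt_dtau a t \<tau> y * f (t - \<tau>, x - y)) + f (t, x) * Jcoef a t)
      \<longlongrightarrow> deriv (\<lambda>s. sol a f (s, x)) t) (at_right 0)"
proof -
  let ?k = "\<lambda>\<epsilon> i j z. indicat_real (Omega \<epsilon>) z * kern_d2 t i j z * f ((t, x) - z)"
  let ?kz = "\<lambda>\<epsilon> z. indicat_real (Omega \<epsilon>) z * kz t z * f ((t, x) - z)"
  let ?g = "\<lambda>\<epsilon> z. (\<Sum>i\<in>UNIV. \<Sum>j\<in>UNIV. a t $ i $ j * ?k \<epsilon> i j z) - ?kz \<epsilon> z"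
  have m: "?g \<epsilon> \<in> borel_measurable borel" for \<epsilon> by measurable
  have AE: "AE z in lborel. indicat_real (Omega \<epsilon>) z *\<^sub>R (case z of (\<tau>, y) \<Rightarrow> kern_dt_dtau a t \<tau> y * f (t - \<tau>, x - y)) = ?g \<epsilon> z" for \<epsilon>
    using AE_kern_dt_dtau[OF t]
  proof eventually_elim
    case (elim z)
    have "indicat_real (Omega \<epsilon>) z *\<^sub>R (case z of (\<tau>, y) \<Rightarrow> kern_dt_dtau a t \<tau> y * f (t - \<tau>, x - y))
      = indicat_real (Omega \<epsilon>) z * kern_dt_dtau a t (fst z) (snd z) * f ((t, x) - z)"
      by (cases z) simp
    also have "\<dots> = ?g \<epsilon> z" unfolding elim by (simp add: algebra_simps sum_distrib_left sum_distrib_right)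
    finally show ?case .
  qed
  have ik: "integrable lborel (?k \<epsilon> i j)" if "\<epsilon> > 0" for \<epsilon> i j
    by (rule integrable_kern_d2_Omega[OF that, where B=B]) (use bnd(1) in auto)
  have ikz: "integrable lborel (?kz \<epsilon>)" for \<epsilon>
  proof -
    have "integrable lborel (\<lambda>z. kz t z * (indicat_real (Omega \<epsilon>) z * f ((t, x) - z)))"
      by (rule integrable_kz_bounded[where B=B]) (use bnd(1) B_nonneg in \<open>auto simp: indicator_def\<close>)
    then show ?thesis by (simp add: mult_ac)
  qed
  have isum: "integrable lborel (\<lambda>z. \<Sum>i\<in>UNIV. \<Sum>j\<in>UNIV. a t $ i $ j * ?k \<epsilon> i j z)" if "\<epsilon> > 0" for \<epsilon>
    by (intro Bochner_Integration.integrable_sum integrable_mult_right ik that)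
  show "set_integrable lebesgue (Omega \<epsilon>) (\<lambda>(\<tau>, y). kern_dt_dtau a t \<tau> y * f (t - \<tau>, x - y))" if "\<epsilon> > 0"
    unfolding set_integrable_def lebesgue_lborel_AE(1)[OF m AE]
    by (intro Bochner_Integration.integrable_diff isum ikz that)
  have int: "(LINT (\<tau>, y):Omega \<epsilon>|lebesgue. kern_dt_dtau a t \<tau> y * f (t - \<tau>, x - y))
    = (\<Sum>i\<in>UNIV. \<Sum>j\<in>UNIV. a t $ i $ j * (\<integral>z. ?k \<epsilon> i j z \<partial>lborel)) - (\<integral>z. ?kz \<epsilon> z \<partial>lborel)" if "\<epsilon> > 0" for \<epsilon>
  proof -
    have "(\<integral>z. (\<Sum>i\<in>UNIV. \<Sum>j\<in>UNIV. a t $ i $ j * ?k \<epsilon> i j z) \<partial>lborel) = (\<Sum>i\<in>UNIV. (\<integral>z. (\<Sum>j\<in>UNIV. a t $ i $ j * ?k \<epsilon> i j z) \<partial>lborel))"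
      by (intro Bochner_Integration.integral_sum Bochner_Integration.integrable_sum integrable_mult_right ik that)
    also have "\<dots> = (\<Sum>i\<in>UNIV. \<Sum>j\<in>UNIV. (\<integral>z. a t $ i $ j * ?k \<epsilon> i j z \<partial>lborel))"
      by (intro sum.cong refl Bochner_Integration.integral_sum integrable_mult_right ik that)
    finally show ?thesis
      unfolding set_lebesgue_integral_def lebesgue_lborel_AE(2)[OF m AE] Bochner_Integration.integral_diff[OF isum[OF that] ikz] by simp
  qed
  let ?d = "(\<Sum>i\<in>UNIV. \<Sum>j\<in>UNIV. a t $ i $ j * sol a (fij i j) (t, x)) - sol a f (t, x) + f (t, x)"
  have "((\<lambda>\<epsilon>. (\<Sum>i\<in>UNIV. \<Sum>j\<in>UNIV. a t $ i $ j * (\<integral>z. ?k \<epsilon> i j z \<partial>lborel)) - (\<integral>z. ?kz \<epsilon> z \<partial>lborel) + f (t, x) * Jcoef a t) \<longlongrightarrow>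
    (\<Sum>i\<in>UNIV. \<Sum>j\<in>UNIV. a t $ i $ j * (sol a (fij i j) (t, x) + f (t, x) * Icoef a i j t)) - sol a f (t, x) + f (t, x) * Jcoef a t) (at_right 0)"
    by (intro tendsto_add tendsto_diff tendsto_sum tendsto_mult tendsto_const tendsto_kern_d2_Omega[OF t] tendsto_kz_Omega)
  moreover have "(\<Sum>i\<in>UNIV. \<Sum>j\<in>UNIV. a t $ i $ j * (sol a (fij i j) (t, x) + f (t, x) * Icoef a i j t)) - sol a f (t, x) + f (t, x) * Jcoef a t = ?d"
  proof -
    have s: "(\<Sum>i\<in>UNIV. \<Sum>j\<in>UNIV. a t $ i $ j * (f (t, x) * Icoef a i j t)) = f (t, x) * (\<Sum>i\<in>UNIV. \<Sum>j\<in>UNIV. a t $ i $ j * Icoef a i j t)"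
      by (simp add: sum_distrib_left mult_ac)
    have J: "(\<Sum>i\<in>UNIV. \<Sum>j\<in>UNIV. a t $ i $ j * Icoef a i j t) = 1 - Jcoef a t"
      using Icoef_Jcoef_sum[of l a t] t l_pos by (simp add: good_time_def)
    show ?thesis
      unfolding distrib_left sum.distrib s J by (simp add: right_diff_distrib)
  qed
  moreover have "deriv (\<lambda>s. sol a f (s, x)) t = ?d" by (rule DERIV_imp_deriv[OF sol_time_derivative[OF t]])
  moreover have "\<forall>\<^sub>F \<epsilon> in at_right 0. (\<Sum>i\<in>UNIV. \<Sum>j\<in>UNIV. a t $ i $ j * (\<integral>z. ?k \<epsilon> i j z \<partial>lborel)) - (\<integral>z. ?kz \<epsilon> z \<partial>lborel) + f (t, x) * Jcoef a t
      = (LINT (\<tau>, y):Omega \<epsilon>|lebesgue. kern_dt_dtau a t \<tau> y * f (t - \<tau>, x - y)) + f (t, x) * Jcoef a t"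
    using eventually_at_right_less[of "0 :: real"] by eventually_elim (simp add: int)
  ultimately show "((\<lambda>\<epsilon>. (LINT (\<tau>, y):Omega \<epsilon>|lebesgue. kern_dt_dtau a t \<tau> y * f (t - \<tau>, x - y)) + f (t, x) * Jcoef a t)
      \<longlongrightarrow> deriv (\<lambda>s. sol a f (s, x)) t) (at_right 0)"
    by (simp only: tendsto_cong)
qed

end

theorem theorem1p1:
  fixes a :: "real \<Rightarrow> real ^ 'n ^ 'n"
  assumes "elliptic_coeff a"
  shows
    "(\<forall>(p::ennreal) (f :: real \<times> (real ^ 'n) \<Rightarrow> real). 1 \<le> p \<longrightarrow> f \<in> Lp p \<longrightarrow>
        (AE (t, x) in lebesgue.
           integrable lebesgue (\<lambda>(\<tau>, y). kern a t \<tau> y * f (t - \<tau>, x - y))) \<and>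
        sol a f \<in> Lp p \<and> Lp_norm p (sol a f) \<le> Lp_norm p f) \<and>
     (\<forall>f :: real \<times> (real ^ 'n) \<Rightarrow> real. C2c f \<longrightarrow>
        (bounded (range (sol a f)) \<and> classical_solution a f (sol a f)) \<and>
        (\<forall>v. bounded (range v) \<and> classical_solution a f v \<longrightarrow> v = sol a f) \<and>
        (AE t in lebesgue. \<forall>x.
           (\<forall>i j.
              (\<forall>\<epsilon>>0. set_integrable lebesgue (Omega \<epsilon>)
                 (\<lambda>(\<tau>, y). partial i (partial j (kern a t \<tau>)) y * f (t - \<tau>, x - y))) \<and>
              ((\<lambda>\<epsilon>. (LINT (\<tau>, y):Omega \<epsilon>|lebesgue.
                       partial i (partial j (kern a t \<tau>)) y * f (t - \<tau>, x - y))
                     - f (t, x) * Icoef a i j t)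
                 \<longlongrightarrow> partial i (partial j (\<lambda>z. sol a f (t, z))) x) (at_right 0)) \<and>
           (\<forall>\<epsilon>>0. set_integrable lebesgue (Omega \<epsilon>)
              (\<lambda>(\<tau>, y). kern_dt_dtau a t \<tau> y * f (t - \<tau>, x - y))) \<and>
           ((\<lambda>\<epsilon>. (LINT (\<tau>, y):Omega \<epsilon>|lebesgue.
                    kern_dt_dtau a t \<tau> y * f (t - \<tau>, x - y))
                  + f (t, x) * Jcoef a t)
              \<longlongrightarrow> deriv (\<lambda>s. sol a f (s, x)) t) (at_right 0)))"
proof -
  obtain F l K where "primitive_coeff a F l K" using elliptic_coeff_primitive[OF assms] .
  then interpret primitive_coeff a F l K .
  show ?thesis
  proof (intro conjI allI impI)
    fix p :: ennreal and f :: "real \<times> (real ^ 'n) \<Rightarrow> real" assume "1 \<le> p" "f \<in> Lp p"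
    note L = sol_Lp_bounds[OF this]
    show "AE (t, x) in lebesgue. integrable lebesgue (\<lambda>(\<tau>, y). kern a t \<tau> y * f (t - \<tau>, x - y))"
      by (rule L[THEN conjunct1])
    show "sol a f \<in> Lp p" "Lp_norm p (sol a f) \<le> Lp_norm p f"
      by (rule L[THEN conjunct2, THEN conjunct1], rule L[THEN conjunct2, THEN conjunct2])
  next
    fix f :: "real \<times> (real ^ 'n) \<Rightarrow> real" assume "C2c f"
    then obtain fi fij R B where "C2c_data f fi fij R B" by (rule C2c_dataI)
    then interpret C2c_data f fi fij R B .
    interpret parabolic a F l K f fi fij R B ..
    show "bounded (range (sol a f))" "classical_solution a f (sol a f)" by (rule sol_classical)+
    show "v = sol a f" if "bounded (range v) \<and> classical_solution a f v" for v
      using bounded_solution_unique[OF conjunct1[OF that] sol_classical(1) conjunct2[OF that] sol_classical(2)] .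
    show "AE t in lebesgue. \<forall>x.
           (\<forall>i j.
              (\<forall>\<epsilon>>0. set_integrable lebesgue (Omega \<epsilon>)
                 (\<lambda>(\<tau>, y). partial i (partial j (kern a t \<tau>)) y * f (t - \<tau>, x - y))) \<and>
              ((\<lambda>\<epsilon>. (LINT (\<tau>, y):Omega \<epsilon>|lebesgue.
                       partial i (partial j (kern a t \<tau>)) y * f (t - \<tau>, x - y))
                     - f (t, x) * Icoef a i j t)
                 \<longlongrightarrow> partial i (partial j (\<lambda>z. sol a f (t, z))) x) (at_right 0)) \<and>
           (\<forall>\<epsilon>>0. set_integrable lebesgue (Omega \<epsilon>)
              (\<lambda>(\<tau>, y). kern_dt_dtau a t \<tau> y * f (t - \<tau>, x - y))) \<and>
           ((\<lambda>\<epsilon>. (LINT (\<tau>, y):Omega \<epsilon>|lebesgue.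
                    kern_dt_dtau a t \<tau> y * f (t - \<tau>, x - y))
                  + f (t, x) * Jcoef a t)
              \<longlongrightarrow> deriv (\<lambda>s. sol a f (s, x)) t) (at_right 0)"
      \<comment> \<open>The exceptional set is fixed before x, i, j and \<epsilon> are
        chosen.\<close>
      using AE_good_time
    proof eventually_elim
      case (elim t)
      show ?case
        by (intro allI conjI impI space_derivative_limit[OF elim] time_derivative_limit[OF elim])
    qed
  qed
qed

end
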